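(* Let $\alpha>-\frac12$, $a\in(0,1]$ and $1<q\le\infty$. For each $f\in L^1((0,\infty),\gamma_\alpha)$, the following statements are equivalent: (a) $f\in\mathcal{H}^1((0,\infty),\gamma_\alpha)$; (b) $f\in\mathbb{H}_{2a}^{1,q}((0,\infty),\gamma_\alpha)$; (c) $\mathbb{M}_{a,\mathrm{loc}}(f)\in L^1((0,\infty),\gamma_\alpha)$ and $\mathbb{E}_\alpha(f)<\infty$. Moreover, the quantities $\|f\|_{\mathcal{H}^1((0,\infty),\gamma_\alpha)}$, $\|f\|_{\mathbb{H}^{1,q}_a((0,\infty),\gamma_\alpha)}$ and $\|\mathbb{M}_{a,\mathrm{loc}}(f)\|_{L^1((0,\infty),\gamma_\alpha)}+\mathbb{E}_\alpha(f)$ are equivalent (comparable with positive constants independent of $f$).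
   Context: For $\alpha>-\frac12$, $\gamma_\alpha$ is the probability measure on $(0,\infty)$ given by $d\gamma_\alpha(x)=\frac{2x^{2\alpha+1}}{\Gamma(\alpha+1)}e^{-x^2}dx$. For $x,r>0$, $I(x,r):=(x-r,x+r)\cap(0,\infty)$. The space $\mathcal{H}^1$: put $m(x)=\min\{1,1/x\}$. For $a>0$, $\mathcal{B}_a$ is the class of intervals $I(x,r)$ with $0<r\le x$ and $r\le a\,m(x)$. For $1<q\le\infty$ and $a>0$, a measurable function $b$ on $(0,\infty)$ is an $(a,q,\alpha)$-atom when either $b\equiv1$ on $(0,\infty)$, or there exist $0<r\le x$ with $I(x,r)\in\mathcal{B}_a$ such that (i) $\mathrm{supp}(b)\subset I(x,r)$; (ii) $\|b\|_{L^q((0,\infty),\gamma_\alpha)}\le\gamma_\alpha(I(x,r))^{\frac1q-1}$ (with $\frac1q=0$ if $q=\infty$); (iii) $\int_0^\infty b\,d\gamma_\alpha=0$. $\mathcal{H}^{1,q}_a((0,\infty),\gamma_\alpha)$ consists of all $f\in L^1((0,\infty),\gamma_\alpha)$ such that $f=\sum_{j=0}^\infty\lambda_jb_j$ (convergence in $L^1((0,\infty),\gamma_\alpha)$) with $(a,q,\alpha)$-atoms $b_j$ and $\lambda_j\in\mathbb{C}$, $\sum_j|\lambda_j|<\infty$; its norm is the infimum of $\sum_j|\lambda_j|$ over all such representations. These spaces do not depend on $a>0$ and $1<q\le\infty$ (with equivalent norms), and $\mathcal{H}^1((0,\infty),\gamma_\alpha)$ denotes any of them, e.g. $\mathcal{H}^{1,\infty}_1((0,\infty),\gamma_\alpha)$.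 The spaces $\mathbb{H}^{1,q}_a$: put $w(x)=\frac18\min\{x,\frac1x\}$, $x>0$. For $a\in(0,8)$, $\mathbb{B}_a$ is the class of intervals $I(x,r)$ with $x>0$ and $0<r\le a\,w(x)$. For $1<q\le\infty$ and $a\in(0,8)$, a measurable function $b$ on $(0,\infty)$ is an $(a,q,\alpha)_w$-atom when either $b\equiv1$ on $(0,\infty)$, or there is $I(x,r)\in\mathbb{B}_a$ such that (i), (ii) and (iii) above hold for this $I(x,r)$. $\mathbb{H}^{1,q}_a((0,\infty),\gamma_\alpha)$ is the space of measurable $f$ on $(0,\infty)$ with $f=\sum_{j=0}^\infty\lambda_jb_j$ (convergence in $L^1((0,\infty),\gamma_\alpha)$), where each $b_j$ is an $(a,q,\alpha)_w$-atom and $\lambda_j\in\mathbb{C}$ with $\sum_j|\lambda_j|<\infty$; $\|f\|_{\mathbb{H}^{1,q}_a((0,\infty),\gamma_\alpha)}$ is the infimum of $\sum_j|\lambda_j|$ over all such representations. Maximal function: $\mathbb{A}=\{\phi\in C_c^1(-1,1):\|\phi\|_\infty\le1,\ \|\phi'\|_\infty\le1\}$, where $C^1_c(-1,1)$ denotes $C^1$ functions with compact support in $(-1,1)$; $\phi_t(x)=\frac1t\phi(\frac xt)$ for $t>0$. For $a\in(0,8)$ and $f\in L^1_{\mathrm{loc}}((0,\infty),dx)$, $$\mathbb{M}_{a,\mathrm{loc}}(f)(x)=\sup\{|\phi_t*f(x)|:\ \phi\in\mathbb{A},\ 0<t<a\,w(x)\},\quad x\in(0,\infty),$$ where $*$ is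 the usual convolution on $\mathbb{R}$ (only values of $f$ on $(0,\infty)$ are involved since $\mathrm{supp}(\phi_t(x-\cdot))\subset I(x,t)\subset(0,\infty)$ when $0<t\le x$). For $f\in L^1((0,\infty),\gamma_\alpha)$, $$\mathbb{E}_\alpha(f)=\int_0^1\frac1y\left|\int_0^yf(x)\,d\gamma_\alpha(x)\right|dy+\int_1^\infty y\left|\int_y^\infty f(x)\,d\gamma_\alpha(x)\right|dy.$$ *)

theory Defs
  imports "HOL-Probability.Probability"
begin

section \<open>The measure, intervals and Lebesgue norms\<close>

text \<open>
  The measure lives on the half-line itself, so that values of a function
  \<^term>\<open>f :: real \<Rightarrow> complex\<close> on the nonpositive reals are irrelevant.
\<close>

definition gamma_measure :: "real \<Rightarrow> real measure" where
  "gamma_measure \<alpha> =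
     density (restrict_space lborel {0<..})
       (\<lambda>x. ennreal (2 * x powr (2 * \<alpha> + 1) / Gamma (\<alpha> + 1) * exp (- (x\<^sup>2))))"

definition L1_space :: "'a measure \<Rightarrow> ('a \<Rightarrow> complex) set" where
  "L1_space M = {f. integrable M f}"

definition L1_dist :: "'a measure \<Rightarrow> ('a \<Rightarrow> complex) \<Rightarrow> ('a \<Rightarrow> complex) \<Rightarrow> ennreal" where
  "L1_dist M f g = (\<integral>\<^sup>+ x. ennreal (norm (f x - g x)) \<partial>M)"

definition Lq_norm :: "ennreal \<Rightarrow> 'a measure \<Rightarrow> ('a \<Rightarrow> complex) \<Rightarrow> ennreal" where
  "Lq_norm q M f =
     (if q = \<infinity> then esssup M (\<lambda>x. ennreal (norm (f x)))
      else let p = enn2real q; J = (\<integral>\<^sup>+ x. ennreal (norm (f x) powr p) \<partial>M)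
           in if J = \<infinity> then \<infinity> else ennreal (enn2real J powr (1 / p)))"

definition itv :: "real \<Rightarrow> real \<Rightarrow> real set" where
  "itv x r = {x - r<..<x + r} \<inter> {0<..}"

definition m_fun :: "real \<Rightarrow> real" where
  "m_fun x = min 1 (1 / x)"

definition w_fun :: "real \<Rightarrow> real" where
  "w_fun x = 1 / 8 * min x (1 / x)"

definition cal_B :: "real \<Rightarrow> real set set" where
  "cal_B a = {itv x r | x r. 0 < r \<and> r \<le> x \<and> r \<le> a * m_fun x}"

definition bb_B :: "real \<Rightarrow> real set set" where
  "bb_B a = {itv x r | x r. 0 < x \<and> 0 < r \<and> r \<le> a * w_fun x}"


section \<open>Atomic Hardy spaces\<close>

text \<open>
  Atoms are measurable functions understood up to null sets. As usual for atoms, the support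
  condition means that \<^term>\<open>b\<close> vanishes off the (open) interval \<^term>\<open>J\<close>.
  The two kinds of atoms differ only in the admissible class \<^term>\<open>\<B>\<close> of intervals.
  Note that \<^term>\<open>enn2real (inverse q)\<close> is 0 for infinite \<^term>\<open>q\<close>.
\<close>

definition is_atom ::
  "real set set \<Rightarrow> ennreal \<Rightarrow> real \<Rightarrow> (real \<Rightarrow> complex) \<Rightarrow> bool" where
  "is_atom \<B> q \<alpha> b \<longleftrightarrow>
     b \<in> borel_measurable (gamma_measure \<alpha>) \<and>
     ((\<forall>x>0. b x = 1) \<or>
      (\<exists>J\<in>\<B>. support_on {0<..} b \<subseteq> J \<and>
         Lq_norm q (gamma_measure \<alpha>) b
           \<le> ennreal (measure (gamma_measure \<alpha>) J powr (enn2real (inverse q) - 1)) \<and>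
         (LINT x|gamma_measure \<alpha>. b x) = 0))"

definition is_atomic_rep ::
  "real set set \<Rightarrow> ennreal \<Rightarrow> real \<Rightarrow> (real \<Rightarrow> complex) \<Rightarrow>
     (nat \<Rightarrow> complex) \<Rightarrow> (nat \<Rightarrow> real \<Rightarrow> complex) \<Rightarrow> bool" where
  "is_atomic_rep \<B> q \<alpha> f c b \<longleftrightarrow>
     (\<forall>j. is_atom \<B> q \<alpha> (b j)) \<and> summable (\<lambda>j. norm (c j)) \<and>
     (\<lambda>n. L1_dist (gamma_measure \<alpha>) (\<lambda>x. \<Sum>j<n. c j * b j x) f) \<longlonglongrightarrow> 0"

text \<open>The infimum is \<^term>\<open>\<infinity>\<close> if there is no representation.\<close>

definition atomic_norm ::
  "real set set \<Rightarrow> ennreal \<Rightarrow> real \<Rightarrow> (real \<Rightarrow> complex) \<Rightarrow> ennreal" where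
  "atomic_norm \<B> q \<alpha> f =
     Inf {\<Sum>j. ennreal (norm (c j)) | c b. is_atomic_rep \<B> q \<alpha> f c b}"

definition cal_H :: "real \<Rightarrow> ennreal \<Rightarrow> real \<Rightarrow> (real \<Rightarrow> complex) set" where
  "cal_H a q \<alpha> =
     {f \<in> L1_space (gamma_measure \<alpha>). \<exists>c b. is_atomic_rep (cal_B a) q \<alpha> f c b}"

definition cal_H_norm :: "real \<Rightarrow> ennreal \<Rightarrow> real \<Rightarrow> (real \<Rightarrow> complex) \<Rightarrow> ennreal" where
  "cal_H_norm a q \<alpha> = atomic_norm (cal_B a) q \<alpha>"

text \<open>
  The spaces \<^term>\<open>cal_H a q \<alpha>\<close> do not depend on \<^term>\<open>a\<close> and \<^term>\<open>q\<close>, up to equivalent norms;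
  the choice here fixes a representative.
\<close>

definition H1 :: "real \<Rightarrow> (real \<Rightarrow> complex) set" where
  "H1 \<alpha> = cal_H 1 \<infinity> \<alpha>"

definition H1_norm :: "real \<Rightarrow> (real \<Rightarrow> complex) \<Rightarrow> ennreal" where
  "H1_norm \<alpha> = cal_H_norm 1 \<infinity> \<alpha>"

definition bb_H :: "real \<Rightarrow> ennreal \<Rightarrow> real \<Rightarrow> (real \<Rightarrow> complex) set" where
  "bb_H a q \<alpha> =
     {f \<in> borel_measurable (gamma_measure \<alpha>). \<exists>c b. is_atomic_rep (bb_B a) q \<alpha> f c b}"

definition bb_H_norm :: "real \<Rightarrow> ennreal \<Rightarrow> real \<Rightarrow> (real \<Rightarrow> complex) \<Rightarrow> ennreal" where
  "bb_H_norm a q \<alpha> = atomic_norm (bb_B a) q \<alpha>"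


section \<open>The local maximal function and the functional E\<close>

text \<open>
  Scalars are complex throughout, also for the test functions. A function on \<open>(-1,1)\<close> with compact
  support is identified with its extension by zero.
\<close>

definition test_functions :: "(real \<Rightarrow> complex) set" where
  "test_functions =
     {\<phi>. \<phi> C1_differentiable_on UNIV \<and> closure (support_on UNIV \<phi>) \<subseteq> {-1<..<1} \<and>
         (\<forall>x. norm (\<phi> x) \<le> 1) \<and> (\<forall>x. norm (vector_derivative \<phi> (at x)) \<le> 1)}"

definition dilate :: "real \<Rightarrow> (real \<Rightarrow> complex) \<Rightarrow> real \<Rightarrow> complex" where
  "dilate t \<phi> x = complex_of_real (1 / t) * \<phi> (x / t)"

definition fun_conv :: "(real \<Rightarrow> complex) \<Rightarrow> (real \<Rightarrow> complex) \<Rightarrow> real \<Rightarrow> complex" where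
  "fun_conv g f x = (LINT y|lborel. g (x - y) * f y)"

definition local_maximal :: "real \<Rightarrow> (real \<Rightarrow> complex) \<Rightarrow> real \<Rightarrow> ennreal" where
  "local_maximal a f x =
     Sup {ennreal (norm (fun_conv (dilate t \<phi>) f x)) | \<phi> t.
            \<phi> \<in> test_functions \<and> 0 < t \<and> t < a * w_fun x}"

definition E_fun :: "real \<Rightarrow> (real \<Rightarrow> complex) \<Rightarrow> ennreal" where
  "E_fun \<alpha> f =
     (\<integral>\<^sup>+ y\<in>{0<..<1}. ennreal (1 / y * norm (LINT x:{0<..<y}|gamma_measure \<alpha>. f x)) \<partial>lborel) +
     (\<integral>\<^sup>+ y\<in>{1<..}. ennreal (y * norm (LINT x:{y<..}|gamma_measure \<alpha>. f x)) \<partial>lborel)"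


section \<open>Comparability\<close>

definition comparable_on :: "'a set \<Rightarrow> ('a \<Rightarrow> ennreal) \<Rightarrow> ('a \<Rightarrow> ennreal) \<Rightarrow> bool" where
  "comparable_on F N N' \<longleftrightarrow>
     (\<exists>c C :: real. 0 < c \<and> 0 < C \<and>
        (\<forall>f\<in>F. ennreal c * N f \<le> N' f \<and> N' f \<le> ennreal C * N f))"

end

(*
  Write mu for gamma_alpha, M for the local maximal function and N f = ||M f||_1 + E f.

  Upper bound for the atomic norm. In the coordinate sigma = K (ln x + x^2 / 2), in which mu is
  doubling at unit scale, the dyadic quadratic B-splines h_{n,i} form nested partitions of unity:
  each h_{n,i} is a positive combination of the splines (n+1,2i+e), e < 4, and the mu-average
  c_{n,i} of f against h_{n,i} is a convex combination of the four child averages, so f becomes a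
  martingale along a random walk on nodes. The averages are controlled by M f on the support of
  h_{n,i}, since h_{n,i} times the density of mu is a dilated C^1 bump. Stopping the
  walk when a child average exceeds 2^k times a base level yields functions V_k, bounded by 2^k,
  that tend to f, and V_{k+1} - V_k is a sum of multiples of bounded atoms; the total cost is the
  dyadic layer cake of the integral of M f. What remains is sum_i c_{0,i} h_{0,i}; by Abel
  summation it is a sum of differences of neighbouring normalised bumps with coefficients
  bounded by E f.

  Lower bound. N is sublinear along atomic series, because convolutions and tail integrals are
  integrals against bounded kernels; so it suffices to bound N on atoms. Near the supporting
  interval this is the weak type (1,1) inequality applied to truncations of the atom; away from it
  cancellation and the Lipschitz bound for phi_t(x - y) / density(y) give decay like
  r / |x - x0|^2.

  All the spaces in the theorem lie between the smallest atom class (admissible intervals of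
  radius a w, q = infinity) and the largest (radius m, exponent q), so both bounds apply to each.
*)
theory Submission
  imports Defs
begin

section \<open>Series of atoms\<close>

text \<open>The local maximal function tests only against C^1 bumps, so averages over dyadic
  intervals are out of its reach. Quadratic B-splines are C^1 and still obey an exact two-scale
  relation with positive coefficients. The price is overlap: a stopping rule selects no disjoint
  intervals, since a point is shared by several branches, and the stopped part of a node is a weight
  \<open>Z\<close> between 0 and \<open>h\<close>, not a set. Averages and cancellation refer to
  gamma_alpha; its density is absorbed into the bump. The rule looks one generation ahead: a walk is
  halted before it can enter a node of large average. All averages met stay below the level, while
  the halted mass is charged to the large child. The coordinate tau has derivative v = x + 1/x, and
  1/v is comparable to w, so cells of equal length in tau are admissible intervals. As v is also
  comparable to 1/y near 0 and to y near infinity, which are the weights in E, the moments of the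
  coarse part are controlled by E.\<close>

definition atomic_le :: "'a measure \<Rightarrow> ('a \<Rightarrow> complex) set \<Rightarrow> ('a \<Rightarrow> complex) \<Rightarrow> real \<Rightarrow> bool" where
  "atomic_le M \<A> F s \<longleftrightarrow>
     (\<exists>c b. (\<forall>j. b j \<in> \<A>) \<and> summable (\<lambda>j. norm (c j)) \<and> (\<Sum>j. norm (c j)) \<le> s \<and>
            (AE x in M. (\<lambda>j::nat. c j * b j x) sums F x))"

text \<open>The enumerated double series converges absolutely, so Fubini for unordered sums
  (\<open>has_sum\<close>) allows summation by rows; uniqueness of limits then identifies the value
  with \<open>g\<close>.\<close>

lemma sums_prod_decode:
  fixes a :: "nat \<Rightarrow> nat \<Rightarrow> complex"
  assumes "summable (\<lambda>m. norm (case_prod a (prod_decode m)))"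
    and "\<And>k. a k sums f k" and "f sums g"
  shows "(\<lambda>m. case_prod a (prod_decode m)) sums g"
proof -
  let ?b = "\<lambda>m. case_prod a (prod_decode m)"
  have s: "?b sums suminf ?b"
    using summable_norm_cancel[OF assms(1)] by (rule summable_sums)
  have "(?b has_sum suminf ?b) UNIV"
    by (rule norm_summable_imp_has_sum[OF assms(1) s])
  then have h: "(case_prod a has_sum suminf ?b) (Sigma UNIV (\<lambda>_. UNIV))"
    using has_sum_reindex_bij_betw[OF bij_prod_decode, of "case_prod a"] by simp
  have row: "(a k has_sum f k) UNIV" for k
  proof -
    have "a k summable_on UNIV"
      using summable_on_SigmaD1[of a UNIV "\<lambda>_. UNIV" k] has_sum_imp_summable[OF h] by simp
    then obtain t where "(a k has_sum t) UNIV" by (auto simp: summable_on_def)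
    with has_sum_imp_sums[OF this] assms(2)[of k] show ?thesis
      using sums_unique2 by blast
  qed
  have "(f has_sum suminf ?b) UNIV"
    by (rule has_sum_SigmaD[OF h]) (simp add: row)
  then have "f sums suminf ?b" by (rule has_sum_imp_sums)
  with assms(3) s show ?thesis using sums_unique2 by metis
qed

text \<open>A uniform L1 bound makes combinations with summable coefficients converge absolutely
  almost everywhere and in L1.\<close>

locale L1_bounded_family =
  fixes M :: "'a measure" and \<A> :: "('a \<Rightarrow> complex) set" and L :: real
  assumes nonempty: "\<A> \<noteq> {}"
    and integrable: "\<And>b. b \<in> \<A> \<Longrightarrow> integrable M b"
    and L1_le: "\<And>b. b \<in> \<A> \<Longrightarrow> (\<integral>\<^sup>+ x. ennreal (norm (b x)) \<partial>M) \<le> ennreal L"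
begin

text \<open>Integrating term by term, the series of norms has integral at most \<open>L\<close>
  times the sum of the coefficients. The same series is the majorant for dominated convergence
  later.\<close>

lemma AE_summable_combination:
  assumes b: "\<And>j. b j \<in> \<A>" and c: "summable (\<lambda>j::nat. norm (c j))"
  shows "AE x in M. summable (\<lambda>j. norm (c j * b j x))"
    and "(\<integral>\<^sup>+ x. (\<Sum>j. ennreal (norm (c j * b j x))) \<partial>M) < \<infinity>"
proof -
  have [measurable]: "b j \<in> borel_measurable M" for j
    using integrable[OF b] by auto
  have "(\<integral>\<^sup>+ x. (\<Sum>j. ennreal (norm (c j * b j x))) \<partial>M) =
        (\<Sum>j. \<integral>\<^sup>+ x. ennreal (norm (c j * b j x)) \<partial>M)"
    by (rule nn_integral_suminf) measurable
  also have "\<dots> = (\<Sum>j. ennreal (norm (c j)) * (\<integral>\<^sup>+ x. ennreal (norm (b j x)) \<partial>M))"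
    by (simp add: norm_mult ennreal_mult nn_integral_cmult)
  also have "\<dots> \<le> (\<Sum>j. ennreal (norm (c j)) * ennreal L)"
    by (intro suminf_le mult_left_mono L1_le b) auto
  also have "\<dots> = (\<Sum>j. ennreal (norm (c j))) * ennreal L" by simp
  also have "\<dots> = ennreal (\<Sum>j. norm (c j)) * ennreal L"
    using c by (simp add: suminf_ennreal2)
  also have "\<dots> < \<infinity>" by (simp add: ennreal_mult_less_top)
  finally show fin: "(\<integral>\<^sup>+ x. (\<Sum>j. ennreal (norm (c j * b j x))) \<partial>M) < \<infinity>" .
  have "AE x in M. (\<Sum>j. ennreal (norm (c j * b j x))) \<noteq> \<infinity>"
    using fin by (intro nn_integral_noteq_infinite) auto
  then show "AE x in M. summable (\<lambda>j. norm (c j * b j x))"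
    by eventually_elim (auto intro: summable_suminf_not_top)
qed

text \<open>The double series of all atoms is enumerated by \<open>prod_decode\<close>; its
  coefficients remain summable, so almost everywhere the rows may be summed back to
  \<open>F k\<close>. Only pointwise convergence to \<open>G\<close> is asked, which suits
  telescoping series.\<close>

lemma atomic_le_sums:
  fixes F :: "nat \<Rightarrow> 'a \<Rightarrow> complex"
  assumes "\<And>k. atomic_le M \<A> (F k) (s k)" and s: "summable s"
    and G: "AE x in M. (\<lambda>k. F k x) sums G x"
  shows "atomic_le M \<A> G (suminf s)"
proof -
  let ?P = "\<lambda>k c b. (\<forall>j. b j \<in> \<A>) \<and> summable (\<lambda>j. norm (c j)) \<and> (\<Sum>j. norm (c j)) \<le> s k \<and>
            (AE x in M. (\<lambda>j. c j * b j x) sums F k x)"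
  have "\<forall>k. \<exists>c b. ?P k c b"
    using assms(1) unfolding atomic_le_def by simp
  then obtain c where "\<forall>k. \<exists>b. ?P k (c k) b" by (rule choice[THEN exE])
  then obtain b where "\<forall>k. ?P k (c k) (b k)" by (rule choice[THEN exE])
  then have b: "\<And>k j. b k j \<in> \<A>"
    and c: "\<And>k. summable (\<lambda>j. norm (c k j))" and cs: "\<And>k. (\<Sum>j. norm (c k j)) \<le> s k"
    and F: "\<And>k. AE x in M. (\<lambda>j. c k j * b k j x) sums F k x"
    by simp_all
  define C where "C m = case_prod c (prod_decode m)" for m
  define B where "B m = case_prod b (prod_decode m)" for m
  have s_nonneg: "0 \<le> s k" for k
    using cs[of k] suminf_nonneg[OF c[of k]] by simp
  have "(\<Sum>m. ennreal (norm (C m))) = (\<Sum>k. \<Sum>j. ennreal (norm (c k j)))"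
    unfolding C_def case_prod_unfold
    by (rule suminf_ennreal_2dimen[where f="\<lambda>p. ennreal (norm (c (fst p) (snd p)))"]) simp
  also have "\<dots> = (\<Sum>k. ennreal (\<Sum>j. norm (c k j)))"
    using c by (simp add: suminf_ennreal2)
  also have "\<dots> \<le> (\<Sum>k. ennreal (s k))"
    by (intro suminf_le ennreal_leI cs) auto
  also have "\<dots> = ennreal (suminf s)"
    using s s_nonneg by (intro suminf_ennreal2)
  finally have le: "(\<Sum>m. ennreal (norm (C m))) \<le> ennreal (suminf s)" .
  then have "(\<Sum>m. ennreal (norm (C m))) \<noteq> top" by (auto simp: top_unique)
  then have C: "summable (\<lambda>m. norm (C m))" by (intro summable_suminf_not_top) auto
  have s0: "0 \<le> suminf s"
    using s s_nonneg by (intro suminf_nonneg)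
  have Cs: "(\<Sum>m. norm (C m)) \<le> suminf s"
    using le C s0 by (simp add: suminf_ennreal2)
  have BA: "B m \<in> \<A>" for m by (simp add: B_def b split: prod.splits)
  have "AE x in M. \<forall>k. (\<lambda>j. c k j * b k j x) sums F k x"
    using F by (simp add: AE_all_countable)
  with AE_summable_combination(1)[where b=B, OF BA C] G
  have "AE x in M. (\<lambda>m. C m * B m x) sums G x"
  proof eventually_elim
    case (elim x)
    have eq: "C m * B m x = (case prod_decode m of (k, j) \<Rightarrow> c k j * b k j x)" for m
      by (simp add: C_def B_def split: prod.splits)
    show ?case
      unfolding eq
      by (rule sums_prod_decode[where f="\<lambda>k. F k x"]) (use elim eq in auto)
  qed
  with BA C Cs show ?thesis
    unfolding atomic_le_def by (intro exI[of _ C] exI[of _ B]) simp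
qed

text \<open>Zero coefficients still have to multiply atoms, hence the appeal to
  \<open>nonempty\<close>.\<close>

lemma atomic_le_zero: "AE x in M. F x = 0 \<Longrightarrow> 0 \<le> s \<Longrightarrow> atomic_le M \<A> F s"
proof -
  assume F: "AE x in M. F x = 0" and s: "0 \<le> s"
  obtain b where "b \<in> \<A>" using nonempty by blast
  moreover from F have "AE x in M. (\<lambda>j::nat. 0 * b x) sums F x" by eventually_elim simp
  ultimately show ?thesis
    unfolding atomic_le_def using s by (intro exI[of _ "\<lambda>_. 0"] exI[of _ "\<lambda>_. b"]) auto
qed

lemma atomic_le_atom:
  assumes b: "b \<in> \<A>" and F: "AE x in M. F x = c * b x" and s: "norm c \<le> s"
  shows "atomic_le M \<A> F s"
proof -
  have eq: "(\<lambda>j::nat. norm (if j = 0 then c else 0)) = (\<lambda>j. if j = 0 then norm c else 0)" by auto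
  have s1: "(\<lambda>j::nat. if j = 0 then norm c else 0) sums norm c"
    using sums_single[of 0 "\<lambda>_. norm c"] by simp
  from F have "AE x in M. (\<lambda>j::nat. (if j = 0 then c else 0) * b x) sums F x"
  proof eventually_elim
    case (elim x)
    have eq: "(\<lambda>j::nat. (if j = 0 then c else 0) * b x) = (\<lambda>j. if j = 0 then c * b x else 0)" by auto
    show ?case unfolding eq elim using sums_single[of 0 "\<lambda>_. c * b x"] by simp
  qed
  with b s s1 show ?thesis
    unfolding atomic_le_def
    by (intro exI[of _ "\<lambda>j. if j = 0 then c else 0"] exI[of _ "\<lambda>_. b"])
       (auto simp: eq sums_iff)
qed

lemma atomic_le_mono: "atomic_le M \<A> F s \<Longrightarrow> s \<le> t \<Longrightarrow> atomic_le M \<A> F t"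
  unfolding atomic_le_def by (elim exE conjE, intro exI conjI) (assumption | rule order_trans)+

lemma atomic_le_cmult:
  assumes "atomic_le M \<A> F s"
  shows "atomic_le M \<A> (\<lambda>x. a * F x) (norm a * s)"
proof -
  from assms obtain c b where b: "\<forall>j. b j \<in> \<A>"
    and c: "summable (\<lambda>j. norm (c j))" and cs: "(\<Sum>j. norm (c j)) \<le> s"
    and F: "AE x in M. (\<lambda>j. c j * b j x) sums F x"
    unfolding atomic_le_def by (elim exE conjE)
  from F have "AE x in M. (\<lambda>j. a * c j * b j x) sums (a * F x)"
    by eventually_elim (simp add: mult.assoc sums_mult)
  moreover have "summable (\<lambda>j. norm (a * c j))" using c by (simp add: norm_mult summable_mult)
  moreover have "(\<Sum>j. norm (a * c j)) \<le> norm a * s"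
    using c cs by (simp add: norm_mult suminf_mult mult_left_mono)
  ultimately show ?thesis
    unfolding atomic_le_def using b by (intro exI[of _ "\<lambda>j. a * c j"] exI[of _ b]) simp
qed

lemma atomic_le_sum:
  assumes "\<And>k. k < n \<Longrightarrow> atomic_le M \<A> (F k) (s k)"
    and G: "AE x in M. G x = (\<Sum>k<n. F k x)"
  shows "atomic_le M \<A> G (\<Sum>k<(n::nat). s k)"
proof -
  let ?s = "\<lambda>k. if k < n then s k else 0" and ?F = "\<lambda>k x. if k < n then F k x else 0"
  have fin: "finite {k. k < n}" by auto
  have ss: "?s sums (\<Sum>k<n. s k)"
    using sums_If_finite[OF fin, of s] by (simp add: lessThan_def)
  from G have "AE x in M. (\<lambda>k. ?F k x) sums G x"
  proof eventually_elim
    case (elim x) then show ?case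
      using sums_If_finite[OF fin, of "\<lambda>k. F k x"] by (simp add: lessThan_def)
  qed
  moreover have "atomic_le M \<A> (?F k) (?s k)" for k
    using assms(1)[of k] atomic_le_zero[of "\<lambda>x. 0" 0] by auto
  ultimately have "atomic_le M \<A> G (suminf ?s)"
    using ss by (intro atomic_le_sums[where F="?F"]) (auto simp: sums_iff)
  with ss show ?thesis by (simp add: sums_iff)
qed

lemma atomic_le_add:
  assumes "atomic_le M \<A> F s" and "atomic_le M \<A> G t" and "AE x in M. H x = F x + G x"
  shows "atomic_le M \<A> H (s + t)"
proof -
  have "atomic_le M \<A> H (\<Sum>k<Suc (Suc 0). if k = 0 then s else t)"
    by (rule atomic_le_sum[where F="\<lambda>k. if k = 0 then F else G"])
       (use assms in \<open>auto simp: less_Suc_eq\<close>)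
  then show ?thesis by simp
qed

text \<open>The almost everywhere convergence in \<open>atomic_le\<close> is upgraded here to the L1
  convergence that an atomic representation requires, by dominated convergence.\<close>

lemma atomic_le_L1_limit:
  assumes b: "\<And>j. b j \<in> \<A>" and c: "summable (\<lambda>j::nat. norm (c j))"
    and F: "AE x in M. (\<lambda>j. c j * b j x) sums F x" and [measurable]: "F \<in> borel_measurable M"
  shows "(\<lambda>n. L1_dist M (\<lambda>x. \<Sum>j<n. c j * b j x) F) \<longlonglongrightarrow> 0"
proof -
  have [measurable]: "b j \<in> borel_measurable M" for j
    using integrable[OF b] by auto
  let ?w = "\<lambda>x. \<Sum>j. ennreal (norm (c j * b j x))"
  have "(\<lambda>n. \<integral>\<^sup>+x. ennreal (norm ((\<Sum>j<n. c j * b j x) - F x)) \<partial>M) \<longlonglongrightarrow> (\<integral>\<^sup>+x. ennreal 0 \<partial>M)"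
  proof (rule nn_integral_dominated_convergence[where w="\<lambda>x. ?w x"])
    show "(\<integral>\<^sup>+ x. ?w x \<partial>M) < \<infinity>"
      using AE_summable_combination(2)[where b=b, OF b c] .
    fix n show "AE x in M. ennreal (norm ((\<Sum>j<n. c j * b j x) - F x)) \<le> ?w x"
      using F AE_summable_combination(1)[where b=b, OF b c]
    proof eventually_elim
      case (elim x)
      let ?a = "\<lambda>j. c j * b j x"
      have s: "summable ?a" using elim by (auto simp: sums_iff)
      \<comment> \<open>The remainder after \<open>n\<close> terms is the shifted series, so the
        full sum of norms bounds it uniformly in \<open>n\<close>.\<close>
      have "norm ((\<Sum>j<n. ?a j) - F x) = norm (\<Sum>j. ?a (j + n))"
        using suminf_minus_initial_segment[OF s, of n] elim(1)
        by (simp add: sums_iff norm_minus_commute)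
      also have "\<dots> \<le> (\<Sum>j. norm (?a (j + n)))"
        using summable_ignore_initial_segment[OF elim(2), of n] by (rule summable_norm)
      also have "\<dots> \<le> (\<Sum>j. norm (?a j))"
        using suminf_minus_initial_segment[OF elim(2), of n] by (simp add: sum_nonneg)
      finally show ?case
        using elim(2) by (simp add: suminf_ennreal2 ennreal_leI)
    qed
    show "AE x in M. (\<lambda>n. ennreal (norm ((\<Sum>j<n. c j * b j x) - F x))) \<longlonglongrightarrow> ennreal 0"
      using F
    proof eventually_elim
      case (elim x)
      then have "(\<lambda>n. (\<Sum>j<n. c j * b j x) - F x) \<longlonglongrightarrow> F x - F x"
        unfolding sums_def by (intro tendsto_diff) auto
      then have "(\<lambda>n. norm ((\<Sum>j<n. c j * b j x) - F x)) \<longlonglongrightarrow> 0"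
        by (simp add: tendsto_norm_zero_iff)
      then show ?case by (intro tendsto_ennrealI)
    qed
  qed auto
  then show ?thesis by (simp add: L1_dist_def)
qed

end

section \<open>Stopped walks on a refining family of weights\<close>

text \<open>Two-scale coefficients of the quadratic B-spline, the binomial coefficients 1, 3, 3, 1
  divided by 4. They add up to 2, not 1: the transition probabilities of the walk are these weights
  times the ratio of the masses of child and parent.\<close>

definition refine_weight :: "nat \<Rightarrow> real" where
  "refine_weight e = (if e = 1 \<or> e = 2 then 3 / 4 else 1 / 4)"

lemma refine_weight_pos: "0 < refine_weight e" and refine_weight_ge: "1 / 4 \<le> refine_weight e"
  by (simp_all add: refine_weight_def)

text \<open>Unnormalised expected payoff of the walk that collects \<open>Y\<close> at the first
  node satisfying \<open>S\<close>. Only nodes fewer than \<open>d\<close> generations below the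
  start count; a walk not halted among them contributes 0.\<close>

primrec stopped_sum ::
  "(nat \<Rightarrow> int \<Rightarrow> bool) \<Rightarrow> (nat \<Rightarrow> int \<Rightarrow> 'b::real_vector) \<Rightarrow> nat \<Rightarrow> nat \<Rightarrow> int \<Rightarrow> 'b" where
  "stopped_sum S Y 0 n i = 0"
| "stopped_sum S Y (Suc d) n i =
     (if S n i then Y n i
      else \<Sum>e<4. refine_weight e *\<^sub>R stopped_sum S Y d (Suc n) (2 * i + int e))"

lemma stopped_sum_incr_Suc:
  "stopped_sum S Y (Suc (Suc d)) n i - stopped_sum S Y (Suc d) n i =
     (if S n i then 0
      else \<Sum>e<4. refine_weight e *\<^sub>R
             (stopped_sum S Y (Suc d) (Suc n) (2 * i + int e)
              - stopped_sum S Y d (Suc n) (2 * i + int e)))"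
proof (cases "S n i")
  case False
  then have "stopped_sum S Y (Suc m) n i =
      (\<Sum>e<4. refine_weight e *\<^sub>R stopped_sum S Y m (Suc n) (2 * i + int e))" for m
    by simp
  from this[of "Suc d"] this[of d] False show ?thesis
    by (simp only: if_False scaleR_diff_right sum_subtractf)
qed simp

text \<open>Raising the depth by one adds only the payoffs at nodes halted exactly in the new
  generation. The invariant \<open>I\<close> carries bounds that hold merely at nodes reachable
  without stopping.\<close>

lemma stopped_sum_norm_incr_le:
  fixes Y :: "nat \<Rightarrow> int \<Rightarrow> 'b::real_normed_vector" and W :: "nat \<Rightarrow> int \<Rightarrow> real"
  assumes inv: "\<And>n i e. I n i \<Longrightarrow> \<not> S n i \<Longrightarrow> e < 4 \<Longrightarrow> I (Suc n) (2 * i + int e)"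
    and YW: "\<And>n i. I n i \<Longrightarrow> S n i \<Longrightarrow> norm (Y n i) \<le> W n i"
    and "I n i"
  shows "norm (stopped_sum S Y (Suc d) n i - stopped_sum S Y d n i)
         \<le> stopped_sum S W (Suc d) n i - stopped_sum S W d n i"
  using \<open>I n i\<close>
proof (induction d arbitrary: n i)
  case 0 then show ?case using YW by simp
next
  case (Suc d)
  show ?case
  proof (cases "S n i")
    case False
    show ?thesis
      unfolding stopped_sum_incr_Suc using False
      by (auto simp del: stopped_sum.simps(2) intro!: sum_norm_le mult_left_mono Suc.IH inv Suc.prems
               simp: refine_weight_pos less_imp_le)
  qed (simp add: stopped_sum_incr_Suc del: stopped_sum.simps)
qed

lemma stopped_sum_mono:
  fixes Y W :: "nat \<Rightarrow> int \<Rightarrow> real"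
  assumes "\<And>n i. S n i \<Longrightarrow> Y n i \<le> W n i"
  shows "stopped_sum S Y d n i \<le> stopped_sum S W d n i"
  by (induction d arbitrary: n i)
     (auto intro!: sum_mono mult_left_mono assms simp: refine_weight_pos less_imp_le)

text \<open>Domination of \<open>Y\<close> by itself: the increment bounds a norm and is therefore
  nonnegative.\<close>

lemma stopped_sum_incseq:
  fixes Y :: "nat \<Rightarrow> int \<Rightarrow> real"
  assumes "\<And>n i. 0 \<le> Y n i"
  shows "incseq (\<lambda>d. stopped_sum S Y d n i)"
  using stopped_sum_norm_incr_le[of "\<lambda>_ _. True" S Y Y n i] assms
  by (intro incseq_SucI) (smt (verit, best) norm_ge_zero real_norm_def abs_of_nonneg)

lemma stopped_sum_cmult:
  fixes Y :: "nat \<Rightarrow> int \<Rightarrow> real"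
  shows "stopped_sum S (\<lambda>n i. a * Y n i) d n i = a * stopped_sum S Y d n i"
  by (induction d arbitrary: n i) (auto simp: sum_distrib_left algebra_simps)

text \<open>Isolates what the stopping argument uses of the spline grid. \<open>mass_child\<close>
  is a doubling property, and \<open>atomic_le_bounded\<close> is the only source of atoms: mean
  zero and domination by a multiple of one node.\<close>

locale refinement = L1_bounded_family M \<A> L + finite_measure M
  for M :: "'a measure" and \<A> :: "('a \<Rightarrow> complex) set" and L :: real +
  fixes h :: "nat \<Rightarrow> int \<Rightarrow> 'a \<Rightarrow> real" and A D :: real
  assumes h_measurable [measurable]: "\<And>n i. h n i \<in> borel_measurable M"
    and h_nonneg: "\<And>n i x. 0 \<le> h n i x" and h_le_1: "\<And>n i x. h n i x \<le> 1"
    and h_refine: "\<And>n i x. h n i x = (\<Sum>e<4. refine_weight e * h (Suc n) (2 * i + int e) x)"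
    and h_cover: "\<And>n x. x \<in> space M \<Longrightarrow> \<exists>i. 0 < h n i x"
    and mass_pos: "\<And>n i. 0 < (\<integral>x. h n i x \<partial>M)"
    and mass_child: "\<And>n i e. e < 4 \<Longrightarrow>
          (\<integral>x. h n i x \<partial>M) \<le> D * (\<integral>x. h (Suc n) (2 * i + int e) x \<partial>M)"
    and A_nonneg: "0 \<le> A" and D_nonneg: "0 \<le> D"
    and atomic_le_bounded: "\<And>n i F B.
          F \<in> borel_measurable M \<Longrightarrow> (\<And>x. x \<in> space M \<Longrightarrow> h n i x = 0 \<Longrightarrow> F x = 0) \<Longrightarrow>
          AE x in M. norm (F x) \<le> B * h n i x \<Longrightarrow> 0 \<le> B \<Longrightarrow> (\<integral>x. F x \<partial>M) = 0 \<Longrightarrow>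
          atomic_le M \<A> F (A * B * (\<integral>x. h n i x \<partial>M))"
begin

abbreviation "mass n i \<equiv> \<integral>x. h n i x \<partial>M"

lemma h_integrable [simp]: "integrable M (h n i)"
  by (rule integrable_const_bound[of _ 1]) (auto simp: h_nonneg h_le_1)

lemma refine_le:
  "(\<And>e. e < 4 \<Longrightarrow> y e \<le> h (Suc n) (2 * i + int e) x) \<Longrightarrow> (\<Sum>e<4. refine_weight e * y e) \<le> h n i x"
  unfolding h_refine[of n i x] by (intro sum_mono mult_left_mono) (auto simp: refine_weight_pos less_imp_le)

lemma refine_ge:
  "(\<And>e. e < 4 \<Longrightarrow> h (Suc n) (2 * i + int e) x \<le> y e) \<Longrightarrow> h n i x \<le> (\<Sum>e<4. refine_weight e * y e)"
  unfolding h_refine[of n i x] by (intro sum_mono mult_left_mono) (auto simp: refine_weight_pos less_imp_le)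

end

section \<open>Calderon-Zygmund splitting of a node at one level\<close>

locale refinement_function = refinement +
  fixes f :: "'a \<Rightarrow> complex"
  assumes f_integrable: "integrable M f"
begin

definition avg :: "nat \<Rightarrow> int \<Rightarrow> complex" where
  "avg n i = (\<integral>x. of_real (h n i x) * f x \<partial>M) / of_real (mass n i)"

text \<open>Testing the children, not the node itself, keeps
  \<open>norm (avg n i) \<le> \<theta>\<close> as an invariant along the walk, including the node
  where it halts.\<close>

definition stop :: "real \<Rightarrow> nat \<Rightarrow> int \<Rightarrow> bool" where
  "stop \<theta> n i \<longleftrightarrow> (\<exists>e<4. \<theta> < norm (avg (Suc n) (2 * i + int e)))"

lemma not_stop_child: "\<not> stop \<theta> n i \<Longrightarrow> e < 4 \<Longrightarrow> norm (avg (Suc n) (2 * i + int e)) \<le> \<theta>"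
  unfolding stop_def by force

lemma stop_antimono: "stop \<theta>' n i \<Longrightarrow> \<theta> \<le> \<theta>' \<Longrightarrow> stop \<theta> n i"
  by (force simp: stop_def)

text \<open>The part of \<open>h n i\<close> carried by walks halted within \<open>d\<close>
  generations. In \<open>C\<close> each halted spline is moreover multiplied by its average.\<close>

definition Z :: "real \<Rightarrow> nat \<Rightarrow> nat \<Rightarrow> int \<Rightarrow> 'a \<Rightarrow> real" where
  "Z \<theta> d n i x = stopped_sum (stop \<theta>) (\<lambda>n i. h n i x) d n i"

definition C :: "real \<Rightarrow> nat \<Rightarrow> nat \<Rightarrow> int \<Rightarrow> 'a \<Rightarrow> complex" where
  "C \<theta> d n i x = stopped_sum (stop \<theta>) (\<lambda>n i. avg n i * of_real (h n i x)) d n i"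

definition Zlim :: "real \<Rightarrow> nat \<Rightarrow> int \<Rightarrow> 'a \<Rightarrow> real" where
  "Zlim \<theta> n i x = lim (\<lambda>d. Z \<theta> d n i x)"

text \<open>A genuine limit when the starting average is at most the level, see
  \<open>C_lim\<close>; all later uses have this hypothesis.\<close>

definition Clim :: "real \<Rightarrow> nat \<Rightarrow> int \<Rightarrow> 'a \<Rightarrow> complex" where
  "Clim \<theta> n i x = lim (\<lambda>d. C \<theta> d n i x)"

text \<open>The good part of \<open>h f\<close> at height \<open>\<theta>\<close> in the sense of
  Calderon and Zygmund: \<open>f\<close> survives on the weight that is never halted and is replaced
  by averages on the rest.\<close>

definition V :: "real \<Rightarrow> nat \<Rightarrow> int \<Rightarrow> 'a \<Rightarrow> complex" where
  "V \<theta> n i x = f x * of_real (h n i x - Zlim \<theta> n i x) + Clim \<theta> n i x"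

lemma f_measurable [measurable]: "f \<in> borel_measurable M"
  using f_integrable by auto

lemma h_f_integrable [simp]: "integrable M (\<lambda>x. of_real (h n i x) * f x)"
  by (rule Bochner_Integration.integrable_bound[OF integrable_norm[OF f_integrable]])
     (auto simp: norm_mult h_nonneg h_le_1 mult_left_le_one_le)

lemma avg_mass: "avg n i * of_real (mass n i) = (\<integral>x. of_real (h n i x) * f x \<partial>M)"
  using mass_pos[of n i] by (simp add: avg_def)

lemma Z_Suc: "Z \<theta> (Suc d) n i x =
    (if stop \<theta> n i then h n i x else \<Sum>e<4. refine_weight e * Z \<theta> d (Suc n) (2 * i + int e) x)"
  by (simp add: Z_def)

lemma C_Suc: "C \<theta> (Suc d) n i x =
    (if stop \<theta> n i then avg n i * of_real (h n i x)
     else \<Sum>e<4. of_real (refine_weight e) * C \<theta> d (Suc n) (2 * i + int e) x)"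
  by (simp add: C_def scaleR_conv_of_real)

lemma Z_0 [simp]: "Z \<theta> 0 n i x = 0" and C_0 [simp]: "C \<theta> 0 n i x = 0"
  by (simp_all add: Z_def C_def)

lemma Z_measurable [measurable]: "Z \<theta> d n i \<in> borel_measurable M"
proof (induction d arbitrary: n i)
  case (Suc d) note [measurable] = Suc.IH
  show ?case by (cases "stop \<theta> n i") (simp_all add: Z_Suc[abs_def])
qed (simp add: Z_0[abs_def])

lemma C_measurable [measurable]: "C \<theta> d n i \<in> borel_measurable M"
proof (induction d arbitrary: n i)
  case (Suc d) note [measurable] = Suc.IH
  show ?case by (cases "stop \<theta> n i") (simp_all add: C_Suc[abs_def])
qed (simp add: C_0[abs_def])

lemma Z_incseq: "incseq (\<lambda>d. Z \<theta> d n i x)"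
  unfolding Z_def by (rule stopped_sum_incseq) (rule h_nonneg)

lemma Z_nonneg: "0 \<le> Z \<theta> d n i x"
  using Z_incseq[of \<theta> n i x] by (auto dest!: incseqD[of _ 0 d])

lemma Z_le_h: "Z \<theta> d n i x \<le> h n i x"
proof (induction d arbitrary: n i)
  case (Suc d)
  then show ?case
    by (auto simp: Z_Suc intro!: refine_le)
qed (simp add: h_nonneg)

lemma Z_lim: "(\<lambda>d. Z \<theta> d n i x) \<longlonglongrightarrow> Zlim \<theta> n i x"
proof -
  obtain l where "(\<lambda>d. Z \<theta> d n i x) \<longlonglongrightarrow> l"
    by (rule incseq_convergent[OF Z_incseq[of \<theta> n i x], where B="h n i x"]) (use Z_le_h in auto)
  then show ?thesis by (simp add: Zlim_def limI)
qed

lemma Z_le_Zlim: "Z \<theta> d n i x \<le> Zlim \<theta> n i x"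
  using incseq_le[OF Z_incseq Z_lim] .

lemma Zlim_nonneg: "0 \<le> Zlim \<theta> n i x"
  using Z_nonneg Z_le_Zlim order_trans by blast

lemma Zlim_le_h: "Zlim \<theta> n i x \<le> h n i x"
  by (rule LIMSEQ_le_const2[OF Z_lim]) (auto simp: Z_le_h)

lemma Zlim_measurable [measurable]: "Zlim \<theta> n i \<in> borel_measurable M"
  by (rule borel_measurable_LIMSEQ_metric[where f="\<lambda>d. Z \<theta> d n i"]) (auto intro: Z_lim)

text \<open>Starting below the level, the walk halts only at nodes with average at most
  \<open>\<theta>\<close>, so \<open>C\<close> grows no faster than \<open>\<theta>\<close> times
  \<open>Z\<close>.\<close>

lemma C_incr_le:
  assumes "norm (avg n i) \<le> \<theta>"
  shows "norm (C \<theta> (Suc d) n i x - C \<theta> d n i x) \<le> \<theta> * (Z \<theta> (Suc d) n i x - Z \<theta> d n i x)"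
proof -
  have "norm (C \<theta> (Suc d) n i x - C \<theta> d n i x) \<le>
     stopped_sum (stop \<theta>) (\<lambda>n i. \<theta> * h n i x) (Suc d) n i - stopped_sum (stop \<theta>) (\<lambda>n i. \<theta> * h n i x) d n i"
    unfolding C_def
    by (rule stopped_sum_norm_incr_le[where I="\<lambda>n i. norm (avg n i) \<le> \<theta>"])
       (use assms in \<open>auto simp: norm_mult h_nonneg intro!: mult_right_mono not_stop_child\<close>)
  then show ?thesis by (simp only: stopped_sum_cmult Z_def right_diff_distrib)
qed

lemma C_le: "norm (avg n i) \<le> \<theta> \<Longrightarrow> norm (C \<theta> d n i x) \<le> \<theta> * Z \<theta> d n i x"
proof (induction d)
  case (Suc d)
  have "norm (C \<theta> (Suc d) n i x) \<le> norm (C \<theta> (Suc d) n i x - C \<theta> d n i x) + norm (C \<theta> d n i x)"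
    by norm
  with C_incr_le[OF Suc.prems, of d x] Suc show ?case by (simp add: algebra_simps)
qed simp

text \<open>The increments are dominated by those of \<open>Z\<close>, whose telescoping series
  converges.\<close>

lemma C_lim:
  assumes "norm (avg n i) \<le> \<theta>"
  shows "(\<lambda>d. C \<theta> d n i x) \<longlonglongrightarrow> Clim \<theta> n i x"
proof -
  have "(\<lambda>d. \<theta> * (Z \<theta> (Suc d) n i x - Z \<theta> d n i x)) sums (\<theta> * (Zlim \<theta> n i x - Z \<theta> 0 n i x))"
    by (intro sums_mult telescope_sums Z_lim)
  then have "summable (\<lambda>d. C \<theta> (Suc d) n i x - C \<theta> d n i x)"
    by (intro summable_comparison_test'[OF sums_summable, where N=0]) (use C_incr_le[OF assms] in auto)
  then have "convergent (\<lambda>n'. \<Sum>d<n'. C \<theta> (Suc d) n i x - C \<theta> d n i x)"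
    by (simp add: summable_iff_convergent)
  moreover have "(\<Sum>d<n'. C \<theta> (Suc d) n i x - C \<theta> d n i x) = C \<theta> n' n i x" for n'
    using sum_lessThan_telescope[of "\<lambda>d. C \<theta> d n i x" n'] by simp
  ultimately show ?thesis by (simp add: Clim_def convergent_LIMSEQ_iff)
qed

lemma Clim_le: "norm (avg n i) \<le> \<theta> \<Longrightarrow> norm (Clim \<theta> n i x) \<le> \<theta> * Zlim \<theta> n i x"
  by (rule LIMSEQ_le[OF tendsto_norm[OF C_lim] tendsto_mult[OF tendsto_const Z_lim]])
     (auto simp: C_le)

lemma Zlim_rec: "Zlim \<theta> n i x =
    (if stop \<theta> n i then h n i x else \<Sum>e<4. refine_weight e * Zlim \<theta> (Suc n) (2 * i + int e) x)"
proof (rule LIMSEQ_unique[OF LIMSEQ_Suc[OF Z_lim]])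
  show "(\<lambda>d. Z \<theta> (Suc d) n i x) \<longlonglongrightarrow>
    (if stop \<theta> n i then h n i x else \<Sum>e<4. refine_weight e * Zlim \<theta> (Suc n) (2 * i + int e) x)"
    unfolding Z_Suc by (cases "stop \<theta> n i") (auto intro!: tendsto_sum tendsto_mult Z_lim)
qed

lemma Clim_rec:
  assumes "norm (avg n i) \<le> \<theta>"
  shows "Clim \<theta> n i x = (if stop \<theta> n i then avg n i * of_real (h n i x)
           else \<Sum>e<4. of_real (refine_weight e) * Clim \<theta> (Suc n) (2 * i + int e) x)"
proof (rule LIMSEQ_unique[OF LIMSEQ_Suc[OF C_lim[OF assms]]])
  show "(\<lambda>d. C \<theta> (Suc d) n i x) \<longlonglongrightarrow> (if stop \<theta> n i then avg n i * of_real (h n i x)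
           else \<Sum>e<4. of_real (refine_weight e) * Clim \<theta> (Suc n) (2 * i + int e) x)"
    unfolding C_Suc
    by (cases "stop \<theta> n i")
       (simp_all, intro tendsto_sum tendsto_mult tendsto_const C_lim not_stop_child, simp_all)
qed

text \<open>All ingredients of \<open>V\<close> refine with the same coefficients. At a halted node
  \<open>Zlim\<close> equals \<open>h\<close>, so the term with \<open>f\<close> drops out.\<close>

lemma V_rec:
  assumes "norm (avg n i) \<le> \<theta>"
  shows "V \<theta> n i x = (if stop \<theta> n i then avg n i * of_real (h n i x)
           else \<Sum>e<4. of_real (refine_weight e) * V \<theta> (Suc n) (2 * i + int e) x)"
proof (cases "stop \<theta> n i")
  case False
  have "of_real (h n i x - Zlim \<theta> n i x) = (\<Sum>e<4. complex_of_real (refine_weight e) *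
      of_real (h (Suc n) (2 * i + int e) x - Zlim \<theta> (Suc n) (2 * i + int e) x))"
    using False h_refine[of n i x] Zlim_rec[of \<theta> n i x]
    by (simp add: right_diff_distrib sum_subtractf)
  then show ?thesis
    using False
    by (simp add: V_def Clim_rec[OF assms, of x] sum_distrib_left distrib_left sum.distrib mult.left_commute)
next
  case True
  then show ?thesis by (simp add: V_def Clim_rec[OF assms, of x] Zlim_rec[of \<theta> n i x])
qed

lemma V_measurable [measurable]:
  assumes "norm (avg n i) \<le> \<theta>" shows "V \<theta> n i \<in> borel_measurable M"
proof -
  have [measurable]: "Clim \<theta> n i \<in> borel_measurable M"
    by (rule borel_measurable_LIMSEQ_metric[where f="\<lambda>d. C \<theta> d n i"]) (auto intro: C_lim assms)
  show ?thesis unfolding V_def by measurable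
qed

text \<open>If some weight at \<open>x\<close> is still unhalted, at least one branch through
  \<open>x\<close> survives \<open>d\<close> generations, and every node on it has average at most
  \<open>\<theta>\<close>. Together with differentiation this bounds \<open>f x\<close>.\<close>

lemma unstopped_node:
  assumes "Z \<theta> d n i x < h n i x" and "norm (avg n i) \<le> \<theta>"
  shows "\<exists>j. 0 < h (n + d) j x \<and> norm (avg (n + d) j) \<le> \<theta>"
  using assms
proof (induction d arbitrary: n i)
  case (Suc d)
  then have ns: "\<not> stop \<theta> n i" by (auto simp: Z_Suc)
  have "\<exists>e<4. Z \<theta> d (Suc n) (2 * i + int e) x < h (Suc n) (2 * i + int e) x"
  proof (rule ccontr)
    assume "\<not> ?thesis"
    then have "h n i x \<le> Z \<theta> (Suc d) n i x"
      using ns by (simp add: Z_Suc) (rule refine_ge, force simp: not_less)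
    with Suc.prems show False by simp
  qed
  then show ?case using Suc.IH not_stop_child[OF ns] by (metis add_Suc_right add_Suc)
qed auto

text \<open>Optional stopping: the integral of \<open>h f\<close> over a node is the weighted sum of
  those over its children, so replacing \<open>f\<close> by averages at halted nodes preserves the
  integral.\<close>

lemma W_integral:
  "integrable M (\<lambda>x. f x * of_real (h n i x - Z \<theta> d n i x) + C \<theta> d n i x) \<and>
   (\<integral>x. f x * of_real (h n i x - Z \<theta> d n i x) + C \<theta> d n i x \<partial>M) = avg n i * of_real (mass n i)"
proof (induction d arbitrary: n i)
  case 0
  then show ?case using h_f_integrable[of n i] by (simp add: avg_mass mult.commute[of "f _"])
next
  case (Suc d)
  show ?case
  proof (cases "stop \<theta> n i")
    case True
    then show ?thesis by (simp add: Z_Suc C_Suc)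
  next
    case False
    let ?W = "\<lambda>n i x. f x * of_real (h n i x - Z \<theta> d n i x) + C \<theta> d n i x"
    have eq: "f x * of_real (h n i x - Z \<theta> (Suc d) n i x) + C \<theta> (Suc d) n i x =
       (\<Sum>e<4. of_real (refine_weight e) * ?W (Suc n) (2 * i + int e) x)" for x
      using False h_refine[of n i x]
      by (simp add: Z_Suc C_Suc sum_distrib_left distrib_left right_diff_distrib sum.distrib
          sum_subtractf mult.left_commute)
    have "(\<Sum>e<4. of_real (refine_weight e) * (avg (Suc n) (2 * i + int e) * of_real (mass (Suc n) (2 * i + int e))))
        = (\<Sum>e<4. (\<integral>x. of_real (refine_weight e) * (of_real (h (Suc n) (2 * i + int e) x) * f x) \<partial>M))"
      by (simp add: avg_mass)
    also have "\<dots> = (\<integral>x. (\<Sum>e<4. of_real (refine_weight e) * (of_real (h (Suc n) (2 * i + int e) x) * f x)) \<partial>M)"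
      by (subst Bochner_Integration.integral_sum) simp_all
    also have "\<dots> = (\<integral>x. of_real (h n i x) * f x \<partial>M)"
      by (intro Bochner_Integration.integral_cong refl)
         (simp add: h_refine[of n i] sum_distrib_right mult.assoc)
    finally have "(\<Sum>e<4. of_real (refine_weight e) * (avg (Suc n) (2 * i + int e) * of_real (mass (Suc n) (2 * i + int e))))
        = avg n i * of_real (mass n i)" by (simp add: avg_mass)
    then show ?thesis
      unfolding eq using Suc.IH by (subst Bochner_Integration.integral_sum) auto
  qed
qed

lemma W_bound:
  assumes "norm (avg n i) \<le> \<theta>"
  shows "norm (f x * of_real (h n i x - Z \<theta> d n i x) + C \<theta> d n i x) \<le> norm (f x) + \<theta>"
proof -
  have t: "0 \<le> \<theta>" using assms norm_ge_zero[of "avg n i"] by linarith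
  have "norm (f x * of_real (h n i x - Z \<theta> d n i x)) \<le> norm (f x)"
    using Z_le_h[of \<theta> d n i x] Z_nonneg[of \<theta> d n i x] h_le_1[of n i x]
    by (auto simp: norm_mult simp del: of_real_diff intro!: mult_right_le_one_le)
  moreover have "norm (C \<theta> d n i x) \<le> \<theta> * 1"
    using C_le[OF assms, of d x] Z_le_h[of \<theta> d n i x] h_le_1[of n i x] t
    by (meson mult_left_mono order_trans)
  ultimately show ?thesis by norm
qed

lemma W_lim:
  assumes "norm (avg n i) \<le> \<theta>"
  shows "(\<lambda>d. f x * of_real (h n i x - Z \<theta> d n i x) + C \<theta> d n i x) \<longlonglongrightarrow> V \<theta> n i x"
  unfolding V_def by (intro tendsto_add tendsto_mult tendsto_const tendsto_of_real tendsto_diff Z_lim C_lim assms)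

text \<open>Dominated convergence carries optional stopping to infinite depth. The resulting mean
  does not involve \<open>\<theta>\<close>, so differences of \<open>V\<close> at two levels have
  mean zero.\<close>

lemma V_integral:
  assumes "norm (avg n i) \<le> \<theta>"
  shows "integrable M (V \<theta> n i)" and "(\<integral>x. V \<theta> n i x \<partial>M) = avg n i * of_real (mass n i)"
proof -
  have dom: "integrable M (\<lambda>x. norm (f x) + \<theta>)" using f_integrable by auto
  note [measurable] = V_measurable[OF assms]
  show "integrable M (V \<theta> n i)"
    by (rule integrable_dominated_convergence[where w="\<lambda>x. norm (f x) + \<theta>" and
       s="\<lambda>d x. f x * of_real (h n i x - Z \<theta> d n i x) + C \<theta> d n i x"])
       (use dom W_bound[OF assms] W_lim[OF assms] in auto)
  have "(\<lambda>d. \<integral>x. f x * of_real (h n i x - Z \<theta> d n i x) + C \<theta> d n i x \<partial>M) \<longlonglongrightarrow> (\<integral>x. V \<theta> n i x \<partial>M)"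
    by (rule integral_dominated_convergence[where w="\<lambda>x. norm (f x) + \<theta>"])
       (use dom W_bound[OF assms] W_lim[OF assms] in auto)
  then show "(\<integral>x. V \<theta> n i x \<partial>M) = avg n i * of_real (mass n i)"
    using W_integral by (simp add: LIMSEQ_const_iff)
qed

lemma Z_antimono: "\<theta> \<le> \<theta>' \<Longrightarrow> Z \<theta>' d n i x \<le> Z \<theta> d n i x"
proof (induction d arbitrary: n i)
  case (Suc d)
  show ?case
  proof (cases "stop \<theta> n i")
    case True then show ?thesis using Z_le_h[of \<theta>' "Suc d" n i x] by (simp add: Z_Suc[of \<theta>])
  next
    case False
    then have "\<not> stop \<theta>' n i" using stop_antimono Suc.prems by blast
    with False show ?thesis
      using Suc by (auto simp: Z_Suc refine_weight_pos less_imp_le intro!: sum_mono mult_left_mono)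
  qed
qed simp

lemma Zlim_antimono: "\<theta> \<le> \<theta>' \<Longrightarrow> Zlim \<theta>' n i x \<le> Zlim \<theta> n i x"
  by (rule LIMSEQ_le[OF Z_lim Z_lim]) (auto intro: Z_antimono)

text \<open>Walks never halted at \<open>\<theta>\<close> are never halted at
  \<open>\<theta>'\<close> either, and there both functions keep \<open>f\<close>. The bound is
  crude, as it contains \<open>f\<close>; it serves only to make restart errors vanish.\<close>

lemma V_diff_le:
  assumes "norm (avg n i) \<le> \<theta>" "\<theta> \<le> \<theta>'"
  shows "norm (V \<theta>' n i x - V \<theta> n i x) \<le> (norm (f x) + 2 * \<theta>') * Zlim \<theta> n i x"
proof -
  note Z' = Zlim_antimono[OF assms(2), of n i x]
  have t: "0 \<le> \<theta>" "0 \<le> \<theta>'" using assms norm_ge_zero[of "avg n i"] by linarith+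
  have "V \<theta>' n i x - V \<theta> n i x = f x * of_real (Zlim \<theta> n i x - Zlim \<theta>' n i x) + (Clim \<theta>' n i x - Clim \<theta> n i x)"
    by (simp add: V_def algebra_simps)
  also have "norm \<dots> \<le> norm (f x) * Zlim \<theta> n i x + (\<theta>' * Zlim \<theta> n i x + \<theta>' * Zlim \<theta> n i x)"
  proof (intro norm_triangle_le add_mono norm_triangle_le_diff)
    show "norm (f x * of_real (Zlim \<theta> n i x - Zlim \<theta>' n i x)) \<le> norm (f x) * Zlim \<theta> n i x"
      using Z' Zlim_nonneg[of \<theta>' n i x] by (auto simp: norm_mult simp del: of_real_diff intro!: mult_left_mono)
    have "norm (Clim \<theta>' n i x) \<le> \<theta>' * Zlim \<theta>' n i x" by (rule Clim_le) (use assms in linarith)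
    then show "norm (Clim \<theta>' n i x) \<le> \<theta>' * Zlim \<theta> n i x"
      using Z' t by (meson mult_left_mono order_trans)
    show "norm (Clim \<theta> n i x) \<le> \<theta>' * Zlim \<theta> n i x"
      using Clim_le[OF assms(1), of x] assms(2) Zlim_nonneg[of \<theta> n i x] by (meson mult_right_mono order_trans)
  qed
  finally show ?thesis by (simp add: algebra_simps)
qed

text \<open>Strong Markov property: below level \<open>\<theta>'\<close> the process restarts at the nodes stopped at level \<open>\<theta>\<close>.\<close>

definition restart :: "real \<Rightarrow> real \<Rightarrow> nat \<Rightarrow> nat \<Rightarrow> int \<Rightarrow> 'a \<Rightarrow> complex" where
  "restart \<theta> \<theta>' d n i x =
     stopped_sum (stop \<theta>) (\<lambda>n i. V \<theta>' n i x - avg n i * of_real (h n i x)) d n i"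

lemma Zlim_minus_Z_Suc:
  assumes "\<not> stop \<theta> n i"
  shows "Zlim \<theta> n i x - Z \<theta> (Suc d) n i x = (\<Sum>e<4. refine_weight e *
         (Zlim \<theta> (Suc n) (2 * i + int e) x - Z \<theta> d (Suc n) (2 * i + int e) x))"
proof -
  have "Zlim \<theta> n i x = (\<Sum>e<4. refine_weight e * Zlim \<theta> (Suc n) (2 * i + int e) x)"
    using Zlim_rec[of \<theta> n i x] assms by simp
  moreover have "Z \<theta> (Suc d) n i x = (\<Sum>e<4. refine_weight e * Z \<theta> d (Suc n) (2 * i + int e) x)"
    using assms by (simp add: Z_Suc)
  ultimately show ?thesis by (simp only: right_diff_distrib sum_subtractf)
qed

text \<open>After \<open>d\<close> generations the discrepancy lives on walks halted at
  \<open>\<theta>\<close> later than that. At depth 0 the claim is \<open>V_diff_le\<close>, at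
  halted nodes the error is exactly 0, and the recursion propagates both.\<close>

lemma restart_error:
  assumes "norm (avg n i) \<le> \<theta>" "\<theta> \<le> \<theta>'"
  shows "norm (V \<theta>' n i x - V \<theta> n i x - restart \<theta> \<theta>' d n i x)
         \<le> (norm (f x) + 2 * \<theta>') * (Zlim \<theta> n i x - Z \<theta> d n i x)"
  using assms(1)
proof (induction d arbitrary: n i)
  case 0
  then show ?case using V_diff_le[OF _ assms(2)] by (simp add: restart_def)
next
  case (Suc d)
  show ?case
  proof (cases "stop \<theta> n i")
    case True
    then show ?thesis
      using V_rec[OF Suc.prems, of x] Zlim_rec[of \<theta> n i x] by (simp add: restart_def Z_Suc)
  next
    case False
    then have "\<not> stop \<theta>' n i" using stop_antimono assms(2) by blast
    then have eq: "V \<theta>' n i x - V \<theta> n i x - restart \<theta> \<theta>' (Suc d) n i x =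
       (\<Sum>e<4. of_real (refine_weight e) * (V \<theta>' (Suc n) (2 * i + int e) x -
          V \<theta> (Suc n) (2 * i + int e) x - restart \<theta> \<theta>' d (Suc n) (2 * i + int e) x))"
      using False V_rec[OF Suc.prems, of x] V_rec[OF order_trans[OF Suc.prems assms(2)], of x]
      by (simp add: restart_def scaleR_conv_of_real right_diff_distrib sum_subtractf)
    have "norm (V \<theta>' n i x - V \<theta> n i x - restart \<theta> \<theta>' (Suc d) n i x) \<le>
       (\<Sum>e<4. refine_weight e * ((norm (f x) + 2 * \<theta>') *
       (Zlim \<theta> (Suc n) (2 * i + int e) x - Z \<theta> d (Suc n) (2 * i + int e) x)))"
      unfolding eq
    proof (rule sum_norm_le)
      fix e :: nat assume "e \<in> {..<4}"
      then have "norm (avg (Suc n) (2 * i + int e)) \<le> \<theta>" using not_stop_child[OF False] by simp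
      from mult_left_mono[OF Suc.IH[OF this], of "refine_weight e"]
      show "norm (of_real (refine_weight e) * (V \<theta>' (Suc n) (2 * i + int e) x -
          V \<theta> (Suc n) (2 * i + int e) x - restart \<theta> \<theta>' d (Suc n) (2 * i + int e) x))
        \<le> refine_weight e * ((norm (f x) + 2 * \<theta>') *
           (Zlim \<theta> (Suc n) (2 * i + int e) x - Z \<theta> d (Suc n) (2 * i + int e) x))"
        using refine_weight_pos[of e] by (simp only: norm_mult norm_of_real abs_of_pos)
    qed
    also have "\<dots> = (norm (f x) + 2 * \<theta>') * (Zlim \<theta> n i x - Z \<theta> (Suc d) n i x)"
      unfolding Zlim_minus_Z_Suc[OF False] sum_distrib_left
      by (rule sum.cong[OF refl mult.left_commute])
    finally show ?thesis .
  qed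
qed

lemma restart_lim:
  assumes "norm (avg n i) \<le> \<theta>" "\<theta> \<le> \<theta>'"
  shows "(\<lambda>d. restart \<theta> \<theta>' d n i x) \<longlonglongrightarrow> V \<theta>' n i x - V \<theta> n i x"
proof -
  have "(\<lambda>d. (norm (f x) + 2 * \<theta>') * (Zlim \<theta> n i x - Z \<theta> d n i x)) \<longlonglongrightarrow>
      (norm (f x) + 2 * \<theta>') * (Zlim \<theta> n i x - Zlim \<theta> n i x)"
    by (intro tendsto_mult tendsto_const tendsto_diff Z_lim)
  then have lim0: "(\<lambda>d. (norm (f x) + 2 * \<theta>') * (Zlim \<theta> n i x - Z \<theta> d n i x)) \<longlonglongrightarrow> 0"
    by simp
  have "(\<lambda>d. V \<theta>' n i x - V \<theta> n i x - restart \<theta> \<theta>' d n i x) \<longlonglongrightarrow> 0"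
    by (rule Lim_null_comparison[OF always_eventually[OF allI[OF restart_error[OF assms]]] lim0])
  from tendsto_diff[OF tendsto_const[of "V \<theta>' n i x - V \<theta> n i x"] this]
  show ?thesis by simp
qed

end

text \<open>\<open>mf\<close> will be a multiple of the local maximal function plus a constant.
  Differentiation is asked along some arbitrarily deep generations but for all nodes active at
  \<open>x\<close>, because the surviving branch from \<open>unstopped_node\<close> cannot be
  prescribed.\<close>

locale refinement_maximal = refinement_function +
  fixes mf :: "'a \<Rightarrow> ennreal"
  assumes mf_measurable [measurable]: "mf \<in> borel_measurable M"
    and avg_le: "\<And>n i x. x \<in> space M \<Longrightarrow> 0 < h n i x \<Longrightarrow> ennreal (norm (avg n i)) \<le> mf x"
    and f_diff: "AE x in M. \<forall>\<epsilon>>0. \<forall>N. \<exists>m\<ge>N. \<forall>i. 0 < h m i x \<longrightarrow> norm (avg m i - f x) < \<epsilon>"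
begin

lemma f_le_mf: "AE x in M. ennreal (norm (f x)) \<le> mf x"
  using f_diff AE_space
proof eventually_elim
  case (elim x)
  show ?case
  proof (rule ennreal_le_epsilon)
    fix e :: real assume "0 < e"
    with elim(1) obtain m where m: "\<forall>i. 0 < h m i x \<longrightarrow> norm (avg m i - f x) < e" by blast
    obtain i where i: "0 < h m i x" using h_cover elim(2) by blast
    with m have "norm (avg m i - f x) < e" by blast
    then have "norm (f x) \<le> norm (avg m i) + e" by norm
    then have "ennreal (norm (f x)) \<le> ennreal (norm (avg m i)) + ennreal e"
      using \<open>0 < e\<close> by (simp add: ennreal_leI flip: ennreal_plus)
    also have "\<dots> \<le> mf x + ennreal e" using avg_le[OF elim(2) i] by (rule add_right_mono)
    finally show "ennreal (norm (f x)) \<le> mf x + ennreal e" .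
  qed
qed

text \<open>Where weight survives, nodes of average at most \<open>\<theta>\<close> shrink to
  \<open>x\<close>, so differentiation gives \<open>norm (f x) \<le> \<theta>\<close>; the halted
  weight carries averages of at most \<open>\<theta>\<close>.\<close>

lemma V_le:
  assumes "norm (avg n i) \<le> \<theta>"
  shows "AE x in M. norm (V \<theta> n i x) \<le> \<theta> * h n i x"
  using f_diff
proof eventually_elim
  case (elim x)
  have "norm (f x) * (h n i x - Zlim \<theta> n i x) \<le> \<theta> * (h n i x - Zlim \<theta> n i x)"
  proof (cases "Zlim \<theta> n i x = h n i x")
    case False
    have "norm (f x) \<le> \<theta> + e" if "0 < e" for e
    proof -
      from elim that obtain m where m: "m \<ge> n" "\<forall>i. 0 < h m i x \<longrightarrow> norm (avg m i - f x) < e"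
        by blast
      have "Z \<theta> (m - n) n i x < h n i x"
        using False Z_le_Zlim[of \<theta> "m - n" n i x] Zlim_le_h[of \<theta> n i x] by linarith
      from unstopped_node[OF this assms] m obtain j where "0 < h m j x" "norm (avg m j) \<le> \<theta>"
        by auto
      with m have "norm (avg m j - f x) < e" "norm (avg m j) \<le> \<theta>" by blast+
      then show ?thesis by norm
    qed
    then have "norm (f x) \<le> \<theta>" by (rule field_le_epsilon)
    then show ?thesis using Zlim_le_h[of \<theta> n i x] by (intro mult_right_mono) auto
  qed simp
  moreover have "norm (V \<theta> n i x) \<le> norm (f x) * (h n i x - Zlim \<theta> n i x) + \<theta> * Zlim \<theta> n i x"
    unfolding V_def using Clim_le[OF assms, of x] Zlim_le_h[of \<theta> n i x]
    by (intro norm_triangle_le add_mono) (auto simp: norm_mult simp del: of_real_diff)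
  ultimately show ?case by (simp add: algebra_simps)
qed

text \<open>The increment collects the nodes halted exactly \<open>d\<close> generations down. At
  each of them the difference of \<open>V\<close> and the average has mean zero and is at most 2
  \<open>\<theta>'\<close> times \<open>h\<close>; adding the costs leaves the increment of the
  halted mass.\<close>

lemma restart_incr_atomic:
  assumes "norm (avg n i) \<le> \<theta>" "\<theta> \<le> \<theta>'"
  shows "atomic_le M \<A> (\<lambda>x. restart \<theta> \<theta>' (Suc d) n i x - restart \<theta> \<theta>' d n i x)
     (2 * A * \<theta>' * (stopped_sum (stop \<theta>) mass (Suc d) n i - stopped_sum (stop \<theta>) mass d n i))"
  using assms(1)
proof (induction d arbitrary: n i)
  case 0
  show ?case
  proof (cases "stop \<theta> n i")
    case True
    have t: "norm (avg n i) \<le> \<theta>'" "0 \<le> \<theta>'" using 0 assms(2) norm_ge_zero[of "avg n i"] by linarith+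
    note [measurable] = V_measurable[OF t(1)]
    note V = V_integral[OF t(1)]
    have "atomic_le M \<A> (\<lambda>x. V \<theta>' n i x - avg n i * of_real (h n i x)) (A * (2 * \<theta>') * mass n i)"
    proof (rule atomic_le_bounded)
      \<comment> \<open>Off the node both terms vanish at every point, not only almost everywhere,
        as the support condition for atoms demands.\<close>
      show "V \<theta>' n i x - avg n i * of_real (h n i x) = 0" if "h n i x = 0" for x
      proof -
        have "Zlim \<theta>' n i x = 0" using Zlim_le_h[of \<theta>' n i x] Zlim_nonneg[of \<theta>' n i x] that by simp
        then show ?thesis using Clim_le[OF t(1), of x] that by (simp add: V_def)
      qed
      show "AE x in M. norm (V \<theta>' n i x - avg n i * of_real (h n i x)) \<le> 2 * \<theta>' * h n i x"
        using V_le[OF t(1)]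
      proof eventually_elim
        case (elim x)
        have "norm (avg n i * of_real (h n i x)) \<le> \<theta>' * h n i x"
          using t(1) h_nonneg[of n i x] by (simp add: norm_mult mult_right_mono)
        with elim norm_triangle_ineq4[of "V \<theta>' n i x" "avg n i * of_real (h n i x)"]
        show ?case by linarith
      qed
      show "(\<integral>x. V \<theta>' n i x - avg n i * of_real (h n i x) \<partial>M) = 0"
        using V by (subst Bochner_Integration.integral_diff) auto
    qed (use t in auto)
    then show ?thesis using True by (simp add: restart_def mult_ac)
  qed (simp add: restart_def atomic_le_zero)
next
  case (Suc d)
  show ?case
  proof (cases "stop \<theta> n i")
    case True
    then show ?thesis
      by (simp add: restart_def stopped_sum_incr_Suc atomic_le_zero del: stopped_sum.simps)
  next
    case False
    let ?R = "\<lambda>e x. restart \<theta> \<theta>' (Suc d) (Suc n) (2 * i + int e) x - restart \<theta> \<theta>' d (Suc n) (2 * i + int e) x"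
    let ?m = "\<lambda>e. stopped_sum (stop \<theta>) mass (Suc d) (Suc n) (2 * i + int e) - stopped_sum (stop \<theta>) mass d (Suc n) (2 * i + int e)"
    have "atomic_le M \<A> (\<lambda>x. restart \<theta> \<theta>' (Suc (Suc d)) n i x - restart \<theta> \<theta>' (Suc d) n i x)
       (\<Sum>e<4. norm (complex_of_real (refine_weight e)) * (2 * A * \<theta>' * ?m e))"
    proof (rule atomic_le_sum)
      fix e :: nat assume "e < 4"
      show "atomic_le M \<A> (\<lambda>x. of_real (refine_weight e) * ?R e x)
        (norm (complex_of_real (refine_weight e)) * (2 * A * \<theta>' * ?m e))"
        by (rule atomic_le_cmult[OF Suc.IH[OF not_stop_child[OF False \<open>e < 4\<close>]]])
    next
      show "AE x in M. restart \<theta> \<theta>' (Suc (Suc d)) n i x - restart \<theta> \<theta>' (Suc d) n i x =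
         (\<Sum>e<4. of_real (refine_weight e) * ?R e x)"
        using False
        by (simp add: restart_def stopped_sum_incr_Suc scaleR_conv_of_real del: stopped_sum.simps)
    qed
    also have "(\<Sum>e<4. norm (complex_of_real (refine_weight e)) * (2 * A * \<theta>' * ?m e)) =
      2 * A * \<theta>' * (stopped_sum (stop \<theta>) mass (Suc (Suc d)) n i - stopped_sum (stop \<theta>) mass (Suc d) n i)"
      using False
      by (simp add: stopped_sum_incr_Suc refine_weight_pos less_imp_le del: stopped_sum.simps)
         (simp only: sum_distrib_left mult.left_commute)
    finally show ?thesis .
  qed
qed

lemma stopped_mass_eq: "stopped_sum (stop \<theta>) mass d n i = (\<integral>x. Z \<theta> d n i x \<partial>M)"
  and Z_integrable: "integrable M (Z \<theta> d n i)"
proof (induction d arbitrary: n i)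
  case (Suc d)
  { case 1 then show ?case using Suc by (simp add: Z_Suc) }
  { case 2 then show ?case using Suc by (cases "stop \<theta> n i") (simp_all add: Z_Suc[abs_def]) }
qed (simp_all add: Z_0[abs_def])

lemma Zlim_integrable: "integrable M (Zlim \<theta> n i)"
  by (rule integrable_const_bound[of _ 1])
     (auto simp: Zlim_nonneg intro: order_trans[OF Zlim_le_h h_le_1])

lemma stopped_mass_le: "stopped_sum (stop \<theta>) mass d n i \<le> (\<integral>x. Zlim \<theta> n i x \<partial>M)"
  unfolding stopped_mass_eq
  by (intro integral_mono Z_integrable Zlim_integrable Z_le_Zlim)

text \<open>Telescoping in the depth: the total cost is governed by the mass that is ever halted at
  the lower level.\<close>

lemma V_diff_atomic:
  assumes "norm (avg n i) \<le> \<theta>" "\<theta> \<le> \<theta>'"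
  shows "atomic_le M \<A> (\<lambda>x. V \<theta>' n i x - V \<theta> n i x) (2 * A * \<theta>' * (\<integral>x. Zlim \<theta> n i x \<partial>M))"
proof -
  have t: "0 \<le> \<theta>'" using assms norm_ge_zero[of "avg n i"] by linarith
  let ?m = "\<lambda>d. stopped_sum (stop \<theta>) mass d n i"
  have inc: "incseq ?m" by (rule stopped_sum_incseq) (use mass_pos in \<open>auto intro: less_imp_le\<close>)
  obtain l where l: "?m \<longlonglongrightarrow> l"
    by (rule incseq_convergent[OF inc, where B="\<integral>x. Zlim \<theta> n i x \<partial>M"]) (use stopped_mass_le in auto)
  have ll: "l \<le> (\<integral>x. Zlim \<theta> n i x \<partial>M)"
    by (rule LIMSEQ_le_const2[OF l]) (use stopped_mass_le in auto)
  have s: "(\<lambda>d. 2 * A * \<theta>' * (?m (Suc d) - ?m d)) sums (2 * A * \<theta>' * (l - ?m 0))"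
    by (intro sums_mult telescope_sums l)
  have "atomic_le M \<A> (\<lambda>x. V \<theta>' n i x - V \<theta> n i x) (suminf (\<lambda>d. 2 * A * \<theta>' * (?m (Suc d) - ?m d)))"
  proof (rule atomic_le_sums[OF restart_incr_atomic[OF assms]])
    show "summable (\<lambda>d. 2 * A * \<theta>' * (?m (Suc d) - ?m d))" using s by (rule sums_summable)
    show "AE x in M. (\<lambda>d. restart \<theta> \<theta>' (Suc d) n i x - restart \<theta> \<theta>' d n i x) sums (V \<theta>' n i x - V \<theta> n i x)"
    proof (rule AE_I2)
      fix x
      have "restart \<theta> \<theta>' 0 n i x = 0" by (simp add: restart_def)
      then show "(\<lambda>d. restart \<theta> \<theta>' (Suc d) n i x - restart \<theta> \<theta>' d n i x) sums (V \<theta>' n i x - V \<theta> n i x)"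
        using telescope_sums[OF restart_lim[OF assms, of x]] by simp
    qed
  qed
  then show ?thesis
    by (rule atomic_le_mono) (use s ll t A_nonneg in \<open>auto simp: sums_iff intro!: mult_left_mono\<close>)
qed

end

text \<open>The terms below \<open>r\<close> form a geometric progression, which is less than twice
  its largest member.\<close>

lemma dyadic_sum_le:
  fixes r \<xi> :: real
  assumes "0 \<le> \<xi>" "0 \<le> r"
  shows "(\<Sum>k<m. 2 ^ k * \<xi> * (if 2 ^ k * \<xi> < r then 1 else 0)) \<le> 2 * r"
proof (induction m)
  case (Suc m)
  show ?case
  proof (cases "2 ^ m * \<xi> < r")
    case True
    have "(\<Sum>k<Suc m. 2 ^ k * \<xi> * (if 2 ^ k * \<xi> < r then 1 else 0)) \<le> (\<Sum>k<Suc m. 2 ^ k * \<xi>)"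
      using assms by (intro sum_mono) auto
    also have "\<dots> = (2 ^ Suc m - 1) * \<xi>"
      by (simp only: sum_distrib_right[symmetric] mask_eq_sum_exp)
         (induction m, auto simp: algebra_simps)
    also have "\<dots> \<le> 2 * r" using True assms by (simp add: algebra_simps)
    finally show ?thesis .
  qed (use Suc in simp)
qed (use assms in simp)

lemma dyadic_suminf_le:
  fixes \<xi> :: real and r :: ennreal
  assumes "0 \<le> \<xi>"
  shows "(\<Sum>k. ennreal (2 ^ k * \<xi>) * indicator {t. ennreal (2 ^ k * \<xi>) < t} r) \<le> 2 * r"
proof (cases r)
  case (real s)
  have "(\<Sum>k<m. ennreal (2 ^ k * \<xi>) * indicator {t. ennreal (2 ^ k * \<xi>) < t} r) \<le> 2 * r" for m
  proof -
    have "(\<Sum>k<m. ennreal (2 ^ k * \<xi>) * indicator {t. ennreal (2 ^ k * \<xi>) < t} r) =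
      (\<Sum>k<m. ennreal (2 ^ k * \<xi> * (if 2 ^ k * \<xi> < s then 1 else 0)))"
      using real assms by (intro sum.cong) (auto simp: ennreal_less_iff indicator_def)
    also have "\<dots> = ennreal (\<Sum>k<m. 2 ^ k * \<xi> * (if 2 ^ k * \<xi> < s then 1 else 0))"
      using assms by (intro sum_ennreal) auto
    also have "\<dots> \<le> ennreal (2 * s)" using dyadic_sum_le[OF assms] real by (intro ennreal_leI) auto
    also have "\<dots> = 2 * r" using real by (simp add: ennreal_mult)
    finally show ?thesis .
  qed
  then show ?thesis by (intro suminf_le_const) auto
qed (simp add: ennreal_mult_top)

section \<open>Halted mass and the sum over dyadic levels\<close>

context refinement_maximal begin

lemma indicator_h_integrable:
  "B \<in> sets M \<Longrightarrow> integrable M (\<lambda>x. indicator B x * h n i x)"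
  by (rule integrable_const_bound[of _ 1]) (auto simp: indicator_def h_nonneg h_le_1)

text \<open>Restricting to \<open>B\<close> and integrating is linear and so passes through the
  finite recursion.\<close>

lemma stopped_sum_indicator:
  assumes B: "B \<in> sets M"
  shows "integrable M (\<lambda>x. indicator B x * Z \<theta> d n i x)" and
    "stopped_sum (stop \<theta>) (\<lambda>n i. \<integral>x. indicator B x * h n i x \<partial>M) d n i = (\<integral>x. indicator B x * Z \<theta> d n i x \<partial>M)"
proof (induction d arbitrary: n i)
  case (Suc d)
  have eq: "indicator B x * Z \<theta> (Suc d) n i x = (\<Sum>e<4. refine_weight e * (indicator B x * Z \<theta> d (Suc n) (2 * i + int e) x))"
    if "\<not> stop \<theta> n i" for n i x
    using that by (simp add: Z_Suc sum_distrib_left mult.left_commute)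
  have stopped: "indicator B x * Z \<theta> (Suc d) n i x = indicator B x * h n i x" if "stop \<theta> n i" for n i x
    using that by (simp add: Z_Suc)
  { case (1 n i) show ?case
    proof (cases "stop \<theta> n i")
      case True show ?thesis unfolding stopped[OF True] by (rule indicator_h_integrable[OF B])
    next
      case False show ?thesis unfolding eq[OF False]
        by (intro Bochner_Integration.integrable_sum integrable_mult_right Suc.IH)
    qed }
  { case (2 n i) show ?case
    proof (cases "stop \<theta> n i")
      case True then show ?thesis unfolding stopped[OF True] by simp
    next
      case False
      then show ?thesis unfolding eq[OF False]
        by (subst Bochner_Integration.integral_sum)
           (simp_all add: Suc.IH integrable_mult_right del: integrable_mult_right_iff)
    qed }
qed simp_all

text \<open>The weak type bound of the construction. A halted node has a child with average above
  \<open>\<theta>\<close>, so \<open>mf\<close> exceeds \<open>\<theta>\<close> on the support of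
  this child; the child enters its parent with weight at least 1/4, and \<open>D\<close> compares
  the two masses.\<close>

lemma stopped_mass_le_maximal:
  assumes \<theta>: "0 \<le> \<theta>"
  shows "stopped_sum (stop \<theta>) mass d n i \<le> 4 * D * (\<integral>x. indicator {x\<in>space M. ennreal \<theta> < mf x} x * h n i x \<partial>M)"
proof -
  define B where "B = {x\<in>space M. ennreal \<theta> < mf x}"
  have B: "B \<in> sets M" unfolding B_def by measurable
  let ?I = "\<lambda>n i. \<integral>x. indicator B x * h n i x \<partial>M"
  have "stopped_sum (stop \<theta>) mass d n i \<le> stopped_sum (stop \<theta>) (\<lambda>n i. 4 * D * ?I n i) d n i"
  proof (rule stopped_sum_mono)
    fix n i assume "stop \<theta> n i"
    then obtain e where e: "e < 4" "\<theta> < norm (avg (Suc n) (2 * i + int e))" by (auto simp: stop_def)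
    have "mass (Suc n) (2 * i + int e) \<le> (\<integral>x. 4 * (indicator B x * h n i x) \<partial>M)"
    proof (rule integral_mono)
      fix x assume x: "x \<in> space M"
      show "h (Suc n) (2 * i + int e) x \<le> 4 * (indicator B x * h n i x)"
      proof (cases "h (Suc n) (2 * i + int e) x = 0")
        case False
        then have pos: "0 < h (Suc n) (2 * i + int e) x" using h_nonneg[of "Suc n" "2 * i + int e" x] by simp
        have "ennreal \<theta> < ennreal (norm (avg (Suc n) (2 * i + int e)))" using e \<theta> by (simp add: ennreal_less_iff)
        with avg_le[OF x pos] x have "x \<in> B" by (auto simp: B_def)
        have "refine_weight e * h (Suc n) (2 * i + int e) x \<le> h n i x"
          unfolding h_refine[of n i x] using e
          by (intro member_le_sum) (auto simp: h_nonneg refine_weight_pos less_imp_le)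
        moreover have "1 / 4 * h (Suc n) (2 * i + int e) x \<le> refine_weight e * h (Suc n) (2 * i + int e) x"
          using pos refine_weight_ge[of e] by (intro mult_right_mono) auto
        ultimately show ?thesis using \<open>x \<in> B\<close> by simp
      qed (simp add: h_nonneg)
    qed (use indicator_h_integrable[OF B, of n i] in auto)
    then have "mass (Suc n) (2 * i + int e) \<le> 4 * ?I n i" by simp
    from mult_left_mono[OF this D_nonneg] mass_child[OF e(1), of n i]
    show "mass n i \<le> 4 * D * ?I n i" by simp
  qed
  also have "\<dots> = 4 * D * (\<integral>x. indicator B x * Z \<theta> d n i x \<partial>M)"
    by (simp only: stopped_sum_cmult stopped_sum_indicator(2)[OF B])
  also have "\<dots> \<le> 4 * D * ?I n i"
    using D_nonneg
    by (intro mult_left_mono integral_mono stopped_sum_indicator(1) indicator_h_integrable B) (auto simp: Z_le_h)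
  finally show ?thesis by (simp add: B_def)
qed

lemma Zlim_mass_le:
  assumes \<theta>: "0 \<le> \<theta>"
  shows "(\<integral>x. Zlim \<theta> n i x \<partial>M) \<le> 4 * D * (\<integral>x. indicator {x\<in>space M. ennreal \<theta> < mf x} x * h n i x \<partial>M)"
proof (rule LIMSEQ_le_const2)
  show "(\<lambda>d. \<integral>x. Z \<theta> d n i x \<partial>M) \<longlonglongrightarrow> (\<integral>x. Zlim \<theta> n i x \<partial>M)"
    by (rule integral_dominated_convergence[where w="h n i"])
       (auto simp: Z_lim Z_nonneg Z_le_h)
qed (use stopped_mass_le_maximal[OF \<theta>] in \<open>auto simp: stopped_mass_eq\<close>)

lemma V_minus_f_le:
  assumes "norm (avg n i) \<le> \<theta>"
  shows "norm (V \<theta> n i x - of_real (h n i x) * f x) \<le> (\<theta> + norm (f x)) * Zlim \<theta> n i x"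
proof -
  have "V \<theta> n i x - of_real (h n i x) * f x = Clim \<theta> n i x - f x * of_real (Zlim \<theta> n i x)"
    by (simp add: V_def algebra_simps)
  also have "norm \<dots> \<le> norm (Clim \<theta> n i x) + norm (f x * of_real (Zlim \<theta> n i x))"
    by (rule norm_triangle_ineq4)
  also have "\<dots> \<le> (\<theta> + norm (f x)) * Zlim \<theta> n i x"
    using Clim_le[OF assms, of x] Zlim_nonneg[of \<theta> n i x] by (simp add: norm_mult algebra_simps)
  finally show ?thesis .
qed

text \<open>Telescoping over the levels 2^k \<open>\<xi>\<close>. The base level costs 2 A I; the
  jump from level k to k + 1 costs 4 A \<open>z k\<close>, and the \<open>z k\<close> add up to at
  most 8 D I by the layer cake.\<close>

theorem local_atomic:
  assumes fin: "(\<integral>\<^sup>+x. ennreal (h n i x) * mf x \<partial>M) \<le> ennreal I" and I: "0 \<le> I"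
  shows "atomic_le M \<A> (\<lambda>x. of_real (h n i x) * f x - avg n i * of_real (h n i x)) ((2 * A + 32 * A * D) * I)"
proof -
  have avgI: "norm (avg n i) * mass n i \<le> I"
  proof -
    have "ennreal (norm (avg n i) * mass n i) = ennreal (norm (avg n i)) * (\<integral>\<^sup>+x. ennreal (h n i x) \<partial>M)"
      by (subst nn_integral_eq_integral) (auto simp: h_nonneg ennreal_mult)
    also have "\<dots> = (\<integral>\<^sup>+x. ennreal (h n i x) * ennreal (norm (avg n i)) \<partial>M)"
      by (simp add: nn_integral_multc mult.commute)
    also have "\<dots> \<le> (\<integral>\<^sup>+x. ennreal (h n i x) * mf x \<partial>M)"
    proof (rule nn_integral_mono)
      fix x assume x: "x \<in> space M"
      show "ennreal (h n i x) * ennreal (norm (avg n i)) \<le> ennreal (h n i x) * mf x"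
      proof (cases "h n i x = 0")
        case False
        then have "0 < h n i x" using h_nonneg[of n i x] by simp
        from avg_le[OF x this] show ?thesis by (rule mult_left_mono) simp
      qed simp
    qed
    also note fin
    finally show ?thesis using I by simp
  qed
  show ?thesis
  proof (cases "I = 0")
    \<comment> \<open>With \<open>I = 0\<close> there is no positive base level; but then
      \<open>mf\<close>, and with it \<open>f\<close>, vanishes almost everywhere where
      \<open>h n i\<close> is positive.\<close>
    case True
    have "norm (avg n i) * mass n i = 0" using avgI mass_pos[of n i] True
      by (metis antisym less_imp_le mult_nonneg_nonneg norm_ge_zero)
    then have a0: "avg n i = 0" using mass_pos[of n i] by auto
    have "(\<integral>\<^sup>+x. ennreal (h n i x) * mf x \<partial>M) = 0" using fin True by simp
    then have "AE x in M. ennreal (h n i x) * mf x = 0" by (subst (asm) nn_integral_0_iff_AE) auto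
    with f_le_mf have "AE x in M. of_real (h n i x) * f x - avg n i * of_real (h n i x) = 0"
    proof eventually_elim
      case (elim x)
      then have "h n i x = 0 \<or> mf x = 0" using h_nonneg[of n i x] by (auto simp: ennreal_eq_0_iff)
      then show ?case using elim(1) a0 by (auto simp: ennreal_eq_0_iff)
    qed
    then show ?thesis using True by (simp add: atomic_le_zero)
  next
    case False
    define \<xi> where "\<xi> = I / mass n i"
    have \<xi>: "0 < \<xi>" using False I mass_pos[of n i] by (simp add: \<xi>_def)
    have \<xi>m: "\<xi> * mass n i = I" using mass_pos[of n i] by (simp add: \<xi>_def)
    define \<theta> where "\<theta> k = 2 ^ k * \<xi>" for k :: nat
    have \<theta>0: "\<theta> 0 = \<xi>" by (simp add: \<theta>_def)
    have \<theta>S: "\<theta> (Suc k) = 2 * \<theta> k" for k by (simp add: \<theta>_def)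
    have \<theta>_ge: "\<xi> \<le> \<theta> k" for k using \<xi> by (simp add: \<theta>_def)
    then have \<theta>_pos: "0 < \<theta> k" for k using \<xi> by (meson less_le_trans)
    have "norm (avg n i) \<le> \<xi>"
      using avgI mass_pos[of n i] by (simp add: \<xi>_def pos_le_divide_eq)
    then have avg: "norm (avg n i) \<le> \<theta> k" for k using \<theta>_ge[of k] by linarith
    define B where "B k = {x\<in>space M. ennreal (\<theta> k) < mf x}" for k
    have B [measurable]: "B k \<in> sets M" for k unfolding B_def by measurable
    define z where "z k = \<theta> k * (\<integral>x. Zlim (\<theta> k) n i x \<partial>M)" for k
    have z0: "0 \<le> z k" for k
      unfolding z_def using \<theta>_pos by (intro mult_nonneg_nonneg integral_nonneg) (auto simp: Zlim_nonneg less_imp_le)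
    have "(\<Sum>k. ennreal (z k)) \<le> (\<Sum>k. ennreal (4 * D) * (\<integral>\<^sup>+x. ennreal (\<theta> k) * indicator (B k) x * ennreal (h n i x) \<partial>M))"
    proof (rule suminf_le)
      fix k
      have "z k \<le> \<theta> k * (4 * D * (\<integral>x. indicator (B k) x * h n i x \<partial>M))"
        unfolding z_def B_def using \<theta>_pos[of k] by (intro mult_left_mono Zlim_mass_le) auto
      also have "\<dots> = 4 * D * (\<integral>x. \<theta> k * (indicator (B k) x * h n i x) \<partial>M)"
        using indicator_h_integrable[OF B] by simp
      finally have "ennreal (z k) \<le> ennreal (4 * D) * ennreal (\<integral>x. \<theta> k * (indicator (B k) x * h n i x) \<partial>M)"
        using D_nonneg \<theta>_pos[of k]
        by (subst ennreal_mult[symmetric])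
           (auto intro!: ennreal_leI integral_nonneg simp: h_nonneg less_imp_le)
      also have "ennreal (\<integral>x. \<theta> k * (indicator (B k) x * h n i x) \<partial>M) =
          (\<integral>\<^sup>+x. ennreal (\<theta> k * (indicator (B k) x * h n i x)) \<partial>M)"
        using indicator_h_integrable[OF B] \<theta>_pos[of k]
        by (subst nn_integral_eq_integral) (auto simp: h_nonneg less_imp_le)
      also have "\<dots> = (\<integral>\<^sup>+x. ennreal (\<theta> k) * indicator (B k) x * ennreal (h n i x) \<partial>M)"
        using \<theta>_pos[of k] by (intro nn_integral_cong) (auto simp: indicator_def ennreal_mult h_nonneg less_imp_le)
      finally show "ennreal (z k) \<le> ennreal (4 * D) * (\<integral>\<^sup>+x. ennreal (\<theta> k) * indicator (B k) x * ennreal (h n i x) \<partial>M)" .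
    qed auto
    also have "\<dots> = ennreal (4 * D) * (\<integral>\<^sup>+x. (\<Sum>k. ennreal (\<theta> k) * indicator (B k) x * ennreal (h n i x)) \<partial>M)"
      by (subst nn_integral_suminf) auto
    also have "\<dots> \<le> ennreal (4 * D) * (\<integral>\<^sup>+x. 2 * (ennreal (h n i x) * mf x) \<partial>M)"
    proof (intro mult_left_mono nn_integral_mono)
      fix x assume x: "x \<in> space M"
      have "(\<Sum>k. ennreal (\<theta> k) * indicator (B k) x * ennreal (h n i x)) =
         (\<Sum>k. ennreal (2 ^ k * \<xi>) * indicator {t. ennreal (2 ^ k * \<xi>) < t} (mf x)) * ennreal (h n i x)"
        using x by (simp add: B_def \<theta>_def indicator_def)
      also have "\<dots> \<le> 2 * mf x * ennreal (h n i x)"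
        using \<xi> by (intro mult_right_mono dyadic_suminf_le) auto
      finally show "(\<Sum>k. ennreal (\<theta> k) * indicator (B k) x * ennreal (h n i x)) \<le> 2 * (ennreal (h n i x) * mf x)"
        by (simp add: mult_ac)
    qed auto
    also have "\<dots> \<le> ennreal (4 * D) * (2 * ennreal I)"
      using fin by (subst nn_integral_cmult) (auto intro!: mult_left_mono)
    also have "\<dots> = ennreal (8 * D * I)"
      using D_nonneg I by (simp add: ennreal_mult[symmetric] flip: ennreal_numeral)
    finally have zs: "(\<Sum>k. ennreal (z k)) \<le> ennreal (8 * D * I)" .
    then have "(\<Sum>k. ennreal (z k)) \<noteq> top" by (auto simp: top_unique)
    then have z_sum: "summable z" by (intro summable_suminf_not_top z0)
    have z_le: "suminf z \<le> 8 * D * I"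
      using zs z_sum z0 D_nonneg I by (simp add: suminf_ennreal2)
    \<comment> \<open>A convergent series of integrals forces its terms to 0 almost everywhere. The
      factor \<open>\<theta> k\<close> is kept because the averages on the halted part can be as
      large as that.\<close>
    have AE_z: "AE x in M. (\<lambda>k. \<theta> k * Zlim (\<theta> k) n i x) \<longlonglongrightarrow> 0"
    proof -
      have "(\<integral>\<^sup>+x. (\<Sum>k. ennreal (\<theta> k * Zlim (\<theta> k) n i x)) \<partial>M) = (\<Sum>k. \<integral>\<^sup>+x. ennreal (\<theta> k * Zlim (\<theta> k) n i x) \<partial>M)"
        by (rule nn_integral_suminf) measurable
      also have "\<dots> = (\<Sum>k. ennreal (z k))"
        using \<theta>_pos Zlim_integrable[of _ n i]
        by (intro suminf_cong, subst nn_integral_eq_integral) (auto simp: z_def Zlim_nonneg less_imp_le)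
      also have "\<dots> < \<infinity>" by (rule le_less_trans[OF zs]) simp
      finally have "AE x in M. (\<Sum>k. ennreal (\<theta> k * Zlim (\<theta> k) n i x)) \<noteq> \<infinity>"
        by (intro nn_integral_noteq_infinite) auto
      then show ?thesis
      proof eventually_elim
        case (elim x)
        then have "summable (\<lambda>k. \<theta> k * Zlim (\<theta> k) n i x)"
          using \<theta>_pos by (intro summable_suminf_not_top) (auto simp: Zlim_nonneg less_imp_le)
        then show ?case by (rule summable_LIMSEQ_zero)
      qed
    qed
    have V_lim: "AE x in M. (\<lambda>k. V (\<theta> k) n i x) \<longlonglongrightarrow> of_real (h n i x) * f x"
      using AE_z
    proof eventually_elim
      case (elim x)
      have "norm (V (\<theta> k) n i x - of_real (h n i x) * f x) \<le> (1 + norm (f x) / \<xi>) * (\<theta> k * Zlim (\<theta> k) n i x)" for k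
      proof -
        \<comment> \<open>As \<open>\<theta> k\<close> is at least \<open>\<xi>\<close>, the
          contribution of \<open>f\<close> is absorbed into a fixed multiple of
          \<open>\<theta> k\<close>.\<close>
        have "norm (f x) \<le> norm (f x) / \<xi> * \<theta> k"
          using \<theta>_ge[of k] \<xi> mult_left_mono[of \<xi> "\<theta> k" "norm (f x) / \<xi>"] by simp
        then have "(\<theta> k + norm (f x)) * Zlim (\<theta> k) n i x \<le> (\<theta> k + norm (f x) / \<xi> * \<theta> k) * Zlim (\<theta> k) n i x"
          by (intro mult_right_mono) (auto simp: Zlim_nonneg)
        with V_minus_f_le[OF avg[of k], of x] show ?thesis by (simp add: algebra_simps)
      qed
      moreover have "(\<lambda>k. (1 + norm (f x) / \<xi>) * (\<theta> k * Zlim (\<theta> k) n i x)) \<longlonglongrightarrow> 0"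
        using tendsto_mult[OF tendsto_const elim, of "1 + norm (f x) / \<xi>"] by simp
      ultimately have "(\<lambda>k. V (\<theta> k) n i x - of_real (h n i x) * f x) \<longlonglongrightarrow> 0"
        by (rule Lim_null_comparison[OF always_eventually[OF allI]])
      then show ?case by (rule LIM_zero_cancel)
    qed
    have 1: "atomic_le M \<A> (\<lambda>x. V (\<theta> 0) n i x - avg n i * of_real (h n i x)) (2 * A * I)"
    proof -
      note [measurable] = V_measurable[OF avg[of 0]]
      note V = V_integral[OF avg[of 0]]
      have m: "A * (2 * \<xi>) * mass n i = 2 * A * I" using \<xi>m by auto
      have "atomic_le M \<A> (\<lambda>x. V (\<theta> 0) n i x - avg n i * of_real (h n i x)) (A * (2 * \<xi>) * mass n i)"
      proof (rule atomic_le_bounded)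
        show "V (\<theta> 0) n i x - avg n i * of_real (h n i x) = 0" if "h n i x = 0" for x
        proof -
          have "Zlim (\<theta> 0) n i x = 0"
            using Zlim_le_h[of "\<theta> 0" n i x] Zlim_nonneg[of "\<theta> 0" n i x] that by simp
          then show ?thesis using Clim_le[OF avg[of 0], of x] that by (simp add: V_def)
        qed
        show "AE x in M. norm (V (\<theta> 0) n i x - avg n i * of_real (h n i x)) \<le> 2 * \<xi> * h n i x"
          using V_le[OF avg[of 0]]
        proof eventually_elim
          case (elim x)
          have "norm (avg n i * of_real (h n i x)) \<le> \<xi> * h n i x"
            using avg[of 0] h_nonneg[of n i x] by (simp add: norm_mult mult_right_mono \<theta>0)
          with elim norm_triangle_ineq4[of "V (\<theta> 0) n i x" "avg n i * of_real (h n i x)"]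
          show ?case by (simp add: \<theta>0)
        qed
        show "(\<integral>x. V (\<theta> 0) n i x - avg n i * of_real (h n i x) \<partial>M) = 0"
          using V by (subst Bochner_Integration.integral_diff) auto
      qed (use \<xi> in auto)
      then show ?thesis unfolding m .

    qed
    have 2: "atomic_le M \<A> (\<lambda>x. of_real (h n i x) * f x - V (\<theta> 0) n i x) (32 * A * D * I)"
    proof -
      have "atomic_le M \<A> (\<lambda>x. of_real (h n i x) * f x - V (\<theta> 0) n i x) (suminf (\<lambda>k. 4 * A * z k))"
      proof (rule atomic_le_sums)
        fix k
        have "atomic_le M \<A> (\<lambda>x. V (\<theta> (Suc k)) n i x - V (\<theta> k) n i x)
           (2 * A * \<theta> (Suc k) * (\<integral>x. Zlim (\<theta> k) n i x \<partial>M))"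
          using \<theta>_pos[of k] by (intro V_diff_atomic avg) (simp add: \<theta>S)
        then show "atomic_le M \<A> (\<lambda>x. V (\<theta> (Suc k)) n i x - V (\<theta> k) n i x) (4 * A * z k)"
          by (simp add: z_def \<theta>S mult_ac)
        show "summable (\<lambda>k. 4 * A * z k)" using z_sum by (rule summable_mult)
        show "AE x in M. (\<lambda>k. V (\<theta> (Suc k)) n i x - V (\<theta> k) n i x) sums (of_real (h n i x) * f x - V (\<theta> 0) n i x)"
          using V_lim by eventually_elim (rule telescope_sums)
      qed
      moreover have "(\<Sum>k. 4 * A * z k) \<le> 4 * A * (8 * D * I)"
        unfolding suminf_mult[OF z_sum, of "4 * A"] using z_le A_nonneg by (intro mult_left_mono) auto
      ultimately have "atomic_le M \<A> (\<lambda>x. of_real (h n i x) * f x - V (\<theta> 0) n i x) (4 * A * (8 * D * I))"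
        by (rule atomic_le_mono)
      then show ?thesis by (simp add: mult_ac)
    qed
    from atomic_le_add[OF 1 2, of "\<lambda>x. of_real (h n i x) * f x - avg n i * of_real (h n i x)"]
    show ?thesis by (simp add: algebra_simps)
  qed
qed

end

section \<open>The density\<close>

locale gamma_setting =
  fixes \<alpha> :: real
  assumes alpha: "\<alpha> > - 1 / 2"
begin

abbreviation "\<gamma> \<equiv> gamma_measure \<alpha>"

definition gd :: "real \<Rightarrow> real" where
  "gd x = 2 * x powr (2 * \<alpha> + 1) / Gamma (\<alpha> + 1) * exp (- (x\<^sup>2))"

text \<open>Reciprocal of the admissible scale up to constants, see \<open>w_bounds\<close>.\<close>

definition v :: "real \<Rightarrow> real" where "v x = x + 1 / x"

text \<open>A primitive of \<open>v\<close>: length measured in units of the admissible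
  scale.\<close>

definition \<tau> :: "real \<Rightarrow> real" where "\<tau> x = ln x + x\<^sup>2 / 2"

text \<open>The sum of 2 alpha + 1, from the power of x, and 2, from the Gaussian: if tau changes by
  eta, then ln x changes by at most eta and x^2 by at most 2 eta.\<close>

definition \<beta> :: real where "\<beta> = 2 * \<alpha> + 3"

lemma beta: "2 < \<beta>" using alpha by (simp add: \<beta>_def)

lemma Gamma_pos: "0 < Gamma (\<alpha> + 1)"
  using alpha by (intro Gamma_real_pos) simp

lemma gd_pos: "0 < x \<Longrightarrow> 0 < gd x"
  using Gamma_pos by (simp add: gd_def)

lemma gd_nonneg: "0 \<le> gd x"
  using Gamma_pos by (simp add: gd_def)

lemma gd_measurable [measurable]: "gd \<in> borel_measurable borel"
  unfolding gd_def by measurable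

lemma gamma_measure_eq: "\<gamma> = density (restrict_space lborel {0<..}) (\<lambda>x. ennreal (gd x))"
  by (simp add: gamma_measure_def gd_def)

lemma space_gamma [simp]: "space \<gamma> = {0<..}"
  by (simp add: gamma_measure_eq space_restrict_space)

lemma sets_gamma: "sets \<gamma> = sets (restrict_space borel {0<..})"
  by (simp add: gamma_measure_eq sets_restrict_space)

lemma sets_gamma_iff: "A \<in> sets \<gamma> \<longleftrightarrow> A \<in> sets borel \<and> A \<subseteq> {0<..}"
  by (simp add: sets_gamma sets_restrict_space_iff) auto

lemma measurable_gamma_eq: "borel_measurable \<gamma> = borel_measurable (restrict_space borel {0<..})"
  by (rule measurable_cong_sets) (simp_all add: sets_gamma)

lemma measurable_gammaI: "u \<in> borel_measurable borel \<Longrightarrow> u \<in> borel_measurable \<gamma>"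
  unfolding measurable_gamma_eq by (rule measurable_restrict_space1)

lemma measurable_gamma_indicator:
  fixes u :: "real \<Rightarrow> 'b::real_normed_vector"
  shows "u \<in> borel_measurable \<gamma> \<longleftrightarrow> (\<lambda>x. indicator {0<..} x *\<^sub>R u x) \<in> borel_measurable borel"
  unfolding measurable_gamma_eq by (simp add: borel_measurable_restrict_space_iff)

lemma nn_integral_gamma:
  assumes "u \<in> borel_measurable \<gamma>"
  shows "(\<integral>\<^sup>+x. u x \<partial>\<gamma>) = (\<integral>\<^sup>+x. ennreal (gd x) * u x * indicator {0<..} x \<partial>lborel)"
proof -
  have m: "u \<in> borel_measurable (restrict_space lborel {0<..})"
    using assms by (simp add: gamma_measure_eq)
  have [measurable]: "(\<lambda>x. ennreal (gd x)) \<in> borel_measurable (restrict_space lborel {0<..})"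
    by (intro measurable_restrict_space1) simp
  show ?thesis
    unfolding gamma_measure_eq
    using m by (subst nn_integral_density) (auto simp: nn_integral_restrict_space)
qed

lemma integral_gamma:
  fixes u :: "real \<Rightarrow> complex"
  assumes "u \<in> borel_measurable \<gamma>"
  shows "(\<integral>x. u x \<partial>\<gamma>) = (\<integral>x. indicator {0<..} x *\<^sub>R (gd x *\<^sub>R u x) \<partial>lborel)"
    and "integrable \<gamma> u \<longleftrightarrow> integrable lborel (\<lambda>x. indicator {0<..} x *\<^sub>R (gd x *\<^sub>R u x))"
proof -
  have m: "u \<in> borel_measurable (restrict_space lborel {0<..})"
    using assms by (simp add: gamma_measure_eq)
  have g: "gd \<in> borel_measurable (restrict_space lborel {0<..})"
    by (intro measurable_restrict_space1) simp
  show "(\<integral>x. u x \<partial>\<gamma>) = (\<integral>x. indicator {0<..} x *\<^sub>R (gd x *\<^sub>R u x) \<partial>lborel)"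
    unfolding gamma_measure_eq
    using m g by (subst integral_density) (auto simp: gd_nonneg integral_restrict_space)
  show "integrable \<gamma> u \<longleftrightarrow> integrable lborel (\<lambda>x. indicator {0<..} x *\<^sub>R (gd x *\<^sub>R u x))"
    unfolding gamma_measure_eq
    using m g by (subst integrable_density) (auto simp: gd_nonneg integrable_restrict_space)
qed

text \<open>The power grows no faster than a constant times exp x, and x - x^2 is at most 4 - 3 x
  because (x - 2)^2 is nonnegative.\<close>

lemma gd_exp_bound: "\<exists>C>0. \<forall>x>0. gd x \<le> C * exp (- 3 * x)"
proof -
  let ?p = "2 * \<alpha> + 1"
  have p: "0 < ?p" using alpha by simp
  let ?C = "2 / Gamma (\<alpha> + 1) * exp (?p * ln ?p + 4)"
  have "gd x \<le> ?C * exp (- 3 * x)" if x: "0 < x" for x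
  proof -
    have "ln (x / ?p) \<le> x / ?p - 1" using x p by (intro ln_le_minus_one) auto
    then have "?p * ln (x / ?p) \<le> ?p * (x / ?p - 1)" using p by (intro mult_left_mono) auto
    also have "\<dots> = x - ?p" using p by (simp add: field_simps)
    finally have "?p * ln x \<le> x + ?p * ln ?p" using x p by (simp add: ln_div right_diff_distrib)
    moreover have "x - x\<^sup>2 \<le> 4 - 3 * x" using zero_le_power2[of "x - 2"] by (simp add: power2_eq_square algebra_simps)
    ultimately have "exp (?p * ln x + - x\<^sup>2) \<le> exp ((?p * ln ?p + 4) + - 3 * x)"
      by simp
    then have "x powr ?p * exp (- x\<^sup>2) \<le> exp (?p * ln ?p + 4) * exp (- 3 * x)"
      using x by (simp only: powr_def exp_add) simp
    then show ?thesis
      using Gamma_pos by (simp add: gd_def field_simps)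
  qed
  moreover have "0 < ?C" using Gamma_pos by simp
  ultimately show ?thesis by blast
qed

lemma nn_integral_exp: "(\<integral>\<^sup>+x. ennreal (exp (- x)) * indicator {0..} x \<partial>lborel) = 1"
  using nn_intergal_power_times_exp_Ici[of 0] by simp

lemma emeasure_tail: "\<exists>C>0. \<forall>y\<ge>0. emeasure \<gamma> {y<..} \<le> ennreal (C * exp (- 2 * y))"
proof -
  obtain C where C: "C > 0" "\<And>x. 0 < x \<Longrightarrow> gd x \<le> C * exp (- 3 * x)" using gd_exp_bound by blast
  have "emeasure \<gamma> {y<..} \<le> ennreal (C * exp (- 2 * y))" if y: "0 \<le> y" for y
  proof -
    have s: "{y<..} \<in> sets \<gamma>" using y by (auto simp: sets_gamma_iff)
    have "emeasure \<gamma> {y<..} = (\<integral>\<^sup>+x. indicator {y<..} x \<partial>\<gamma>)" using s by simp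
    also have "\<dots> = (\<integral>\<^sup>+x. ennreal (gd x) * indicator {y<..} x * indicator {0<..} x \<partial>lborel)"
      using s by (intro nn_integral_gamma borel_measurable_indicator)
    also have "\<dots> \<le> (\<integral>\<^sup>+x. ennreal (C * exp (- 2 * y)) * (ennreal (exp (- x)) * indicator {0..} x) \<partial>lborel)"
    proof (rule nn_integral_mono)
      fix x
      show "ennreal (gd x) * indicator {y<..} x * indicator {0<..} x
         \<le> ennreal (C * exp (- 2 * y)) * (ennreal (exp (- x)) * indicator {0..} x)"
      proof (cases "y < x")
        case True
        have "gd x \<le> C * exp (- 3 * x)" using C True y by auto
        also have "\<dots> \<le> C * exp (- 2 * y + - x)" using True C by simp
        finally have "gd x \<le> C * exp (- 2 * y) * exp (- x)" by (simp only: exp_add mult.assoc)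
        then show ?thesis
          using True y C by (auto simp: ennreal_mult[symmetric] indicator_def intro!: ennreal_leI)
      qed simp
    qed
    also have "\<dots> = ennreal (C * exp (- 2 * y))"
      by (subst nn_integral_cmult) (auto simp: nn_integral_exp)
    finally show ?thesis .
  qed
  with C show ?thesis by blast
qed

lemma finite_measure_gamma: "finite_measure \<gamma>"
proof
  obtain C where "emeasure \<gamma> {0<..} \<le> ennreal (C * exp (- 2 * 0))"
    using emeasure_tail by fastforce
  then show "emeasure \<gamma> (space \<gamma>) \<noteq> \<infinity>" by (auto simp: top_unique)
qed

sublocale finite_measure \<gamma> by (rule finite_measure_gamma)

lemma measure_interval_le:
  assumes "0 \<le> A" "A \<le> B" "\<And>x. A < x \<Longrightarrow> x < B \<Longrightarrow> gd x \<le> u"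
  shows "measure \<gamma> {A<..<B} \<le> (B - A) * u"
proof (cases "A = B")
  case False
  then have "A < B" using assms by simp
  then have u: "0 \<le> u" using assms(3)[of "(A + B) / 2"] gd_nonneg[of "(A + B) / 2"] by simp
  have s: "{A<..<B} \<in> sets \<gamma>" using assms by (auto simp: sets_gamma_iff)
  have "emeasure \<gamma> {A<..<B} = (\<integral>\<^sup>+x. indicator {A<..<B} x \<partial>\<gamma>)" using s by simp
  also have "\<dots> = (\<integral>\<^sup>+x. ennreal (gd x) * indicator {A<..<B} x * indicator {0<..} x \<partial>lborel)"
    using s by (intro nn_integral_gamma borel_measurable_indicator)
  also have "\<dots> \<le> (\<integral>\<^sup>+x. ennreal u * indicator {A<..<B} x \<partial>lborel)"
    using assms by (intro nn_integral_mono) (auto simp: indicator_def intro!: ennreal_leI)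
  also have "\<dots> = ennreal ((B - A) * u)"
    using assms u by (simp add: nn_integral_cmult ennreal_mult[symmetric] mult.commute)
  finally show ?thesis using u assms by (simp add: emeasure_eq_measure)
qed simp

lemma measure_interval_ge:
  assumes "0 \<le> A" "A \<le> B" "\<And>x. A < x \<Longrightarrow> x < B \<Longrightarrow> l \<le> gd x" "0 \<le> l"
  shows "(B - A) * l \<le> measure \<gamma> {A<..<B}"
proof -
  have s: "{A<..<B} \<in> sets \<gamma>" using assms by (auto simp: sets_gamma_iff)
  have "ennreal ((B - A) * l) = (\<integral>\<^sup>+x. ennreal l * indicator {A<..<B} x \<partial>lborel)"
    using assms by (simp add: nn_integral_cmult ennreal_mult[symmetric] mult.commute)
  also have "\<dots> \<le> (\<integral>\<^sup>+x. ennreal (gd x) * indicator {A<..<B} x * indicator {0<..} x \<partial>lborel)"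
    using assms by (intro nn_integral_mono) (auto simp: indicator_def intro!: ennreal_leI)
  also have "\<dots> = (\<integral>\<^sup>+x. indicator {A<..<B} x \<partial>\<gamma>)"
    using s by (intro nn_integral_gamma[symmetric] borel_measurable_indicator)
  also have "\<dots> = emeasure \<gamma> {A<..<B}" using s by simp
  finally show ?thesis by (simp add: emeasure_eq_measure)
qed

lemma gd_deriv:
  assumes x: "0 < x"
  shows "(gd has_real_derivative gd x * ((2 * \<alpha> + 1) / x - 2 * x)) (at x)"
proof -
  have p: "x powr (2 * \<alpha> + 1) = x * x powr (2 * \<alpha>)" using x by (simp add: powr_add)
  have "((\<lambda>x. 2 / Gamma (\<alpha> + 1) * (x powr (2 * \<alpha> + 1) * exp (- x\<^sup>2))) has_real_derivative
      2 / Gamma (\<alpha> + 1) * ((2 * \<alpha> + 1) * x powr (2 * \<alpha> + 1 - 1) * exp (- x\<^sup>2)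
        + x powr (2 * \<alpha> + 1) * (exp (- x\<^sup>2) * (- (2 * x))))) (at x)"
    using x Gamma_pos[THEN less_imp_neq] by (auto intro!: derivative_eq_intros)
  moreover have "2 / Gamma (\<alpha> + 1) * ((2 * \<alpha> + 1) * x powr (2 * \<alpha> + 1 - 1) * exp (- x\<^sup>2)
        + x powr (2 * \<alpha> + 1) * (exp (- x\<^sup>2) * (- (2 * x)))) = gd x * ((2 * \<alpha> + 1) / x - 2 * x)"
  proof -
    have "Gamma (\<alpha> + 1) \<noteq> 0" using Gamma_pos by simp
    then show ?thesis using x by (simp add: gd_def p) (simp add: field_simps)
  qed
  moreover have "gd = (\<lambda>x. 2 / Gamma (\<alpha> + 1) * (x powr (2 * \<alpha> + 1) * exp (- x\<^sup>2)))"
    by (simp add: gd_def fun_eq_iff)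
  ultimately show ?thesis by (simp only:)
qed

lemma v_pos: "0 < x \<Longrightarrow> 0 < v x" and v_ge_2: "0 < x \<Longrightarrow> 2 \<le> v x"
proof -
  assume x: "0 < x"
  show "0 < v x" using x by (simp add: v_def add_pos_pos)
  have "0 \<le> (x - 1)\<^sup>2 / x" using x by simp
  also have "\<dots> = v x - 2" using x by (simp add: v_def field_simps power2_eq_square)
  finally show "2 \<le> v x" by simp
qed

lemma gd_deriv_le: "0 < x \<Longrightarrow> \<bar>gd x * ((2 * \<alpha> + 1) / x - 2 * x)\<bar> \<le> \<beta> * gd x * v x"
proof -
  assume x: "0 < x"
  have "\<bar>(2 * \<alpha> + 1) / x - 2 * x\<bar> \<le> (2 * \<alpha> + 1) / x + 2 * x" using x alpha by (intro abs_leI) auto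
  also have "\<dots> \<le> \<beta> * (1 / x) + \<beta> * x"
    using x alpha by (intro add_mono mult_right_mono) (auto simp: \<beta>_def divide_right_mono)
  finally have "gd x * \<bar>(2 * \<alpha> + 1) / x - 2 * x\<bar> \<le> gd x * (\<beta> * v x)"
    by (intro mult_left_mono) (auto simp: gd_nonneg v_def algebra_simps)
  then show ?thesis by (simp add: abs_mult gd_nonneg mult_ac)
qed

section \<open>The coordinate tau and its inverse\<close>

lemma tau_deriv: "0 < x \<Longrightarrow> (\<tau> has_real_derivative v x) (at x)"
  unfolding \<tau>_def v_def by (auto intro!: derivative_eq_intros)

lemma tau_less: "0 < x \<Longrightarrow> x < y \<Longrightarrow> \<tau> x < \<tau> y"
  unfolding \<tau>_def by (intro add_less_le_mono) (auto intro!: divide_right_mono power_mono)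

lemma tau_less_iff: "0 < x \<Longrightarrow> 0 < y \<Longrightarrow> \<tau> x < \<tau> y \<longleftrightarrow> x < y"
  using tau_less[of x y] tau_less[of y x] by (metis less_asym linorder_neqE_linordered_idom)

lemma tau_le_iff: "0 < x \<Longrightarrow> 0 < y \<Longrightarrow> \<tau> x \<le> \<tau> y \<longleftrightarrow> x \<le> y"
  using tau_less_iff[of y x] by (simp add: linorder_not_less[symmetric])

lemma tau_surj: "\<exists>x>0. \<tau> x = s"
proof -
  \<comment> \<open>At the lower point x^2 / 2 is at most 1/2, which the shift by 1 in the
    exponential compensates; at the upper point it only helps.\<close>
  let ?l = "min 1 (exp (s - 1))" and ?u = "max 1 (exp s)"
  have "\<tau> ?l \<le> s"
  proof -
    have "ln ?l \<le> s - 1" by (metis exp_gt_zero exp_le_cancel_iff exp_ln min.cobounded2 min_less_iff_conj zero_less_one)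
    moreover have "?l\<^sup>2 \<le> 1" by (intro power_le_one) auto
    ultimately show ?thesis by (simp add: \<tau>_def)
  qed
  moreover have "s \<le> \<tau> ?u"
  proof -
    have "s \<le> ln ?u" by (metis exp_gt_zero ln_exp ln_le_cancel_iff max.cobounded2 max.strict_coboundedI2)
    then show ?thesis by (simp add: \<tau>_def add_increasing2)
  qed
  moreover have lu: "0 < ?l" "?l \<le> ?u" by auto
  moreover have "continuous_on {?l..?u} \<tau>"
  proof -
    have "x \<noteq> 0" if "x \<in> {?l..?u}" for x using less_le_trans[OF lu(1), of x] that by auto
    then show ?thesis unfolding \<tau>_def by (intro continuous_intros) auto
  qed
  ultimately obtain x where "?l \<le> x" "x \<le> ?u" "\<tau> x = s" using IVT'[of \<tau> ?l s ?u] by blast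
  with less_le_trans[OF lu(1)] show ?thesis by blast
qed

definition X :: "real \<Rightarrow> real" where "X s = (SOME x. 0 < x \<and> \<tau> x = s)"

lemma X_pos: "0 < X s" and tau_X [simp]: "\<tau> (X s) = s"
  using someI_ex[OF tau_surj[of s, unfolded Bex_def], folded X_def] by auto

lemma X_less_iff: "X s < X t \<longleftrightarrow> s < t"
  using tau_less_iff[OF X_pos[of s] X_pos[of t]] by simp

lemma less_X_iff: "0 < x \<Longrightarrow> x < X s \<longleftrightarrow> \<tau> x < s" and X_less_iff': "0 < x \<Longrightarrow> X s < x \<longleftrightarrow> s < \<tau> x"
  using tau_less_iff[OF _ X_pos[of s], of x] tau_less_iff[OF X_pos[of s], of x] by simp_all

text \<open>Both summands of tau are increasing, so neither can change by more than their sum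
  does.\<close>

lemma tau_close:
  assumes "0 < x" "0 < y" "\<bar>\<tau> x - \<tau> y\<bar> \<le> \<eta>"
  shows "\<bar>ln x - ln y\<bar> \<le> \<eta>" "\<bar>x\<^sup>2 - y\<^sup>2\<bar> \<le> 2 * \<eta>"
proof -
  have "\<bar>ln x - ln y\<bar> \<le> \<eta> \<and> \<bar>x\<^sup>2 - y\<^sup>2\<bar> \<le> 2 * \<eta>" if "x \<le> y" "0 < x" "0 < y" "\<bar>\<tau> x - \<tau> y\<bar> \<le> \<eta>" for x y
  proof -
    have "ln x \<le> ln y" "x\<^sup>2 \<le> y\<^sup>2" using that by (auto intro!: power_mono)
    with that(4) show ?thesis unfolding \<tau>_def by linarith
  qed
  from this[of x y] this[of y x] assms
  show "\<bar>ln x - ln y\<bar> \<le> \<eta>" "\<bar>x\<^sup>2 - y\<^sup>2\<bar> \<le> 2 * \<eta>"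
    unfolding abs_minus_commute[of "\<tau> y"] abs_minus_commute[of "ln y"] abs_minus_commute[of "y\<^sup>2"]
    by linarith+
qed

lemma compare:
  assumes "0 < x" "0 < y" "\<bar>\<tau> x - \<tau> y\<bar> \<le> \<eta>"
  shows "y \<le> exp \<eta> * x" "v y \<le> exp \<eta> * v x" "gd y \<le> exp (\<beta> * \<eta>) * gd x"
proof -
  have *: "y \<le> exp \<eta> * x" if "0 < x" "0 < y" "\<bar>ln x - ln y\<bar> \<le> \<eta>" for x y
  proof -
    have "exp (ln y) \<le> exp (\<eta> + ln x)" unfolding exp_le_cancel_iff using that by linarith
    then show ?thesis using that by (simp add: exp_add)
  qed
  note l = tau_close[OF assms]
  show "y \<le> exp \<eta> * x" using * assms l by blast
  moreover have "1 / y \<le> exp \<eta> * (1 / x)"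
  proof -
    have "x \<le> exp \<eta> * y" using *[of y x] assms l by (simp add: abs_minus_commute)
    then show ?thesis using assms by (simp add: field_simps)
  qed
  ultimately show "v y \<le> exp \<eta> * v x" by (simp add: v_def algebra_simps)
  have "(2 * \<alpha> + 1) * (ln y - ln x) \<le> (2 * \<alpha> + 1) * \<eta>"
    using l alpha by (intro mult_left_mono) auto
  then have "(2 * \<alpha> + 1) * ln y + - y\<^sup>2 \<le> \<beta> * \<eta> + ((2 * \<alpha> + 1) * ln x + - x\<^sup>2)"
    using l by (simp add: \<beta>_def algebra_simps)
  then have "exp ((2 * \<alpha> + 1) * ln y + - y\<^sup>2) \<le> exp (\<beta> * \<eta> + ((2 * \<alpha> + 1) * ln x + - x\<^sup>2))"
    by simp
  then have "y powr (2 * \<alpha> + 1) * exp (- y\<^sup>2) \<le> exp (\<beta> * \<eta>) * (x powr (2 * \<alpha> + 1) * exp (- x\<^sup>2))"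
    using assms by (simp only: powr_def exp_add) simp
  from mult_left_mono[OF this, of "2 / Gamma (\<alpha> + 1)"] Gamma_pos
  show "gd y \<le> exp (\<beta> * \<eta>) * gd x" by (simp add: gd_def mult_ac)
qed

lemma tau_MVT:
  assumes "0 < A" "A < B"
  obtains z where "A < z" "z < B" "\<tau> B - \<tau> A = (B - A) * v z"
  using MVT2[of A B \<tau> v] assms tau_deriv by (meson less_le_trans that)

text \<open>Mean value theorem for tau; replacing \<open>v\<close> at the intermediate point by
  \<open>v x\<close> costs a factor e.\<close>

lemma length_bounds:
  assumes "0 < x" "0 < A" "A < B" "\<bar>\<tau> x - \<tau> A\<bar> \<le> 1" "\<bar>\<tau> x - \<tau> B\<bar> \<le> 1"
  shows "B - A \<le> exp 1 * (\<tau> B - \<tau> A) / v x" "exp (- 1) * (\<tau> B - \<tau> A) / v x \<le> B - A"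
proof -
  obtain z where z: "A < z" "z < B" "\<tau> B - \<tau> A = (B - A) * v z" using tau_MVT assms by blast
  have "\<tau> A < \<tau> z" "\<tau> z < \<tau> B" using z assms by (auto intro!: tau_less)
  then have c: "\<bar>\<tau> x - \<tau> z\<bar> \<le> 1" "\<bar>\<tau> z - \<tau> x\<bar> \<le> 1" using assms by auto
  have zp: "0 < z" using z assms by simp
  note vs = v_pos[OF zp] v_pos[OF assms(1)]
  have "v x \<le> exp 1 * v z" "v z \<le> exp 1 * v x" using compare(2) c assms zp by blast+
  then have "(B - A) * v x \<le> (B - A) * (exp 1 * v z)" "(B - A) * v z \<le> (B - A) * (exp 1 * v x)"
    using assms by (intro mult_left_mono; simp)+
  then have 1: "(B - A) * v x \<le> exp 1 * (\<tau> B - \<tau> A)" and 2: "\<tau> B - \<tau> A \<le> exp 1 * ((B - A) * v x)"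
    by (simp_all add: z mult_ac)
  show "B - A \<le> exp 1 * (\<tau> B - \<tau> A) / v x"
    using 1 vs by (simp add: pos_le_divide_eq)
  from mult_left_mono[OF 2, of "exp (- 1)"] have "exp (- 1) * (\<tau> B - \<tau> A) \<le> (B - A) * v x"
    by (simp add: mult.assoc[symmetric] exp_add[symmetric])
  then show "exp (- 1) * (\<tau> B - \<tau> A) / v x \<le> B - A"
    using vs by (simp add: pos_divide_le_eq)
qed

text \<open>A factor exp beta for freezing the density at a point and a factor e for freezing
  \<open>v\<close>, within tau-distance 1.\<close>

definition c0 :: real where "c0 = exp (\<beta> + 1)"

lemma c0_ge: "1 \<le> c0" using beta by (simp add: c0_def)

lemma mass_bounds:
  assumes "0 < x" "0 < A" "A < B" "\<bar>\<tau> x - \<tau> A\<bar> \<le> 1" "\<bar>\<tau> x - \<tau> B\<bar> \<le> 1"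
  shows "measure \<gamma> {A<..<B} \<le> c0 * (\<tau> B - \<tau> A) * (gd x / v x)"
    and "(\<tau> B - \<tau> A) * (gd x / v x) \<le> c0 * measure \<gamma> {A<..<B}"
proof -
  have c: "gd z \<le> exp \<beta> * gd x" "exp (- \<beta>) * gd x \<le> gd z" if "A < z" "z < B" for z
  proof -
    have "\<tau> A < \<tau> z" "\<tau> z < \<tau> B" using that assms by (auto intro!: tau_less)
    then have c: "\<bar>\<tau> x - \<tau> z\<bar> \<le> 1" "\<bar>\<tau> z - \<tau> x\<bar> \<le> 1" using assms by auto
    have "gd z \<le> exp (\<beta> * 1) * gd x" "gd x \<le> exp (\<beta> * 1) * gd z"
      using compare(3) c assms that by (meson less_trans)+
    then show "gd z \<le> exp \<beta> * gd x" "exp (- \<beta>) * gd x \<le> gd z" by (simp_all add: exp_minus field_simps)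
  qed
  note L = length_bounds[OF assms]
  have g: "0 < gd x" and vp: "0 < v x" using gd_pos v_pos assms by auto
  have "measure \<gamma> {A<..<B} \<le> (B - A) * (exp \<beta> * gd x)"
    using assms c by (intro measure_interval_le) auto
  also have "\<dots> \<le> (exp 1 * (\<tau> B - \<tau> A) / v x) * (exp \<beta> * gd x)"
    using L g by (intro mult_right_mono) auto
  finally show "measure \<gamma> {A<..<B} \<le> c0 * (\<tau> B - \<tau> A) * (gd x / v x)"
    by (simp add: c0_def exp_add mult_ac)
  have "(exp (- 1) * (\<tau> B - \<tau> A) / v x) * (exp (- \<beta>) * gd x) \<le> (B - A) * (exp (- \<beta>) * gd x)"
    using L g by (intro mult_right_mono) auto
  also have "\<dots> \<le> measure \<gamma> {A<..<B}"
    using assms c g by (intro measure_interval_ge) auto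
  finally have "c0 * ((exp (- 1) * (\<tau> B - \<tau> A) / v x) * (exp (- \<beta>) * gd x)) \<le> c0 * measure \<gamma> {A<..<B}"
    using c0_ge by (intro mult_left_mono) auto
  moreover have "c0 * ((exp (- 1) * (\<tau> B - \<tau> A) / v x) * (exp (- \<beta>) * gd x)) =
    (c0 * (exp (- 1) * exp (- \<beta>))) * ((\<tau> B - \<tau> A) * (gd x / v x))" by simp
  moreover have "c0 * (exp (- 1) * exp (- \<beta>)) = 1" by (simp add: c0_def exp_add[symmetric])
  ultimately show "(\<tau> B - \<tau> A) * (gd x / v x) \<le> c0 * measure \<gamma> {A<..<B}"
    by (simp only: mult_1_left)
qed

text \<open>The larger of x and 1/x lies between v/2 and v, and the smaller one is its
  reciprocal.\<close>

lemma w_bounds: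
  assumes "0 < x" shows "1 / (8 * v x) \<le> w_fun x" "w_fun x \<le> 1 / (4 * v x)" "w_fun x \<le> x / 8" "0 < w_fun x"
proof -
  note vp = v_pos[OF assms]
  have "1 / v x \<le> x" using assms vp by (simp add: pos_divide_le_eq) (simp add: v_def distrib_left)
  moreover have "1 / v x \<le> 1 / x" using assms by (intro divide_left_mono mult_pos_pos vp) (auto simp: v_def)
  ultimately have "1 / v x \<le> min x (1 / x)" by simp
  then have "1 / 8 * (1 / v x) \<le> 1 / 8 * min x (1 / x)" by (intro mult_left_mono) auto
  then show "1 / (8 * v x) \<le> w_fun x" by (simp add: w_fun_def)
  have "min x (1 / x) * v x \<le> 2"
  proof (cases "x \<le> 1")
    case True
    then have "x * x \<le> 1" using assms by (intro mult_le_one) auto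
    then have "x * v x \<le> 2" using assms by (simp add: v_def distrib_left)
    moreover have "min x (1 / x) * v x \<le> x * v x" using vp by (intro mult_right_mono) auto
    ultimately show ?thesis by linarith
  next
    case False
    then have "1 / x * (1 / x) \<le> 1" using assms by (intro mult_le_one) auto
    then have "1 / x * v x \<le> 2" using assms by (simp add: v_def distrib_left)
    moreover have "min x (1 / x) * v x \<le> 1 / x * v x" using vp by (intro mult_right_mono) auto
    ultimately show ?thesis by linarith
  qed
  then show "w_fun x \<le> 1 / (4 * v x)" using vp by (simp add: w_fun_def field_simps)
  show "w_fun x \<le> x / 8" "0 < w_fun x" using assms by (auto simp: w_fun_def)
qed

end

section \<open>The B-spline grid\<close>

definition sqpos :: "real \<Rightarrow> real" where "sqpos u = (max 0 u)\<^sup>2"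

text \<open>The cardinal quadratic B-spline with support [0,3], as a third difference of truncated
  squares.\<close>

definition bspline :: "real \<Rightarrow> real" where
  "bspline s = (sqpos s - 3 * sqpos (s - 1) + 3 * sqpos (s - 2) - sqpos (s - 3)) / 2"

definition bspline' :: "real \<Rightarrow> real" where
  "bspline' s = max 0 s - 3 * max 0 (s - 1) + 3 * max 0 (s - 2) - max 0 (s - 3)"

text \<open>The sum of \<open>bspline (s + k)\<close> over all k >= 0, falling from 1 at s = 1 to 0
  at s = 3. It turns spline moments into telescoping differences.\<close>

definition ramp :: "real \<Rightarrow> real" where
  "ramp s = 1 - (sqpos (s - 1) - 2 * sqpos (s - 2) + sqpos (s - 3)) / 2"

definition ramp' :: "real \<Rightarrow> real" where
  "ramp' s = - (max 0 (s - 1) - 2 * max 0 (s - 2) + max 0 (s - 3))"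

lemma sqpos_double: "sqpos u = sqpos (2 * u) / 4"
  by (auto simp: sqpos_def max_def power2_eq_square)

text \<open>Truncated squares are homogeneous of degree 2, and (1 - z^2)^3 = (1 - z)^3 (1 + z)^3
  converts differences of step 2 into differences of step 1; the factor (1 + z)^3 supplies the
  coefficients.\<close>

lemma bspline_refine: "bspline s = (\<Sum>e<4. refine_weight e * bspline (2 * s - real e))"
  unfolding bspline_def sqpos_double[of s] sqpos_double[of "s - 1"] sqpos_double[of "s - 2"] sqpos_double[of "s - 3"]
  by (simp add: eval_nat_numeral refine_weight_def algebra_simps) (simp add: field_simps)

lemma bspline_ramp: "bspline s = ramp s - ramp (s + 1)"
  by (simp add: bspline_def ramp_def algebra_simps) (simp add: field_simps)

lemma sqpos_deriv: "(sqpos has_real_derivative 2 * max 0 u) (at u)"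
proof (cases "u = 0")
  case True
  have "(\<lambda>h. (sqpos (0 + h) - sqpos 0) / h) \<midarrow>0\<rightarrow> 0"
  proof (rule Lim_null_comparison)
    show "\<forall>\<^sub>F h in at 0. norm ((sqpos (0 + h) - sqpos 0) / h) \<le> \<bar>h\<bar>"
      by (rule always_eventually) (auto simp: sqpos_def max_def power2_eq_square)
    show "(\<lambda>h. \<bar>h::real\<bar>) \<midarrow>0\<rightarrow> 0" by (intro tendsto_rabs_zero) auto
  qed
  then show ?thesis using True by (simp add: DERIV_def)
next
  case False
  then consider "u < 0" | "u > 0" by linarith
  then show ?thesis
  proof cases
    case 1
    have "((\<lambda>u. 0) has_real_derivative 0) (at u)" by simp
    then show ?thesis
      using 1 by (subst DERIV_cong_ev[OF refl _ refl, where g="\<lambda>u. 0"])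
        (auto simp: sqpos_def intro!: eventually_mono[OF eventually_nhds_in_open[of "{..<0}" u]])
  next
    case 2
    have "((\<lambda>u. u\<^sup>2) has_real_derivative 2 * u) (at u)" by (auto intro!: derivative_eq_intros)
    then show ?thesis
      using 2 by (subst DERIV_cong_ev[OF refl _ refl, where g="\<lambda>u. u\<^sup>2"])
        (auto simp: sqpos_def intro!: eventually_mono[OF eventually_nhds_in_open[of "{0<..}" u]])
  qed
qed

lemma bspline_deriv: "(bspline has_real_derivative bspline' s) (at s)"
proof -
  note d = DERIV_chain2[OF sqpos_deriv]
  show ?thesis
    unfolding bspline_def
    by (rule DERIV_cong, (rule derivative_eq_intros d refl | simp)+) (simp add: bspline'_def field_simps)
qed

lemma ramp_deriv: "(ramp has_real_derivative ramp' s) (at s)"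
proof -
  note d = DERIV_chain2[OF sqpos_deriv]
  show ?thesis
    unfolding ramp_def
    by (rule DERIV_cong, (rule derivative_eq_intros d refl | simp)+) (simp add: ramp'_def field_simps)
qed

lemma continuous_bspline': "continuous_on UNIV bspline'"
  unfolding bspline'_def by (intro continuous_intros)

lemma bspline_measurable [measurable]: "bspline \<in> borel_measurable borel"
  unfolding bspline_def sqpos_def by measurable

lemma ramp_measurable [measurable]: "ramp \<in> borel_measurable borel"
  and ramp'_measurable [measurable]: "ramp' \<in> borel_measurable borel"
  unfolding ramp_def sqpos_def ramp'_def by measurable

lemma bspline'_bound: "\<bar>bspline' s\<bar> \<le> 1"
  unfolding bspline'_def by (auto simp: max_def abs_le_iff)

lemma ramp'_bound: "\<bar>ramp' s\<bar> \<le> 1" and ramp'_zero: "s \<le> 1 \<or> 3 \<le> s \<Longrightarrow> ramp' s = 0"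
  unfolding ramp'_def by (auto simp: max_def abs_le_iff)

lemma ramp_left: "s \<le> 1 \<Longrightarrow> ramp s = 1"
  by (simp add: ramp_def sqpos_def max_def)

lemma ramp_right: "3 \<le> s \<Longrightarrow> ramp s = 0"
  by (auto simp add: ramp_def sqpos_def max_def power2_eq_square algebra_simps)

lemma bspline_outside: "s \<le> 0 \<or> 3 \<le> s \<Longrightarrow> bspline s = 0"
  by (auto simp: bspline_ramp ramp_left ramp_right)

lemma bspline_1: "0 \<le> s \<Longrightarrow> s \<le> 1 \<Longrightarrow> bspline s = s\<^sup>2 / 2"
  and bspline_2: "1 \<le> s \<Longrightarrow> s \<le> 2 \<Longrightarrow> bspline s = 3 / 4 - (s - 3 / 2)\<^sup>2"
  and bspline_3: "2 \<le> s \<Longrightarrow> s \<le> 3 \<Longrightarrow> bspline s = (3 - s)\<^sup>2 / 2"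
  by (auto simp add: bspline_def sqpos_def max_def power2_eq_square field_simps)

lemma bspline_middle: "1 \<le> s \<Longrightarrow> s \<le> 2 \<Longrightarrow> 1 / 2 \<le> bspline s"
proof -
  assume s: "1 \<le> s" "s \<le> 2"
  then have "\<bar>s - 3 / 2\<bar> \<le> \<bar>1 / 2\<bar>" by linarith
  then have "(s - 3 / 2)\<^sup>2 \<le> (1 / 2)\<^sup>2" by (rule abs_le_square_iff[THEN iffD1])
  then show ?thesis using s by (simp add: bspline_2 power2_eq_square)
qed

lemma bspline_pos: "0 < s \<Longrightarrow> s < 3 \<Longrightarrow> 0 < bspline s"
  using bspline_1[of s] bspline_3[of s] bspline_middle[of s] zero_less_power[of s 2] zero_less_power[of "3 - s" 2]
  by (cases "s \<le> 1"; cases "s \<le> 2") linarith+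

lemma bspline_nonneg: "0 \<le> bspline s"
  using bspline_pos[of s] bspline_outside[of s] by (cases "0 < s \<and> s < 3") auto

lemma bspline_pos_iff: "0 < bspline s \<longleftrightarrow> 0 < s \<and> s < 3"
  using bspline_pos[of s] bspline_outside[of s] by force

text \<open>The sum telescopes to \<open>ramp u - ramp (u + 3)\<close> with \<open>u\<close> the
  fractional part of \<open>s\<close>.\<close>

lemma bspline_partition: "bspline (s - of_int \<lfloor>s\<rfloor>) + bspline (s - of_int \<lfloor>s\<rfloor> + 1) + bspline (s - of_int \<lfloor>s\<rfloor> + 2) = 1"
proof -
  have "s - of_int \<lfloor>s\<rfloor> \<le> 1" "3 \<le> s - of_int \<lfloor>s\<rfloor> + 3" by linarith+
  then show ?thesis
    using ramp_left[of "s - of_int \<lfloor>s\<rfloor>"] ramp_right[of "s - of_int \<lfloor>s\<rfloor> + 3"]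
    by (simp add: bspline_ramp add.assoc)
qed

lemma bspline_le_1: "bspline s \<le> 1"
proof -
  have "bspline s \<le> 1" if s: "0 < s" "s < 3"
  proof -
    consider "0 \<le> s" "s \<le> 1" | "1 \<le> s" "s \<le> 2" | "2 \<le> s" "s \<le> 3" using s by linarith
    then show ?thesis
    proof cases
      case 1 then have "s * s \<le> 1" by (intro mult_le_one) auto
      with 1 show ?thesis by (simp add: bspline_1 power2_eq_square)
    next
      case 2 then show ?thesis by (simp add: bspline_2)
        (use zero_le_power2[of "s - 3 / 2"] in linarith)
    next
      case 3 then have "(3 - s) * (3 - s) \<le> 1" by (intro mult_le_one) auto
      with 3 show ?thesis by (simp add: bspline_3 power2_eq_square)
    qed
  qed
  then show ?thesis using bspline_outside[of s] by (cases "0 < s \<and> s < 3") auto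
qed

section \<open>The spline grid in the coordinate sigma\<close>

locale gamma_grid = gamma_setting +
  fixes a :: real
  assumes a_pos: "0 < a" and a_le_1: "a \<le> 1"
begin

text \<open>Large enough that four cells of the coarsest grid fit into an interval of radius a w
  (\<open>pt_radius\<close>), and that every node is seen by a bump of scale below a w
  (\<open>av_le_local_maximal\<close>).\<close>

definition K :: real where "K = 100 / a"

lemma K_ge: "100 \<le> K" using a_pos a_le_1 by (simp add: K_def pos_le_divide_eq)

lemma K_pos: "0 < K" using K_ge by simp

definition \<sigma> :: "real \<Rightarrow> real" where "\<sigma> x = K * \<tau> x"

text \<open>The case distinction discards the values of \<open>\<sigma>\<close> at nonpositive
  arguments, where \<open>ln\<close> is not the logarithm.\<close>

definition h :: "nat \<Rightarrow> int \<Rightarrow> real \<Rightarrow> real" where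
  "h n i x = (if 0 < x then bspline (2 ^ n * \<sigma> x - of_int i) else 0)"

definition pt :: "nat \<Rightarrow> real \<Rightarrow> real" where "pt n s = X (s / (2 ^ n * K))"

lemma pt_pos: "0 < pt n s" by (simp add: pt_def X_pos)

lemma sigma_pt [simp]: "2 ^ n * \<sigma> (pt n s) = s"
  using K_pos by (simp add: \<sigma>_def pt_def)

lemma tau_pt: "\<tau> (pt n s) = s / (2 ^ n * K)" by (simp add: pt_def)

lemma pt_less_iff: "pt n s < pt n t \<longleftrightarrow> s < t"
  using K_pos by (auto simp: pt_def X_less_iff divide_less_cancel mult_less_0_iff)

lemma pt_less: "0 < x \<Longrightarrow> pt n s < x \<longleftrightarrow> s < 2 ^ n * \<sigma> x" and less_pt: "0 < x \<Longrightarrow> x < pt n s \<longleftrightarrow> 2 ^ n * \<sigma> x < s"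
  using K_pos by (simp_all add: pt_def X_less_iff' less_X_iff \<sigma>_def pos_divide_less_eq pos_less_divide_eq mult_ac)

lemma h_pos_iff: "0 < h n i x \<longleftrightarrow> x \<in> {pt n (of_int i)<..<pt n (of_int i + 3)}"
  using pt_pos[of n "of_int i"] by (auto simp: h_def bspline_pos_iff pt_less less_pt)

lemma h_nonneg: "0 \<le> h n i x" by (simp add: h_def bspline_nonneg)

lemma h_le_1: "h n i x \<le> 1" by (simp add: h_def bspline_le_1)

lemma h_zero_iff: "h n i x = 0 \<longleftrightarrow> x \<notin> {pt n (of_int i)<..<pt n (of_int i + 3)}"
  using h_pos_iff[of n i x] h_nonneg[of n i x] by auto

lemma tau_measurable [measurable]: "\<tau> \<in> borel_measurable borel"
  unfolding \<tau>_def by measurable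

lemma sigma_measurable [measurable]: "\<sigma> \<in> borel_measurable borel"
  unfolding \<sigma>_def by measurable

lemma h_measurable_borel [measurable]: "h n i \<in> borel_measurable borel"
  unfolding h_def by measurable

lemma h_measurable_gamma: "h n i \<in> borel_measurable \<gamma>"
  by (rule measurable_gammaI) measurable

lemma h_refine: "h n i x = (\<Sum>e<4. refine_weight e * h (Suc n) (2 * i + int e) x)"
  unfolding h_def by (subst bspline_refine) (simp add: algebra_simps)

lemma h_partition:
  fixes n x
  assumes "0 < x"
  defines "i \<equiv> \<lfloor>2 ^ n * \<sigma> x\<rfloor>"
  shows "h n i x + h n (i - 1) x + h n (i - 2) x = 1"
  using bspline_partition[of "2 ^ n * \<sigma> x"] assms by (simp add: h_def algebra_simps)

lemma h_cover: "0 < x \<Longrightarrow> \<exists>i. 0 < h n i x"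
  using h_partition[of x n] h_nonneg by (metis add.right_neutral less_eq_real_def zero_neq_one)

text \<open>Density times approximate length of one cell of generation \<open>n\<close> near
  \<open>x\<close>: the mass of such a cell up to \<open>c0\<close>.\<close>

definition \<rho> :: "nat \<Rightarrow> real \<Rightarrow> real" where "\<rho> n x = gd x / v x / (2 ^ n * K)"

lemma rho_pos: "0 < x \<Longrightarrow> 0 < \<rho> n x"
  using gd_pos v_pos K_pos by (simp add: \<rho>_def)

text \<open>Twenty cells of any generation span at most 20/100 in tau, as K is at least 100.\<close>

lemma tau_near:
  assumes "0 < x" "\<bar>2 ^ n * \<sigma> x - s\<bar> \<le> 20"
  shows "\<bar>\<tau> x - s / (2 ^ n * K)\<bar> \<le> 1 / 5"
proof -
  have N: "100 \<le> 2 ^ n * K" using K_ge mult_mono[of 1 "2 ^ n" 100 K] by simp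
  have "\<tau> x - s / (2 ^ n * K) = (2 ^ n * \<sigma> x - s) / (2 ^ n * K)"
    using K_pos by (simp add: \<sigma>_def field_simps)
  then have "\<bar>\<tau> x - s / (2 ^ n * K)\<bar> = \<bar>2 ^ n * \<sigma> x - s\<bar> / (2 ^ n * K)" using N by simp
  also have "\<dots> \<le> 20 / 100" using assms N by (intro frac_le) auto
  finally show ?thesis by simp
qed

lemma pt_interval_mass:
  assumes x: "0 < x" and st: "s < t" and s: "\<bar>2 ^ n * \<sigma> x - s\<bar> \<le> 20" and t: "\<bar>2 ^ n * \<sigma> x - t\<bar> \<le> 20"
  shows "measure \<gamma> {pt n s<..<pt n t} \<le> c0 * (t - s) * \<rho> n x"
    and "(t - s) * \<rho> n x \<le> c0 * measure \<gamma> {pt n s<..<pt n t}"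
    and "pt n t - pt n s \<le> exp 1 * (t - s) / (2 ^ n * K * v x)"
proof -
  have d: "\<bar>\<tau> x - \<tau> (pt n s)\<bar> \<le> 1" "\<bar>\<tau> x - \<tau> (pt n t)\<bar> \<le> 1"
    using tau_near[OF x s] tau_near[OF x t] by (simp_all add: tau_pt)
  have l: "pt n s < pt n t" using st by (simp add: pt_less_iff)
  have e: "\<tau> (pt n t) - \<tau> (pt n s) = (t - s) / (2 ^ n * K)" by (simp add: tau_pt diff_divide_distrib)
  note m = mass_bounds[OF x pt_pos l d] length_bounds(1)[OF x pt_pos l d]
  show "measure \<gamma> {pt n s<..<pt n t} \<le> c0 * (t - s) * \<rho> n x"
    and "(t - s) * \<rho> n x \<le> c0 * measure \<gamma> {pt n s<..<pt n t}"
    and "pt n t - pt n s \<le> exp 1 * (t - s) / (2 ^ n * K * v x)"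
    using m by (simp_all add: e \<rho>_def mult_ac)
qed

lemma pt_interval_sets [simp]: "{pt n s<..<t} \<in> sets \<gamma>"
  using pt_pos[of n s] by (auto simp: sets_gamma_iff)

lemma h_integrable: "integrable \<gamma> (h n i)"
  by (rule integrable_const_bound[of _ 1]) (auto simp: h_nonneg h_le_1 h_measurable_gamma)

text \<open>A tolerance of 17 cells and the 3 cells of a support stay within the 20 allowed by
  \<open>pt_interval_mass\<close>.\<close>

lemma mass_upper:
  assumes x: "0 < x" "\<bar>2 ^ n * \<sigma> x - of_int i\<bar> \<le> 17"
  shows "(\<integral>x. h n i x \<partial>\<gamma>) \<le> 3 * c0 * \<rho> n x"
    and "measure \<gamma> {pt n (of_int i)<..<pt n (of_int i + 3)} \<le> 3 * c0 * \<rho> n x"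
proof -
  let ?S = "{pt n (of_int i)<..<pt n (of_int i + 3)}"
  have "(\<integral>x. h n i x \<partial>\<gamma>) \<le> (\<integral>x. indicator ?S x \<partial>\<gamma>)"
  proof (intro integral_mono h_integrable integrable_real_indicator)
    show "h n i x \<le> indicator ?S x" for x
      using h_zero_iff[of n i x] h_le_1[of n i x] by (cases "x \<in> ?S") auto
  qed (auto simp: emeasure_eq_measure)
  also have "\<dots> = measure \<gamma> (?S \<inter> {0<..})" by simp
  also have "?S \<inter> {0<..} = ?S" using pt_pos[of n "of_int i"] by auto
  finally have 1: "(\<integral>x. h n i x \<partial>\<gamma>) \<le> measure \<gamma> ?S" .
  have 2: "measure \<gamma> ?S \<le> c0 * ((of_int i + 3) - of_int i) * \<rho> n x"
    using x by (intro pt_interval_mass(1)) auto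
  from 2 show "measure \<gamma> ?S \<le> 3 * c0 * \<rho> n x" by simp
  from 1 2 show "(\<integral>x. h n i x \<partial>\<gamma>) \<le> 3 * c0 * \<rho> n x" by simp
qed

text \<open>The middle third of the support, where the spline is at least 1/2, already carries
  enough mass.\<close>

lemma mass_lower:
  assumes x: "0 < x" "\<bar>2 ^ n * \<sigma> x - of_int i\<bar> \<le> 17"
  shows "\<rho> n x \<le> 2 * c0 * (\<integral>x. h n i x \<partial>\<gamma>)"
proof -
  let ?S = "{pt n (of_int i + 1)<..<pt n (of_int i + 2)}"
  have "(\<integral>x. indicator ?S x / 2 \<partial>\<gamma>) \<le> (\<integral>x. h n i x \<partial>\<gamma>)"
  proof (intro integral_mono h_integrable)
    fix x assume "x \<in> space \<gamma>"
    then have "0 < x" by simp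
    then show "indicator ?S x / 2 \<le> h n i x"
      using bspline_middle[of "2 ^ n * \<sigma> x - of_int i"] h_nonneg[of n i x]
      by (auto simp: indicator_def pt_less less_pt h_def)
  qed (auto simp: emeasure_eq_measure)
  moreover have "?S \<inter> {0<..} = ?S" using pt_pos[of n "of_int i + 1"] by auto
  ultimately have 1: "measure \<gamma> ?S \<le> 2 * (\<integral>x. h n i x \<partial>\<gamma>)" by simp
  have "((of_int i + 2) - (of_int i + 1)) * \<rho> n x \<le> c0 * measure \<gamma> ?S"
    using x by (intro pt_interval_mass(2)) auto
  then have "\<rho> n x \<le> c0 * measure \<gamma> ?S" by simp
  also have "\<dots> \<le> c0 * (2 * (\<integral>x. h n i x \<partial>\<gamma>))" using 1 c0_ge by (intro mult_left_mono) auto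
  finally show ?thesis by simp
qed

lemma mass_pos: "0 < (\<integral>x. h n i x \<partial>\<gamma>)"
proof -
  have "0 < \<rho> n (pt n (of_int i))" by (rule rho_pos[OF pt_pos])
  also have "\<dots> \<le> 2 * c0 * (\<integral>x. h n i x \<partial>\<gamma>)" by (rule mass_lower[OF pt_pos]) simp
  finally show ?thesis using c0_ge by (simp add: zero_less_mult_iff)
qed

text \<open>Both masses are compared with \<open>\<rho>\<close> at the left end of the parent, and
  \<open>\<rho>\<close> halves from one generation to the next; the constant is 3 c0 times 2 times 2
  c0.\<close>

lemma mass_child:
  assumes "e < 4"
  shows "(\<integral>x. h n i x \<partial>\<gamma>) \<le> 12 * c0\<^sup>2 * (\<integral>x. h (Suc n) (2 * i + int e) x \<partial>\<gamma>)"
proof -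
  let ?x = "pt n (of_int i)"
  have e: "2 ^ Suc n * \<sigma> ?x = 2 * of_int i" using sigma_pt[of n "of_int i"] by (simp only: power_Suc mult.assoc)
  have "(\<integral>x. h n i x \<partial>\<gamma>) \<le> 3 * c0 * \<rho> n ?x"
    by (rule mass_upper(1)[OF pt_pos]) simp
  also have "\<rho> n ?x = 2 * \<rho> (Suc n) ?x" using K_pos by (simp add: \<rho>_def)
  also have "3 * c0 * (2 * \<rho> (Suc n) ?x) \<le> 3 * c0 * (2 * (2 * c0 * (\<integral>x. h (Suc n) (2 * i + int e) x \<partial>\<gamma>)))"
    using c0_ge assms by (intro mult_left_mono mass_lower[OF pt_pos]) (auto simp: e simp del: power_Suc)
  finally show ?thesis by (simp add: power2_eq_square)
qed

section \<open>Differentiation of integrals along spline averages\<close>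

definition av :: "(real \<Rightarrow> complex) \<Rightarrow> nat \<Rightarrow> int \<Rightarrow> complex" where
  "av f n i = (\<integral>x. of_real (h n i x) * f x \<partial>\<gamma>) / of_real (\<integral>x. h n i x \<partial>\<gamma>)"

definition cell :: "nat \<Rightarrow> real \<Rightarrow> int" where "cell n x = \<lfloor>2 ^ n * \<sigma> x\<rfloor>"

text \<open>Only the nodes \<open>cell n x - int e\<close> with e < 3 can be active at
  \<open>x\<close>, so \<open>osc\<close> controls every average relevant there.\<close>

definition osc :: "nat \<Rightarrow> (real \<Rightarrow> complex) \<Rightarrow> real \<Rightarrow> real" where
  "osc n f x = (\<Sum>e<3. norm (av f n (cell n x - int e) - f x))"

definition osc_int :: "nat \<Rightarrow> (real \<Rightarrow> complex) \<Rightarrow> ennreal" where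
  "osc_int n f = (\<integral>\<^sup>+x. ennreal (osc n f x) \<partial>\<gamma>)"

lemma h_times_integrable: "integrable \<gamma> f \<Longrightarrow> integrable \<gamma> (\<lambda>x. of_real (h n i x) * f x :: complex)"
  by (rule Bochner_Integration.integrable_bound[of _ "\<lambda>x. norm (f x)"])
     (use h_measurable_gamma in \<open>auto simp: norm_mult h_nonneg h_le_1 mult_left_le_one_le\<close>)

lemma av_add: "integrable \<gamma> f \<Longrightarrow> integrable \<gamma> g \<Longrightarrow> av (\<lambda>x. f x + g x) n i = av f n i + av g n i"
  using h_times_integrable[of f n i] h_times_integrable[of g n i]
  by (simp add: av_def distrib_left add_divide_distrib)

lemma av_diff: "integrable \<gamma> f \<Longrightarrow> integrable \<gamma> g \<Longrightarrow> av (\<lambda>x. f x - g x) n i = av f n i - av g n i"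
  using h_times_integrable[of f n i] h_times_integrable[of g n i]
  by (simp add: av_def right_diff_distrib diff_divide_distrib)

lemma av_cmult: "av (\<lambda>x. c * f x) n i = c * av f n i"
  by (simp add: av_def mult.left_commute)

lemma av_const: "av (\<lambda>x. c) n i = c"
  using mass_pos[of n i] by (simp add: av_def)

lemma av_eq_const:
  assumes "\<And>x. 0 < h n i x \<Longrightarrow> f x = c"
  shows "av f n i = c"
proof -
  have "(\<lambda>x. of_real (h n i x) * f x) = (\<lambda>x. of_real (h n i x) * c)"
    using assms h_nonneg[of n i] by (auto simp: fun_eq_iff less_le)
  then show ?thesis using mass_pos[of n i] by (simp add: av_def)
qed

lemma av_norm_le:
  assumes f: "integrable \<gamma> f"
  shows "ennreal (norm (av f n i)) \<le> (\<integral>\<^sup>+y. ennreal (h n i y / (\<integral>x. h n i x \<partial>\<gamma>)) * ennreal (norm (f y)) \<partial>\<gamma>)"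
proof -
  let ?m = "\<integral>x. h n i x \<partial>\<gamma>"
  note m = mass_pos[of n i]
  have eq: "av f n i = (\<integral>x. of_real (h n i x / ?m) * f x \<partial>\<gamma>)"
    using m by (simp add: av_def)
  have "integrable \<gamma> (\<lambda>x. of_real (h n i x / ?m) * f x)"
    using h_times_integrable[OF f, of n i] by simp
  then have "ennreal (norm (av f n i)) \<le> (\<integral>\<^sup>+y. ennreal (norm (of_real (h n i y / ?m) * f y)) \<partial>\<gamma>)"
    unfolding eq by (rule integral_norm_bound_ennreal)
  also have "\<dots> = (\<integral>\<^sup>+y. ennreal (h n i y / ?m) * ennreal (norm (f y)) \<partial>\<gamma>)"
    using m h_nonneg by (intro nn_integral_cong) (simp add: norm_mult norm_divide ennreal_mult[symmetric])
  finally show ?thesis .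
qed

lemma cell_measurable [measurable]: "cell n \<in> borel \<rightarrow>\<^sub>M count_space UNIV"
  unfolding cell_def by measurable

lemma cell_measurable_gamma: "cell n \<in> \<gamma> \<rightarrow>\<^sub>M count_space UNIV"
  unfolding measurable_cong_sets[OF sets_gamma refl] by (rule measurable_restrict_space1[OF cell_measurable])

lemma cell_shift_measurable: "(\<lambda>x. cell n x - j) \<in> \<gamma> \<rightarrow>\<^sub>M count_space UNIV"
  using measurable_compose[OF cell_measurable_gamma[of n], of "\<lambda>i. i - j" "count_space UNIV"] by simp

lemma av_cell_measurable: "(\<lambda>x. av f n (cell n x - j)) \<in> borel_measurable \<gamma>"
  using measurable_compose[OF cell_shift_measurable[of n j], of "av f n" borel] by simp

lemma osc_measurable:
  assumes "integrable \<gamma> f"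
  shows "osc n f \<in> borel_measurable \<gamma>"
proof -
  note [measurable] = av_cell_measurable[of f n] borel_measurable_integrable[OF assms]
  show ?thesis unfolding osc_def[abs_def] by measurable
qed

lemma osc_nonneg: "0 \<le> osc n f x"
  by (auto simp: osc_def intro!: sum_nonneg)

text \<open>Exchanging the integrals reduces the claim to fixed \<open>y\<close>: the kernel is then
  at most 2 c0 / \<open>\<rho>\<close> and vanishes unless \<open>x\<close> lies within 6 cells of
  \<open>y\<close>, a set of mass at most 12 c0 \<open>\<rho>\<close>.\<close>

lemma av_cell_L1:
  assumes f: "integrable \<gamma> f" and e: "e < 3"
  shows "(\<integral>\<^sup>+x. ennreal (norm (av f n (cell n x - int e))) \<partial>\<gamma>) \<le> ennreal (24 * c0\<^sup>2) * (\<integral>\<^sup>+x. ennreal (norm (f x)) \<partial>\<gamma>)"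
proof -
  interpret pair_sigma_finite \<gamma> \<gamma> ..
  let ?m = "\<lambda>i. \<integral>x. h n i x \<partial>\<gamma>"
  let ?I = "\<lambda>x. cell n x - int e"
  let ?k = "\<lambda>x y. ennreal (h n (?I x) y / ?m (?I x))"
  have [measurable]: "f \<in> borel_measurable \<gamma>" "\<And>i. h n i \<in> borel_measurable \<gamma>"
    using f h_measurable_gamma by auto
  have "(\<lambda>p. ?I (fst p)) \<in> \<gamma> \<Otimes>\<^sub>M \<gamma> \<rightarrow>\<^sub>M count_space UNIV"
    by (rule measurable_compose[OF measurable_fst cell_shift_measurable])
  \<comment> \<open>The kernel depends on \<open>x\<close> only through the countably valued cell
    index, which gives joint measurability.\<close>
  then have "(\<lambda>p. (\<lambda>i p. ennreal (h n i (snd p) / ?m i)) (?I (fst p)) p) \<in> borel_measurable (\<gamma> \<Otimes>\<^sub>M \<gamma>)"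
    by (rule measurable_compose_countable[rotated]) measurable
  then have km [measurable]: "(\<lambda>(x, y). ?k x y) \<in> borel_measurable (\<gamma> \<Otimes>\<^sub>M \<gamma>)"
    by (simp add: case_prod_unfold)
  have "(\<integral>\<^sup>+x. ennreal (norm (av f n (?I x))) \<partial>\<gamma>) \<le> (\<integral>\<^sup>+x. \<integral>\<^sup>+y. ?k x y * ennreal (norm (f y)) \<partial>\<gamma> \<partial>\<gamma>)"
    by (intro nn_integral_mono av_norm_le f)
  also have "\<dots> = (\<integral>\<^sup>+y. \<integral>\<^sup>+x. ?k x y * ennreal (norm (f y)) \<partial>\<gamma> \<partial>\<gamma>)"
    using Fubini[of "\<lambda>(x, y). ?k x y * ennreal (norm (f y))"] by (simp add: case_prod_unfold)
  also have "\<dots> \<le> (\<integral>\<^sup>+y. ennreal (24 * c0\<^sup>2) * ennreal (norm (f y)) \<partial>\<gamma>)"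
  proof (rule nn_integral_mono)
    fix y assume "y \<in> space \<gamma>"
    then have y: "0 < y" by simp
    let ?s = "2 ^ n * \<sigma> y"
    let ?S = "{pt n (?s - 6)<..<pt n (?s + 6)}"
    have [measurable]: "(\<lambda>x. ?k x y) \<in> borel_measurable \<gamma>"
      using measurable_compose[OF measurable_Pair1'[of y \<gamma> \<gamma>] km] y
      by (simp add: comp_def)
    have "(\<integral>\<^sup>+x. ?k x y \<partial>\<gamma>) \<le> (\<integral>\<^sup>+x. ennreal (2 * c0 / \<rho> n y) * indicator ?S x \<partial>\<gamma>)"
    proof (rule nn_integral_mono)
      fix x assume "x \<in> space \<gamma>"
      then have x: "0 < x" by simp
      show "?k x y \<le> ennreal (2 * c0 / \<rho> n y) * indicator ?S x"
      proof (cases "h n (?I x) y = 0")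
        case False
        then have "0 < h n (?I x) y" using h_nonneg[of n "?I x" y] by simp
        then have "0 < ?s - of_int (?I x)" "?s - of_int (?I x) < 3"
          using y by (simp_all add: h_def bspline_pos_iff)
        moreover have "of_int (cell n x) \<le> 2 ^ n * \<sigma> x" "2 ^ n * \<sigma> x < of_int (cell n x) + 1"
          unfolding cell_def by linarith+
        ultimately have c: "\<bar>?s - of_int (?I x)\<bar> \<le> 17" "?s - 6 < 2 ^ n * \<sigma> x" "2 ^ n * \<sigma> x < ?s + 6"
          using e by auto
        then have "x \<in> ?S" using x by (simp add: pt_less less_pt)
        moreover have "h n (?I x) y / ?m (?I x) \<le> 1 / ?m (?I x)"
          using mass_pos[of n "?I x"] h_le_1 by (intro divide_right_mono) auto
        moreover have "1 / ?m (?I x) \<le> 2 * c0 / \<rho> n y"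
          using mass_lower[OF y c(1)] mass_pos[of n "?I x"] rho_pos[OF y, of n] by (simp add: field_simps)
        ultimately show ?thesis by (auto intro!: ennreal_leI)
      qed simp
    qed
    also have "\<dots> = ennreal (2 * c0 / \<rho> n y) * ennreal (measure \<gamma> ?S)"
      by (subst nn_integral_cmult_indicator) (auto simp: emeasure_eq_measure)
    also have "\<dots> \<le> ennreal (2 * c0 / \<rho> n y) * ennreal (c0 * 12 * \<rho> n y)"
      using pt_interval_mass(1)[OF y, of "?s - 6" "?s + 6" n] by (intro mult_left_mono ennreal_leI) auto
    also have "\<dots> = ennreal (24 * c0\<^sup>2)"
      using rho_pos[OF y, of n] c0_ge by (simp add: ennreal_mult[symmetric] power2_eq_square)
    finally have "(\<integral>\<^sup>+x. ?k x y \<partial>\<gamma>) \<le> ennreal (24 * c0\<^sup>2)" .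
    then show "(\<integral>\<^sup>+x. ?k x y * ennreal (norm (f y)) \<partial>\<gamma>) \<le> ennreal (24 * c0\<^sup>2) * ennreal (norm (f y))"
      by (simp add: nn_integral_multc mult_right_mono)
  qed
  also have "\<dots> = ennreal (24 * c0\<^sup>2) * (\<integral>\<^sup>+x. ennreal (norm (f x)) \<partial>\<gamma>)"
    by (rule nn_integral_cmult) measurable
  finally show ?thesis .
qed

lemma osc_int_le:
  assumes f: "integrable \<gamma> f"
  shows "osc_int n f \<le> ennreal (75 * c0\<^sup>2) * (\<integral>\<^sup>+x. ennreal (norm (f x)) \<partial>\<gamma>)"
proof -
  have [measurable]: "f \<in> borel_measurable \<gamma>" using f by auto
  note [measurable] = av_cell_measurable[of f n]
  have "osc_int n f \<le> (\<integral>\<^sup>+x. (\<Sum>e<3. ennreal (norm (av f n (cell n x - int e))) + ennreal (norm (f x))) \<partial>\<gamma>)"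
    unfolding osc_int_def
  proof (rule nn_integral_mono)
    fix x
    have "osc n f x \<le> (\<Sum>e<3. norm (av f n (cell n x - int e)) + norm (f x))"
      unfolding osc_def by (intro sum_mono norm_triangle_ineq4)
    then have "ennreal (osc n f x) \<le> ennreal (\<Sum>e<3. norm (av f n (cell n x - int e)) + norm (f x))"
      by (rule ennreal_leI)
    also have "\<dots> = (\<Sum>e<3. ennreal (norm (av f n (cell n x - int e))) + ennreal (norm (f x)))"
      by (subst sum_ennreal[symmetric]) auto
    finally show "ennreal (osc n f x) \<le> (\<Sum>e<3. ennreal (norm (av f n (cell n x - int e))) + ennreal (norm (f x)))" .
  qed
  also have "\<dots> = (\<Sum>e<3. (\<integral>\<^sup>+x. ennreal (norm (av f n (cell n x - int e))) \<partial>\<gamma>) + (\<integral>\<^sup>+x. ennreal (norm (f x)) \<partial>\<gamma>))"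
    by (subst nn_integral_sum) (auto intro!: sum.cong nn_integral_add)
  also have "\<dots> \<le> (\<Sum>e<(3::nat). ennreal (24 * c0\<^sup>2) * (\<integral>\<^sup>+x. ennreal (norm (f x)) \<partial>\<gamma>)
      + ennreal (c0\<^sup>2) * (\<integral>\<^sup>+x. ennreal (norm (f x)) \<partial>\<gamma>))"
  proof (intro sum_mono add_mono av_cell_L1 f)
    have "1 \<le> c0\<^sup>2" using c0_ge by simp
    then have "ennreal 1 \<le> ennreal (c0\<^sup>2)" by (rule ennreal_leI)
    from mult_right_mono[OF this, of "\<integral>\<^sup>+x. ennreal (norm (f x)) \<partial>\<gamma>"]
    show "(\<integral>\<^sup>+x. ennreal (norm (f x)) \<partial>\<gamma>) \<le> ennreal (c0\<^sup>2) * (\<integral>\<^sup>+x. ennreal (norm (f x)) \<partial>\<gamma>)" by simp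
  qed auto
  also have "\<dots> = ennreal (75 * c0\<^sup>2) * (\<integral>\<^sup>+x. ennreal (norm (f x)) \<partial>\<gamma>)"
  proof -
    have "ennreal (24 * c0\<^sup>2) + ennreal (c0\<^sup>2) = ennreal (25 * c0\<^sup>2)"
      by (subst ennreal_plus[symmetric]) auto
    then have "(\<Sum>e<(3::nat). ennreal (24 * c0\<^sup>2) * I + ennreal (c0\<^sup>2) * I) = 3 * (ennreal (25 * c0\<^sup>2) * I)" for I
      by (simp add: distrib_right[symmetric])
    also have "3 * (ennreal (25 * c0\<^sup>2) * I) = ennreal (75 * c0\<^sup>2) * I" for I
      by (simp add: ennreal_mult[symmetric] mult.assoc[symmetric] flip: ennreal_numeral)
    finally show ?thesis .
  qed
  finally show ?thesis .
qed

text \<open>L1 convergence is stable under L1 limits by the uniform bound \<open>osc_int_le\<close>,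
  and a subsequence of generations then converges almost everywhere.\<close>

definition diffable :: "(real \<Rightarrow> complex) \<Rightarrow> bool" where
  "diffable f \<longleftrightarrow> integrable \<gamma> f \<and> (\<lambda>n. osc_int n f) \<longlonglongrightarrow> 0"

lemma osc_add:
  assumes "integrable \<gamma> f" "integrable \<gamma> g"
  shows "osc_int n (\<lambda>x. f x + g x) \<le> osc_int n f + osc_int n g"
proof -
  have "ennreal (osc n (\<lambda>x. f x + g x) x) \<le> ennreal (osc n f x) + ennreal (osc n g x)" for x
  proof -
    have "osc n (\<lambda>x. f x + g x) x \<le> osc n f x + osc n g x"
      unfolding osc_def av_add[OF assms] sum.distrib[symmetric]
      by (intro sum_mono) (metis add_diff_add norm_triangle_ineq)
    then have "ennreal (osc n (\<lambda>x. f x + g x) x) \<le> ennreal (osc n f x + osc n g x)" by (rule ennreal_leI)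
    also have "\<dots> = ennreal (osc n f x) + ennreal (osc n g x)"
      by (rule ennreal_plus) (auto simp: osc_def intro!: sum_nonneg)
    finally show ?thesis .
  qed
  then have "osc_int n (\<lambda>x. f x + g x) \<le> (\<integral>\<^sup>+x. ennreal (osc n f x) + ennreal (osc n g x) \<partial>\<gamma>)"
    unfolding osc_int_def by (intro nn_integral_mono)
  also have "\<dots> = osc_int n f + osc_int n g"
    unfolding osc_int_def using osc_measurable assms by (intro nn_integral_add) auto
  finally show ?thesis .
qed

lemma osc_cmult:
  assumes "integrable \<gamma> f"
  shows "osc_int n (\<lambda>x. c * f x) = ennreal (norm c) * osc_int n f"
proof -
  have "osc n (\<lambda>x. c * f x) x = norm c * osc n f x" for x
    unfolding osc_def av_cmult right_diff_distrib[symmetric] norm_mult sum_distrib_left ..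
  then show ?thesis
    unfolding osc_int_def using osc_measurable[OF assms]
    by (simp add: ennreal_mult nn_integral_cmult osc_nonneg)
qed

lemma tendsto_zero_ennrealI:
  fixes u :: "nat \<Rightarrow> ennreal"
  assumes "\<And>e. 0 < e \<Longrightarrow> eventually (\<lambda>n. u n \<le> ennreal e) sequentially"
  shows "u \<longlonglongrightarrow> 0"
proof (rule order_tendstoI)
  fix b :: ennreal assume "0 < b"
  then obtain c where c: "0 < c" "c < b" using dense by blast
  then obtain r where r: "c = ennreal r" "0 < r" by (cases c) auto
  from assms[OF r(2)] show "eventually (\<lambda>n. u n < b) sequentially"
    by eventually_elim (use c r in \<open>auto intro: le_less_trans\<close>)
qed auto

text \<open>The oscillation of the approximation error is bounded by its L1 norm, uniformly in the
  generation.\<close>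

lemma diffable_closed:
  assumes F: "\<And>k. diffable (F k)" and f: "integrable \<gamma> f"
    and lim: "(\<lambda>k. \<integral>\<^sup>+x. ennreal (norm (f x - F k x)) \<partial>\<gamma>) \<longlonglongrightarrow> 0"
  shows "diffable f"
  unfolding diffable_def
proof (intro conjI f tendsto_zero_ennrealI)
  fix e :: real assume e: "0 < e"
  have Fi: "integrable \<gamma> (F k)" for k using F by (simp add: diffable_def)
  have "(\<lambda>k. ennreal (75 * c0\<^sup>2) * (\<integral>\<^sup>+x. ennreal (norm (f x - F k x)) \<partial>\<gamma>)) \<longlonglongrightarrow> ennreal (75 * c0\<^sup>2) * 0"
    using lim by (intro ennreal_tendsto_cmult) auto
  then have "eventually (\<lambda>k. ennreal (75 * c0\<^sup>2) * (\<integral>\<^sup>+x. ennreal (norm (f x - F k x)) \<partial>\<gamma>) < ennreal (e / 2)) sequentially"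
    using e by (intro order_tendstoD(2)) auto
  then obtain k where k: "ennreal (75 * c0\<^sup>2) * (\<integral>\<^sup>+x. ennreal (norm (f x - F k x)) \<partial>\<gamma>) < ennreal (e / 2)"
    by (auto simp: eventually_sequentially)
  have "(\<lambda>n. osc_int n (F k)) \<longlonglongrightarrow> 0" using F by (simp add: diffable_def)
  then have "eventually (\<lambda>n. osc_int n (F k) < ennreal (e / 2)) sequentially"
    using e by (intro order_tendstoD(2)) auto
  then show "eventually (\<lambda>n. osc_int n f \<le> ennreal e) sequentially"
  proof eventually_elim
    case (elim n)
    have "osc_int n f = osc_int n (\<lambda>x. F k x + (f x - F k x))" by simp
    also have "\<dots> \<le> osc_int n (F k) + osc_int n (\<lambda>x. f x - F k x)"
      using f Fi by (intro osc_add) auto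
    also have "\<dots> \<le> ennreal (e / 2) + ennreal (e / 2)"
      using elim k osc_int_le[of "\<lambda>x. f x - F k x" n] f Fi by (intro add_mono) auto
    also have "\<dots> = ennreal e" using e by (simp flip: ennreal_plus)
    finally show ?case .
  qed
qed

lemma diffable_add: "diffable f \<Longrightarrow> diffable g \<Longrightarrow> diffable (\<lambda>x. f x + g x)"
proof -
  assume fg: "diffable f" "diffable g"
  then have lim: "(\<lambda>n. osc_int n f + osc_int n g) \<longlonglongrightarrow> 0"
    using tendsto_add[of "\<lambda>n. osc_int n f" 0 sequentially "\<lambda>n. osc_int n g" 0] by (simp add: diffable_def)
  have "(\<lambda>n. osc_int n (\<lambda>x. f x + g x)) \<longlonglongrightarrow> 0"
  proof (rule tendsto_sandwich[OF _ _ tendsto_const lim])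
    show "eventually (\<lambda>n. osc_int n (\<lambda>x. f x + g x) \<le> osc_int n f + osc_int n g) sequentially"
      using fg by (intro always_eventually allI osc_add) (auto simp: diffable_def)
  qed auto
  then show ?thesis using fg by (simp add: diffable_def)
qed

lemma diffable_cmult: "diffable f \<Longrightarrow> diffable (\<lambda>x. c * f x)"
  using ennreal_tendsto_cmult[of "ennreal (norm c)" "\<lambda>n. osc_int n f" 0 sequentially]
  by (auto simp: diffable_def osc_cmult)

lemma diffable_const: "diffable (\<lambda>x. c)"
  by (simp add: diffable_def osc_int_def osc_def av_const)

lemma node_close:
  assumes "0 < x" "0 < h n i y" "cell n x - 2 \<le> i" "i \<le> cell n x"
  shows "0 < y" "\<bar>2 ^ n * \<sigma> y - 2 ^ n * \<sigma> x\<bar> \<le> 4"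
proof -
  show y: "0 < y" using assms(2) by (simp add: h_def split: if_splits)
  have "0 < 2 ^ n * \<sigma> y - of_int i" "2 ^ n * \<sigma> y - of_int i < 3"
    using assms(2) y by (simp_all add: h_def bspline_pos_iff)
  moreover have "of_int (cell n x) \<le> 2 ^ n * \<sigma> x" "2 ^ n * \<sigma> x < of_int (cell n x) + 1"
    unfolding cell_def by linarith+
  moreover have "real_of_int (cell n x) - 2 \<le> of_int i" "real_of_int i \<le> of_int (cell n x)"
    using assms(3,4) by linarith+
  ultimately show "\<bar>2 ^ n * \<sigma> y - 2 ^ n * \<sigma> x\<bar> \<le> 4" by linarith
qed

text \<open>For x different from s, the nodes active at x eventually stay on one side of s, and then
  their averages equal the indicator exactly. Three terms of at most 2 give the majorant 6.\<close>

lemma diffable_atMost: "diffable (indicator {..s})"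
proof -
  have ind: "(indicator {..s} :: real \<Rightarrow> complex) \<in> borel_measurable \<gamma>"
    by (rule measurable_gammaI) simp
  have i: "integrable \<gamma> (indicator {..s} :: real \<Rightarrow> complex)"
    by (rule integrable_const_bound[of _ 1]) (use ind in \<open>auto simp: indicator_def\<close>)
  have b: "norm (av (indicator {..s}) n j) \<le> 1" for n j
  proof -
    note m = mass_pos[of n j]
    have "norm (\<integral>x. of_real (h n j x) * indicator {..s} x \<partial>\<gamma> :: complex) \<le> (\<integral>x. h n j x \<partial>\<gamma>)"
      by (rule Bochner_Integration.integral_norm_bound_integral[OF h_times_integrable[OF i] h_integrable])
         (auto simp: norm_mult indicator_def h_nonneg)
    then show ?thesis using m by (simp add: av_def norm_divide)
  qed
  have "(\<lambda>n. \<integral>\<^sup>+x. ennreal (osc n (indicator {..s}) x) \<partial>\<gamma>) \<longlonglongrightarrow> (\<integral>\<^sup>+x. 0 \<partial>\<gamma>)"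
  proof (rule nn_integral_dominated_convergence[where w="\<lambda>_. ennreal 6"])
    show "(\<lambda>x. ennreal (osc n (indicator {..s}) x)) \<in> borel_measurable \<gamma>" for n
      using osc_measurable[OF i] by simp
    show "AE x in \<gamma>. ennreal (osc n (indicator {..s}) x) \<le> ennreal 6" for n
    proof (rule AE_I2, rule ennreal_leI)
      fix x
      have "osc n (indicator {..s}) x \<le> (\<Sum>e<(3::nat). 1 + 1)"
        unfolding osc_def
      proof (rule sum_mono)
        fix e :: nat
        have "norm (indicator {..s} x :: complex) \<le> 1" by (auto simp: indicator_def)
        with b[of n "cell n x - int e"] norm_triangle_ineq4[of "av (indicator {..s}) n (cell n x - int e)" "indicator {..s} x"]
        show "norm (av (indicator {..s}) n (cell n x - int e) - indicator {..s} x) \<le> 1 + 1" by linarith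
      qed
      then show "osc n (indicator {..s}) x \<le> 6" by simp
    qed
    show "(\<integral>\<^sup>+x. ennreal 6 \<partial>\<gamma>) < \<infinity>"
      by (simp add: emeasure_eq_measure ennreal_mult[symmetric] flip: ennreal_numeral)
    have "AE x in lborel. x \<noteq> s" by (rule AE_lborel_singleton)
    then have "AE x in \<gamma>. x \<noteq> s"
      unfolding gamma_measure_eq
      by (subst AE_density) (auto simp: AE_restrict_space_iff intro!: measurable_restrict_space1)
    with AE_space show "AE x in \<gamma>. (\<lambda>n. ennreal (osc n (indicator {..s}) x)) \<longlonglongrightarrow> 0"
    proof eventually_elim
      case (elim x)
      then have x: "0 < x" by simp
      have "eventually (\<lambda>n. ennreal (osc n (indicator {..s}) x) = 0) sequentially"
      proof -
        \<comment> \<open>Distance between \<open>x\<close> and \<open>s\<close> in the coordinate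
          sigma. For \<open>s\<close> not positive the indicator vanishes on the half-line and any
          positive number will do.\<close>
        define d where "d = (if 0 < s then \<bar>\<sigma> x - \<sigma> s\<bar> else 1)"
        have "0 < d"
          using tau_less_iff[OF x, of s] tau_less_iff[of s x] x elim K_pos
          by (auto simp: d_def \<sigma>_def)
        then obtain N where N: "4 / d < 2 ^ N" using real_arch_pow[of 2 "4 / d"] by auto
        have "osc n (indicator {..s}) x = 0" if n: "N \<le> n" for n
        proof -
          have "4 / d < 2 ^ n" using N power_increasing[of N n "2::real"] n by linarith
          then have dn: "4 < 2 ^ n * d" using \<open>0 < d\<close> by (simp add: field_simps)
          have "av (indicator {..s}) n (cell n x - int e) = indicator {..s} x" if e: "e < 3" for e
          proof (rule av_eq_const)
            fix y assume y: "0 < h n (cell n x - int e) y"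
            have c: "0 < y" "\<bar>2 ^ n * \<sigma> y - 2 ^ n * \<sigma> x\<bar> \<le> 4"
              using node_close[OF x y] e by auto
            show "indicator {..s} y = (indicator {..s} x :: complex)"
            proof (cases "0 < s")
              case True
              have "4 < \<bar>2 ^ n * \<sigma> x - 2 ^ n * \<sigma> s\<bar>"
                using dn True by (simp add: d_def right_diff_distrib[symmetric] abs_mult)
              with c have "(2 ^ n * \<sigma> y \<le> 2 ^ n * \<sigma> s) = (2 ^ n * \<sigma> x \<le> 2 ^ n * \<sigma> s)" by linarith
              then have "(\<tau> y \<le> \<tau> s) = (\<tau> x \<le> \<tau> s)" using K_pos by (simp add: \<sigma>_def)
              then show ?thesis using tau_le_iff c x True by (simp add: indicator_def)
            next
              case False then show ?thesis using c x by (simp add: indicator_def)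
            qed
          qed
          then show ?thesis by (simp add: osc_def)
        qed
        then show ?thesis unfolding eventually_sequentially by (intro exI[of _ N]) simp
      qed
      then show ?case by (rule tendsto_eventually)
    qed
  qed auto
  then show ?thesis using i by (simp add: diffable_def osc_int_def)
qed

lemma L1_limit_DCT:
  assumes [measurable]: "\<And>k. F k \<in> borel_measurable \<gamma>" "f \<in> borel_measurable \<gamma>"
    and w: "integrable \<gamma> w" and F: "\<And>x. x \<in> space \<gamma> \<Longrightarrow> (\<lambda>k. F k x) \<longlonglongrightarrow> f x"
    and le: "\<And>k x. x \<in> space \<gamma> \<Longrightarrow> norm (f x - F k x :: complex) \<le> w x"
  shows "(\<lambda>k. \<integral>\<^sup>+x. ennreal (norm (f x - F k x)) \<partial>\<gamma>) \<longlonglongrightarrow> 0"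
proof -
  have w0: "0 \<le> w x" if "x \<in> space \<gamma>" for x using le[OF that, of 0] norm_ge_zero order_trans by blast
  have "(\<lambda>k. \<integral>\<^sup>+x. ennreal (norm (f x - F k x)) \<partial>\<gamma>) \<longlonglongrightarrow> (\<integral>\<^sup>+x. 0 \<partial>\<gamma>)"
  proof (rule nn_integral_dominated_convergence[where w="\<lambda>x. ennreal (w x)"])
    show "(\<integral>\<^sup>+x. ennreal (w x) \<partial>\<gamma>) < \<infinity>"
      using w w0 by (subst nn_integral_eq_integral) auto
    show "AE x in \<gamma>. (\<lambda>k. ennreal (norm (f x - F k x))) \<longlonglongrightarrow> 0"
    proof (rule AE_I2)
      fix x assume "x \<in> space \<gamma>"
      from tendsto_norm[OF tendsto_diff[OF tendsto_const F[OF this], of "f x"]]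
      have "(\<lambda>k. norm (f x - F k x)) \<longlonglongrightarrow> 0" by simp
      then show "(\<lambda>k. ennreal (norm (f x - F k x))) \<longlonglongrightarrow> 0"
        using tendsto_ennrealI by fastforce
    qed
  qed (use w le in \<open>auto intro!: ennreal_leI\<close>)
  then show ?thesis by simp
qed

text \<open>Dynkin's argument from the half-lines: complements by linearity, disjoint unions as L1
  limits of finite sums.\<close>

lemma diffable_indicator: "A \<in> sets borel \<Longrightarrow> diffable (indicator A)"
proof -
  assume "A \<in> sets borel"
  then have A: "A \<in> sigma_sets UNIV (range (\<lambda>s::real. {..s}))"
    unfolding borel_eq_atMost by (simp add: sets_measure_of)
  have int: "Int_stable (range (\<lambda>s::real. {..s}))"
    by (auto simp: Int_stable_def)
  have bor: "B \<in> sets borel" if "B \<in> sigma_sets UNIV (range (\<lambda>s::real. {..s}))" for B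
    using that unfolding borel_eq_atMost by (simp add: sets_measure_of)
  have sub: "range (\<lambda>s::real. {..s}) \<subseteq> Pow UNIV" by simp
  from int sub A show ?thesis
  proof (induction rule: sigma_sets_induct_disjoint)
    case (basic B) then show ?case using diffable_atMost by auto
  next
    case empty show ?case using diffable_const[of 0] by (simp add: indicator_def)
  next
    case (compl B)
    have "indicator (UNIV - B) = (\<lambda>x. 1 + (- 1) * indicator B x :: complex)"
      by (auto simp: indicator_def fun_eq_iff)
    then show ?case using diffable_add[OF diffable_const diffable_cmult[OF compl(2)], of 1 "- 1"] by simp
  next
    case (union B)
    have Bb: "B i \<in> sets borel" for i using union(2) bor by auto
    let ?F = "\<lambda>k x. \<Sum>i<k. indicator (B i) x :: complex"
    have fin: "diffable (?F k)" for k
    proof (induction k)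
      case 0 show ?case using diffable_const[of 0] by simp
    next
      case (Suc k) then show ?case using diffable_add[OF Suc union(3)[of k]] by (simp add: add.commute)
    qed
    have Fk: "?F k x = indicator (\<Union>i<k. B i) x" for k x
    proof -
      have "disjoint_family_on B {..<k}" using union(1) by (rule disjoint_family_on_mono[OF subset_UNIV])
      then show ?thesis by (simp add: indicator_UN_disjoint)
    qed
    have m: "indicator (\<Union>i. B i) \<in> borel_measurable \<gamma>" "?F k \<in> borel_measurable \<gamma>" for k
      using Bb by (auto intro!: measurable_gammaI)
    show ?case
    proof (rule diffable_closed[OF fin])
      show "integrable \<gamma> (indicator (\<Union>i. B i) :: real \<Rightarrow> complex)"
        by (rule integrable_const_bound[of _ 1]) (use m in \<open>auto simp: indicator_def\<close>)
      show "(\<lambda>k. \<integral>\<^sup>+x. ennreal (norm (indicator (\<Union>i. B i) x - ?F k x)) \<partial>\<gamma>) \<longlonglongrightarrow> 0"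
      proof (rule L1_limit_DCT[where w="\<lambda>_. 1"])
        show "(\<lambda>k. ?F k x) \<longlonglongrightarrow> indicator (\<Union>i. B i) x" for x
          unfolding Fk by (rule LIMSEQ_indicator_UN)
        show "norm (indicator (\<Union>i. B i) x - ?F k x) \<le> 1" for k x
          unfolding Fk by (auto simp: indicator_def)
      qed (use m in auto)
    qed
  qed
qed

lemma diffable_integrable: "integrable \<gamma> f \<Longrightarrow> diffable f"
proof (induction rule: integrable_induct)
  case (base A c)
  then have "A \<in> sets borel" by (simp add: sets_gamma_iff)
  from diffable_cmult[OF diffable_indicator[OF this], of c]
  show ?case by (simp add: scaleR_conv_of_real mult.commute[of _ c] of_real_indicator)
next
  case (add f g) then show ?case by (simp add: diffable_add)
next
  case (lim f s)
  have "(\<lambda>k. \<integral>\<^sup>+x. ennreal (norm (f x - s k x)) \<partial>\<gamma>) \<longlonglongrightarrow> 0"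
  proof (rule L1_limit_DCT[where w="\<lambda>x. 3 * norm (f x)"])
    fix k x assume "x \<in> space \<gamma>"
    then have "norm (s k x) \<le> 2 * norm (f x)" using lim by auto
    with norm_triangle_ineq4[of "f x" "s k x"]
    show "norm (f x - s k x) \<le> 3 * norm (f x)" by linarith
  qed (use lim in auto)
  then show ?case by (rule diffable_closed[rotated 2]) (fact lim)+
qed

text \<open>The oscillation tends to 0 in L1, hence almost everywhere along a subsequence
  \<open>r\<close> of generations; this accounts for the form "for every N some m >= N".\<close>

theorem av_differentiation:
  assumes f: "integrable \<gamma> f"
  shows "AE x in \<gamma>. \<forall>\<epsilon>>0. \<forall>N. \<exists>m\<ge>N. \<forall>i. 0 < h m i x \<longrightarrow> norm (av f m i - f x) < \<epsilon>"
proof -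
  note osc0 = osc_nonneg[of _ f]
  note [measurable] = osc_measurable[OF f]
  have fin: "osc_int n f < \<infinity>" for n
  proof -
    have "(\<integral>\<^sup>+x. ennreal (norm (f x)) \<partial>\<gamma>) < \<infinity>" using f by (simp add: integrable_iff_bounded)
    then show ?thesis
      by (intro le_less_trans[OF osc_int_le[OF f]]) (simp add: ennreal_mult_less_top)
  qed
  have i: "integrable \<gamma> (osc n f)" for n
    using fin[of n] osc0 by (intro integrableI_bounded) (auto simp: osc_int_def)
  have "(\<lambda>n. ennreal (\<integral>x. norm (osc n f x) \<partial>\<gamma>)) \<longlonglongrightarrow> ennreal 0"
    using diffable_integrable[OF f] i osc0
    by (simp add: diffable_def osc_int_def nn_integral_eq_integral)
  then have "(\<lambda>n. \<integral>x. norm (osc n f x) \<partial>\<gamma>) \<longlonglongrightarrow> 0"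
    by (subst (asm) tendsto_ennreal_iff) (auto intro!: always_eventually)
  from tendsto_L1_AE_subseq[OF i this] obtain r :: "nat \<Rightarrow> nat" where r: "strict_mono r"
    and lim: "AE x in \<gamma>. (\<lambda>n. osc (r n) f x) \<longlonglongrightarrow> 0" by blast
  from lim AE_space show ?thesis
  proof eventually_elim
    case (elim x)
    then have x: "0 < x" by simp
    show ?case
    proof (intro allI impI)
      fix \<epsilon> :: real and N :: nat assume "0 < \<epsilon>"
      with elim(1) have "eventually (\<lambda>n. osc (r n) f x < \<epsilon>) sequentially" by (rule order_tendstoD)
      then obtain n where n: "n \<ge> N" "osc (r n) f x < \<epsilon>"
        by (metis (mono_tags, lifting) eventually_sequentially le_cases)
      have "norm (av f (r n) i - f x) < \<epsilon>" if i: "0 < h (r n) i x" for i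
      proof -
        have "0 < 2 ^ r n * \<sigma> x - of_int i" "2 ^ r n * \<sigma> x - of_int i < 3"
          using i x by (simp_all add: h_def bspline_pos_iff)
        then have c: "cell (r n) x - 2 \<le> i" "i \<le> cell (r n) x" unfolding cell_def by linarith+
        define e where "e = nat (cell (r n) x - i)"
        have e: "e < 3" "i = cell (r n) x - int e" using c by (auto simp: e_def)
        have "norm (av f (r n) i - f x) \<le> osc (r n) f x"
          unfolding osc_def e(2) using e(1)
          by (intro member_le_sum[of e "{..<3}" "\<lambda>e. norm (av f (r n) (cell (r n) x - int e) - f x)"]) auto
        with n show ?thesis by simp
      qed
      moreover have "N \<le> r n" using n strict_mono_imp_increasing[OF r, of n] by simp
      ultimately show "\<exists>m\<ge>N. \<forall>i. 0 < h m i x \<longrightarrow> norm (av f m i - f x) < \<epsilon>" by blast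
    qed
  qed
qed

end

section \<open>Averages and the local maximal function\<close>

lemma test_functionD:
  assumes "\<phi> \<in> test_functions"
  shows "continuous_on UNIV \<phi>" "norm (\<phi> z) \<le> 1" "1 \<le> \<bar>z\<bar> \<Longrightarrow> \<phi> z = 0"
    "norm (\<phi> z - \<phi> y) \<le> \<bar>z - y\<bar>"
proof -
  from assms obtain D where D: "\<And>z. (\<phi> has_vector_derivative D z) (at z)"
    and supp: "closure (support_on UNIV \<phi>) \<subseteq> {-1<..<1}" and le: "\<And>z. norm (\<phi> z) \<le> 1"
    and le': "\<And>z. norm (vector_derivative \<phi> (at z)) \<le> 1"
    by (auto simp: test_functions_def C1_differentiable_on_def)
  show "continuous_on UNIV \<phi>"
    using D by (intro continuous_at_imp_continuous_on ballI has_vector_derivative_continuous)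
  show "norm (\<phi> z) \<le> 1" by (rule le)
  show "\<phi> z = 0" if "1 \<le> \<bar>z\<bar>"
  proof (rule ccontr)
    assume "\<phi> z \<noteq> 0"
    then have "z \<in> closure (support_on UNIV \<phi>)"
      using closure_subset[of "support_on UNIV \<phi>"] by (auto simp: support_on_def)
    with supp have "z \<in> {-1<..<1}" by blast
    then have "- 1 < z" "z < 1" by simp_all
    with that show False by linarith
  qed
  have D1: "norm (D z) \<le> 1" for z using le'[of z] vector_derivative_at[OF D[of z]] by simp
  have "norm (\<phi> z - \<phi> y) \<le> 1 * norm (z - y)"
  proof (rule differentiable_bound[of UNIV \<phi> "\<lambda>x h. h *\<^sub>R D x"])
    show "onorm (\<lambda>h. h *\<^sub>R D x) \<le> 1" for x
    proof (rule onorm_bound)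
      show "norm (h *\<^sub>R D x) \<le> 1 * norm h" for h
        using mult_left_mono[OF D1[of x], of "norm h"] by simp
    qed simp
    show "(\<phi> has_derivative (\<lambda>h. h *\<^sub>R D x)) (at x within UNIV)" for x
      using D[of x] by (simp add: has_vector_derivative_def)
  qed simp_all
  then show "norm (\<phi> z - \<phi> y) \<le> \<bar>z - y\<bar>" by simp
qed

lemma test_function_measurable: "\<phi> \<in> test_functions \<Longrightarrow> \<phi> \<in> borel_measurable borel"
  by (intro borel_measurable_continuous_onI test_functionD(1))

lemma isCont_convolution:
  fixes g F :: "real \<Rightarrow> complex"
  assumes g: "continuous_on UNIV g" "\<And>z. norm (g z) \<le> B" and F: "integrable lborel F"
  shows "isCont (\<lambda>x. \<integral>y. g (x - y) * F y \<partial>lborel) x0"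
  unfolding continuous_at_sequentially comp_def
proof (intro allI impI)
  fix u :: "nat \<Rightarrow> real" assume u: "u \<longlonglongrightarrow> x0"
  have [measurable]: "g \<in> borel_measurable borel" using g(1) by (rule borel_measurable_continuous_onI)
  have [measurable]: "F \<in> borel_measurable borel" using F by auto
  show "(\<lambda>n. \<integral>y. g (u n - y) * F y \<partial>lborel) \<longlonglongrightarrow> (\<integral>y. g (x0 - y) * F y \<partial>lborel)"
  proof (rule integral_dominated_convergence[where w="\<lambda>y. B * norm (F y)"])
    show "AE y in lborel. (\<lambda>n. g (u n - y) * F y) \<longlonglongrightarrow> g (x0 - y) * F y"
    proof (rule AE_I2)
      fix y
      have "isCont g (x0 - y)" using g(1) by (simp add: continuous_on_eq_continuous_at)
      then have "(\<lambda>n. g (u n - y)) \<longlonglongrightarrow> g (x0 - y)"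
        using u by (intro isCont_tendsto_compose[of "x0 - y" g] tendsto_diff tendsto_const)
      then show "(\<lambda>n. g (u n - y) * F y) \<longlonglongrightarrow> g (x0 - y) * F y" by (intro tendsto_mult tendsto_const)
    qed
    show "AE y in lborel. norm (g (u n - y) * F y) \<le> B * norm (F y)" for n
      by (auto simp: norm_mult intro!: mult_right_mono g(2))
  qed (use F in auto)
qed

section \<open>Atoms on grid intervals\<close>

context gamma_grid begin

definition atoms :: "(real \<Rightarrow> complex) set" where
  "atoms = {b. is_atom (bb_B a) \<infinity> \<alpha> b}"

lemma Lq_norm_infinity: "Lq_norm \<infinity> M f = esssup M (\<lambda>x. ennreal (norm (f x)))"
  by (simp add: Lq_norm_def)

lemma const_atom: "(\<lambda>_. 1) \<in> atoms"
  by (simp add: atoms_def is_atom_def)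

lemma itv_sets: "itv x r \<in> sets \<gamma>"
  by (auto simp: itv_def sets_gamma_iff)

text \<open>The constant atom has L1 norm equal to the total mass, every other atom at most
  1.\<close>

definition L :: real where "L = max 1 (measure \<gamma> {0<..})"

lemma atoms_L1:
  assumes "b \<in> atoms"
  shows "integrable \<gamma> b" and "(\<integral>\<^sup>+x. ennreal (norm (b x)) \<partial>\<gamma>) \<le> ennreal L"
proof -
  have bm: "b \<in> borel_measurable \<gamma>" using assms by (simp add: atoms_def is_atom_def)
  show le: "(\<integral>\<^sup>+x. ennreal (norm (b x)) \<partial>\<gamma>) \<le> ennreal L"
  proof (cases "\<forall>x>0. b x = 1")
    case True
    then have "(\<integral>\<^sup>+x. ennreal (norm (b x)) \<partial>\<gamma>) = (\<integral>\<^sup>+x. 1 \<partial>\<gamma>)"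
      by (intro nn_integral_cong) simp
    also have "\<dots> \<le> ennreal L" by (simp add: L_def emeasure_eq_measure)
    finally show ?thesis .
  next
    case False
    with assms obtain J where J: "J \<in> bb_B a" "support_on {0<..} b \<subseteq> J"
      and s': "Lq_norm \<infinity> \<gamma> b \<le> ennreal (measure \<gamma> J powr (enn2real (inverse \<infinity>) - 1))"
      unfolding atoms_def is_atom_def by blast
    have e: "enn2real (inverse \<infinity>) - 1 = - 1" by simp
    have s: "esssup \<gamma> (\<lambda>x. ennreal (norm (b x))) \<le> ennreal (measure \<gamma> J powr (- 1))"
      using s' unfolding Lq_norm_infinity e .
    have Js: "J \<in> sets \<gamma>" using J(1) itv_sets by (auto simp: bb_B_def)
    have "(\<integral>\<^sup>+x. ennreal (norm (b x)) \<partial>\<gamma>) \<le> (\<integral>\<^sup>+x. ennreal (measure \<gamma> J powr (- 1)) * indicator J x \<partial>\<gamma>)"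
    proof (rule nn_integral_mono_AE)
      show "AE x in \<gamma>. ennreal (norm (b x)) \<le> ennreal (measure \<gamma> J powr (- 1)) * indicator J x"
        using esssup_AE[where M=\<gamma> and f="\<lambda>x. ennreal (norm (b x))"] AE_space
      proof eventually_elim
        case (elim x)
        show ?case
        proof (cases "x \<in> J")
          case True
          then show ?thesis
            using order_trans[OF elim(1) s] by (simp only: indicator_simps(1) mult.right_neutral)
        next
          case False with elim J(2) have "b x = 0" by (auto simp: support_on_def)
          then show ?thesis by simp
        qed
      qed
    qed
    also have "\<dots> = ennreal (measure \<gamma> J powr (- 1)) * ennreal (measure \<gamma> J)"
      using Js by (simp add: nn_integral_cmult_indicator emeasure_eq_measure)
    also have "\<dots> \<le> 1"
      by (cases "measure \<gamma> J = 0") (auto simp: ennreal_mult[symmetric] powr_minus_divide)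
    also have "\<dots> \<le> ennreal L" by (simp add: L_def)
    finally show ?thesis .
  qed
  then show "integrable \<gamma> b"
    using bm by (intro integrableI_bounded) (auto intro: le_less_trans)
qed

sublocale at: L1_bounded_family \<gamma> atoms L
  by standard (use const_atom atoms_L1 in auto)

text \<open>Division by \<open>c\<close> times the mass of the interval produces an atom; if this
  product is 0, the function vanishes almost everywhere.\<close>

lemma atomic_le_interval:
  assumes AB: "0 < A" "A < B" "(B - A) / 2 \<le> a * w_fun ((A + B) / 2)"
    and F: "F \<in> borel_measurable \<gamma>" "\<And>x. 0 < x \<Longrightarrow> x \<notin> {A<..<B} \<Longrightarrow> F x = 0"
      "AE x in \<gamma>. norm (F x) \<le> c" "0 \<le> c" "(\<integral>x. F x \<partial>\<gamma>) = 0"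
  shows "atomic_le \<gamma> atoms F (c * measure \<gamma> {A<..<B})"
proof (cases "c * measure \<gamma> {A<..<B} = 0")
  case True
  let ?J = "{A<..<B}"
  have J: "?J \<in> sets \<gamma>" using AB by (auto simp: sets_gamma_iff)
  have "AE x in \<gamma>. F x = 0"
  proof (cases "c = 0")
    case False
    then have "?J \<in> null_sets \<gamma>" using True J by (auto simp: null_sets_def emeasure_eq_measure)
    from AE_not_in[OF this] AE_space show ?thesis by eventually_elim (use F in auto)
  qed (use F(3) in auto)
  then show ?thesis unfolding True by (rule at.atomic_le_zero) simp
next
  case False
  let ?J = "{A<..<B}" and ?m = "measure \<gamma> {A<..<B}"
  have m: "0 < ?m" and c: "0 < c" using False F(4) by (auto simp: less_le)
  let ?b = "\<lambda>x. F x / of_real (c * ?m)"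
  have J: "?J = itv ((A + B) / 2) ((B - A) / 2)" using AB by (auto simp: itv_def field_simps)
  have "?b \<in> atoms"
    unfolding atoms_def is_atom_def
  proof (intro CollectI conjI disjI2 bexI[of _ ?J])
    show "?b \<in> borel_measurable \<gamma>" using F(1) by simp
    show "?J \<in> bb_B a"
      unfolding bb_B_def
      by (rule CollectI, intro exI[of _ "(A + B) / 2"] exI[of _ "(B - A) / 2"] conjI J) (use AB in simp_all)
    show "support_on {0<..} ?b \<subseteq> ?J"
    proof
      fix x assume "x \<in> support_on {0<..} ?b"
      then have "0 < x" "F x \<noteq> 0" by (auto simp: support_on_def)
      with F(2)[of x] show "x \<in> ?J" by blast
    qed
    have e: "?m powr (enn2real (inverse \<infinity>) - 1) = 1 / ?m" using m by (simp add: powr_minus_divide)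
    show "Lq_norm \<infinity> \<gamma> ?b \<le> ennreal (?m powr (enn2real (inverse \<infinity>) - 1))"
      unfolding Lq_norm_infinity e
    proof (rule esssup_I)
      show "AE x in \<gamma>. ennreal (norm (?b x)) \<le> ennreal (1 / ?m)"
        using F(3) by eventually_elim
          (use m c in \<open>auto simp: norm_divide norm_mult field_simps intro!: ennreal_leI\<close>)
    qed (use F(1) in simp)
    show "(\<integral>x. ?b x \<partial>\<gamma>) = 0" using F(5) by simp
  qed
  then show ?thesis
    by (rule at.atomic_le_atom[where c="of_real (c * ?m)"]) (use m c in \<open>auto simp: norm_mult\<close>)
qed

text \<open>By e <= 3 four cells have length at most 12 / (K v) = 0.12 a / v, whereas 2 a w is at
  least 0.25 a / v.\<close>

lemma pt_radius:
  assumes "s < t" "t \<le> s + 4"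
  shows "(pt n t - pt n s) / 2 \<le> a * w_fun ((pt n s + pt n t) / 2)"
proof -
  let ?x = "(pt n s + pt n t) / 2"
  have l: "pt n s < pt n t" using assms by (simp add: pt_less_iff)
  have x: "0 < ?x" using pt_pos[of n s] pt_pos[of n t] by simp
  have "pt n s < ?x" "?x < pt n t" using l by auto
  then have "s < 2 ^ n * \<sigma> ?x" "2 ^ n * \<sigma> ?x < t" using pt_less[OF x] less_pt[OF x] by blast+
  then have "pt n t - pt n s \<le> exp 1 * (t - s) / (2 ^ n * K * v ?x)"
    using assms by (intro pt_interval_mass(3)[OF x]) auto
  also have "\<dots> \<le> (3 * 4) / (K * v ?x)"
  proof (rule frac_le)
    show "exp 1 * (t - s) \<le> 3 * 4" using assms exp_le by (intro mult_mono) auto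
    show "K * v ?x \<le> 2 ^ n * K * v ?x" using v_pos[OF x] K_pos by (simp add: mult_le_cancel_right1)
  qed (use v_pos[OF x] K_pos in auto)
  also have "\<dots> = 12 / 100 * a / v ?x" using a_pos by (simp add: K_def)
  also have "\<dots> \<le> 2 * (a * (1 / (8 * v ?x)))" using v_pos[OF x] a_pos by (simp add: field_simps)
  also have "\<dots> \<le> 2 * (a * w_fun ?x)" using w_bounds(1)[OF x] a_pos by (intro mult_left_mono) auto
  finally show ?thesis by simp
qed

text \<open>The atom lives on the support interval of the node, of measure at most 3 c0 times 2 c0
  times the mass of the node.\<close>

lemma atomic_le_node:
  assumes F: "F \<in> borel_measurable \<gamma>" "\<And>x. x \<in> space \<gamma> \<Longrightarrow> h n i x = 0 \<Longrightarrow> F x = 0"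
    "AE x in \<gamma>. norm (F x) \<le> B * h n i x" "0 \<le> B" "(\<integral>x. F x \<partial>\<gamma>) = 0"
  shows "atomic_le \<gamma> atoms F (6 * c0\<^sup>2 * B * (\<integral>x. h n i x \<partial>\<gamma>))"
proof -
  let ?J = "{pt n (of_int i)<..<pt n (of_int i + 3)}"
  have "atomic_le \<gamma> atoms F (B * measure \<gamma> ?J)"
  proof (rule atomic_le_interval[OF pt_pos _ _ F(1) _ _ F(4,5)])
    show "pt n (of_int i) < pt n (of_int i + 3)" by (simp add: pt_less_iff)
    show "(pt n (of_int i + 3) - pt n (of_int i)) / 2 \<le> a * w_fun ((pt n (of_int i) + pt n (of_int i + 3)) / 2)"
      by (rule pt_radius) auto
    show "F x = 0" if "0 < x" "x \<notin> ?J" for x using F(2)[of x] that h_zero_iff[of n i x] by simp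
    show "AE x in \<gamma>. norm (F x) \<le> B"
      using F(3) by eventually_elim (meson F(4) h_le_1 h_nonneg mult_left_le order_trans)
  qed
  moreover have "B * measure \<gamma> ?J \<le> B * (3 * c0 * (2 * c0 * (\<integral>x. h n i x \<partial>\<gamma>)))"
  proof (rule mult_left_mono[OF _ F(4)])
    let ?x = "pt n (of_int i)"
    have "measure \<gamma> ?J \<le> 3 * c0 * \<rho> n ?x" by (rule mass_upper(2)[OF pt_pos]) simp
    also have "\<dots> \<le> 3 * c0 * (2 * c0 * (\<integral>x. h n i x \<partial>\<gamma>))"
      using c0_ge by (intro mult_left_mono mass_lower[OF pt_pos]) auto
    finally show "measure \<gamma> ?J \<le> 3 * c0 * (2 * c0 * (\<integral>x. h n i x \<partial>\<gamma>))" .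
  qed
  ultimately have "atomic_le \<gamma> atoms F (B * (3 * c0 * (2 * c0 * (\<integral>x. h n i x \<partial>\<gamma>))))"
    by (rule at.atomic_le_mono)
  then show ?thesis by (simp add: power2_eq_square mult_ac)
qed

sublocale refinement \<gamma> atoms L h "6 * c0\<^sup>2" "12 * c0\<^sup>2"
proof
  show "\<exists>i. 0 < h n i x" if "x \<in> space \<gamma>" for n x using that h_cover by simp
qed (fact h_measurable_gamma h_nonneg h_le_1 h_refine mass_pos mass_child atomic_le_node | simp)+

text \<open>The factor is 2 A + 32 A D of \<open>local_atomic\<close> for A = 6 c0^2 and D = 12
  c0^2.\<close>

lemma local_atomic_node:
  assumes f: "integrable \<gamma> f" and mf: "mf \<in> borel_measurable \<gamma>"
    and le: "\<And>n i x. 0 < x \<Longrightarrow> 0 < h n i x \<Longrightarrow> ennreal (norm (av f n i)) \<le> mf x"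
    and fin: "(\<integral>\<^sup>+x. ennreal (h n i x) * mf x \<partial>\<gamma>) \<le> ennreal I" and I: "0 \<le> I"
  shows "atomic_le \<gamma> atoms (\<lambda>x. of_real (h n i x) * f x - av f n i * of_real (h n i x))
    ((12 * c0\<^sup>2 + 2304 * c0 ^ 4) * I)"
proof -
  interpret rf: refinement_function \<gamma> atoms L h "6 * c0\<^sup>2" "12 * c0\<^sup>2" f
    by (intro refinement_function.intro refinement_axioms refinement_function_axioms.intro f)
  have avg: "rf.avg = av f" by (simp add: fun_eq_iff rf.avg_def av_def)
  interpret rm: refinement_maximal \<gamma> atoms L h "6 * c0\<^sup>2" "12 * c0\<^sup>2" f mf
    by (intro refinement_maximal.intro rf.refinement_function_axioms refinement_maximal_axioms.intro)
       (use mf le av_differentiation[OF f] in \<open>simp_all only: avg space_gamma greaterThan_iff\<close>)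
  show ?thesis
    using rm.local_atomic[OF fin I] by (simp add: avg power2_eq_square eval_nat_numeral)
qed

lemma f_le_maximal:
  assumes f: "integrable \<gamma> f" and mf: "mf \<in> borel_measurable \<gamma>"
    and le: "\<And>n i x. 0 < x \<Longrightarrow> 0 < h n i x \<Longrightarrow> ennreal (norm (av f n i)) \<le> mf x"
  shows "AE x in \<gamma>. ennreal (norm (f x)) \<le> mf x"
proof -
  interpret rf: refinement_function \<gamma> atoms L h "6 * c0\<^sup>2" "12 * c0\<^sup>2" f
    by (intro refinement_function.intro refinement_axioms refinement_function_axioms.intro f)
  have avg: "rf.avg = av f" by (simp add: fun_eq_iff rf.avg_def av_def)
  interpret rm: refinement_maximal \<gamma> atoms L h "6 * c0\<^sup>2" "12 * c0\<^sup>2" f mf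
    by (intro refinement_maximal.intro rf.refinement_function_axioms refinement_maximal_axioms.intro)
       (use mf le av_differentiation[OF f] in \<open>simp_all only: avg space_gamma greaterThan_iff\<close>)
  show ?thesis by (rule rm.f_le_mf)
qed

section \<open>Node averages as convolutions with test functions\<close>

definition gd' :: "real \<Rightarrow> real" where "gd' x = gd x * ((2 * \<alpha> + 1) / x - 2 * x)"

text \<open>The derivative of \<open>h n i y * gd y\<close>.\<close>

definition node_fun' :: "nat \<Rightarrow> int \<Rightarrow> real \<Rightarrow> real" where
  "node_fun' n i y = (if 0 < y then bspline' (2 ^ n * \<sigma> y - of_int i) * (2 ^ n * (K * v y)) * gd y
     + bspline (2 ^ n * \<sigma> y - of_int i) * gd' y else 0)"

lemma bspline'_left: "s \<le> 0 \<Longrightarrow> bspline' s = 0"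
  by (simp add: bspline'_def)

lemma bspline'_outside: "s \<le> 0 \<or> 3 \<le> s \<Longrightarrow> bspline' s = 0"
  by (auto simp: bspline'_def max_def)

text \<open>The support of a node starts at a positive point, so the product vanishes near 0 and is
  C^1 on the whole line, although the density need not be smooth at 0.\<close>

lemma node_fun_left: "y < pt n (of_int i) \<Longrightarrow> h n i y * gd y = 0 \<and> node_fun' n i y = 0"
  using less_pt[of y n "of_int i"] by (auto simp: h_def node_fun'_def bspline_outside bspline'_left)

lemma node_fun_deriv: "((\<lambda>y. h n i y * gd y) has_real_derivative node_fun' n i y) (at y)"
proof (cases "0 < y")
  case True
  have s: "(\<sigma> has_real_derivative K * v y) (at y)"
    unfolding \<sigma>_def[abs_def] by (rule DERIV_cmult[OF tau_deriv[OF True]])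
  have "((\<lambda>y. 2 ^ n * \<sigma> y - of_int i) has_real_derivative 2 ^ n * (K * v y)) (at y)"
    using DERIV_diff[OF DERIV_cmult[OF s, of "2 ^ n"] DERIV_const[of "of_int i"]] by simp
  from DERIV_mult[OF DERIV_chain2[OF bspline_deriv this] gd_deriv[OF True, folded gd'_def]]
  have "((\<lambda>y. bspline (2 ^ n * \<sigma> y - of_int i) * gd y) has_real_derivative node_fun' n i y) (at y)"
    using True by (simp add: node_fun'_def mult_ac add.commute)
  moreover have "eventually (\<lambda>y. h n i y * gd y = bspline (2 ^ n * \<sigma> y - of_int i) * gd y) (nhds y)"
    using True by (auto simp: h_def intro!: eventually_mono[OF eventually_nhds_in_open[of "{0<..}" y]])
  ultimately show ?thesis by (subst DERIV_cong_ev[OF refl _ refl]) auto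
next
  case False
  then have y: "y < pt n (of_int i)" using pt_pos[of n "of_int i"] by simp
  have "eventually (\<lambda>y. h n i y * gd y = 0) (nhds y)"
    using y by (auto intro!: eventually_mono[OF eventually_nhds_in_open[of "{..<pt n (of_int i)}" y]]
      dest: node_fun_left)
  then have "((\<lambda>y. h n i y * gd y) has_real_derivative 0) (at y)"
    by (subst DERIV_cong_ev[OF refl _ refl, where g="\<lambda>_. 0"]) auto
  then show ?thesis using False by (simp add: node_fun'_def)
qed

lemma node_fun'_continuous: "continuous_on UNIV (node_fun' n i)"
proof -
  have "isCont (node_fun' n i) y" for y
  proof (cases "0 < y")
    case True
    have c\<sigma>: "continuous_on {0<..} \<sigma>" unfolding \<sigma>_def[abs_def] \<tau>_def[abs_def]
      by (intro continuous_intros) auto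
    have cgd: "continuous_on {0<..} gd" unfolding gd_def[abs_def]
      using Gamma_pos by (intro continuous_intros) auto
    have cgd': "continuous_on {0<..} gd'" unfolding gd'_def[abs_def]
      by (intro continuous_intros cgd) auto
    have cv: "continuous_on {0<..} v" unfolding v_def[abs_def] by (intro continuous_intros) auto
    have cb: "continuous_on UNIV bspline"
      by (rule DERIV_continuous_on[where D=bspline']) (auto intro: bspline_deriv has_field_derivative_at_within)
    have "continuous_on {0<..} (\<lambda>y. bspline' (2 ^ n * \<sigma> y - of_int i) * (2 ^ n * (K * v y)) * gd y
     + bspline (2 ^ n * \<sigma> y - of_int i) * gd' y)"
      by (intro continuous_intros c\<sigma> cgd cgd' cv continuous_on_compose2[OF cb] continuous_on_compose2[OF continuous_bspline']) auto
    then have "continuous_on {0<..} (node_fun' n i)"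
      by (rule continuous_on_eq) (simp add: node_fun'_def)
    then show ?thesis using True by (simp add: continuous_on_eq_continuous_at)
  next
    case False
    then have y: "y < pt n (of_int i)" using pt_pos[of n "of_int i"] by simp
    have "eventually (\<lambda>y. node_fun' n i y = 0) (nhds y)"
      using y by (auto intro!: eventually_mono[OF eventually_nhds_in_open[of "{..<pt n (of_int i)}" y]]
        dest: node_fun_left)
    then show ?thesis by (subst isCont_cong[where g="\<lambda>_. 0"]) auto
  qed
  then show ?thesis by (simp add: continuous_at_imp_continuous_on)
qed

text \<open>Across a node the density varies by a factor exp beta and \<open>v\<close> by a factor
  e. Differentiating the spline costs 2^n K v, differentiating the density beta v, which is at most
  beta times the former.\<close>

lemma node_fun_bounds:
  assumes x: "0 < x" "0 < h n i x"
  shows "\<bar>h n i y * gd y\<bar> \<le> exp \<beta> * gd x"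
    and "\<bar>node_fun' n i y\<bar> \<le> (1 + \<beta>) * exp (\<beta> + 1) * (2 ^ n * K * v x) * gd x"
proof -
  have "\<bar>h n i y * gd y\<bar> \<le> exp \<beta> * gd x \<and>
    \<bar>node_fun' n i y\<bar> \<le> (1 + \<beta>) * exp (\<beta> + 1) * (2 ^ n * K * v x) * gd x"
  proof (cases "0 < y \<and> 0 < 2 ^ n * \<sigma> y - of_int i \<and> 2 ^ n * \<sigma> y - of_int i < 3")
    case True
    then have y: "0 < y" by simp
    have "0 < 2 ^ n * \<sigma> x - of_int i" "2 ^ n * \<sigma> x - of_int i < 3"
      using x by (simp_all add: h_def bspline_pos_iff)
    then have "\<bar>\<tau> x - of_int i / (2 ^ n * K)\<bar> \<le> 1 / 5" by (intro tau_near x) linarith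
    moreover have "\<bar>\<tau> y - of_int i / (2 ^ n * K)\<bar> \<le> 1 / 5" using True by (intro tau_near y) linarith
    ultimately have "\<bar>\<tau> x - \<tau> y\<bar> \<le> 1" by linarith
    note c = compare[OF x(1) y this]
    have g: "gd y \<le> exp \<beta> * gd x" and vv: "v y \<le> exp 1 * v x" using c by simp_all
    note p = gd_nonneg[of y] v_pos[OF y] K_pos gd_nonneg[of x] v_pos[OF x(1)]
    have 1: "\<bar>h n i y * gd y\<bar> \<le> exp \<beta> * gd x"
    proof -
      have "\<bar>h n i y * gd y\<bar> \<le> 1 * gd y" using h_nonneg[of n i y] h_le_1[of n i y] p
        by (simp add: abs_mult mult_left_le_one_le)
      with g show ?thesis by simp
    qed
    let ?N = "2 ^ n * K"
    have N: "1 \<le> ?N" using K_ge mult_mono[of 1 "2 ^ n" 1 K] by simp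
    have "\<bar>node_fun' n i y\<bar> \<le> \<bar>bspline' (2 ^ n * \<sigma> y - of_int i)\<bar> * (?N * v y * gd y)
        + \<bar>bspline (2 ^ n * \<sigma> y - of_int i)\<bar> * \<bar>gd' y\<bar>"
      using y p by (auto simp: node_fun'_def abs_mult mult_ac intro!: order_trans[OF abs_triangle_ineq])
    also have "\<dots> \<le> 1 * (?N * v y * gd y) + 1 * (\<beta> * gd y * v y)"
      using bspline'_bound bspline_nonneg bspline_le_1 gd_deriv_le[OF y] p beta N
      by (intro add_mono mult_mono) (auto simp: gd'_def)
    also have "\<dots> \<le> ?N * v y * gd y + \<beta> * (?N * v y * gd y)"
    proof -
      have "1 * (v y * gd y) \<le> ?N * (v y * gd y)" using N p by (intro mult_right_mono) auto
      then have "\<beta> * (v y * gd y) \<le> \<beta> * (?N * v y * gd y)" using beta by (intro mult_left_mono) (auto simp: mult.assoc)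
      then show ?thesis by (simp add: mult_ac)
    qed
    also have "\<dots> = (1 + \<beta>) * ?N * (v y * gd y)" by (simp add: algebra_simps)
    also have "\<dots> \<le> (1 + \<beta>) * ?N * ((exp 1 * v x) * (exp \<beta> * gd x))"
      using g vv p beta N by (intro mult_left_mono mult_mono) auto
    also have "\<dots> = (1 + \<beta>) * exp (\<beta> + 1) * (2 ^ n * K * v x) * gd x" by (simp add: exp_add mult_ac)
    finally show ?thesis using 1 by blast
  next
    case False
    then have "h n i y * gd y = 0 \<and> node_fun' n i y = 0"
      by (auto simp: h_def node_fun'_def bspline_outside bspline'_outside not_less)
    then have z: "h n i y * gd y = 0" "node_fun' n i y = 0" by blast+
    show ?thesis unfolding z using gd_nonneg[of x] v_pos[OF x(1)] beta K_pos by simp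
  qed
  then show "\<bar>h n i y * gd y\<bar> \<le> exp \<beta> * gd x"
    and "\<bar>node_fun' n i y\<bar> \<le> (1 + \<beta>) * exp (\<beta> + 1) * (2 ^ n * K * v x) * gd x" by blast+
qed

definition Cm :: real where "Cm = 200 * (1 + \<beta>) * exp (\<beta> + 1) * c0"

lemma Cm_pos: "0 < Cm" using beta c0_ge by (simp add: Cm_def)

text \<open>The unnormalised average is, up to the factor \<open>\<kappa>\<close>, the convolution
  of \<open>f\<close> at \<open>x\<close> with \<open>dilate t \<phi>\<close> for a suitable test
  function: the profile \<open>\<psi>\<close> is read off from h times the density, centred at
  \<open>x\<close>.\<close>

theorem av_le_local_maximal:
  assumes f: "f \<in> borel_measurable \<gamma>" and x: "0 < x" "0 < h n i x"
  shows "ennreal (norm (av f n i)) \<le> ennreal Cm * local_maximal a f x"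
proof -
  let ?T = "2 ^ n * K * v x"
  define B where "B = (1 + \<beta>) * exp (\<beta> + 1)"
  \<comment> \<open>A node has length at most 9 / \<open>?T\<close>, so at scale 10 /
    \<open>?T\<close> the profile is supported in [-9/10, 9/10], compactly inside (-1,1).\<close>
  define t where "t = 10 / ?T"
  \<comment> \<open>The derivative decides: that of the profile is at most \<open>\<kappa>\<close>
    t^2 B \<open>?T\<close> gd x, and this choice makes the bound equal to 1.\<close>
  define \<kappa> where "\<kappa> = 1 / (t * (10 * B * gd x))"
  note p = v_pos[OF x(1)] gd_pos[OF x(1)] K_pos
  have T: "0 < ?T" using p by simp
  have B: "1 \<le> B" "exp \<beta> \<le> B"
  proof -
    have "1 * exp \<beta> \<le> (1 + \<beta>) * exp (\<beta> + 1)" using beta by (intro mult_mono) auto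
    then show "exp \<beta> \<le> B" by (simp add: B_def)
    moreover have "1 \<le> exp \<beta>" using beta by simp
    ultimately show "1 \<le> B" by linarith
  qed
  have t: "0 < t" using T by (simp add: t_def)
  have \<kappa>: "0 < \<kappa>" using t B p by (simp add: \<kappa>_def)
  define \<psi> where "\<psi> z = \<kappa> * t * (h n i (x - t * z) * gd (x - t * z))" for z
  define \<psi>' where "\<psi>' z = - (\<kappa> * t * t * node_fun' n i (x - t * z))" for z
  let ?\<phi> = "\<lambda>z. complex_of_real (\<psi> z)"
  have d: "(\<psi> has_real_derivative \<psi>' z) (at z)" for z
  proof -
    have "((\<lambda>z. x - t * z) has_real_derivative - t) (at z)" by (auto intro!: derivative_eq_intros)
    from DERIV_cmult[OF DERIV_chain2[OF node_fun_deriv this], of "\<kappa> * t"]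
    show ?thesis unfolding \<psi>_def[abs_def] \<psi>'_def by (simp add: mult_ac)
  qed
  have vd: "(?\<phi> has_vector_derivative of_real (\<psi>' z)) (at z)" for z
    using d[of z] by (intro has_vector_derivative_of_real) (simp add: has_real_derivative_iff_has_vector_derivative)
  have "?\<phi> \<in> test_functions"
    unfolding test_functions_def
  proof (intro CollectI conjI allI)
    have "continuous_on UNIV \<psi>'"
      unfolding \<psi>'_def[abs_def]
      by (intro continuous_intros continuous_on_compose2[OF node_fun'_continuous]) auto
    then show "?\<phi> C1_differentiable_on UNIV"
      unfolding C1_differentiable_on_def using vd
      by (intro exI[of _ "\<lambda>z. of_real (\<psi>' z)"]) (auto intro!: continuous_intros)
    show "closure (support_on UNIV ?\<phi>) \<subseteq> {-1<..<1}"
    proof -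
      have "support_on UNIV ?\<phi> \<subseteq> {- (9 / 10)..9 / 10}"
      proof
        fix z assume "z \<in> support_on UNIV ?\<phi>"
        then have "h n i (x - t * z) \<noteq> 0" by (auto simp: support_on_def \<psi>_def)
        then have "x - t * z \<in> {pt n (of_int i)<..<pt n (of_int i + 3)}" by (simp add: h_zero_iff)
        moreover have "x \<in> {pt n (of_int i)<..<pt n (of_int i + 3)}" using x(2) h_pos_iff by blast
        ultimately have "\<bar>t * z\<bar> \<le> pt n (of_int i + 3) - pt n (of_int i)" by auto
        also have "\<dots> \<le> exp 1 * ((of_int i + 3) - of_int i) / (2 ^ n * K * v x)"
          using x by (intro pt_interval_mass(3)) (auto simp: h_def bspline_pos_iff)
        also have "\<dots> \<le> 9 / ?T" using T exp_le by (intro divide_right_mono) auto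
        also have "\<dots> = t * (9 / 10)" by (simp add: t_def)
        finally have "\<bar>z\<bar> \<le> 9 / 10" using t by (simp add: abs_mult)
        then show "z \<in> {- (9 / 10)..9 / 10}" by auto
      qed
      then have "closure (support_on UNIV ?\<phi>) \<subseteq> {- (9 / 10)..9 / 10}"
        by (rule closure_minimal) simp
      then show ?thesis by auto
    qed
    fix z
    have kt: "\<kappa> * t = 1 / (10 * B * gd x)" using t by (simp add: \<kappa>_def)
    have "\<bar>\<psi> z\<bar> \<le> \<kappa> * t * (B * gd x)"
    proof -
      have "\<bar>h n i (x - t * z) * gd (x - t * z)\<bar> \<le> B * gd x"
        using node_fun_bounds(1)[OF x] B p by (meson mult_right_mono order_trans less_imp_le)
      then show ?thesis unfolding \<psi>_def using \<kappa> t by (simp add: abs_mult del: mult_le_cancel_left_pos)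
    qed
    also have "\<dots> \<le> 1" unfolding kt using B p by simp
    finally show "norm (?\<phi> z) \<le> 1" by simp
    have "\<bar>\<psi>' z\<bar> \<le> \<kappa> * t * t * (B * ?T * gd x)"
      unfolding \<psi>'_def using \<kappa> t node_fun_bounds(2)[OF x, of "x - t * z"]
      by (simp add: abs_mult B_def del: mult_le_cancel_left_pos)
    also have "\<dots> = 1" unfolding kt using B p T by (simp add: t_def)
    finally show "norm (vector_derivative ?\<phi> (at z)) \<le> 1"
      using vector_derivative_at[OF vd[of z]] by simp
  qed
  moreover have "t < a * w_fun x"
  proof -
    have "t \<le> 10 / (K * v x)"
      unfolding t_def using p by (intro divide_left_mono) (auto simp: mult_le_cancel_right1)
    also have "\<dots> = a / (10 * v x)" using a_pos by (simp add: K_def)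
    also have "\<dots> < a * (1 / (8 * v x))" using p a_pos by (simp add: field_simps)
    also have "\<dots> \<le> a * w_fun x" using w_bounds(1)[OF x(1)] a_pos by (intro mult_left_mono) auto
    finally show ?thesis .
  qed
  ultimately have sup: "ennreal (norm (fun_conv (dilate t ?\<phi>) f x)) \<le> local_maximal a f x"
    unfolding local_maximal_def using t by (intro Sup_upper) blast
  have "fun_conv (dilate t ?\<phi>) f x = (\<integral>y. of_real \<kappa> * (indicator {0<..} y *\<^sub>R (gd y *\<^sub>R (of_real (h n i y) * f y))) \<partial>lborel)"
    unfolding fun_conv_def
    by (intro Bochner_Integration.integral_cong refl)
       (use t in \<open>auto simp: dilate_def \<psi>_def indicator_def h_def scaleR_conv_of_real\<close>)
  also have "\<dots> = of_real \<kappa> * (\<integral>y. of_real (h n i y) * f y \<partial>\<gamma>)"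
  proof -
    have "(\<lambda>y. of_real (h n i y) * f y) \<in> borel_measurable \<gamma>" using f h_measurable_gamma by simp
    then show ?thesis
      unfolding integral_gamma(1)[OF \<open>(\<lambda>y. of_real (h n i y) * f y) \<in> borel_measurable \<gamma>\<close>]
      by (intro integral_mult_right_zero)
  qed
  also have "\<dots> = of_real \<kappa> * (av f n i * of_real (\<integral>x. h n i x \<partial>\<gamma>))"
    using mass_pos[of n i] by (simp add: av_def)
  finally have "norm (fun_conv (dilate t ?\<phi>) f x) = \<kappa> * (\<integral>x. h n i x \<partial>\<gamma>) * norm (av f n i)"
    using \<kappa> mass_pos[of n i] by (simp add: norm_mult)
  moreover have "1 \<le> Cm * (\<kappa> * (\<integral>x. h n i x \<partial>\<gamma>))"
  proof -
    have "\<rho> n x \<le> 2 * c0 * (\<integral>x. h n i x \<partial>\<gamma>)"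
      using x by (intro mass_lower) (auto simp: h_def bspline_pos_iff)
    then have le: "100 * B * \<rho> n x \<le> 100 * B * (2 * c0 * (\<integral>x. h n i x \<partial>\<gamma>))"
      using B by (intro mult_left_mono) auto
    \<comment> \<open>Here t gd x is ten times the cell mass \<open>\<rho>\<close>, and
      \<open>\<rho>\<close> is at most 2 c0 times the mass of the node; hence the 200 in
      \<open>Cm\<close>.\<close>
    have "t * (10 * B * gd x) = 10 * B * (t * gd x)" by simp
    also have "t * gd x = 10 * \<rho> n x" by (simp add: t_def \<rho>_def)
    also have "10 * B * (10 * \<rho> n x) \<le> Cm * (\<integral>x. h n i x \<partial>\<gamma>)"
    proof -
      have "Cm = 200 * B * c0" by (simp add: Cm_def B_def)
      then show ?thesis using le by simp
    qed
    finally have "1 \<le> Cm * (\<integral>x. h n i x \<partial>\<gamma>) / (t * (10 * B * gd x))"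
      using t B p by (subst pos_le_divide_eq) auto
    then show ?thesis by (simp add: \<kappa>_def)
  qed
  ultimately have "norm (av f n i) \<le> Cm * norm (fun_conv (dilate t ?\<phi>) f x)"
    using mult_right_mono[of 1 "Cm * (\<kappa> * (\<integral>x. h n i x \<partial>\<gamma>))" "norm (av f n i)"] by (simp add: mult_ac)
  then have "ennreal (norm (av f n i)) \<le> ennreal Cm * ennreal (norm (fun_conv (dilate t ?\<phi>) f x))"
    using Cm_pos by (simp add: ennreal_mult[symmetric] ennreal_leI)
  also have "\<dots> \<le> ennreal Cm * local_maximal a f x" using sup by (rule mult_left_mono) simp
  finally show ?thesis .
qed

end

section \<open>The functional E and the coarse scale\<close>

context gamma_grid begin

text \<open>On a compact interval in the open half-line the density has a positive minimum, and
  division by it passes to Lebesgue measure.\<close>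

lemma locally_integrable:
  fixes f :: "real \<Rightarrow> complex"
  assumes f: "integrable \<gamma> f" and l: "0 < l"
  shows "integrable lborel (\<lambda>y. indicator {l..u} y *\<^sub>R f y)"
proof (cases "l \<le> u")
  case True
  have fm: "f \<in> borel_measurable \<gamma>" using f by auto
  have cgd: "continuous_on {l..u} gd" unfolding gd_def[abs_def]
    using Gamma_pos l by (intro continuous_intros) auto
  obtain z where z: "z \<in> {l..u}" "\<And>y. y \<in> {l..u} \<Longrightarrow> gd z \<le> gd y"
    using continuous_attains_inf[OF compact_Icc _ cgd] True by auto
  have gz: "0 < gd z" using z l by (auto intro: gd_pos)
  have m: "(\<lambda>y. indicator {0<..} y *\<^sub>R f y) \<in> borel_measurable borel"
    using fm measurable_gamma_indicator by blast
  have eq: "(\<lambda>y. indicator {l..u} y *\<^sub>R f y) = (\<lambda>y. indicator {l..u} y *\<^sub>R (indicator {0<..} y *\<^sub>R f y))"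
    using l by (auto simp: fun_eq_iff indicator_def)
  show ?thesis
  proof (rule Bochner_Integration.integrable_bound[OF integrable_mult_right[OF integral_gamma(2)[OF fm, THEN iffD1, OF f]]])
    show "(\<lambda>y. indicator {l..u} y *\<^sub>R f y) \<in> borel_measurable lborel"
      unfolding eq using m by measurable
    show "AE y in lborel. norm (indicator {l..u} y *\<^sub>R f y) \<le>
       norm (of_real (1 / gd z) * (indicator {0<..} y *\<^sub>R (gd y *\<^sub>R f y)))"
    proof (rule AE_I2)
      fix y
      show "norm (indicator {l..u} y *\<^sub>R f y) \<le>
       norm (of_real (1 / gd z) * (indicator {0<..} y *\<^sub>R (gd y *\<^sub>R f y)))"
      proof (cases "y \<in> {l..u}")
        case True
        then have "1 \<le> gd y / gd z" using z gz by simp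
        from mult_right_mono[OF this, of "norm (f y)"] True gz l gd_nonneg[of y] show ?thesis
          by (simp add: norm_mult norm_divide)
      qed simp
    qed
  qed
qed simp

lemma w_fun_continuous: "continuous_on {0<..} w_fun"
  unfolding w_fun_def[abs_def] by (intro continuous_intros) auto

text \<open>Near \<open>x0\<close> the bump sees only values of \<open>f\<close> on a compact part
  of the open half-line, where \<open>f\<close> is Lebesgue integrable.\<close>

lemma fun_conv_continuous:
  assumes f: "integrable \<gamma> f" and \<phi>: "\<phi> \<in> test_functions" and t: "0 < t" and x0: "t < x0"
  shows "isCont (fun_conv (dilate t \<phi>) f) x0"
proof -
  define c where "c = (x0 - t) / 2"
  have c: "0 < c" using x0 by (simp add: c_def)
  let ?F = "\<lambda>y. indicator {c..x0 + c + t} y *\<^sub>R f y"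
  have cd: "continuous_on UNIV (dilate t \<phi>)"
    unfolding dilate_def[abs_def] using t
    by (intro continuous_intros continuous_on_compose2[OF test_functionD(1)[OF \<phi>]]) auto
  have bd: "norm (dilate t \<phi> z) \<le> 1 / t" for z
    using t test_functionD(2)[OF \<phi>, of "z / t"] by (simp add: dilate_def norm_mult norm_divide divide_right_mono)
  have "isCont (\<lambda>x. \<integral>y. dilate t \<phi> (x - y) * ?F y \<partial>lborel) x0"
    by (rule isCont_convolution[OF cd bd locally_integrable[OF f c]])
  moreover have "eventually (\<lambda>x. fun_conv (dilate t \<phi>) f x = (\<integral>y. dilate t \<phi> (x - y) * ?F y \<partial>lborel)) (nhds x0)"
  proof -
    have "fun_conv (dilate t \<phi>) f x = (\<integral>y. dilate t \<phi> (x - y) * ?F y \<partial>lborel)" if x: "x \<in> {x0 - c<..<x0 + c}" for x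
      unfolding fun_conv_def
    proof (intro Bochner_Integration.integral_cong refl)
      fix y
      show "dilate t \<phi> (x - y) * f y = dilate t \<phi> (x - y) * ?F y"
      proof (cases "\<bar>x - y\<bar> < t")
        case True
        then have "y \<in> {c..x0 + c + t}" using x by (auto simp: c_def field_simps)
        then show ?thesis by simp
      next
        case False
        then have "1 \<le> \<bar>(x - y) / t\<bar>" using t by (simp add: abs_divide)
        then show ?thesis using test_functionD(3)[OF \<phi>] by (simp add: dilate_def)
      qed
    qed
    then show ?thesis
      using c by (auto intro!: eventually_mono[OF eventually_nhds_in_open[of "{x0 - c<..<x0 + c}" x0]])
  qed
  ultimately show ?thesis by (subst isCont_cong)
qed

text \<open>Convolutions at fixed scale and \<open>w_fun\<close> are continuous, so a superlevel set
  is a union of open sets, one for each test function and scale; even the uncountable union is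
  open.\<close>

theorem local_maximal_measurable:
  assumes f: "integrable \<gamma> f"
  shows "local_maximal a f \<in> borel_measurable \<gamma>"
proof (rule borel_measurableI_greater)
  fix s :: ennreal
  let ?U = "\<lambda>t. {x. 0 < x \<and> t < a * w_fun x}"
  have sub: "t < x" if "x \<in> ?U t" "0 < t" for x t
  proof -
    have "a * w_fun x \<le> 1 * w_fun x" using a_le_1 w_bounds(4)[of x] that by (intro mult_right_mono) auto
    also have "\<dots> \<le> x" using w_bounds(3)[of x] that by simp
    finally show ?thesis using that by simp
  qed
  have U: "open (?U t)" for t
  proof -
    have "open ({0<..} \<inter> (\<lambda>x. a * w_fun x) -` {t<..})"
      by (intro continuous_open_preimage continuous_intros w_fun_continuous)
    also have "{0<..} \<inter> (\<lambda>x. a * w_fun x) -` {t<..} = ?U t" by auto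
    finally show ?thesis .
  qed
  have O: "open (?U t \<inter> fun_conv (dilate t \<phi>) f -` {z. s < ennreal (norm z)})"
    if "\<phi> \<in> test_functions" "0 < t" for \<phi> t
  proof (rule continuous_open_preimage)
    show "continuous_on (?U t) (fun_conv (dilate t \<phi>) f)"
      using fun_conv_continuous[OF f that] sub[OF _ that(2)]
      by (intro continuous_at_imp_continuous_on ballI) blast
    show "open {z::complex. s < ennreal (norm z)}"
      by (intro open_Collect_less continuous_on_ennreal continuous_intros)
  qed (rule U)
  have "{x \<in> space \<gamma>. s < local_maximal a f x} =
     (\<Union>\<phi>\<in>test_functions. \<Union>t\<in>{0<..}. ?U t \<inter> fun_conv (dilate t \<phi>) f -` {z. s < ennreal (norm z)})"
  proof (intro set_eqI iffI)
    fix x assume "x \<in> {x \<in> space \<gamma>. s < local_maximal a f x}"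
    then obtain \<phi> t where "0 < x" "\<phi> \<in> test_functions" "0 < t" "t < a * w_fun x"
      "s < ennreal (norm (fun_conv (dilate t \<phi>) f x))"
      by (auto simp: local_maximal_def less_Sup_iff)
    then show "x \<in> (\<Union>\<phi>\<in>test_functions. \<Union>t\<in>{0<..}. ?U t \<inter> fun_conv (dilate t \<phi>) f -` {z. s < ennreal (norm z)})"
      by blast
  next
    fix x assume "x \<in> (\<Union>\<phi>\<in>test_functions. \<Union>t\<in>{0<..}. ?U t \<inter> fun_conv (dilate t \<phi>) f -` {z. s < ennreal (norm z)})"
    then obtain \<phi> t where "0 < x" "\<phi> \<in> test_functions" "0 < t" "t < a * w_fun x"
      "s < ennreal (norm (fun_conv (dilate t \<phi>) f x))" by auto
    then show "x \<in> {x \<in> space \<gamma>. s < local_maximal a f x}"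
      unfolding local_maximal_def less_Sup_iff mem_Collect_eq by auto
  qed
  moreover have "open \<dots>" using O by (intro open_UN ballI) auto
  ultimately have "{x \<in> space \<gamma>. s < local_maximal a f x} \<in> sets borel" by simp
  then show "{x \<in> space \<gamma>. s < local_maximal a f x} \<in> sets \<gamma>" by (auto simp: sets_gamma_iff)
qed

section \<open>Integrals from 0 and tail integrals in the functional E\<close>

definition Phi :: "(real \<Rightarrow> complex) \<Rightarrow> real \<Rightarrow> complex" where
  "Phi f y = (LINT x:{0<..<y}|\<gamma>. f x)"

definition Psi :: "(real \<Rightarrow> complex) \<Rightarrow> real \<Rightarrow> complex" where
  "Psi f y = (LINT x:{y<..}|\<gamma>. f x)"

lemma E_fun_eq: "E_fun \<alpha> f =
     (\<integral>\<^sup>+ y. ennreal (1 / y * norm (Phi f y)) * indicator {0<..<1} y \<partial>lborel) +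
     (\<integral>\<^sup>+ y. ennreal (y * norm (Psi f y)) * indicator {1<..} y \<partial>lborel)"
  by (simp add: E_fun_def Phi_def Psi_def)

lemma id_measurable_gamma: "(\<lambda>x. x) \<in> \<gamma> \<rightarrow>\<^sub>M borel"
  by (rule measurable_gammaI) simp

lemma fst_snd_measurable:
  "fst \<in> borel_measurable (lborel \<Otimes>\<^sub>M \<gamma>)" "snd \<in> borel_measurable (lborel \<Otimes>\<^sub>M \<gamma>)"
proof -
  have "fst \<in> lborel \<Otimes>\<^sub>M \<gamma> \<rightarrow>\<^sub>M lborel" by (rule measurable_fst)
  then show "fst \<in> borel_measurable (lborel \<Otimes>\<^sub>M \<gamma>)" by (simp only: measurable_lborel1)
  show "snd \<in> borel_measurable (lborel \<Otimes>\<^sub>M \<gamma>)"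
    by (rule measurable_compose[OF measurable_snd id_measurable_gamma])
qed

lemma Phi_measurable:
  assumes "integrable \<gamma> f"
  shows "Phi f \<in> borel_measurable borel" "Psi f \<in> borel_measurable borel"
proof -
  note [measurable] = fst_snd_measurable
  have [measurable]: "f \<in> borel_measurable \<gamma>" using assms by auto
  have 1: "(\<lambda>(y, x). indicator {0<..<y} x *\<^sub>R f x) = (\<lambda>p. (if 0 < snd p \<and> snd p < fst p then 1 else 0) *\<^sub>R f (snd p))"
   and 2: "(\<lambda>(y, x). indicator {y<..} x *\<^sub>R f x) = (\<lambda>p. (if fst p < snd p then 1 else 0) *\<^sub>R f (snd p))"
    by (auto simp: fun_eq_iff)
  have "(\<lambda>(y, x). indicator {0<..<y} x *\<^sub>R f x) \<in> borel_measurable (lborel \<Otimes>\<^sub>M \<gamma>)"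
    unfolding 1 by measurable
  from borel_measurable_lebesgue_integral[OF this]
  show "Phi f \<in> borel_measurable borel" by (simp add: Phi_def[abs_def] set_lebesgue_integral_def)
  have "(\<lambda>(y, x). indicator {y<..} x *\<^sub>R f x) \<in> borel_measurable (lborel \<Otimes>\<^sub>M \<gamma>)"
    unfolding 2 by measurable
  from borel_measurable_lebesgue_integral[OF this]
  show "Psi f \<in> borel_measurable borel" by (simp add: Psi_def[abs_def] set_lebesgue_integral_def)
qed

lemma set_integrable_gamma:
  fixes f :: "real \<Rightarrow> complex"
  assumes "integrable \<gamma> f"
  shows "set_integrable \<gamma> {0<..<y} f" "set_integrable \<gamma> ({y<..} \<inter> {0<..}) f" "set_integrable \<gamma> {y<..} f"
proof -
  have s: "{0<..<y} \<in> sets \<gamma>" "{y<..} \<inter> {0<..} \<in> sets \<gamma>" by (auto simp: sets_gamma_iff)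
  show "set_integrable \<gamma> {0<..<y} f" "set_integrable \<gamma> ({y<..} \<inter> {0<..}) f"
    using s assms by (auto simp: set_integrable_def intro!: integrable_mult_indicator)
  then show "set_integrable \<gamma> {y<..} f"
    unfolding set_integrable_def
    by (subst Bochner_Integration.integrable_cong[OF refl, of _ _ "\<lambda>x. indicator ({y<..} \<inter> {0<..}) x *\<^sub>R f x"])
       (auto simp: indicator_def)
qed

lemma Phi_diff_const:
  assumes f: "integrable \<gamma> f"
  shows "Phi (\<lambda>x. f x - c) y = Phi f y - c * Phi (\<lambda>_. 1) y"
    and "Psi (\<lambda>x. f x - c) y = Psi f y - c * Psi (\<lambda>_. 1) y"
proof -
  have i: "integrable \<gamma> (\<lambda>_. c)" "integrable \<gamma> (\<lambda>_. 1::complex)" by auto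
  note s = set_integrable_gamma[OF f, of y] set_integrable_gamma[OF i(1), of y]
  have eq: "(LINT x:S|\<gamma>. c) = c * (LINT x:S|\<gamma>. 1)" for S
    by (simp add: set_lebesgue_integral_def scaleR_conv_of_real mult.commute)
  show "Phi (\<lambda>x. f x - c) y = Phi f y - c * Phi (\<lambda>_. 1) y"
    unfolding Phi_def by (subst set_integral_diff(2)[OF s(1) s(4)]) (simp add: eq)
  show "Psi (\<lambda>x. f x - c) y = Psi f y - c * Psi (\<lambda>_. 1) y"
    unfolding Psi_def by (subst set_integral_diff(2)[OF s(3) s(6)]) (simp add: eq)
qed

text \<open>Prepares the subtraction of the mean of \<open>f\<close> in
  \<open>atomic_decomposition\<close>.\<close>

lemma E_fun_diff_const:
  assumes f: "integrable \<gamma> f"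
  shows "E_fun \<alpha> (\<lambda>x. f x - c) \<le> E_fun \<alpha> f + ennreal (norm c) * E_fun \<alpha> (\<lambda>_. 1)"
proof -
  have i: "integrable \<gamma> (\<lambda>_. 1::complex)" by auto
  note [measurable] = Phi_measurable[OF f] Phi_measurable[OF i]
  have *: "ennreal (r * norm (A - c * B)) * I \<le> ennreal (r * norm A) * I + ennreal (norm c) * (ennreal (r * norm B) * I)"
    if "0 \<le> r" for r A B I
  proof -
    have "r * norm (A - c * B) \<le> r * norm A + norm c * (r * norm B)"
      using mult_left_mono[OF norm_triangle_ineq4[of A "c * B"] that] by (simp add: norm_mult algebra_simps)
    then have "ennreal (r * norm (A - c * B)) \<le> ennreal (r * norm A + norm c * (r * norm B))"
      by (rule ennreal_leI)
    also have "\<dots> = ennreal (r * norm A) + ennreal (norm c) * ennreal (r * norm B)"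
      using that by (simp add: ennreal_mult)
    finally have "ennreal (r * norm (A - c * B)) * I \<le> (ennreal (r * norm A) + ennreal (norm c) * ennreal (r * norm B)) * I"
      by (rule mult_right_mono) simp
    then show ?thesis by (simp add: distrib_right mult.assoc)
  qed
  have 1: "(\<integral>\<^sup>+ y. ennreal (1 / y * norm (Phi (\<lambda>x. f x - c) y)) * indicator {0<..<1} y \<partial>lborel) \<le>
     (\<integral>\<^sup>+ y. ennreal (1 / y * norm (Phi f y)) * indicator {0<..<1} y \<partial>lborel) +
     ennreal (norm c) * (\<integral>\<^sup>+ y. ennreal (1 / y * norm (Phi (\<lambda>_. 1) y)) * indicator {0<..<1} y \<partial>lborel)"
    unfolding Phi_diff_const[OF f]
    by (subst nn_integral_cmult[symmetric], measurable, subst nn_integral_add[symmetric], measurable)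
       (intro nn_integral_mono, rename_tac y, case_tac "0 < y", rule *, auto)
  have 2: "(\<integral>\<^sup>+ y. ennreal (y * norm (Psi (\<lambda>x. f x - c) y)) * indicator {1<..} y \<partial>lborel) \<le>
     (\<integral>\<^sup>+ y. ennreal (y * norm (Psi f y)) * indicator {1<..} y \<partial>lborel) +
     ennreal (norm c) * (\<integral>\<^sup>+ y. ennreal (y * norm (Psi (\<lambda>_. 1) y)) * indicator {1<..} y \<partial>lborel)"
    unfolding Phi_diff_const[OF f]
    by (subst nn_integral_cmult[symmetric], measurable, subst nn_integral_add[symmetric], measurable)
       (intro nn_integral_mono, rename_tac y, case_tac "0 < y", rule *, auto)
  show ?thesis
    unfolding E_fun_eq using add_mono[OF 1 2] by (simp add: distrib_left add_ac)
qed

text \<open>The density is bounded, so \<open>Phi\<close> of 1 is at most linear near 0; the tail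
  decays like exp (-2 y), which absorbs the weight y.\<close>

lemma E_one_finite: "E_fun \<alpha> (\<lambda>_. 1) < \<infinity>"
proof -
  obtain C where C: "C > 0" "\<And>x. 0 < x \<Longrightarrow> gd x \<le> C * exp (- 3 * x)" using gd_exp_bound by blast
  obtain C' where C': "C' > 0" "\<And>y. 0 \<le> y \<Longrightarrow> emeasure \<gamma> {y<..} \<le> ennreal (C' * exp (- 2 * y))"
    using emeasure_tail by blast
  have "Phi (\<lambda>_. 1) y = of_real (measure \<gamma> {0<..<y})" for y
    unfolding Phi_def set_lebesgue_integral_def
    by (simp add: scaleR_conv_of_real Int_absorb2 subset_eq del: of_real_indicator)
  moreover have "measure \<gamma> {0<..<y} \<le> C * y" if "0 < y" for y
  proof -
    have "measure \<gamma> {0<..<y} \<le> (y - 0) * C"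
    proof (rule measure_interval_le)
      fix x assume "0 < x" "x < y"
      have "gd x \<le> C * exp (- 3 * x)" using C \<open>0 < x\<close> by simp
      also have "\<dots> \<le> C * 1" using C \<open>0 < x\<close> by (intro mult_left_mono) auto
      finally show "gd x \<le> C" by simp
    qed (use that in auto)
    then show ?thesis by (simp add: mult.commute)
  qed
  ultimately have P: "1 / y * norm (Phi (\<lambda>_. 1) y) \<le> C" if "0 < y" for y
    using that by (simp add: pos_divide_le_eq)
  have "(\<integral>\<^sup>+ y. ennreal (1 / y * norm (Phi (\<lambda>_. 1) y)) * indicator {0<..<1} y \<partial>lborel) \<le>
      (\<integral>\<^sup>+ y. ennreal C * indicator {0<..<1::real} y \<partial>lborel)"
    by (intro nn_integral_mono) (use P in \<open>auto simp: indicator_def intro!: ennreal_leI\<close>)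
  also have "\<dots> < \<infinity>" by (simp add: nn_integral_cmult_indicator ennreal_mult_less_top)
  finally have 1: "(\<integral>\<^sup>+ y. ennreal (1 / y * norm (Phi (\<lambda>_. 1) y)) * indicator {0<..<1} y \<partial>lborel) < \<infinity>" .
  have Q: "y * norm (Psi (\<lambda>_. 1) y) \<le> C' * exp (- y)" if "1 < y" for y
  proof -
    have "{y<..} \<inter> {0<..} = {y<..}" using that by auto
    then have "Psi (\<lambda>_. 1) y = of_real (measure \<gamma> {y<..})"
      unfolding Psi_def set_lebesgue_integral_def
      using that by (simp add: scaleR_conv_of_real del: of_real_indicator)
    moreover have "measure \<gamma> {y<..} \<le> C' * exp (- 2 * y)"
      using C'(2)[of y] C'(1) that by (simp add: emeasure_eq_measure)
    moreover have "y \<le> exp y" using exp_ge_add_one_self[of y] by linarith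
    ultimately have "y * norm (Psi (\<lambda>_. 1) y) \<le> exp y * (C' * exp (- 2 * y))"
      using that by (intro mult_mono) auto
    also have "\<dots> = C' * exp (y + - 2 * y)" by (simp only: exp_add mult_ac)
    finally show ?thesis by simp
  qed
  have "(\<integral>\<^sup>+ y. ennreal (y * norm (Psi (\<lambda>_. 1) y)) * indicator {1<..} y \<partial>lborel) \<le>
      (\<integral>\<^sup>+ y. ennreal C' * (ennreal (exp (- y)) * indicator {0..} y) \<partial>lborel)"
    using C'(1) by (intro nn_integral_mono)
      (use Q in \<open>auto simp: indicator_def ennreal_mult[symmetric] intro!: ennreal_leI\<close>)
  also have "\<dots> = ennreal C'" by (subst nn_integral_cmult) (auto simp: nn_integral_exp)
  also have "\<dots> < \<infinity>" by simp
  finally show ?thesis unfolding E_fun_eq using 1 by simp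
qed

text \<open>Minus the derivative of \<open>ramp (\<sigma> y - of_int j)\<close> with respect to
  y.\<close>

definition ramp_kernel :: "int \<Rightarrow> real \<Rightarrow> real" where
  "ramp_kernel j y = (if 0 < y then - ramp' (\<sigma> y - of_int j) * (K * v y) else 0)"

lemma v_measurable [measurable]: "v \<in> borel_measurable borel"
  unfolding v_def by measurable

lemma ramp_kernel_measurable [measurable]: "ramp_kernel j \<in> borel_measurable borel"
  unfolding ramp_kernel_def by measurable

lemma ramp_kernel_nonneg: "0 \<le> ramp_kernel j y"
proof -
  have "0 \<le> - ramp' s" for s by (auto simp: ramp'_def max_def)
  from mult_nonneg_nonneg[OF this, of "K * v y" "\<sigma> y - of_int j"] show ?thesis
    using v_pos[of y] K_pos by (cases "0 < y") (auto simp: ramp_kernel_def)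
qed

text \<open>Fundamental theorem of calculus up to a point \<open>b\<close> beyond which the ramp is
  0.\<close>

lemma ramp_kernel_integral:
  assumes x: "0 < x"
  shows "has_bochner_integral lborel (\<lambda>y. indicator {x<..} y * ramp_kernel j y) (ramp (\<sigma> x - of_int j))"
proof -
  define b where "b = max x (pt 0 (of_int j + 3))"
  have b: "x \<le> b" "pt 0 (of_int j + 3) \<le> b" by (auto simp: b_def)
  have big: "3 \<le> \<sigma> y - of_int j" if "b \<le> y" for y
  proof -
    have "0 < y" using that b x by simp
    then have "\<not> 2 ^ 0 * \<sigma> y < of_int j + 3" using less_pt[of y 0 "of_int j + 3"] that b by linarith
    then show ?thesis by simp
  qed
  let ?k = "\<lambda>y. - ramp' (\<sigma> y - of_int j) * (K * v y)"
  have "has_bochner_integral lborel (\<lambda>y. ?k y * indicator {x..b} y)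
     (- ramp (\<sigma> b - of_int j) - - ramp (\<sigma> x - of_int j))"
  proof (rule has_bochner_integral_FTC_Icc_real[OF b(1)])
    fix y assume "x \<le> y" "y \<le> b"
    then have y: "0 < y" using x by simp
    have s: "(\<sigma> has_real_derivative K * v y) (at y)"
      unfolding \<sigma>_def[abs_def] by (rule DERIV_cmult[OF tau_deriv[OF y]])
    have "((\<lambda>y. \<sigma> y - of_int j) has_real_derivative K * v y) (at y)"
      using DERIV_diff[OF s DERIV_const[of "of_int j"]] by simp
    from DERIV_minus[OF DERIV_chain2[OF ramp_deriv this]]
    show "((\<lambda>y. - ramp (\<sigma> y - of_int j)) has_real_derivative ?k y) (at y)" by simp
    have cr: "isCont ramp' z" for z
    proof -
      have "continuous_on UNIV ramp'" unfolding ramp'_def[abs_def] by (intro continuous_intros)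
      then show ?thesis by (simp add: continuous_on_eq_continuous_at)
    qed
    have "isCont v y" unfolding v_def[abs_def] using y by (intro continuous_intros) auto
    moreover have "isCont (\<lambda>y. ramp' (\<sigma> y - of_int j)) y"
      using DERIV_isCont[OF s] by (intro isCont_o2[OF _ cr] continuous_intros)
    ultimately show "isCont ?k y" by (intro continuous_intros)
  qed
  moreover have "ramp (\<sigma> b - of_int j) = 0" using big[of b] by (simp add: ramp_right)
  ultimately have h: "has_bochner_integral lborel (\<lambda>y. ?k y * indicator {x..b} y) (ramp (\<sigma> x - of_int j))"
    by simp
  have "AE y in lborel. y \<noteq> x" by (rule AE_lborel_singleton)
  then have ae: "AE y in lborel. indicator {x<..} y * ramp_kernel j y = ?k y * indicator {x..b} y"
  proof eventually_elim
    case (elim y)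
    show ?case
    proof (cases "b < y")
      case True
      then have "ramp' (\<sigma> y - of_int j) = 0" using big[of y] ramp'_zero by simp
      then show ?thesis by (simp add: ramp_kernel_def)
    qed (use elim x in \<open>auto simp: indicator_def ramp_kernel_def\<close>)
  qed
  show ?thesis
    by (rule has_bochner_integral_cong_AE[THEN iffD2, OF _ _ ae h])
       (auto intro!: borel_measurable_times)
qed

text \<open>The derivative of the ramp vanishes off (1,3), so at most two indices contribute at a
  given point, each at most K v.\<close>

lemma ramp_kernel_sum_le:
  assumes y: "0 < y" and F: "finite F"
  shows "(\<Sum>j\<in>F. ramp_kernel j y) \<le> 2 * K * v y"
proof -
  let ?S = "{\<lfloor>\<sigma> y\<rfloor> - 2, \<lfloor>\<sigma> y\<rfloor> - 1}"
  have z: "ramp_kernel j y = 0" if "j \<notin> ?S" for j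
  proof -
    have "\<sigma> y - of_int j \<le> 1 \<or> 3 \<le> \<sigma> y - of_int j"
    proof (rule ccontr)
      assume "\<not> ?thesis"
      then have "1 < \<sigma> y - of_int j" "\<sigma> y - of_int j < 3" by auto
      then have "\<lfloor>\<sigma> y\<rfloor> - 2 \<le> j" "j \<le> \<lfloor>\<sigma> y\<rfloor> - 1" by linarith+
      with that show False by auto
    qed
    then show ?thesis by (simp add: ramp_kernel_def ramp'_zero)
  qed
  have "(\<Sum>j\<in>F. ramp_kernel j y) \<le> (\<Sum>j\<in>F \<union> ?S. ramp_kernel j y)"
    using F by (intro sum_mono2) (auto simp: ramp_kernel_nonneg)
  also have "\<dots> = (\<Sum>j\<in>?S. ramp_kernel j y)"
    using F z by (intro sum.mono_neutral_right) auto
  also have "\<dots> \<le> (\<Sum>j\<in>?S. K * v y)"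
  proof (rule sum_mono)
    fix j
    have "- ramp' (\<sigma> y - of_int j) \<le> 1" using ramp'_bound[of "\<sigma> y - of_int j"] by linarith
    from mult_right_mono[OF this, of "K * v y"] show "ramp_kernel j y \<le> K * v y"
      using y K_pos v_pos[OF y] by (simp add: ramp_kernel_def)
  qed
  also have "\<dots> = 2 * K * v y" by simp
  finally show ?thesis .
qed

lemma ramp_le: "ramp s \<le> 1"
proof -
  consider "s \<le> 2" | "2 \<le> s" "s \<le> 3" | "3 \<le> s" by linarith
  then show ?thesis
  proof cases
    case 1 then show ?thesis by (simp add: ramp_def sqpos_def)
  next
    case 2
    then have "0 \<le> (s - 2) * (3 - s)" by simp
    then show ?thesis using 2 by (simp add: ramp_def sqpos_def max_def power2_eq_square algebra_simps)
  qed (simp add: ramp_right)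
qed

text \<open>Integration by parts, carried out as Fubini after writing the ramp as the integral of
  its kernel over (x, infinity).\<close>

lemma ramp_moment:
  assumes f: "integrable \<gamma> f"
  shows "(\<integral>x. f x * of_real (ramp (\<sigma> x - of_int j)) \<partial>\<gamma>) = (\<integral>y. of_real (ramp_kernel j y) * Phi f y \<partial>lborel)"
proof -
  interpret P: pair_sigma_finite \<gamma> lborel ..
  note [measurable] = fst_snd_measurable
  have fm [measurable]: "f \<in> borel_measurable \<gamma>" using f by auto
  let ?F = "\<lambda>x y. f x * of_real (indicator {x<..} y * ramp_kernel j y)"
  have m: "case_prod ?F \<in> borel_measurable (\<gamma> \<Otimes>\<^sub>M lborel)"
  proof -
    have [measurable]: "fst \<in> borel_measurable (\<gamma> \<Otimes>\<^sub>M lborel)" "snd \<in> borel_measurable (\<gamma> \<Otimes>\<^sub>M lborel)"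
      using measurable_compose[OF measurable_fst id_measurable_gamma, of lborel]
        measurable_compose[OF measurable_snd, of "\<lambda>x. x" lborel borel \<gamma>] by auto
    have eq: "case_prod ?F = (\<lambda>p. f (fst p) * of_real ((if fst p < snd p then 1 else 0) * ramp_kernel j (snd p)))"
      by (auto simp: fun_eq_iff)
    show ?thesis unfolding eq by measurable
  qed
  have n: "(\<integral>\<^sup>+y. ennreal (norm (?F x y)) \<partial>lborel) = ennreal (norm (f x)) * ennreal (ramp (\<sigma> x - of_int j))"
    if "0 < x" for x
  proof -
    note h = ramp_kernel_integral[OF that, of j]
    have "(\<integral>\<^sup>+y. ennreal (norm (?F x y)) \<partial>lborel) =
       (\<integral>\<^sup>+y. ennreal (norm (f x)) * ennreal (indicator {x<..} y * ramp_kernel j y) \<partial>lborel)"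
      by (intro nn_integral_cong) (auto simp: norm_mult ramp_kernel_nonneg ennreal_mult simp del: of_real_mult)
    also have "\<dots> = ennreal (norm (f x)) * (\<integral>\<^sup>+y. ennreal (indicator {x<..} y * ramp_kernel j y) \<partial>lborel)"
      by (rule nn_integral_cmult) measurable
    also have "(\<integral>\<^sup>+y. ennreal (indicator {x<..} y * ramp_kernel j y) \<partial>lborel) = ennreal (ramp (\<sigma> x - of_int j))"
      using h by (subst nn_integral_eq_integral)
        (auto simp: ramp_kernel_nonneg has_bochner_integral_iff)
    finally show ?thesis .
  qed
  have "integrable (\<gamma> \<Otimes>\<^sub>M lborel) (case_prod ?F)"
  proof (rule integrableI_bounded[OF m])
    have "(\<integral>\<^sup>+p. ennreal (norm (case_prod ?F p)) \<partial>(\<gamma> \<Otimes>\<^sub>M lborel)) = (\<integral>\<^sup>+x. \<integral>\<^sup>+y. ennreal (norm (?F x y)) \<partial>lborel \<partial>\<gamma>)"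
      using m by (subst lborel.nn_integral_fst[symmetric]) auto
    also have "\<dots> \<le> (\<integral>\<^sup>+x. ennreal (norm (f x)) \<partial>\<gamma>)"
    proof (rule nn_integral_mono)
      fix x assume "x \<in> space \<gamma>"
      then have "(\<integral>\<^sup>+y. ennreal (norm (?F x y)) \<partial>lborel) = ennreal (norm (f x)) * ennreal (ramp (\<sigma> x - of_int j))"
        by (intro n) simp
      also have "\<dots> \<le> ennreal (norm (f x)) * ennreal 1"
        by (intro mult_left_mono ennreal_leI ramp_le) simp
      finally show "(\<integral>\<^sup>+y. ennreal (norm (?F x y)) \<partial>lborel) \<le> ennreal (norm (f x))" by simp
    qed
    also have "\<dots> < \<infinity>" using f by (simp add: integrable_iff_bounded)
    finally show "(\<integral>\<^sup>+p. ennreal (norm (case_prod ?F p)) \<partial>(\<gamma> \<Otimes>\<^sub>M lborel)) < \<infinity>" .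
  qed
  from P.Fubini_integral[OF this]
  have eq: "(\<integral>y. (\<integral>x. ?F x y \<partial>\<gamma>) \<partial>lborel) = (\<integral>x. (\<integral>y. ?F x y \<partial>lborel) \<partial>\<gamma>)" .
  have "(\<integral>x. (\<integral>y. ?F x y \<partial>lborel) \<partial>\<gamma>) = (\<integral>x. f x * of_real (ramp (\<sigma> x - of_int j)) \<partial>\<gamma>)"
  proof (intro Bochner_Integration.integral_cong refl)
    fix x assume "x \<in> space \<gamma>"
    then have "has_bochner_integral lborel (\<lambda>y. indicator {x<..} y * ramp_kernel j y) (ramp (\<sigma> x - of_int j))"
      by (intro ramp_kernel_integral) simp
    then have "(\<integral>y. indicator {x<..} y * ramp_kernel j y \<partial>lborel) = ramp (\<sigma> x - of_int j)"
      by (simp add: has_bochner_integral_iff)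
    then show "(\<integral>y. ?F x y \<partial>lborel) = f x * of_real (ramp (\<sigma> x - of_int j))"
      by (simp del: of_real_mult)
  qed
  moreover have "(\<integral>y. (\<integral>x. ?F x y \<partial>\<gamma>) \<partial>lborel) = (\<integral>y. of_real (ramp_kernel j y) * Phi f y \<partial>lborel)"
  proof (intro Bochner_Integration.integral_cong refl)
    fix y
    have "(\<integral>x. ?F x y \<partial>\<gamma>) = (\<integral>x. of_real (ramp_kernel j y) * (indicator {0<..<y} x *\<^sub>R f x) \<partial>\<gamma>)"
      by (intro Bochner_Integration.integral_cong refl) (auto simp: indicator_def)
    then show "(\<integral>x. ?F x y \<partial>\<gamma>) = of_real (ramp_kernel j y) * Phi f y"
      unfolding Phi_def set_lebesgue_integral_def by (simp only: integral_mult_right_zero)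
  qed
  ultimately show ?thesis using eq by simp
qed

text \<open>The two integrals add up to the mean, which is 0, since a single point is a null set.
  Beyond 1 this brings in the tail integral that E contains.\<close>

lemma Phi_eq_Psi:
  assumes f: "integrable \<gamma> f" and 0: "(\<integral>x. f x \<partial>\<gamma>) = 0" and y: "0 < y"
  shows "norm (Phi f y) = norm (Psi f y)"
proof -
  have "AE x in lborel. x \<noteq> y" by (rule AE_lborel_singleton)
  then have ae: "AE x in \<gamma>. x \<noteq> y"
    unfolding gamma_measure_eq
    by (subst AE_density) (auto simp: AE_restrict_space_iff intro!: measurable_restrict_space1)
  have "0 = (\<integral>x. f x \<partial>\<gamma>)" using 0 by simp
  also have "\<dots> = (\<integral>x. indicator {0<..<y} x *\<^sub>R f x + indicator {y<..} x *\<^sub>R f x \<partial>\<gamma>)"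
  proof (rule integral_cong_AE)
    show "AE x in \<gamma>. f x = indicator {0<..<y} x *\<^sub>R f x + indicator {y<..} x *\<^sub>R f x"
      using ae AE_space by eventually_elim (auto simp: indicator_def)
  qed (use f set_integrable_gamma[OF f, of y] in \<open>auto simp: set_integrable_def\<close>)
  also have "\<dots> = Phi f y + Psi f y"
    unfolding Phi_def Psi_def set_lebesgue_integral_def
    using set_integrable_gamma[OF f, of y] by (intro Bochner_Integration.integral_add) (auto simp: set_integrable_def)
  finally have "Phi f y = - Psi f y" by (simp add: eq_neg_iff_add_eq_0)
  then show ?thesis by simp
qed

text \<open>The kernels sum to at most 2 K v, and v is at most 2 / y below 1 and at most 2 y above
  1: these are the weights of E.\<close>

theorem ramp_moments_sum:
  assumes f: "integrable \<gamma> f" and 0: "(\<integral>x. f x \<partial>\<gamma>) = 0" and F: "finite F"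
  shows "(\<Sum>j\<in>F. ennreal (norm (\<integral>x. f x * of_real (ramp (\<sigma> x - of_int j)) \<partial>\<gamma>))) \<le> ennreal (4 * K) * E_fun \<alpha> f"
proof -
  note [measurable] = Phi_measurable[OF f]
  have 1: "ennreal (norm (\<integral>x. f x * of_real (ramp (\<sigma> x - of_int j)) \<partial>\<gamma>)) \<le>
      (\<integral>\<^sup>+y. ennreal (ramp_kernel j y) * ennreal (norm (Phi f y)) \<partial>lborel)" for j
  proof (cases "integrable lborel (\<lambda>y. of_real (ramp_kernel j y) * Phi f y)")
    case True
    have "ennreal (norm (\<integral>y. of_real (ramp_kernel j y) * Phi f y \<partial>lborel)) \<le>
      (\<integral>\<^sup>+y. ennreal (norm (of_real (ramp_kernel j y) * Phi f y)) \<partial>lborel)"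
      by (rule integral_norm_bound_ennreal[OF True])
    also have "\<dots> = (\<integral>\<^sup>+y. ennreal (ramp_kernel j y) * ennreal (norm (Phi f y)) \<partial>lborel)"
      by (intro nn_integral_cong) (simp add: norm_mult ramp_kernel_nonneg ennreal_mult)
    finally show ?thesis unfolding ramp_moment[OF f] .
  next
    \<comment> \<open>The Bochner integral of a non-integrable function is 0 by convention.\<close>
    case False then show ?thesis unfolding ramp_moment[OF f] by (simp add: not_integrable_integral_eq)
  qed
  have "(\<Sum>j\<in>F. ennreal (norm (\<integral>x. f x * of_real (ramp (\<sigma> x - of_int j)) \<partial>\<gamma>))) \<le>
      (\<Sum>j\<in>F. \<integral>\<^sup>+y. ennreal (ramp_kernel j y) * ennreal (norm (Phi f y)) \<partial>lborel)"
    by (intro sum_mono 1)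
  also have "\<dots> = (\<integral>\<^sup>+y. (\<Sum>j\<in>F. ennreal (ramp_kernel j y) * ennreal (norm (Phi f y))) \<partial>lborel)"
    by (rule nn_integral_sum[symmetric]) measurable
  also have "\<dots> \<le> (\<integral>\<^sup>+y. ennreal (4 * K) * (ennreal (1 / y * norm (Phi f y)) * indicator {0<..<1} y
       + ennreal (y * norm (Psi f y)) * indicator {1<..} y) \<partial>lborel)"
  proof (rule nn_integral_mono_AE)
    have "AE y in lborel. y \<noteq> (1::real)" by (rule AE_lborel_singleton)
    then show "AE y in lborel. (\<Sum>j\<in>F. ennreal (ramp_kernel j y) * ennreal (norm (Phi f y))) \<le>
      ennreal (4 * K) * (ennreal (1 / y * norm (Phi f y)) * indicator {0<..<1} y
       + ennreal (y * norm (Psi f y)) * indicator {1<..} y)"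
    proof eventually_elim
      case (elim y)
      show ?case
      proof (cases "0 < y")
        case True
        have "(\<Sum>j\<in>F. ennreal (ramp_kernel j y) * ennreal (norm (Phi f y))) = ennreal ((\<Sum>j\<in>F. ramp_kernel j y) * norm (Phi f y))"
          by (simp add: ennreal_mult[symmetric] ramp_kernel_nonneg sum_ennreal sum_distrib_right)
        also have "\<dots> \<le> ennreal (2 * K * v y * norm (Phi f y))"
          by (intro ennreal_leI mult_right_mono ramp_kernel_sum_le True F) simp
        finally have le: "(\<Sum>j\<in>F. ennreal (ramp_kernel j y) * ennreal (norm (Phi f y))) \<le> ennreal (2 * K * v y * norm (Phi f y))" .
        consider "y < 1" | "1 < y" using elim by linarith
        then show ?thesis
        proof cases
          case 1
          then have "y * y \<le> 1" using True by (intro mult_le_one) auto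
          then have "v y \<le> 2 * (1 / y)" using True by (simp add: v_def field_simps)
          from mult_left_mono[OF mult_right_mono[OF this, of "norm (Phi f y)"], of "2 * K"] K_pos
          have "2 * K * v y * norm (Phi f y) \<le> 4 * K * (1 / y * norm (Phi f y))" by (simp add: mult_ac)
          then have "ennreal (2 * K * v y * norm (Phi f y)) \<le> ennreal (4 * K) * ennreal (1 / y * norm (Phi f y))"
            using K_pos True by (subst ennreal_mult[symmetric]) (auto intro!: ennreal_leI)
          with le 1 True show ?thesis by simp
        next
          case 2
          then have "1 \<le> y * y" using mult_mono[of 1 y 1 y] by simp
          then have "v y \<le> 2 * y" using True by (simp add: v_def field_simps)
          from mult_left_mono[OF mult_right_mono[OF this, of "norm (Phi f y)"], of "2 * K"] K_pos
          have "2 * K * v y * norm (Phi f y) \<le> 4 * K * (y * norm (Psi f y))"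
            using Phi_eq_Psi[OF f 0 True] by (simp add: mult_ac)
          then have "ennreal (2 * K * v y * norm (Phi f y)) \<le> ennreal (4 * K) * ennreal (y * norm (Psi f y))"
            using K_pos True by (subst ennreal_mult[symmetric]) (auto intro!: ennreal_leI)
          with le 2 True show ?thesis by simp
        qed
      qed (simp add: ramp_kernel_def)
    qed
  qed
  also have "\<dots> = ennreal (4 * K) * E_fun \<alpha> f"
  proof -
    let ?A = "\<lambda>y. ennreal (1 / y * norm (Phi f y)) * indicator {0<..<1} y"
    let ?B = "\<lambda>y. ennreal (y * norm (Psi f y)) * indicator {1<..} y"
    have "(\<integral>\<^sup>+y. ennreal (4 * K) * (?A y + ?B y) \<partial>lborel) = ennreal (4 * K) * (\<integral>\<^sup>+y. ?A y + ?B y \<partial>lborel)"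
      by (rule nn_integral_cmult) measurable
    also have "(\<integral>\<^sup>+y. ?A y + ?B y \<partial>lborel) = (\<integral>\<^sup>+y. ?A y \<partial>lborel) + (\<integral>\<^sup>+y. ?B y \<partial>lborel)"
      by (rule nn_integral_add) measurable
    finally show ?thesis unfolding E_fun_eq .
  qed
  finally show ?thesis .
qed

end

text \<open>Nodes are indexed by integers but series of atoms by naturals; a bound on all finite
  partial sums survives any enumeration.\<close>

lemma int_decode_summable:
  fixes s :: "int \<Rightarrow> real"
  assumes "\<And>F. finite F \<Longrightarrow> (\<Sum>j\<in>F. ennreal (s j)) \<le> ennreal B" and s: "\<And>j. 0 \<le> s j" and B: "0 \<le> B"
  shows "summable (\<lambda>n. s (int_decode n))" "(\<Sum>n. s (int_decode n)) \<le> B"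
proof -
  have le: "(\<Sum>n<N. s (int_decode n)) \<le> B" for N
  proof -
    have "(\<Sum>n<N. s (int_decode n)) = (\<Sum>j\<in>int_decode ` {..<N}. s j)"
      by (simp add: sum.reindex inj_int_decode)
    moreover have "ennreal (\<Sum>j\<in>int_decode ` {..<N}. s j) \<le> ennreal B"
      using assms(1)[of "int_decode ` {..<N}"] s by (simp add: sum_ennreal)
    ultimately show ?thesis using B by simp
  qed
  show 1: "summable (\<lambda>n. s (int_decode n))"
    by (rule summableI_nonneg_bounded[OF s le])
  show "(\<Sum>n. s (int_decode n)) \<le> B" by (rule suminf_le_const[OF 1 le])
qed

lemma int_decode_sums:
  fixes F :: "int \<Rightarrow> complex"
  assumes "finite N" "\<And>j. j \<notin> N \<Longrightarrow> F j = 0"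
  shows "(\<lambda>n. F (int_decode n)) sums (\<Sum>j\<in>N. F j)"
proof -
  have "(\<lambda>n. F (int_decode n)) sums (\<Sum>n\<in>int_encode ` N. F (int_decode n))"
  proof (rule sums_finite)
    fix n assume "n \<notin> int_encode ` N"
    then have "int_decode n \<notin> N" by (metis image_eqI int_decode_inverse)
    then show "F (int_decode n) = 0" by (rule assms(2))
  qed (use assms in simp)
  also have "(\<Sum>n\<in>int_encode ` N. F (int_decode n)) = (\<Sum>j\<in>N. F j)"
    by (subst sum.reindex) (auto simp: inj_int_encode intro: inj_on_subset)
  finally show ?thesis .
qed

section \<open>Assembling the atomic decomposition\<close>

context gamma_grid begin

lemma h_zero_outside:
  assumes "0 < x" "j \<notin> {cell n x - 2, cell n x - 1, cell n x}"
  shows "h n j x = 0"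
proof -
  have "\<not> (0 < 2 ^ n * \<sigma> x - of_int j \<and> 2 ^ n * \<sigma> x - of_int j < 3)"
  proof
    assume "0 < 2 ^ n * \<sigma> x - of_int j \<and> 2 ^ n * \<sigma> x - of_int j < 3"
    then have "cell n x - 2 \<le> j" "j \<le> cell n x" unfolding cell_def by linarith+
    with assms(2) show False by auto
  qed
  then show ?thesis using assms(1) by (auto simp: h_def not_less bspline_outside)
qed

lemma h_sum_le:
  assumes x: "0 < x" and F: "finite F"
  shows "(\<Sum>j\<in>F. h n j x) \<le> 1"
proof -
  let ?S = "{cell n x - 2, cell n x - 1, cell n x}"
  have "(\<Sum>j\<in>F. h n j x) \<le> (\<Sum>j\<in>F \<union> ?S. h n j x)"
    using F by (intro sum_mono2) (auto simp: h_nonneg)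
  also have "\<dots> = (\<Sum>j\<in>?S. h n j x)"
    using F h_zero_outside[OF x] by (intro sum.mono_neutral_right) auto
  also have "\<dots> = 1" using h_partition[OF x, of n] by (simp add: cell_def)
  finally show ?thesis .
qed

lemma sigma_pt_0 [simp]: "\<sigma> (pt 0 s) = s"
  using sigma_pt[of 0 s] by simp

text \<open>Both normalised bumps have integral 1, so their difference has mean zero. The pair
  occupies four cells, whose mass is at most 8 c0^2 times that of either node.\<close>

lemma atomic_le_pair:
  defines "m \<equiv> \<lambda>j. \<integral>x. h 0 j x \<partial>\<gamma>"
  shows "atomic_le \<gamma> atoms (\<lambda>x. c * (of_real (h 0 j x / m j) - of_real (h 0 (j + 1) x / m (j + 1)))) (16 * c0\<^sup>2 * norm c)"
proof -
  let ?F = "\<lambda>x. c * (of_real (h 0 j x / m j) - of_real (h 0 (j + 1) x / m (j + 1))) :: complex"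
  let ?A = "pt 0 (of_int j)" and ?B = "pt 0 (of_int j + 4)"
  have m: "0 < m j" "0 < m (j + 1)" by (simp_all add: m_def mass_pos)
  let ?c = "norm c * (1 / m j + 1 / m (j + 1))"
  have "atomic_le \<gamma> atoms ?F (?c * measure \<gamma> {?A<..<?B})"
  proof (rule atomic_le_interval[OF pt_pos])
    show "?A < ?B" by (simp add: pt_less_iff)
    show "(?B - ?A) / 2 \<le> a * w_fun ((?A + ?B) / 2)" by (rule pt_radius) auto
    show "?F \<in> borel_measurable \<gamma>" using h_measurable_gamma by measurable
    show "?F x = 0" if "0 < x" "x \<notin> {?A<..<?B}" for x
    proof -
      have "pt 0 (of_int j) < pt 0 (of_int (j + 1))" "pt 0 (of_int j + 3) < ?B" "pt 0 (of_int (j + 1) + 3) = ?B"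
        by (simp_all add: pt_less_iff add.commute)
      then have "h 0 j x = 0" "h 0 (j + 1) x = 0" using that unfolding h_zero_iff by auto
      then show ?thesis by simp
    qed
    show "AE x in \<gamma>. norm (?F x) \<le> ?c"
    proof (rule AE_I2)
      fix x
      have "norm (of_real (h 0 j x / m j) - of_real (h 0 (j + 1) x / m (j + 1)) :: complex)
         \<le> norm (of_real (h 0 j x / m j) :: complex) + norm (of_real (h 0 (j + 1) x / m (j + 1)) :: complex)"
        by (rule norm_triangle_ineq4)
      also have "\<dots> \<le> 1 / m j + 1 / m (j + 1)"
        using m h_nonneg h_le_1 by (intro add_mono) (simp_all add: norm_divide divide_right_mono del: of_real_divide)
      finally show "norm (?F x) \<le> ?c" unfolding norm_mult by (rule mult_left_mono) simp
    qed
    show "0 \<le> ?c" using m by simp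
    have i: "integrable \<gamma> (\<lambda>x. complex_of_real (h 0 j x / m j))" for j
      using h_integrable[of 0 j] by (simp del: of_real_divide)
    have one: "(\<integral>x. complex_of_real (h 0 j x / m j) \<partial>\<gamma>) = 1" for j
      using mass_pos[of 0 j] by (simp add: m_def del: of_real_divide)
    have "(\<integral>x. ?F x \<partial>\<gamma>) = c * (\<integral>x. of_real (h 0 j x / m j) - of_real (h 0 (j + 1) x / m (j + 1)) \<partial>\<gamma>)"
      by (rule integral_mult_right_zero)
    also have "\<dots> = 0" unfolding Bochner_Integration.integral_diff[OF i i] one by simp
    finally show "(\<integral>x. ?F x \<partial>\<gamma>) = 0" .
  qed
  moreover have "?c * measure \<gamma> {?A<..<?B} \<le> 16 * c0\<^sup>2 * norm c"
  proof -
    have "measure \<gamma> {?A<..<?B} \<le> c0 * ((of_int j + 4) - of_int j) * \<rho> 0 ?A"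
      by (rule pt_interval_mass(1)[OF pt_pos]) auto
    moreover have "\<rho> 0 ?A \<le> 2 * c0 * m j" "\<rho> 0 ?A \<le> 2 * c0 * m (j + 1)"
      unfolding m_def by (rule mass_lower[OF pt_pos]; simp)+
    then have "c0 * (4 * \<rho> 0 ?A) \<le> c0 * (4 * (2 * c0 * m j))" "c0 * (4 * \<rho> 0 ?A) \<le> c0 * (4 * (2 * c0 * m (j + 1)))"
      using c0_ge by (intro mult_left_mono; simp)+
    ultimately have "measure \<gamma> {?A<..<?B} \<le> 8 * c0\<^sup>2 * m j" "measure \<gamma> {?A<..<?B} \<le> 8 * c0\<^sup>2 * m (j + 1)"
      by (simp_all add: power2_eq_square)
    then have "1 / m j * measure \<gamma> {?A<..<?B} \<le> 8 * c0\<^sup>2" "1 / m (j + 1) * measure \<gamma> {?A<..<?B} \<le> 8 * c0\<^sup>2"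
      using m by (simp_all add: pos_divide_le_eq)
    then have "(1 / m j + 1 / m (j + 1)) * measure \<gamma> {?A<..<?B} \<le> 16 * c0\<^sup>2"
      unfolding distrib_right by linarith
    from mult_left_mono[OF this, of "norm c"] show ?thesis by (simp add: mult_ac)
  qed
  ultimately show ?thesis by (rule at.atomic_le_mono)
qed

text \<open>After removal of the mean, g is the sum of the local parts \<open>?P\<close>, treated by
  stopping, and of the multiples av_j h_j. With ramp moments S_j, the product of av_j and the mass
  is S_j - S_(j-1), and summation by parts yields the pairs \<open>?Q\<close>.\<close>

theorem atomic_decomposition:
  "\<exists>C>0. \<forall>f. integrable \<gamma> f \<longrightarrow> (\<integral>\<^sup>+x. local_maximal a f x \<partial>\<gamma>) + E_fun \<alpha> f < \<infinity> \<longrightarrow>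
     atomic_le \<gamma> atoms f (C * enn2real ((\<integral>\<^sup>+x. local_maximal a f x \<partial>\<gamma>) + E_fun \<alpha> f))"
proof -
  define T where "T = measure \<gamma> {0<..}"
  have T: "0 < T"
  proof -
    have "0 < (\<integral>x. h 0 0 x \<partial>\<gamma>)" by (rule mass_pos)
    also have "\<dots> \<le> (\<integral>x. 1 \<partial>\<gamma>)" by (intro integral_mono h_integrable) (auto simp: h_le_1)
    finally show ?thesis by (simp add: T_def)
  qed
  define e1 where "e1 = enn2real (E_fun \<alpha> (\<lambda>_. 1))"
  have E1: "E_fun \<alpha> (\<lambda>_. 1) = ennreal e1" using E_one_finite by (simp add: e1_def less_top)
  have e1: "0 \<le> e1" by (simp add: e1_def)
  define C1 where "C1 = 12 * c0\<^sup>2 + 2304 * c0 ^ 4"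
  have C1: "0 \<le> C1" using c0_ge by (simp add: C1_def)
  define C where "C = C1 * (2 * Cm) + 16 * c0\<^sup>2 * (4 * K * (1 + Cm / T * e1)) + Cm / T"
  have "0 < C" unfolding C_def using C1 Cm_pos T K_pos e1 c0_ge
    by (intro add_nonneg_pos add_nonneg_nonneg mult_nonneg_nonneg divide_nonneg_pos divide_pos_pos) auto
  moreover have "atomic_le \<gamma> atoms f (C * enn2real ((\<integral>\<^sup>+x. local_maximal a f x \<partial>\<gamma>) + E_fun \<alpha> f))"
    if f: "integrable \<gamma> f" and fin: "(\<integral>\<^sup>+x. local_maximal a f x \<partial>\<gamma>) + E_fun \<alpha> f < \<infinity>" for f
  proof -
    define m where "m = enn2real (\<integral>\<^sup>+x. local_maximal a f x \<partial>\<gamma>)"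
    define E where "E = enn2real (E_fun \<alpha> f)"
    have m: "(\<integral>\<^sup>+x. local_maximal a f x \<partial>\<gamma>) = ennreal m" "0 \<le> m"
      and E: "E_fun \<alpha> f = ennreal E" "0 \<le> E"
      using fin by (auto simp: m_def E_def less_top)
    have N: "enn2real ((\<integral>\<^sup>+x. local_maximal a f x \<partial>\<gamma>) + E_fun \<alpha> f) = m + E"
      using m E by (simp add: ennreal_plus[symmetric] del: ennreal_plus)
    note [measurable] = local_maximal_measurable[OF f]
    have fm [measurable]: "f \<in> borel_measurable \<gamma>" using f by auto
    let ?mf = "\<lambda>x. ennreal Cm * local_maximal a f x"
    have avf: "ennreal (norm (av f n i)) \<le> ?mf x" if "0 < x" "0 < h n i x" for n i x
      by (rule av_le_local_maximal[OF fm that])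
    have f_le: "AE x in \<gamma>. ennreal (norm (f x)) \<le> ?mf x"
      by (rule f_le_maximal[OF f _ avf]) measurable
    \<comment> \<open>\<open>ramp_moments_sum\<close> demands mean zero; the removed mean is a
      multiple of the constant atom.\<close>
    define \<kappa> where "\<kappa> = (\<integral>x. f x \<partial>\<gamma>) / of_real T"
    have \<kappa>: "norm \<kappa> * T \<le> Cm * m"
    proof -
      have "ennreal (norm (\<integral>x. f x \<partial>\<gamma>)) \<le> (\<integral>\<^sup>+x. ennreal (norm (f x)) \<partial>\<gamma>)"
        by (rule integral_norm_bound_ennreal[OF f])
      also have "\<dots> \<le> (\<integral>\<^sup>+x. ?mf x \<partial>\<gamma>)" by (rule nn_integral_mono_AE[OF f_le])
      also have "\<dots> = ennreal (Cm * m)" using Cm_pos m by (simp add: nn_integral_cmult ennreal_mult)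
      finally have "norm (\<integral>x. f x \<partial>\<gamma>) \<le> Cm * m" using Cm_pos m by simp
      then show ?thesis using T unfolding \<kappa>_def norm_divide by simp
    qed
    then have "norm \<kappa> \<le> Cm * m / T" using T by (subst pos_le_divide_eq)
    then have \<kappa>': "norm \<kappa> \<le> Cm / T * m" by (simp only: times_divide_eq_left)
    define g where "g x = f x - \<kappa>" for x
    have gi: "integrable \<gamma> g" unfolding g_def[abs_def] using f by auto
    have g0: "(\<integral>x. g x \<partial>\<gamma>) = 0"
      unfolding g_def[abs_def] using f T by (simp add: T_def[symmetric] \<kappa>_def scaleR_conv_of_real)
    \<comment> \<open>Majorant for the averages of \<open>g\<close>. The added constant at most
      doubles the integral, since \<open>norm \<kappa>\<close> times the total mass is at most Cm
      m.\<close>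
    let ?mg = "\<lambda>x. ?mf x + ennreal (norm \<kappa>)"
    have avg: "ennreal (norm (av g n i)) \<le> ?mg x" if "0 < x" "0 < h n i x" for n i x
    proof -
      have "av g n i = av f n i - \<kappa>"
        unfolding g_def[abs_def] using f by (subst av_diff) (auto simp: av_const)
      then have "norm (av g n i) \<le> norm (av f n i) + norm \<kappa>" by (simp add: norm_triangle_ineq4)
      then have "ennreal (norm (av g n i)) \<le> ennreal (norm (av f n i)) + ennreal (norm \<kappa>)"
        by (simp add: ennreal_leI flip: ennreal_plus)
      also have "\<dots> \<le> ?mg x" using avf[OF that] by (rule add_right_mono)
      finally show ?thesis .
    qed
    have mgi: "(\<integral>\<^sup>+x. ?mg x \<partial>\<gamma>) \<le> ennreal (2 * Cm * m)"
    proof -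
      have "(\<integral>\<^sup>+x. ?mg x \<partial>\<gamma>) = ennreal (Cm * m) + ennreal (norm \<kappa> * T)"
        using Cm_pos m
        by (simp add: nn_integral_add nn_integral_cmult ennreal_mult emeasure_eq_measure T_def)
      also have "\<dots> = ennreal (Cm * m + norm \<kappa> * T)" using Cm_pos m T by (simp add: ennreal_plus)
      also have "\<dots> \<le> ennreal (2 * Cm * m)"
      proof (rule ennreal_leI)
        have "Cm * m + norm \<kappa> * T \<le> Cm * m + Cm * m" using \<kappa> by (rule add_left_mono)
        then show "Cm * m + norm \<kappa> * T \<le> 2 * Cm * m" by (simp only: mult_2 distrib_right)
      qed
      finally show ?thesis .
    qed
    define I where "I j = enn2real (\<integral>\<^sup>+x. ennreal (h 0 j x) * ?mg x \<partial>\<gamma>)" for j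
    have hm [measurable]: "h 0 j \<in> borel_measurable \<gamma>" for j by (rule h_measurable_gamma)
    have Isum: "(\<Sum>j\<in>F. \<integral>\<^sup>+x. ennreal (h 0 j x) * ?mg x \<partial>\<gamma>) \<le> ennreal (2 * Cm * m)" if "finite F" for F
    proof -
      have "(\<Sum>j\<in>F. \<integral>\<^sup>+x. ennreal (h 0 j x) * ?mg x \<partial>\<gamma>) = (\<integral>\<^sup>+x. (\<Sum>j\<in>F. ennreal (h 0 j x) * ?mg x) \<partial>\<gamma>)"
        by (rule nn_integral_sum[symmetric]) measurable
      also have "\<dots> \<le> (\<integral>\<^sup>+x. ?mg x \<partial>\<gamma>)"
      proof (rule nn_integral_mono)
        fix x assume "x \<in> space \<gamma>"
        then have "(\<Sum>j\<in>F. h 0 j x) \<le> 1" using that by (intro h_sum_le) auto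
        then have "ennreal (\<Sum>j\<in>F. h 0 j x) \<le> ennreal 1" by (rule ennreal_leI)
        then have "(\<Sum>j\<in>F. ennreal (h 0 j x)) \<le> 1" by (simp add: sum_ennreal h_nonneg)
        from mult_right_mono[OF this, of "?mg x"]
        show "(\<Sum>j\<in>F. ennreal (h 0 j x) * ?mg x) \<le> ?mg x" by (simp add: sum_distrib_right)
      qed
      finally show ?thesis using mgi by (rule order_trans)
    qed
    have Ifin: "(\<integral>\<^sup>+x. ennreal (h 0 j x) * ?mg x \<partial>\<gamma>) = ennreal (I j)" for j
    proof -
      have "(\<integral>\<^sup>+x. ennreal (h 0 j x) * ?mg x \<partial>\<gamma>) \<le> ennreal (2 * Cm * m)" using Isum[of "{j}"] by simp
      then have "(\<integral>\<^sup>+x. ennreal (h 0 j x) * ?mg x \<partial>\<gamma>) < top" by (rule le_less_trans) simp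
      then show ?thesis unfolding I_def by (rule ennreal_enn2real[symmetric])
    qed
    have I0: "0 \<le> I j" for j by (simp add: I_def)
    have "(\<Sum>j\<in>F. ennreal (I j)) \<le> ennreal (2 * Cm * m)" if "finite F" for F
      using Isum[OF that] by (simp only: Ifin)
    from int_decode_summable[OF this I0] have Is: "summable (\<lambda>n. I (int_decode n))"
      "(\<Sum>n. I (int_decode n)) \<le> 2 * Cm * m" using Cm_pos m by auto
    define S where "S j = (\<integral>x. g x * of_real (ramp (\<sigma> x - of_int j)) \<partial>\<gamma>)" for j
    have Eg: "E_fun \<alpha> g \<le> ennreal (E + norm \<kappa> * e1)"
      using E_fun_diff_const[OF f, of \<kappa>] E e1 unfolding g_def[abs_def] E1
      by (simp add: ennreal_mult ennreal_plus)
    have "(\<Sum>j\<in>F. ennreal (norm (S j))) \<le> ennreal (4 * K * (E + norm \<kappa> * e1))" if "finite F" for F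
    proof -
      have "(\<Sum>j\<in>F. ennreal (norm (S j))) \<le> ennreal (4 * K) * E_fun \<alpha> g"
        unfolding S_def by (rule ramp_moments_sum[OF gi g0 that])
      also have "\<dots> \<le> ennreal (4 * K) * ennreal (E + norm \<kappa> * e1)" by (rule mult_left_mono[OF Eg]) simp
      also have "\<dots> = ennreal (4 * K * (E + norm \<kappa> * e1))"
        using K_pos E e1 by (intro ennreal_mult[symmetric]) auto
      finally show ?thesis .
    qed
    from int_decode_summable[OF this norm_ge_zero] have Ss: "summable (\<lambda>n. norm (S (int_decode n)))"
      "(\<Sum>n. norm (S (int_decode n))) \<le> 4 * K * (E + norm \<kappa> * e1)" using K_pos E e1 by auto
    let ?m = "\<lambda>j. \<integral>x. h 0 j x \<partial>\<gamma>"
    let ?P = "\<lambda>j x. of_real (h 0 j x) * g x - av g 0 j * of_real (h 0 j x)"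
    let ?Q = "\<lambda>j x. S j * (of_real (h 0 j x / ?m j) - of_real (h 0 (j + 1) x / ?m (j + 1)))"
    \<comment> \<open>Besides the three nodes that can be active at x, the index
      \<open>cell 0 x - 3\<close> is listed because its successor in the pair can be active.\<close>
    let ?N = "\<lambda>x. {cell 0 x - 3, cell 0 x - 2, cell 0 x - 1, cell 0 x}"
    have hz: "h 0 j x = 0" if "0 < x" "j \<notin> {cell 0 x - 2, cell 0 x - 1, cell 0 x}" for j x
      using h_zero_outside[OF that] .
    have P: "atomic_le \<gamma> atoms (\<lambda>x. \<Sum>j\<in>?N x. ?P j x) (\<Sum>n. C1 * I (int_decode n))"
    proof (rule at.atomic_le_sums)
      show "atomic_le \<gamma> atoms (?P (int_decode n)) (C1 * I (int_decode n))" for n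
        unfolding C1_def by (rule local_atomic_node[OF gi _ avg eq_refl[OF Ifin] I0]) measurable
      show "summable (\<lambda>n. C1 * I (int_decode n))" using Is(1) by (rule summable_mult)
      show "AE x in \<gamma>. (\<lambda>n. ?P (int_decode n) x) sums (\<Sum>j\<in>?N x. ?P j x)"
      proof (rule AE_I2)
        fix x assume "x \<in> space \<gamma>"
        then show "(\<lambda>n. ?P (int_decode n) x) sums (\<Sum>j\<in>?N x. ?P j x)"
          by (intro int_decode_sums[where F="\<lambda>j. ?P j x"]) (auto simp: hz)
      qed
    qed
    have Q: "atomic_le \<gamma> atoms (\<lambda>x. \<Sum>j\<in>?N x. ?Q j x) (\<Sum>n. 16 * c0\<^sup>2 * norm (S (int_decode n)))"
    proof (rule at.atomic_le_sums)
      show "atomic_le \<gamma> atoms (?Q (int_decode n)) (16 * c0\<^sup>2 * norm (S (int_decode n)))" for n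
        by (rule atomic_le_pair)
      show "summable (\<lambda>n. 16 * c0\<^sup>2 * norm (S (int_decode n)))" using Ss(1) by (rule summable_mult)
      show "AE x in \<gamma>. (\<lambda>n. ?Q (int_decode n) x) sums (\<Sum>j\<in>?N x. ?Q j x)"
      proof (rule AE_I2)
        fix x assume x: "x \<in> space \<gamma>"
        have "?Q j x = 0" if "j \<notin> ?N x" for j
        proof -
          have "h 0 j x = 0" "h 0 (j + 1) x = 0" using that x by (auto intro!: hz)
          then show ?thesis by simp
        qed
        then show "(\<lambda>n. ?Q (int_decode n) x) sums (\<Sum>j\<in>?N x. ?Q j x)"
          by (intro int_decode_sums[where F="\<lambda>j. ?Q j x"]) auto
      qed
    qed
    have PQ: "g x = (\<Sum>j\<in>?N x. ?P j x) + (\<Sum>j\<in>?N x. ?Q j x)" if x: "0 < x" for x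
    proof -
      define c where "c = cell 0 x"
      have z: "h 0 (c - 3) x = 0" "h 0 (c + 1) x = 0" using x by (auto intro!: hz simp: c_def)
      have one: "h 0 c x + h 0 (c - 1) x + h 0 (c - 2) x = 1"
        using h_partition[OF x, of 0] by (simp add: c_def cell_def)
      have rint: "integrable \<gamma> (\<lambda>x. g x * of_real (ramp (\<sigma> x - of_int j)))" for j
      proof (rule Bochner_Integration.integrable_bound[of _ "\<lambda>x. norm (g x)"])
        have "(\<lambda>x. ramp (\<sigma> x - of_int j)) \<in> borel_measurable \<gamma>"
          by (rule measurable_gammaI) measurable
        then show "(\<lambda>x. g x * of_real (ramp (\<sigma> x - of_int j))) \<in> borel_measurable \<gamma>"
          using borel_measurable_integrable[OF gi] by measurable
        \<comment> \<open>Along integer steps the ramp decreases by values of the nonnegative spline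
          until it reaches 0.\<close>
        have "0 \<le> ramp s" for s
        proof -
          have "ramp (s + of_nat k) \<le> ramp s" for k
          proof (induction k)
            case (Suc k)
            have "ramp (s + of_nat (Suc k)) \<le> ramp (s + of_nat k)"
              using bspline_ramp[of "s + of_nat k"] bspline_nonneg[of "s + of_nat k"] by (simp add: add_ac)
            with Suc show ?case by simp
          qed simp
          moreover obtain k :: nat where "3 - s \<le> of_nat k" using real_arch_simple by blast
          then have "ramp (s + of_nat k) = 0" by (intro ramp_right) simp
          ultimately show ?thesis by metis
        qed
        then show "AE x in \<gamma>. norm (g x * of_real (ramp (\<sigma> x - of_int j))) \<le> norm (norm (g x))"
          using ramp_le by (intro AE_I2) (simp add: norm_mult mult_left_le)
      qed (use gi in auto)
      have mS: "av g 0 j * of_real (?m j) = S j - S (j - 1)" for j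
      proof -
        have "av g 0 j * of_real (?m j) = (\<integral>x. of_real (h 0 j x) * g x \<partial>\<gamma>)"
          using mass_pos[of 0 j] by (simp add: av_def)
        \<comment> \<open>\<open>bspline s = ramp s - ramp (s + 1)\<close>, and adding 1 to the
          argument lowers the index by 1.\<close>
        also have "\<dots> = (\<integral>x. g x * of_real (ramp (\<sigma> x - of_int j)) - g x * of_real (ramp (\<sigma> x - of_int (j - 1))) \<partial>\<gamma>)"
          by (intro Bochner_Integration.integral_cong refl)
             (auto simp: h_def bspline_ramp algebra_simps)
        also have "\<dots> = S j - S (j - 1)"
          unfolding S_def by (rule Bochner_Integration.integral_diff[OF rint rint])
        finally show ?thesis .
      qed
      define u where "u j = complex_of_real (h 0 j x / ?m j)" for j
      have avu: "av g 0 j * of_real (h 0 j x) = (S j - S (j - 1)) * u j" for j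
        unfolding mS[symmetric] u_def using mass_pos[of 0 j] by simp
      have uz: "u (c - 3) = 0" "u (c + 1) = 0" using z by (simp_all add: u_def)
      have sum4: "(\<Sum>j\<in>?N x. F j) = F (c - 3) + F (c - 2) + F (c - 1) + F c" for F :: "int \<Rightarrow> complex"
        by (simp add: c_def add.assoc)
      have "(\<Sum>j\<in>?N x. ?P j x) = of_real (h 0 c x + h 0 (c - 1) x + h 0 (c - 2) x) * g x
          - ((S (c - 2) - S (c - 3)) * u (c - 2) + (S (c - 1) - S (c - 2)) * u (c - 1) + (S c - S (c - 1)) * u c)"
        unfolding sum4 avu using z uz by (simp add: algebra_simps)
      moreover have "(\<Sum>j\<in>?N x. ?Q j x) = (\<Sum>j\<in>?N x. S j * (u j - u (j + 1)))"
        by (simp only: u_def)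
      \<comment> \<open>Summation by parts at a fixed x; there are no boundary terms because
        \<open>u\<close> vanishes at \<open>c - 3\<close> and at \<open>c + 1\<close>.\<close>
      moreover have "(\<Sum>j\<in>?N x. S j * (u j - u (j + 1))) =
          (S (c - 2) - S (c - 3)) * u (c - 2) + (S (c - 1) - S (c - 2)) * u (c - 1) + (S c - S (c - 1)) * u c"
        unfolding sum4 using uz by (simp add: algebra_simps)
      ultimately show ?thesis unfolding one by simp
    qed
    have G: "atomic_le \<gamma> atoms g ((\<Sum>n. C1 * I (int_decode n)) + (\<Sum>n. 16 * c0\<^sup>2 * norm (S (int_decode n))))"
      by (rule at.atomic_le_add[OF P Q]) (use PQ in \<open>auto intro!: AE_I2\<close>)
    have "atomic_le \<gamma> atoms (\<lambda>_. \<kappa>) (norm \<kappa>)"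
      by (rule at.atomic_le_atom[OF const_atom, of _ \<kappa>]) auto
    from at.atomic_le_add[OF G this, of f]
    have "atomic_le \<gamma> atoms f ((\<Sum>n. C1 * I (int_decode n)) + (\<Sum>n. 16 * c0\<^sup>2 * norm (S (int_decode n))) + norm \<kappa>)"
      by (simp add: g_def)
    moreover have "(\<Sum>n. C1 * I (int_decode n)) + (\<Sum>n. 16 * c0\<^sup>2 * norm (S (int_decode n))) + norm \<kappa> \<le> C * (m + E)"
    proof -
      have "(\<Sum>n. C1 * I (int_decode n)) \<le> C1 * (2 * Cm * m)"
        unfolding suminf_mult[OF Is(1)] by (rule mult_left_mono[OF Is(2) C1])
      also have "\<dots> \<le> C1 * (2 * Cm) * (m + E)" using C1 Cm_pos m E by (simp add: distrib_left)
      finally have 1: "(\<Sum>n. C1 * I (int_decode n)) \<le> C1 * (2 * Cm) * (m + E)" .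
      have "E + norm \<kappa> * e1 \<le> (m + E) + Cm / T * m * e1"
        using m mult_right_mono[OF \<kappa>' e1] by simp
      also have "\<dots> \<le> (m + E) + Cm / T * (m + E) * e1"
        using Cm_pos T m E e1 by (intro add_left_mono mult_right_mono mult_left_mono) auto
      also have "\<dots> = (1 + Cm / T * e1) * (m + E)" by (simp add: algebra_simps add_divide_distrib)
      finally have e: "E + norm \<kappa> * e1 \<le> (1 + Cm / T * e1) * (m + E)" .
      have "(\<Sum>n. 16 * c0\<^sup>2 * norm (S (int_decode n))) \<le> 16 * c0\<^sup>2 * (4 * K * (E + norm \<kappa> * e1))"
        unfolding suminf_mult[OF Ss(1)] by (rule mult_left_mono[OF Ss(2)]) simp
      also have "\<dots> \<le> 16 * c0\<^sup>2 * (4 * K * ((1 + Cm / T * e1) * (m + E)))"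
        using e K_pos by (intro mult_left_mono) auto
      finally have 2: "(\<Sum>n. 16 * c0\<^sup>2 * norm (S (int_decode n))) \<le> 16 * c0\<^sup>2 * (4 * K * (1 + Cm / T * e1)) * (m + E)"
        by (simp only: mult.assoc)
      have 3: "norm \<kappa> \<le> Cm / T * (m + E)"
        using \<kappa>' mult_left_mono[of m "m + E" "Cm / T"] Cm_pos T E by simp
      show ?thesis using 1 2 3 unfolding C_def distrib_right by linarith
    qed
    ultimately show ?thesis unfolding N by (rule at.atomic_le_mono)
  qed
  ultimately show ?thesis by blast
qed

end

section \<open>The functional E on atoms\<close>

text \<open>An atom for infinite q satisfies the size condition for every finite exponent above 1;
  the choice 2 is arbitrary.\<close>

definition atom_exponent :: "ennreal \<Rightarrow> real" where
  "atom_exponent q = (if q = \<infinity> then 2 else enn2real q)"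

lemma atom_exponent_gt: "1 < q \<Longrightarrow> 1 < atom_exponent q"
  by (cases q) (auto simp: atom_exponent_def ennreal_less_iff simp flip: ennreal_1)

context gamma_setting begin

text \<open>The power of 3 pays for y <= 3 x, and exp 8 for squares that differ by at most
  8.\<close>

definition c1 :: real where "c1 = 3 powr (2 * \<alpha> + 1) * exp 8"

lemma c1_ge: "exp 8 \<le> c1"
proof -
  have "1 \<le> (3::real) powr (2 * \<alpha> + 1)" using alpha by (intro ge_one_powr_ge_zero) auto
  then show ?thesis by (simp add: c1_def)
qed

lemma c1_pos: "0 < c1"
  using c1_ge exp_gt_zero less_le_trans by blast

lemma gd_upper:
  assumes "0 < x" "0 < y" "y \<le> 3 * x" "x\<^sup>2 - y\<^sup>2 \<le> 8"
  shows "gd y \<le> c1 * gd x"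
proof -
  have "y powr (2 * \<alpha> + 1) \<le> (3 * x) powr (2 * \<alpha> + 1)"
    using assms alpha by (intro powr_mono2) auto
  also have "\<dots> = 3 powr (2 * \<alpha> + 1) * x powr (2 * \<alpha> + 1)" using assms by (simp add: powr_mult)
  finally have 1: "y powr (2 * \<alpha> + 1) \<le> 3 powr (2 * \<alpha> + 1) * x powr (2 * \<alpha> + 1)" .
  have "exp (- y\<^sup>2) \<le> exp (8 + - x\<^sup>2)" using assms by simp
  then have 2: "exp (- y\<^sup>2) \<le> exp 8 * exp (- x\<^sup>2)" by (simp only: exp_add)
  have "y powr (2 * \<alpha> + 1) * exp (- y\<^sup>2) \<le> (3 powr (2 * \<alpha> + 1) * x powr (2 * \<alpha> + 1)) * (exp 8 * exp (- x\<^sup>2))"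
    by (rule mult_mono[OF 1 2]) auto
  from mult_left_mono[OF this, of "2 / Gamma (\<alpha> + 1)"] Gamma_pos show ?thesis
    by (simp add: gd_def c1_def mult_ac)
qed

lemma gd_lower:
  assumes "0 < x" "x \<le> y" "y\<^sup>2 - x\<^sup>2 \<le> 8"
  shows "exp (- 8) * gd x \<le> gd y"
proof -
  have 1: "x powr (2 * \<alpha> + 1) \<le> y powr (2 * \<alpha> + 1)" using assms alpha by (intro powr_mono2) auto
  have "exp (- 8 + - x\<^sup>2) \<le> exp (- y\<^sup>2)" using assms by simp
  then have 2: "exp (- 8) * exp (- x\<^sup>2) \<le> exp (- y\<^sup>2)" by (simp only: exp_add)
  have "x powr (2 * \<alpha> + 1) * (exp (- 8) * exp (- x\<^sup>2)) \<le> y powr (2 * \<alpha> + 1) * exp (- y\<^sup>2)"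
    by (rule mult_mono[OF 1 2]) auto
  from mult_left_mono[OF this, of "2 / Gamma (\<alpha> + 1)"] Gamma_pos show ?thesis
    by (simp add: gd_def mult_ac)
qed

end

text \<open>A non-constant atom of the largest class, with the size condition expressed through p-th
  powers.\<close>

locale atom_setting = gamma_setting +
  fixes b :: "real \<Rightarrow> complex" and x0 r p :: real
  assumes r_pos: "0 < r" and r_le: "r \<le> x0" and r_le_m: "r \<le> m_fun x0" and p: "1 < p"
    and b_measurable: "b \<in> borel_measurable \<gamma>"
    and b_support: "support_on {0<..} b \<subseteq> itv x0 r"
    and b_Lp: "(\<integral>\<^sup>+x. ennreal (norm (b x) powr p) \<partial>\<gamma>) \<le> ennreal (measure \<gamma> (itv x0 r) powr (1 - p))"
    and b_mean: "(\<integral>x. b x \<partial>\<gamma>) = 0"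
begin

abbreviation "J \<equiv> itv x0 r"
abbreviation "m \<equiv> measure \<gamma> J"

lemma x0_pos: "0 < x0" using r_pos r_le by simp

lemma J_eq: "J = {x0 - r<..<x0 + r}" using r_le by (auto simp: itv_def)

lemma J_sets: "J \<in> sets \<gamma>" by (auto simp: itv_def sets_gamma_iff)

lemma r_le_1: "r \<le> 1" and r_x0: "r * x0 \<le> 1"
proof -
  show "r \<le> 1" using r_le_m by (simp add: m_fun_def)
  have "r \<le> 1 / x0" using r_le_m by (simp add: m_fun_def)
  then show "r * x0 \<le> 1" using x0_pos by (simp add: pos_le_divide_eq)
qed

lemma b_zero: "0 < x \<Longrightarrow> x \<notin> J \<Longrightarrow> b x = 0"
  using b_support by (auto simp: support_on_def)

text \<open>Only the right half of the interval is used: the left end may be 0, where the density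
  degenerates.\<close>

lemma m_ge: "r * (exp (- 8) * gd x0) \<le> m"
proof -
  have "(x0 + r - x0) * (exp (- 8) * gd x0) \<le> measure \<gamma> {x0<..<x0 + r}"
  proof (rule measure_interval_ge)
    fix y assume y: "x0 < y" "y < x0 + r"
    then have "y\<^sup>2 \<le> (x0 + r)\<^sup>2" using x0_pos by (intro power_mono) auto
    also have "\<dots> = x0\<^sup>2 + 2 * (r * x0) + r * r" by (simp add: power2_eq_square algebra_simps)
    also have "\<dots> \<le> x0\<^sup>2 + 8" using r_x0 mult_le_one[OF r_le_1 _ r_le_1] r_pos by simp
    finally show "exp (- 8) * gd x0 \<le> gd y" using y x0_pos by (intro gd_lower) auto
  qed (use x0_pos r_pos gd_nonneg in auto)
  also have "\<dots> \<le> m" using J_sets r_pos by (intro finite_measure_mono) (auto simp: J_eq)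
  finally show ?thesis by simp
qed

lemma m_pos: "0 < m"
proof -
  have "0 < r * (exp (- 8) * gd x0)" using r_pos gd_pos[OF x0_pos] by simp
  with m_ge show ?thesis by linarith
qed

text \<open>The bound 8 for the difference of squares is 4 r x0 + 4 r^2, since r and r x0 are at
  most 1.\<close>

lemma gd_upper_J: "0 < y \<Longrightarrow> \<bar>y - x0\<bar> \<le> 2 * r \<Longrightarrow> gd y \<le> c1 * gd x0"
proof (rule gd_upper[OF x0_pos])
  assume y: "0 < y" "\<bar>y - x0\<bar> \<le> 2 * r"
  show "y \<le> 3 * x0" using y r_le by linarith
  have "x0\<^sup>2 - y\<^sup>2 = (x0 - y) * (x0 + y)" by (simp add: power2_eq_square algebra_simps)
  also have "\<dots> \<le> (2 * r) * (2 * x0 + 2 * r)"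
  proof (cases "y \<le> x0")
    case True then show ?thesis using y r_pos x0_pos by (intro mult_mono) auto
  next
    case False
    then have "(x0 - y) * (x0 + y) \<le> 0" using y x0_pos by (intro mult_nonpos_nonneg) auto
    also have "0 \<le> (2 * r) * (2 * x0 + 2 * r)" using r_pos x0_pos by simp
    finally show ?thesis .
  qed
  also have "\<dots> = 4 * (r * x0) + 4 * (r * r)" by (simp add: algebra_simps)
  also have "\<dots> \<le> 8" using r_x0 mult_le_one[OF r_le_1 _ r_le_1] r_pos by simp
  finally show "x0\<^sup>2 - y\<^sup>2 \<le> 8" .
qed

lemma doubling: "measure \<gamma> (itv x0 (2 * r)) \<le> 4 * c1 * exp 8 * m"
proof -
  define A where "A = max 0 (x0 - 2 * r)"
  have eq: "itv x0 (2 * r) = {A<..<x0 + 2 * r}" using r_pos x0_pos by (auto simp: itv_def A_def)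
  have c: "0 \<le> c1 * gd x0" using c1_pos gd_nonneg[of x0] by simp
  have "measure \<gamma> {A<..<x0 + 2 * r} \<le> (x0 + 2 * r - A) * (c1 * gd x0)"
  proof (rule measure_interval_le)
    fix y assume "A < y" "y < x0 + 2 * r"
    then show "gd y \<le> c1 * gd x0" by (intro gd_upper_J) (auto simp: A_def)
  qed (use r_pos x0_pos in \<open>auto simp: A_def\<close>)
  also have "\<dots> \<le> (4 * r) * (c1 * gd x0)" using c by (intro mult_right_mono) (auto simp: A_def)
  also have "\<dots> = 4 * c1 * exp 8 * (r * (exp (- 8) * gd x0))" by (simp add: exp_minus)
  also have "\<dots> \<le> 4 * c1 * exp 8 * m" using m_ge c1_pos
    by (intro mult_left_mono) auto
  finally show ?thesis by (simp add: eq)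
qed

text \<open>Above height \<open>s\<close> the factor norm z to the power 1 - p is at most s to that
  power, the exponent being negative.\<close>

lemma truncated_le:
  fixes z :: complex
  assumes s: "0 < s"
  shows "norm z \<le> s + s powr (1 - p) * norm z powr p"
    and "s < norm z \<Longrightarrow> norm z \<le> s powr (1 - p) * norm z powr p"
proof -
  have 1: "norm z \<le> s powr (1 - p) * norm z powr p" if "s < norm z" for z :: complex
  proof -
    have "norm z powr (1 - p) \<le> s powr (1 - p)" using p s that by (intro powr_mono2') auto
    then have "norm z powr (1 - p) * norm z powr p \<le> s powr (1 - p) * norm z powr p" by (rule mult_right_mono) simp
    moreover have "norm z powr (1 - p) * norm z powr p = norm z" using s that by (simp add: powr_add[symmetric])
    ultimately show ?thesis by simp
  qed
  then show "s < norm z \<Longrightarrow> norm z \<le> s powr (1 - p) * norm z powr p" .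
  show "norm z \<le> s + s powr (1 - p) * norm z powr p"
    using 1[of z] s by (cases "s < norm z") (auto intro: order_trans add_increasing2)
qed

text \<open>Splitting \<open>b\<close> at height s bounds the integral by s R m plus (s m) to the
  power 1 - p; the chosen s makes the two terms equal, hence the factor 2.\<close>

lemma Holder:
  assumes A: "A \<in> sets \<gamma>" and R: "0 < R" and le: "measure \<gamma> A \<le> R * m"
  shows "(\<integral>\<^sup>+x. ennreal (norm (b x)) * indicator A x \<partial>\<gamma>) \<le> ennreal (2 * R powr (1 - 1 / p))"
proof -
  define s where "s = R powr (- 1 / p) / m"
  have s: "0 < s" using R m_pos by (simp add: s_def)
  note [measurable] = b_measurable
  have "(\<integral>\<^sup>+x. ennreal (norm (b x)) * indicator A x \<partial>\<gamma>) \<le>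
    (\<integral>\<^sup>+x. ennreal s * indicator A x + ennreal (s powr (1 - p)) * ennreal (norm (b x) powr p) \<partial>\<gamma>)"
  proof (rule nn_integral_mono)
    fix x
    have "ennreal (norm (b x)) \<le> ennreal (s + s powr (1 - p) * norm (b x) powr p)"
      using truncated_le(1)[OF s] by (rule ennreal_leI)
    also have "\<dots> = ennreal s + ennreal (s powr (1 - p)) * ennreal (norm (b x) powr p)"
      using s by (simp add: ennreal_mult)
    finally show "ennreal (norm (b x)) * indicator A x \<le>
       ennreal s * indicator A x + ennreal (s powr (1 - p)) * ennreal (norm (b x) powr p)"
      by (auto simp: indicator_def)
  qed
  also have "\<dots> = ennreal s * emeasure \<gamma> A + ennreal (s powr (1 - p)) * (\<integral>\<^sup>+x. ennreal (norm (b x) powr p) \<partial>\<gamma>)"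
    using A by (subst nn_integral_add) (auto simp: nn_integral_cmult)
  also have "\<dots> \<le> ennreal s * ennreal (R * m) + ennreal (s powr (1 - p)) * ennreal (m powr (1 - p))"
    using le b_Lp by (intro add_mono mult_left_mono) (auto simp: emeasure_eq_measure intro!: ennreal_leI)
  also have "\<dots> = ennreal (s * (R * m) + s powr (1 - p) * m powr (1 - p))"
    using s R m_pos by (simp add: ennreal_mult[symmetric])
  also have "s * (R * m) + s powr (1 - p) * m powr (1 - p) = 2 * R powr (1 - 1 / p)"
  proof -
    have "s * (R * m) = R powr (- 1 / p) * R powr 1" using m_pos R by (simp add: s_def)
    also have "\<dots> = R powr (1 - 1 / p)" by (simp only: powr_add[symmetric]) (simp add: algebra_simps)
    finally have 1: "s * (R * m) = R powr (1 - 1 / p)" .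
    have "s powr (1 - p) * m powr (1 - p) = (s * m) powr (1 - p)" using s m_pos by (simp add: powr_mult)
    also have "s * m = R powr (- 1 / p)" using m_pos by (simp add: s_def)
    also have "(R powr (- 1 / p)) powr (1 - p) = R powr (1 - 1 / p)"
    proof -
      have "- 1 / p * (1 - p) = 1 - 1 / p" using p by (simp add: field_simps)
      then show ?thesis unfolding powr_powr by (simp only:)
    qed
    finally show ?thesis using 1 by simp
  qed
  finally show ?thesis .
qed

lemma b_L1: "(\<integral>\<^sup>+x. ennreal (norm (b x)) \<partial>\<gamma>) \<le> 2"
proof -
  have "(\<integral>\<^sup>+x. ennreal (norm (b x)) \<partial>\<gamma>) = (\<integral>\<^sup>+x. ennreal (norm (b x)) * indicator J x \<partial>\<gamma>)"
    using b_zero by (intro nn_integral_cong) (auto simp: indicator_def)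
  also have "\<dots> \<le> ennreal (2 * 1 powr (1 - 1 / p))" by (rule Holder[OF J_sets]) auto
  finally show ?thesis by simp
qed

lemma b_integrable: "integrable \<gamma> b"
  using b_L1 b_measurable by (intro integrableI_bounded) (auto intro: le_less_trans)

lemma norm_set_integral_le:
  "ennreal (norm (LINT x:A|\<gamma>. b x)) \<le> (\<integral>\<^sup>+x. ennreal (norm (b x)) * indicator A x \<partial>\<gamma>)"
proof (cases "integrable \<gamma> (\<lambda>x. indicator A x *\<^sub>R b x)")
  case True
  have "ennreal (norm (LINT x:A|\<gamma>. b x)) \<le> (\<integral>\<^sup>+x. ennreal (norm (indicator A x *\<^sub>R b x)) \<partial>\<gamma>)"
    unfolding set_lebesgue_integral_def by (rule integral_norm_bound_ennreal[OF True])
  also have "\<dots> = (\<integral>\<^sup>+x. ennreal (norm (b x)) * indicator A x \<partial>\<gamma>)"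
    by (intro nn_integral_cong) (auto simp: indicator_def)
  finally show ?thesis .
qed (simp add: set_lebesgue_integral_def not_integrable_integral_eq)

lemma norm_set_integral_le_2: "norm (LINT x:A|\<gamma>. b x) \<le> 2"
proof -
  have "ennreal (norm (LINT x:A|\<gamma>. b x)) \<le> (\<integral>\<^sup>+x. ennreal (norm (b x)) * indicator A x \<partial>\<gamma>)"
    by (rule norm_set_integral_le)
  also have "\<dots> \<le> (\<integral>\<^sup>+x. ennreal (norm (b x)) \<partial>\<gamma>)" by (intro nn_integral_mono) (auto simp: indicator_def)
  also have "\<dots> \<le> ennreal 2" using b_L1 by simp
  finally show ?thesis by (subst (asm) ennreal_le_iff) auto
qed

text \<open>From a point outside the supporting interval, each integral runs over none of
  \<open>b\<close> or over all of it, and \<open>b\<close> has mean zero.\<close>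

lemma set_integral_zero:
  assumes "y \<notin> J"
  shows "(LINT x:{0<..<y}|\<gamma>. b x) = 0" and "0 < y \<Longrightarrow> (LINT x:{y<..}|\<gamma>. b x) = 0"
proof -
  have full: "(LINT x:A|\<gamma>. b x) = 0" if "\<And>x. x \<in> J \<Longrightarrow> x \<in> A" for A
  proof -
    have "(LINT x:A|\<gamma>. b x) = (\<integral>x. b x \<partial>\<gamma>)"
      unfolding set_lebesgue_integral_def
      by (intro Bochner_Integration.integral_cong refl) (use that b_zero in \<open>auto simp: indicator_def\<close>)
    then show ?thesis by (simp add: b_mean)
  qed
  have none: "(LINT x:A|\<gamma>. b x) = 0" if "\<And>x. x \<in> J \<Longrightarrow> x \<notin> A" for A
  proof -
    have "(LINT x:A|\<gamma>. b x) = (\<integral>x. 0 \<partial>\<gamma>)"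
      unfolding set_lebesgue_integral_def
      by (intro Bochner_Integration.integral_cong refl) (use that b_zero in \<open>auto simp: indicator_def\<close>)
    then show ?thesis by simp
  qed
  consider "y \<le> x0 - r" | "x0 + r \<le> y" using assms by (auto simp: J_eq)
  then have *: "(LINT x:{0<..<y}|\<gamma>. b x) = 0 \<and> (LINT x:{y<..}|\<gamma>. b x) = 0"
  proof cases
    case 1 then show ?thesis by (intro conjI none full) (auto simp: J_eq)
  next
    case 2 then show ?thesis using r_le by (intro conjI none full) (auto simp: J_eq)
  qed
  then show "(LINT x:{0<..<y}|\<gamma>. b x) = 0" and "0 < y \<Longrightarrow> (LINT x:{y<..}|\<gamma>. b x) = 0" by auto
qed

lemma nn_integral_J: "0 \<le> c \<Longrightarrow> (\<integral>\<^sup>+ y. ennreal c * indicator J y \<partial>lborel) = ennreal (c * (2 * r))"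
  using r_pos by (subst nn_integral_cmult_indicator) (auto simp: J_eq ennreal_mult[symmetric])

text \<open>A bound 8 for the tail integral, 8 for intervals away from 0, and the integral of a
  power y^(-1/p) for intervals that reach down towards 0.\<close>

definition CE :: real where
  "CE = 16 + 2 * (4 * c1 * exp 8) powr (1 - 1 / p) / (1 - 1 / p)"

text \<open>Away from 0 the weight is bounded on the supporting interval, and length times weight is
  bounded because r and r x0 are at most 1, or because r is at most x0 / 2. Near 0 the weight 1/y is
  not integrable; there \<open>Holder\<close> gains a positive power of y.\<close>

lemma E_atom_le: "E_fun \<alpha> b \<le> ennreal CE"
proof -
  let ?\<epsilon> = "1 - 1 / p"
  have eps: "0 < ?\<epsilon>" using p by simp
  have pw0: "0 \<le> 2 * (4 * c1 * exp 8) powr ?\<epsilon> / ?\<epsilon>" using eps by simp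
  have 2: "(\<integral>\<^sup>+ y\<in>{1<..}. ennreal (y * norm (LINT x:{y<..}|\<gamma>. b x)) \<partial>lborel) \<le> ennreal 8"
  proof -
    have "(\<integral>\<^sup>+ y\<in>{1<..}. ennreal (y * norm (LINT x:{y<..}|\<gamma>. b x)) \<partial>lborel) \<le>
       (\<integral>\<^sup>+ y. ennreal ((x0 + r) * 2) * indicator J y \<partial>lborel)"
    proof (rule nn_integral_mono)
      fix y :: real
      show "ennreal (y * norm (LINT x:{y<..}|\<gamma>. b x)) * indicator {1<..} y \<le> ennreal ((x0 + r) * 2) * indicator J y"
      proof (cases "1 < y \<and> y \<in> J")
        case True
        then have "y * norm (LINT x:{y<..}|\<gamma>. b x) \<le> (x0 + r) * 2"
          using norm_set_integral_le_2 by (intro mult_mono) (auto simp: J_eq)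
        then show ?thesis using True by (simp add: ennreal_leI)
      next
        case False then show ?thesis using set_integral_zero(2)[of y] by (cases "1 < y") auto
      qed
    qed
    also have "\<dots> = ennreal ((x0 + r) * 2 * (2 * r))"
      using r_pos x0_pos by (intro nn_integral_J) simp
    also have "\<dots> \<le> ennreal 8"
    proof (rule ennreal_leI)
      have "(x0 + r) * 2 * (2 * r) = 4 * (r * x0) + 4 * (r * r)" by (simp add: algebra_simps)
      then show "(x0 + r) * 2 * (2 * r) \<le> 8" using r_x0 mult_le_one[OF r_le_1 _ r_le_1] r_pos by simp
    qed
    finally show ?thesis .
  qed
  have 1: "(\<integral>\<^sup>+ y\<in>{0<..<1}. ennreal (1 / y * norm (LINT x:{0<..<y}|\<gamma>. b x)) \<partial>lborel) \<le>
      ennreal (8 + 2 * (4 * c1 * exp 8) powr ?\<epsilon> / ?\<epsilon>)"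
  proof (cases "r \<le> x0 / 2")
    case True
    have "(\<integral>\<^sup>+ y\<in>{0<..<1}. ennreal (1 / y * norm (LINT x:{0<..<y}|\<gamma>. b x)) \<partial>lborel) \<le>
       (\<integral>\<^sup>+ y. ennreal (2 / x0 * 2) * indicator J y \<partial>lborel)"
    proof (rule nn_integral_mono)
      fix y :: real
      show "ennreal (1 / y * norm (LINT x:{0<..<y}|\<gamma>. b x)) * indicator {0<..<1} y \<le> ennreal (2 / x0 * 2) * indicator J y"
      proof (cases "y \<in> J")
        case y: True
        then have "x0 / 2 < y" using True by (auto simp: J_eq)
        then have "1 / y \<le> 2 / x0" using x0_pos by (simp add: field_simps)
        then have "1 / y * norm (LINT x:{0<..<y}|\<gamma>. b x) \<le> 2 / x0 * 2"
          using norm_set_integral_le_2 x0_pos by (intro mult_mono) auto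
        then show ?thesis using y by (auto simp: indicator_def intro: ennreal_leI)
      qed (simp add: set_integral_zero)
    qed
    also have "\<dots> = ennreal (2 / x0 * 2 * (2 * r))"
      using x0_pos by (intro nn_integral_J) simp
    also have "\<dots> \<le> ennreal (8 + 2 * (4 * c1 * exp 8) powr ?\<epsilon> / ?\<epsilon>)"
    proof (rule ennreal_leI)
      have "2 / x0 * 2 * (2 * r) \<le> 8" using True x0_pos by (simp add: field_simps)
      with pw0 show "2 / x0 * 2 * (2 * r) \<le> 8 + 2 * (4 * c1 * exp 8) powr ?\<epsilon> / ?\<epsilon>" by linarith
    qed
    finally show ?thesis .
  next
    case False
    \<comment> \<open>Chosen so that (0,y) has mass at most D y m: the density is at most c1 gd x0
      up to 2 x0, and \<open>m_ge\<close> with r > x0 / 2 bounds m from below.\<close>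
    define D where "D = 2 * c1 * exp 8 / x0"
    have D: "0 < D" using c1_pos x0_pos by (simp add: D_def)
    have bound: "norm (LINT x:{0<..<y}|\<gamma>. b x) \<le> 2 * (D * y) powr ?\<epsilon>" if y: "0 < y" "y < 2 * x0" for y
    proof -
      have "measure \<gamma> {0<..<y} \<le> (y - 0) * (c1 * gd x0)"
      proof (rule measure_interval_le)
        fix z assume z: "0 < z" "z < y"
        have "x0 / 2 * x0 \<le> 1" using False r_x0 x0_pos mult_right_mono[of "x0 / 2" r x0] by linarith
        then have "x0\<^sup>2 \<le> 8" by (simp add: power2_eq_square)
        then have "x0\<^sup>2 - z\<^sup>2 \<le> 8" using zero_le_power2[of z] by linarith
        then show "gd z \<le> c1 * gd x0" using z y x0_pos by (intro gd_upper) auto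
      qed (use y in auto)
      also have "(y - 0) * (c1 * gd x0) = D * y * (x0 / 2 * (exp (- 8) * gd x0))"
        using x0_pos by (simp add: D_def exp_minus field_simps)
      also have "\<dots> \<le> D * y * m"
      proof (rule mult_left_mono)
        have "x0 / 2 * (exp (- 8) * gd x0) \<le> r * (exp (- 8) * gd x0)"
          using False gd_nonneg[of x0] by (intro mult_right_mono) auto
        with m_ge show "x0 / 2 * (exp (- 8) * gd x0) \<le> m" by linarith
      qed (use D y in simp)
      finally have "(\<integral>\<^sup>+x. ennreal (norm (b x)) * indicator {0<..<y} x \<partial>\<gamma>) \<le> ennreal (2 * (D * y) powr ?\<epsilon>)"
        using D y by (intro Holder) (auto simp: sets_gamma_iff)
      with norm_set_integral_le[of "{0<..<y}"]
      have "ennreal (norm (LINT x:{0<..<y}|\<gamma>. b x)) \<le> ennreal (2 * (D * y) powr ?\<epsilon>)" by (rule order_trans)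
      then show ?thesis by simp
    qed
    have "(\<integral>\<^sup>+ y\<in>{0<..<1}. ennreal (1 / y * norm (LINT x:{0<..<y}|\<gamma>. b x)) \<partial>lborel) \<le>
       (\<integral>\<^sup>+ y. ennreal (2 * D powr ?\<epsilon>) * (ennreal (y powr (?\<epsilon> - 1)) * indicator {0..2 * x0} y) \<partial>lborel)"
    proof (rule nn_integral_mono)
      fix y :: real
      show "ennreal (1 / y * norm (LINT x:{0<..<y}|\<gamma>. b x)) * indicator {0<..<1} y \<le>
        ennreal (2 * D powr ?\<epsilon>) * (ennreal (y powr (?\<epsilon> - 1)) * indicator {0..2 * x0} y)"
      proof (cases "y \<in> J")
        case True
        then have y: "0 < y" "y < 2 * x0" using r_le by (auto simp: J_eq)
        have "1 / y * norm (LINT x:{0<..<y}|\<gamma>. b x) \<le> 1 / y * (2 * (D * y) powr ?\<epsilon>)"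
          using bound[OF y] y by (intro mult_left_mono) auto
        also have "\<dots> = 2 * D powr ?\<epsilon> * (y powr ?\<epsilon> / y)" using D y by (simp add: powr_mult)
        also have "y powr ?\<epsilon> / y = y powr (?\<epsilon> - 1)"
          using y powr_diff[of y ?\<epsilon> 1] by simp
        finally have "1 / y * norm (LINT x:{0<..<y}|\<gamma>. b x) \<le> 2 * D powr ?\<epsilon> * y powr (?\<epsilon> - 1)" .
        then have "ennreal (1 / y * norm (LINT x:{0<..<y}|\<gamma>. b x)) \<le> ennreal (2 * D powr ?\<epsilon>) * ennreal (y powr (?\<epsilon> - 1))"
          by (subst ennreal_mult[symmetric]) (auto intro!: ennreal_leI)
        then show ?thesis using y by (simp add: indicator_def)
      qed (simp add: set_integral_zero)
    qed
    also have "\<dots> = ennreal (2 * D powr ?\<epsilon>) * (\<integral>\<^sup>+ y. ennreal (y powr (?\<epsilon> - 1)) * indicator {0..2 * x0} y \<partial>lborel)"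
      by (rule nn_integral_cmult) measurable
    also have "(\<integral>\<^sup>+ y. ennreal (y powr (?\<epsilon> - 1)) * indicator {0..2 * x0} y \<partial>lborel) = ennreal ((2 * x0) powr ?\<epsilon> / ?\<epsilon>)"
      using has_integral_powr_from_0[of "?\<epsilon> - 1" "2 * x0"] eps x0_pos
      by (intro nn_integral_has_integral_lebesgue') auto
    also have "ennreal (2 * D powr ?\<epsilon>) * ennreal ((2 * x0) powr ?\<epsilon> / ?\<epsilon>) = ennreal (2 * (D powr ?\<epsilon> * (2 * x0) powr ?\<epsilon>) / ?\<epsilon>)"
      using eps by (subst ennreal_mult[symmetric]) auto
    also have "D powr ?\<epsilon> * (2 * x0) powr ?\<epsilon> = (4 * c1 * exp 8) powr ?\<epsilon>"
    proof -
      have dd: "D * (2 * x0) = 4 * c1 * exp 8" using x0_pos by (simp add: D_def)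
      have "(D * (2 * x0)) powr ?\<epsilon> = D powr ?\<epsilon> * (2 * x0) powr ?\<epsilon>"
        by (rule powr_mult)
      then show ?thesis unfolding dd by (rule sym)
    qed
    also have "ennreal (2 * (4 * c1 * exp 8) powr ?\<epsilon> / ?\<epsilon>) \<le> ennreal (8 + 2 * (4 * c1 * exp 8) powr ?\<epsilon> / ?\<epsilon>)"
      by (intro ennreal_leI) simp
    finally show ?thesis .
  qed
  have "E_fun \<alpha> b \<le> ennreal (8 + 2 * (4 * c1 * exp 8) powr ?\<epsilon> / ?\<epsilon>) + ennreal 8"
    unfolding E_fun_def using 1 2 by (rule add_mono)
  also have "\<dots> = ennreal CE" unfolding CE_def using pw0 by (subst ennreal_plus[symmetric]) auto
  finally show ?thesis .
qed

end

section \<open>The maximal function of an atom\<close>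

context gamma_setting begin

text \<open>Variation of the density within tau-distance 4.\<close>

definition c2 :: real where "c2 = exp (4 * \<beta>)"

lemma c2_ge: "1 \<le> c2" using beta by (simp add: c2_def)

text \<open>Vitali's lemma enlarges balls five times, hence 5 t. As t is at most x / 8, all points
  stay between 3 x / 8 and 13 x / 8, where \<open>v\<close> is at most 8/3 times \<open>v x\<close>;
  and 5 / (4 v) times 8 v / 3 is below 4.\<close>

lemma tau_dist:
  assumes x: "0 < x" and t: "t \<le> w_fun x" and y: "\<bar>y - x\<bar> \<le> 5 * t"
  shows "0 < y" "\<bar>\<tau> x - \<tau> y\<bar> \<le> 4"
proof -
  note w = w_bounds[OF x]
  note vx = v_pos[OF x]
  have d: "\<bar>y - x\<bar> \<le> 5 / 8 * x" using y t w(3) by linarith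
  then show y0: "0 < y" using x by linarith
  have main: "\<bar>\<tau> A - \<tau> B\<bar> \<le> 4" if AB: "A < B" "0 < A" "3 / 8 * x \<le> A" "B \<le> 13 / 8 * x" "B - A \<le> 5 * t" for A B
  proof -
    obtain z where z: "A < z" "z < B" "\<tau> B - \<tau> A = (B - A) * v z" using tau_MVT[OF AB(2,1)] by blast
    have z0: "0 < z" using z AB by linarith
    have "z \<le> 8 / 3 * x" using z AB x by linarith
    moreover have "1 / z \<le> 8 / 3 * (1 / x)"
    proof -
      have "3 / 8 * x \<le> z" using z AB by linarith
      then show ?thesis using z0 x by (simp add: field_simps)
    qed
    ultimately have vz: "v z \<le> 8 / 3 * v x" by (simp add: v_def algebra_simps)
    have "(B - A) * v z \<le> (5 * (1 / (4 * v x))) * (8 / 3 * v x)"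
      using AB t w(2) vz v_pos[OF z0] by (intro mult_mono) auto
    also have "\<dots> \<le> 4" using vx by simp
    finally have "(B - A) * v z \<le> 4" .
    moreover have "0 \<le> (B - A) * v z" using v_pos[OF z0] AB by simp
    ultimately show ?thesis using z(3) by linarith
  qed
  consider "x = y" | "x < y" | "y < x" by linarith
  then show "\<bar>\<tau> x - \<tau> y\<bar> \<le> 4"
  proof cases
    case 2 then show ?thesis using main[of x y] x d y by linarith
  next
    case 3 then show ?thesis using main[of y x] x d y y0 by linarith
  qed simp
qed

lemma gd_near:
  assumes "0 < x" "t \<le> w_fun x" "\<bar>y - x\<bar> \<le> 5 * t"
  shows "gd y \<le> c2 * gd x" "gd x \<le> c2 * gd y" "v y \<le> exp 4 * v x"
  using compare[of x y 4] compare[of y x 4] tau_dist[OF assms] assms(1)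
  by (simp_all add: c2_def abs_minus_commute mult.commute)

lemma ball_measure:
  assumes x: "0 < x" and t: "t \<le> w_fun x" and s: "0 \<le> s" "s \<le> 5 * t"
  shows "ball x s \<in> sets \<gamma>" "measure \<gamma> (ball x s) \<le> 2 * s * (c2 * gd x)" "2 * s * gd x \<le> c2 * measure \<gamma> (ball x s)"
proof -
  have eq: "ball x s = {x - s<..<x + s}" by (auto simp: ball_def dist_real_def)
  have pos: "0 \<le> x - s" using s t w_bounds(3)[OF x] x by linarith
  show "ball x s \<in> sets \<gamma>" using pos by (auto simp: eq sets_gamma_iff)
  have c: "gd y \<le> c2 * gd x" "gd x / c2 \<le> gd y" if "x - s < y" "y < x + s" for y
    using gd_near[OF x t, of y] that s c2_ge by (auto simp: pos_divide_le_eq mult.commute)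
  have "measure \<gamma> {x - s<..<x + s} \<le> (x + s - (x - s)) * (c2 * gd x)"
    using pos s c by (intro measure_interval_le) auto
  then show "measure \<gamma> (ball x s) \<le> 2 * s * (c2 * gd x)" by (simp add: eq)
  have "(x + s - (x - s)) * (gd x / c2) \<le> measure \<gamma> {x - s<..<x + s}"
    using pos s c gd_nonneg[of x] c2_ge by (intro measure_interval_ge) auto
  then have "2 * s * gd x / c2 \<le> measure \<gamma> (ball x s)" by (simp add: eq)
  then show "2 * s * gd x \<le> c2 * measure \<gamma> (ball x s)" using c2_ge by (simp add: pos_divide_le_eq mult.commute)
qed

text \<open>Superlevel set of a centred maximal function with radii up to w(x), written without
  division.\<close>

definition weak_set :: "(real \<Rightarrow> ennreal) \<Rightarrow> real \<Rightarrow> real set" where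
  "weak_set u s = {x. 0 < x \<and> (\<exists>t>0. t \<le> w_fun x \<and>
     ennreal s * emeasure \<gamma> (ball x t) < (\<integral>\<^sup>+y. u y * indicator (ball x t) y \<partial>\<gamma>))}"

text \<open>By Vitali's covering lemma.\<close>

lemma weak_type:
  assumes u [measurable]: "u \<in> borel_measurable \<gamma>" and s: "0 < s"
  shows "\<exists>U\<in>sets \<gamma>. weak_set u s \<subseteq> U \<and> ennreal s * emeasure \<gamma> U \<le> ennreal (5 * c2\<^sup>2) * (\<integral>\<^sup>+y. u y \<partial>\<gamma>)"
proof -
  let ?S = "weak_set u s"
  let ?P = "\<lambda>x t. 0 < t \<and> t \<le> w_fun x \<and> ennreal s * emeasure \<gamma> (ball x t) < (\<integral>\<^sup>+y. u y * indicator (ball x t) y \<partial>\<gamma>)"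
  have "\<forall>x\<in>?S. \<exists>t. ?P x t" by (auto simp: weak_set_def)
  then obtain T where T: "\<And>x. x \<in> ?S \<Longrightarrow> ?P x (T x)" using bchoice[of ?S ?P] by blast
  have S0: "0 < x" if "x \<in> ?S" for x using that by (simp add: weak_set_def)
  have Tb: "0 < T x \<and> T x \<le> 1" if "x \<in> ?S" for x
  proof -
    have "w_fun x \<le> 1"
    proof (cases "x \<le> 1")
      case True then show ?thesis using w_bounds(3)[OF S0[OF that]] S0[OF that] by linarith
    next
      case False
      then have "min x (1 / x) \<le> 1" by (simp add: min_le_iff_disj)
      then show ?thesis by (simp add: w_fun_def)
    qed
    then show ?thesis using T[OF that] by auto
  qed
  have cov: "?S \<subseteq> (\<Union>x\<in>?S. ball x (T x))" using Tb by force
  obtain C where C: "countable C" "C \<subseteq> ?S"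
    and disj: "pairwise (\<lambda>i j. disjnt (ball i (T i)) (ball j (T j))) C"
    and sub: "?S \<subseteq> (\<Union>i\<in>C. ball i (5 * T i))"
    using Vitali_covering_lemma_balls[OF cov Tb] by blast
  have bs: "ball i (T i) \<in> sets \<gamma>" "ball i (5 * T i) \<in> sets \<gamma>" if "i \<in> C" for i
    using that C(2) T[of i] S0[of i] by (auto intro!: ball_measure(1)[of i "T i"])
  have double: "emeasure \<gamma> (ball i (5 * T i)) \<le> ennreal (5 * c2\<^sup>2) * emeasure \<gamma> (ball i (T i))" if "i \<in> C" for i
  proof -
    have i: "0 < i" "T i \<le> w_fun i" "0 < T i" using that C(2) T[of i] S0[of i] by auto
    have "measure \<gamma> (ball i (5 * T i)) \<le> 2 * (5 * T i) * (c2 * gd i)"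
      using i by (intro ball_measure(2)) auto
    also have "\<dots> = 5 * c2 * (2 * T i * gd i)" by simp
    also have "\<dots> \<le> 5 * c2 * (c2 * measure \<gamma> (ball i (T i)))"
      using i c2_ge by (intro mult_left_mono ball_measure(3)[of _ "T i"]) auto
    finally have "measure \<gamma> (ball i (5 * T i)) \<le> 5 * c2\<^sup>2 * measure \<gamma> (ball i (T i))"
      by (simp add: power2_eq_square)
    then show ?thesis
      by (simp add: emeasure_eq_measure ennreal_mult[symmetric] ennreal_leI)
  qed
  let ?U = "\<Union>i\<in>C. ball i (5 * T i)"
  have U: "?U \<in> sets \<gamma>" using C(1) bs by (intro sets.countable_UN') auto
  have "ennreal s * emeasure \<gamma> ?U = ennreal s * (\<integral>\<^sup>+x. indicator ?U x \<partial>\<gamma>)" using U by simp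
  \<comment> \<open>A sum over the countable family is treated as an integral for counting measure,
    which permits exchanging it with the integral over x.\<close>
  also have "\<dots> \<le> ennreal s * (\<integral>\<^sup>+x. \<integral>\<^sup>+i. indicator (ball i (5 * T i)) x \<partial>count_space C \<partial>\<gamma>)"
  proof (intro mult_left_mono nn_integral_mono)
    fix x
    show "indicator ?U x \<le> (\<integral>\<^sup>+i. indicator (ball i (5 * T i)) x \<partial>count_space C)"
    proof (cases "x \<in> ?U")
      case True
      then obtain i where i: "i \<in> C" "x \<in> ball i (5 * T i)" by blast
      have "indicator (ball i (5 * T i)) x \<le> (\<integral>\<^sup>+i. indicator (ball i (5 * T i)) x \<partial>count_space C)"
        by (rule nn_integral_ge_point[OF i(1)])
      then show ?thesis using i True by (simp add: indicator_def)
    qed simp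
  qed simp
  also have "(\<integral>\<^sup>+x. \<integral>\<^sup>+i. indicator (ball i (5 * T i)) x \<partial>count_space C \<partial>\<gamma>) =
      (\<integral>\<^sup>+i. \<integral>\<^sup>+x. indicator (ball i (5 * T i)) x \<partial>\<gamma> \<partial>count_space C)"
    using C(1) bs by (intro nn_integral_count_space_nn_integral borel_measurable_indicator) auto
  also have "\<dots> = (\<integral>\<^sup>+i. emeasure \<gamma> (ball i (5 * T i)) \<partial>count_space C)"
    using bs by (intro nn_integral_cong) simp
  also have "ennreal s * \<dots> = (\<integral>\<^sup>+i. ennreal s * emeasure \<gamma> (ball i (5 * T i)) \<partial>count_space C)"
    by (rule nn_integral_cmult[symmetric]) simp
  also have "\<dots> \<le> (\<integral>\<^sup>+i. ennreal (5 * c2\<^sup>2) * (\<integral>\<^sup>+x. u x * indicator (ball i (T i)) x \<partial>\<gamma>) \<partial>count_space C)"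
  proof (rule nn_integral_mono)
    fix i assume "i \<in> space (count_space C)"
    then have i: "i \<in> C" by simp
    have "ennreal s * emeasure \<gamma> (ball i (5 * T i)) \<le> ennreal s * (ennreal (5 * c2\<^sup>2) * emeasure \<gamma> (ball i (T i)))"
      by (intro mult_left_mono double i) simp
    also have "\<dots> = ennreal (5 * c2\<^sup>2) * (ennreal s * emeasure \<gamma> (ball i (T i)))" by (simp add: mult_ac)
    also have "\<dots> \<le> ennreal (5 * c2\<^sup>2) * (\<integral>\<^sup>+x. u x * indicator (ball i (T i)) x \<partial>\<gamma>)"
      using T[of i] i C(2) by (intro mult_left_mono) (auto intro: less_imp_le)
    finally show "ennreal s * emeasure \<gamma> (ball i (5 * T i)) \<le> ennreal (5 * c2\<^sup>2) * (\<integral>\<^sup>+x. u x * indicator (ball i (T i)) x \<partial>\<gamma>)" .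
  qed
  also have "\<dots> = ennreal (5 * c2\<^sup>2) * (\<integral>\<^sup>+i. \<integral>\<^sup>+x. u x * indicator (ball i (T i)) x \<partial>\<gamma> \<partial>count_space C)"
    by (rule nn_integral_cmult) simp
  also have "(\<integral>\<^sup>+i. \<integral>\<^sup>+x. u x * indicator (ball i (T i)) x \<partial>\<gamma> \<partial>count_space C) =
      (\<integral>\<^sup>+x. \<integral>\<^sup>+i. u x * indicator (ball i (T i)) x \<partial>count_space C \<partial>\<gamma>)"
    using C(1) bs by (intro nn_integral_count_space_nn_integral[symmetric] borel_measurable_times borel_measurable_indicator u) auto
  also have "\<dots> \<le> (\<integral>\<^sup>+x. u x \<partial>\<gamma>)"
  proof (rule nn_integral_mono)
    fix x
    show "(\<integral>\<^sup>+i. u x * indicator (ball i (T i)) x \<partial>count_space C) \<le> u x"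
    proof (cases "\<exists>i\<in>C. x \<in> ball i (T i)")
      case True
      then obtain i where i: "i \<in> C" "x \<in> ball i (T i)" by blast
      have "(\<integral>\<^sup>+j. u x * indicator (ball j (T j)) x \<partial>count_space C) = (\<integral>\<^sup>+j. u x * indicator {i} j \<partial>count_space C)"
      proof (rule nn_integral_cong)
        fix j assume "j \<in> space (count_space C)"
        then have j: "j \<in> C" by simp
        show "u x * indicator (ball j (T j)) x = u x * indicator {i} j"
        proof (cases "j = i")
          case False
          with disj i j have "disjnt (ball j (T j)) (ball i (T i))" by (auto simp: pairwise_def)
          with i False show ?thesis by (auto simp: disjnt_iff indicator_def)
        qed (use i in simp)
      qed
      also have "\<dots> = u x * emeasure (count_space C) {i}"
        using i by (intro nn_integral_cmult_indicator) auto
      also have "\<dots> = u x" using i by (simp add: emeasure_count_space)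
      finally show ?thesis by simp
    next
      case False
      then have "(\<integral>\<^sup>+i. u x * indicator (ball i (T i)) x \<partial>count_space C) = (\<integral>\<^sup>+i. 0 \<partial>count_space C)"
        by (intro nn_integral_cong) (auto simp: indicator_def)
      then show ?thesis by simp
    qed
  qed
  finally have "ennreal s * emeasure \<gamma> ?U \<le> ennreal (5 * c2\<^sup>2) * (\<integral>\<^sup>+x. u x \<partial>\<gamma>)"
    by (simp add: mult_left_mono)
  with U sub show ?thesis by blast
qed

end

section \<open>Convolutions and local averages\<close>

context gamma_grid begin

lemma a_w_less:
  assumes "0 < x" "t < a * w_fun x"
  shows "t \<le> w_fun x" "t < x"
proof -
  have "a * w_fun x \<le> 1 * w_fun x" using a_le_1 w_bounds(4)[OF assms(1)] by (intro mult_right_mono) auto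
  then show "t \<le> w_fun x" "t < x" using assms w_bounds(3)[OF assms(1)] by auto
qed

lemma dilate_bound:
  assumes \<phi>: "\<phi> \<in> test_functions" and t: "0 < t"
  shows "norm (dilate t \<phi> z) \<le> 1 / t" "t \<le> \<bar>z\<bar> \<Longrightarrow> dilate t \<phi> z = 0"
    "norm (dilate t \<phi> z - dilate t \<phi> y) \<le> \<bar>z - y\<bar> / t\<^sup>2"
proof -
  show "norm (dilate t \<phi> z) \<le> 1 / t"
    using t test_functionD(2)[OF \<phi>, of "z / t"] by (simp add: dilate_def norm_mult norm_divide divide_right_mono)
  show "dilate t \<phi> z = 0" if "t \<le> \<bar>z\<bar>"
  proof -
    have "1 \<le> \<bar>z / t\<bar>" using that t by (simp add: abs_divide)
    then show ?thesis using test_functionD(3)[OF \<phi>] by (simp add: dilate_def)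
  qed
  have "norm (dilate t \<phi> z - dilate t \<phi> y) = 1 / t * norm (\<phi> (z / t) - \<phi> (y / t))"
    using t unfolding dilate_def right_diff_distrib[symmetric] norm_mult by (simp add: norm_divide)
  also have "\<dots> \<le> 1 / t * \<bar>z / t - y / t\<bar>"
    using t by (intro mult_left_mono test_functionD(4)[OF \<phi>]) auto
  also have "\<dots> = \<bar>z - y\<bar> / t\<^sup>2"
    using t by (simp add: diff_divide_distrib[symmetric] abs_divide power2_eq_square)
  finally show "norm (dilate t \<phi> z - dilate t \<phi> y) \<le> \<bar>z - y\<bar> / t\<^sup>2" .
qed

text \<open>The kernel is at most 1/t, the density on the ball is comparable to gd x, and the mass
  of the ball is comparable to 2 t gd x. Multiplying by this mass avoids a division of extended
  reals.\<close>

lemma conv_le_average: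
  assumes f: "f \<in> borel_measurable \<gamma>" and x: "0 < x" and \<phi>: "\<phi> \<in> test_functions"
    and t: "0 < t" "t < a * w_fun x"
  shows "ennreal (norm (fun_conv (dilate t \<phi>) f x)) * emeasure \<gamma> (ball x t)
    \<le> ennreal (2 * c2\<^sup>2) * (\<integral>\<^sup>+y. ennreal (norm (f y)) * indicator (ball x t) y \<partial>\<gamma>)"
proof -
  note tw = a_w_less[OF x t(2)]
  note g = gd_pos[OF x]
  note bm = ball_measure[OF x tw(1), of t]
  let ?I = "\<integral>\<^sup>+y. ennreal (norm (f y)) * indicator (ball x t) y \<partial>\<gamma>"
  have um: "(\<lambda>y. ennreal (norm (f y)) * indicator (ball x t) y) \<in> borel_measurable \<gamma>"
  proof -
    have [measurable]: "ball x t \<in> sets \<gamma>" using bm(1) t by simp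
    note [measurable] = f
    show ?thesis by measurable
  qed
  have 1: "ennreal (norm (fun_conv (dilate t \<phi>) f x)) \<le> (\<integral>\<^sup>+y. ennreal (norm (dilate t \<phi> (x - y) * f y)) \<partial>lborel)"
  proof (cases "integrable lborel (\<lambda>y. dilate t \<phi> (x - y) * f y)")
    case True then show ?thesis unfolding fun_conv_def by (rule integral_norm_bound_ennreal)
  qed (simp add: fun_conv_def not_integrable_integral_eq)
  also have "\<dots> \<le> (\<integral>\<^sup>+y. ennreal (gd y) * (ennreal (c2 / (t * gd x)) * (ennreal (norm (f y)) * indicator (ball x t) y)) * indicator {0<..} y \<partial>lborel)"
  proof (rule nn_integral_mono)
    fix y
    show "ennreal (norm (dilate t \<phi> (x - y) * f y)) \<le>
      ennreal (gd y) * (ennreal (c2 / (t * gd x)) * (ennreal (norm (f y)) * indicator (ball x t) y)) * indicator {0<..} y"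
    proof (cases "\<bar>x - y\<bar> < t")
      case True
      then have y: "\<bar>y - x\<bar> \<le> 5 * t" "y \<in> ball x t" using t by (auto simp: dist_real_def)
      note y0 = tau_dist(1)[OF x tw(1) y(1)]
      have "1 \<le> gd y * (c2 / gd x)" using gd_near(2)[OF x tw(1) y(1)] g by (simp add: field_simps)
      then have "1 / t \<le> gd y * (c2 / gd x) / t" using t by (intro divide_right_mono) auto
      then have "norm (dilate t \<phi> (x - y)) \<le> gd y * (c2 / (t * gd x))"
        using dilate_bound(1)[OF \<phi> t(1), of "x - y"] by (simp add: mult.commute)
      then have "norm (dilate t \<phi> (x - y) * f y) \<le> gd y * (c2 / (t * gd x)) * norm (f y)"
        unfolding norm_mult by (rule mult_right_mono) simp
      then have "ennreal (norm (dilate t \<phi> (x - y) * f y)) \<le> ennreal (gd y * (c2 / (t * gd x)) * norm (f y))"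
        by (rule ennreal_leI)
      also have "\<dots> = ennreal (gd y) * (ennreal (c2 / (t * gd x)) * ennreal (norm (f y)))"
      proof -
        have "0 \<le> c2 / (t * gd x)" using g t c2_ge by simp
        then show ?thesis by (simp only: mult.assoc ennreal_mult gd_nonneg norm_ge_zero mult_nonneg_nonneg)
      qed
      finally show ?thesis using y y0 by simp
    next
      case False
      then show ?thesis using dilate_bound(2)[OF \<phi> t(1), of "x - y"] by simp
    qed
  qed
  also have "\<dots> = (\<integral>\<^sup>+y. ennreal (c2 / (t * gd x)) * (ennreal (norm (f y)) * indicator (ball x t) y) \<partial>\<gamma>)"
    using um by (intro nn_integral_gamma[symmetric] borel_measurable_times) auto
  also have "\<dots> = ennreal (c2 / (t * gd x)) * ?I"
    by (rule nn_integral_cmult[OF um])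
  finally have "ennreal (norm (fun_conv (dilate t \<phi>) f x)) * emeasure \<gamma> (ball x t) \<le>
     (ennreal (c2 / (t * gd x)) * ?I) * ennreal (2 * t * (c2 * gd x))"
    using bm(2) t by (intro mult_mono) (auto simp: emeasure_eq_measure intro!: ennreal_leI)
  also have "\<dots> = (ennreal (c2 / (t * gd x)) * ennreal (2 * t * (c2 * gd x))) * ?I"
    by (simp only: mult_ac)
  also have "ennreal (c2 / (t * gd x)) * ennreal (2 * t * (c2 * gd x)) = ennreal (2 * c2\<^sup>2)"
    using t g c2_ge by (subst ennreal_mult[symmetric]) (auto simp: power2_eq_square)
  finally show ?thesis .
qed

text \<open>Contrapositive of \<open>conv_le_average\<close> for a test function that nearly attains
  the supremum.\<close>

lemma maximal_weak_set:
  assumes f: "f \<in> borel_measurable \<gamma>" and x: "0 < x" and s: "0 < s"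
    and M: "ennreal (2 * c2\<^sup>2 * s) < local_maximal a f x"
  shows "x \<in> weak_set (\<lambda>y. ennreal (norm (f y))) s"
proof -
  from M obtain \<phi> t where \<phi>: "\<phi> \<in> test_functions" and t: "0 < t" "t < a * w_fun x"
    and lt: "ennreal (2 * c2\<^sup>2 * s) < ennreal (norm (fun_conv (dilate t \<phi>) f x))"
    by (auto simp: local_maximal_def less_Sup_iff)
  note tw = a_w_less[OF x t(2)]
  let ?m = "measure \<gamma> (ball x t)"
  let ?I = "\<integral>\<^sup>+y. ennreal (norm (f y)) * indicator (ball x t) y \<partial>\<gamma>"
  have m: "0 < ?m"
  proof -
    have "0 < 2 * t * gd x" using t gd_pos[OF x] by simp
    also have "\<dots> \<le> c2 * ?m" using t by (intro ball_measure(3)[OF x tw(1)]) auto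
    finally show ?thesis using c2_ge by (simp add: zero_less_mult_iff)
  qed
  have lt': "2 * c2\<^sup>2 * s < norm (fun_conv (dilate t \<phi>) f x)"
    using lt s c2_ge by (subst (asm) ennreal_less_iff) auto
  have "ennreal s * emeasure \<gamma> (ball x t) < ?I"
  proof (rule ccontr)
    assume "\<not> ?thesis"
    then have le: "?I \<le> ennreal (s * ?m)" using s by (simp add: not_less emeasure_eq_measure ennreal_mult)
    have "ennreal (norm (fun_conv (dilate t \<phi>) f x) * ?m) = ennreal (norm (fun_conv (dilate t \<phi>) f x)) * emeasure \<gamma> (ball x t)"
      by (simp add: emeasure_eq_measure ennreal_mult)
    also have "\<dots> \<le> ennreal (2 * c2\<^sup>2) * ?I" by (rule conv_le_average[OF f x \<phi> t])
    also have "\<dots> \<le> ennreal (2 * c2\<^sup>2) * ennreal (s * ?m)" using le by (rule mult_left_mono) simp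
    also have "\<dots> = ennreal (2 * c2\<^sup>2 * s * ?m)" using s by (subst ennreal_mult[symmetric]) (auto simp: mult.assoc)
    finally have "norm (fun_conv (dilate t \<phi>) f x) * ?m \<le> 2 * c2\<^sup>2 * s * ?m" using s by (subst (asm) ennreal_le_iff) auto
    then have "norm (fun_conv (dilate t \<phi>) f x) \<le> 2 * c2\<^sup>2 * s" using m by simp
    with lt' show False by simp
  qed
  then show ?thesis using x t tw by (auto simp: weak_set_def)
qed

text \<open>A larger value would put \<open>x\<close> into a set where some average of the constant
  1 exceeds 1.\<close>

lemma maximal_one_le: "0 < x \<Longrightarrow> local_maximal a (\<lambda>_. 1) x \<le> ennreal (2 * c2\<^sup>2)"
proof (rule ccontr)
  assume x: "0 < x" and "\<not> ?thesis"
  then have "ennreal (2 * c2\<^sup>2 * 1) < local_maximal a (\<lambda>_. 1) x" by (simp add: not_le)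
  from maximal_weak_set[OF _ x _ this] have "x \<in> weak_set (\<lambda>y. ennreal (norm (1::complex))) 1" by simp
  then obtain t where t: "t \<le> w_fun x" "0 < t"
    and lt: "ennreal 1 * emeasure \<gamma> (ball x t) < (\<integral>\<^sup>+y. ennreal (norm (1::complex)) * indicator (ball x t) y \<partial>\<gamma>)"
    by (auto simp: weak_set_def)
  have "ball x t \<in> sets \<gamma>" using t by (intro ball_measure(1)[OF x t(1)]) auto
  with lt show False by simp
qed

end

text \<open>As long as s 2^n is below R, the n-th term supplies what doubling requires, so the
  minimum of R and s 2^n is dominated by the first n terms. Letting n grow also covers infinite
  R.\<close>

lemma dyadic_layer_cake:
  fixes s :: real and R :: ennreal
  assumes s: "0 < s"
  shows "R \<le> ennreal s + (\<Sum>k. ennreal (s * 2 ^ k) * indicator {t. ennreal (s * 2 ^ k) < t} R)"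
proof -
  let ?f = "\<lambda>k. ennreal (s * 2 ^ k) * indicator {t. ennreal (s * 2 ^ k) < t} R"
  have fin: "min R (ennreal (s * 2 ^ n)) \<le> ennreal s + (\<Sum>k<n. ?f k)" for n
  proof (induction n)
    case (Suc n)
    show ?case
    proof (cases "ennreal (s * 2 ^ n) < R")
      case True
      have "ennreal (s * 2 ^ Suc n) = ennreal (s * 2 ^ n) + ennreal (s * 2 ^ n)"
        using s by (simp add: ennreal_plus[symmetric] del: ennreal_plus)
      also have "\<dots> \<le> (ennreal s + (\<Sum>k<n. ?f k)) + ennreal (s * 2 ^ n)"
        using Suc True by (intro add_right_mono) (simp add: min_def split: if_splits)
      finally have "ennreal (s * 2 ^ Suc n) \<le> ennreal s + (\<Sum>k<Suc n. ?f k)"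
        using True by (simp add: add.assoc)
      then show ?thesis by (rule min.coboundedI2)
    next
      case False
      then have "R \<le> ennreal s + (\<Sum>k<n. ?f k)" using Suc by (simp add: min_def not_less split: if_splits)
      also have "\<dots> \<le> ennreal s + (\<Sum>k<Suc n. ?f k)" by (intro add_left_mono) simp
      finally show ?thesis by (rule min.coboundedI1)
    qed
  qed simp
  have le: "min R (ennreal (s * 2 ^ n)) \<le> ennreal s + (\<Sum>k. ?f k)" for n
    using fin[of n] by (rule order_trans) (intro add_left_mono sum_le_suminf, auto)
  show ?thesis
  proof (rule ccontr)
    assume "\<not> ?thesis"
    then have lt: "ennreal s + (\<Sum>k. ?f k) < R" by (simp add: not_le)
    then have "ennreal s + (\<Sum>k. ?f k) < top" by (rule less_le_trans) simp
    then obtain c where c: "ennreal s + (\<Sum>k. ?f k) = ennreal c" "0 \<le> c" unfolding less_top_ennreal by blast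
    obtain n where n: "c / s < 2 ^ n" using real_arch_pow[of 2 "c / s"] by auto
    then have "c < s * 2 ^ n" using s by (simp add: field_simps)
    then have "ennreal c < ennreal (s * 2 ^ n)" using c by (simp add: ennreal_less_iff)
    then have "ennreal c < min R (ennreal (s * 2 ^ n))" using lt c by simp
    moreover have "min R (ennreal (s * 2 ^ n)) \<le> ennreal c" using le[of n] unfolding c(1) .
    ultimately show False using leD by blast
  qed
qed

context gamma_setting begin

text \<open>The first term stems from the variation of the bump, the second from that of 1/gd, where
  three densities are compared with gd x.\<close>

definition c3 :: real where "c3 = c2 + \<beta> * exp 4 * c2 ^ 3"

lemma c3_pos: "0 < c3"
  using c2_ge beta by (simp add: c3_def add_pos_nonneg)

end

section \<open>Size and smoothness of the convolution kernel\<close>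

context gamma_grid begin

text \<open>Atoms have mean zero for gamma_alpha, so the convolution is rewritten against that
  measure; the density moves into the kernel.\<close>

lemma conv_eq_gamma:
  assumes f [measurable]: "f \<in> borel_measurable \<gamma>" and x: "0 < x" and \<phi>: "\<phi> \<in> test_functions"
    and t: "0 < t" "t < a * w_fun x"
  shows "fun_conv (dilate t \<phi>) f x = (\<integral>y. dilate t \<phi> (x - y) / of_real (gd y) * f y \<partial>\<gamma>)"
    and "(\<lambda>y. dilate t \<phi> (x - y) / of_real (gd y)) \<in> borel_measurable \<gamma>"
proof -
  have [measurable]: "\<phi> \<in> borel_measurable borel" by (rule test_function_measurable[OF \<phi>])
  have "(\<lambda>y. dilate t \<phi> (x - y) / of_real (gd y)) \<in> borel_measurable borel"
    unfolding dilate_def by measurable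
  then show km [measurable]: "(\<lambda>y. dilate t \<phi> (x - y) / of_real (gd y)) \<in> borel_measurable \<gamma>"
    by (rule measurable_gammaI)
  have "(\<integral>y. dilate t \<phi> (x - y) / of_real (gd y) * f y \<partial>\<gamma>) =
    (\<integral>y. indicator {0<..} y *\<^sub>R (gd y *\<^sub>R (dilate t \<phi> (x - y) / of_real (gd y) * f y)) \<partial>lborel)"
    by (rule integral_gamma(1)) measurable
  also have "\<dots> = (\<integral>y. dilate t \<phi> (x - y) * f y \<partial>lborel)"
  proof (rule Bochner_Integration.integral_cong[OF refl])
    fix y :: real
    show "indicator {0<..} y *\<^sub>R (gd y *\<^sub>R (dilate t \<phi> (x - y) / of_real (gd y) * f y)) = dilate t \<phi> (x - y) * f y"
    proof (cases "0 < y")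
      case True then show ?thesis using gd_pos[OF True] by (simp add: scaleR_conv_of_real)
    next
      case False
      then have "t \<le> \<bar>x - y\<bar>" using a_w_less(2)[OF x t(2)] by simp
      then show ?thesis using False dilate_bound(2)[OF \<phi> t(1)] by simp
    qed
  qed
  finally show "fun_conv (dilate t \<phi>) f x = (\<integral>y. dilate t \<phi> (x - y) / of_real (gd y) * f y \<partial>\<gamma>)"
    by (simp add: fun_conv_def)
qed

lemma kernel_bound:
  assumes x: "0 < x" and \<phi>: "\<phi> \<in> test_functions" and t: "0 < t" "t < a * w_fun x" and y: "0 < y"
  shows "norm (dilate t \<phi> (x - y) / of_real (gd y)) \<le> c2 / (t * gd x)"
proof (cases "t \<le> \<bar>x - y\<bar>")
  case True
  then show ?thesis using dilate_bound(2)[OF \<phi> t(1)] c2_ge t gd_nonneg[of x] by simp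
next
  case False
  note tw = a_w_less[OF x t(2)]
  have n: "gd x \<le> c2 * gd y" using False t by (intro gd_near(2)[OF x tw(1)]) auto
  have "norm (dilate t \<phi> (x - y) / of_real (gd y)) \<le> 1 / t / gd y"
    unfolding norm_divide norm_of_real using dilate_bound(1)[OF \<phi> t(1), of "x - y"] gd_nonneg[of y]
    by (simp only: abs_of_nonneg divide_right_mono)
  also have "\<dots> \<le> c2 / (t * gd x)" using n t gd_pos[OF y] gd_pos[OF x] by (simp add: field_simps)
  finally show ?thesis .
qed

text \<open>If both points miss the support of the bump, both values are 0; otherwise one of them
  lies in it by symmetry. The difference is split so that the variation of 1/gd is multiplied by the
  bump at z: densities are then compared only near x.\<close>

lemma kernel_Lipschitz:
  assumes x: "0 < x" and \<phi>: "\<phi> \<in> test_functions" and t: "0 < t" "t < a * w_fun x" and y: "0 < y" and z: "0 < z"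
  shows "norm (dilate t \<phi> (x - y) / of_real (gd y) - dilate t \<phi> (x - z) / of_real (gd z)) \<le> c3 * \<bar>y - z\<bar> / (t\<^sup>2 * gd x)"
proof -
  note tw = a_w_less[OF x t(2)]
  let ?D = "\<lambda>y. dilate t \<phi> (x - y)"
  have gx: "0 < gd x" by (rule gd_pos[OF x])
  have gdiff: "\<bar>gd y - gd z\<bar> \<le> \<beta> * exp 4 * c2 * gd x / t * \<bar>y - z\<bar>" if yz: "\<bar>x - y\<bar> < t" "\<bar>x - z\<bar> < t" for y z
  proof -
    have main: "\<bar>gd B - gd A\<bar> \<le> \<beta> * exp 4 * c2 * gd x / t * (B - A)"
      if AB: "A < B" "\<bar>x - A\<bar> < t" "\<bar>x - B\<bar> < t" for A B
    proof -
      have A0: "0 < A" using AB tw(2) by linarith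
      obtain \<zeta> where zeta: "A < \<zeta>" "\<zeta> < B" "gd B - gd A = (B - A) * (gd \<zeta> * ((2 * \<alpha> + 1) / \<zeta> - 2 * \<zeta>))"
        using MVT2[OF AB(1), of gd "\<lambda>x. gd x * ((2 * \<alpha> + 1) / x - 2 * x)"] gd_deriv A0 by force
      have z0: "0 < \<zeta>" using zeta A0 by simp
      have z5: "\<bar>\<zeta> - x\<bar> \<le> 5 * t" using zeta AB t by linarith
      note n = gd_near[OF x tw(1) z5]
      \<comment> \<open>The scale t is at most w, hence at most 1 / (4 v), so the relative variation
        of the density, beta v, is of order 1/t.\<close>
      have vx: "v x \<le> 1 / t"
      proof -
        have "t * v x \<le> w_fun x * v x" using tw v_pos[OF x] by (intro mult_right_mono) auto
        also have "\<dots> \<le> 1 / (4 * v x) * v x" using w_bounds(2)[OF x] v_pos[OF x] by (intro mult_right_mono) auto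
        also have "\<dots> \<le> 1" using v_pos[OF x] by simp
        finally show ?thesis using t by (simp add: field_simps)
      qed
      have "\<bar>gd \<zeta> * ((2 * \<alpha> + 1) / \<zeta> - 2 * \<zeta>)\<bar> \<le> \<beta> * gd \<zeta> * v \<zeta>" by (rule gd_deriv_le[OF z0])
      also have "\<dots> \<le> \<beta> * (c2 * gd x) * (exp 4 * v x)"
        using n beta c2_ge gx v_pos[OF z0] gd_nonneg[of \<zeta>] by (intro mult_mono) auto
      also have "\<dots> \<le> \<beta> * (c2 * gd x) * (exp 4 * (1 / t))"
        using vx beta c2_ge gx by (intro mult_left_mono) auto
      finally have "\<bar>gd \<zeta> * ((2 * \<alpha> + 1) / \<zeta> - 2 * \<zeta>)\<bar> \<le> \<beta> * exp 4 * c2 * gd x / t" by (simp add: mult_ac)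
      then have "(B - A) * \<bar>gd \<zeta> * ((2 * \<alpha> + 1) / \<zeta> - 2 * \<zeta>)\<bar> \<le> (B - A) * (\<beta> * exp 4 * c2 * gd x / t)"
        using AB by (intro mult_left_mono) auto
      then show ?thesis unfolding zeta(3) abs_mult[of "B - A"] using AB by (simp only: abs_of_pos mult.commute diff_gt_0_iff_gt)
    qed
    consider "y = z" | "y < z" | "z < y" by linarith
    then show ?thesis
    proof cases
      case 2 then show ?thesis using main[of y z] yz by (simp add: abs_minus_commute)
    next
      case 3 then show ?thesis using main[of z y] yz by simp
    qed simp
  qed
  have main: "norm (?D y / of_real (gd y) - ?D z / of_real (gd z)) \<le> c3 * \<bar>y - z\<bar> / (t\<^sup>2 * gd x)"
    if y: "0 < y" and z: "0 < z" and yt: "\<bar>x - y\<bar> < t" for y z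
  proof -
    have gy: "0 < gd y" and gz: "0 < gd z" using y z gd_pos by auto
    have ny: "gd x \<le> c2 * gd y" using yt t by (intro gd_near(2)[OF x tw(1)]) auto
    have iy: "1 / gd y \<le> c2 / gd x" using ny gy gx by (simp add: field_simps)
    have eq: "?D y / of_real (gd y) - ?D z / of_real (gd z) = (?D y - ?D z) / of_real (gd y) + ?D z * of_real (1 / gd y - 1 / gd z)"
      using gy gz by (simp add: field_simps)
    have 1: "norm ((?D y - ?D z) / of_real (gd y)) \<le> c2 * \<bar>y - z\<bar> / (t\<^sup>2 * gd x)"
    proof -
      have "norm ((?D y - ?D z) / of_real (gd y)) = norm (?D y - ?D z) * (1 / gd y)" using gy by (simp add: norm_divide)
      also have "\<dots> \<le> (\<bar>y - z\<bar> / t\<^sup>2) * (c2 / gd x)"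
        using dilate_bound(3)[OF \<phi> t(1), of "x - y" "x - z"] iy gy
        by (intro mult_mono) (auto simp: abs_minus_commute)
      finally show ?thesis by (simp add: mult_ac)
    qed
    have 2: "norm (?D z * of_real (1 / gd y - 1 / gd z)) \<le> \<beta> * exp 4 * c2 ^ 3 * \<bar>y - z\<bar> / (t\<^sup>2 * gd x)"
    proof (cases "\<bar>x - z\<bar> < t")
      case False
      then show ?thesis using dilate_bound(2)[OF \<phi> t(1), of "x - z"] beta c2_ge gx by simp
    next
      case True
      have nz: "gd x \<le> c2 * gd z" using True t by (intro gd_near(2)[OF x tw(1)]) auto
      have iz: "1 / gd z \<le> c2 / gd x" using nz gz gx by (simp add: field_simps)
      have "\<bar>1 / gd y - 1 / gd z\<bar> = \<bar>gd y - gd z\<bar> * (1 / gd y * (1 / gd z))"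
      proof -
        have "1 / gd y - 1 / gd z = - ((gd y - gd z) * (1 / gd y * (1 / gd z)))" using gy gz by (simp add: field_simps)
        then show ?thesis using gy gz by (simp add: abs_mult)
      qed
      also have "\<dots> \<le> (\<beta> * exp 4 * c2 * gd x / t * \<bar>y - z\<bar>) * (c2 / gd x * (c2 / gd x))"
        using gdiff[OF yt True] iy iz gy gz gx c2_ge beta t by (intro mult_mono) auto
      also have "\<dots> = \<beta> * exp 4 * c2 ^ 3 * \<bar>y - z\<bar> / (t * gd x)"
        using gx t by (simp add: field_simps power3_eq_cube)
      finally have le: "\<bar>1 / gd y - 1 / gd z\<bar> \<le> \<beta> * exp 4 * c2 ^ 3 * \<bar>y - z\<bar> / (t * gd x)" .
      have "norm (?D z * of_real (1 / gd y - 1 / gd z)) = norm (?D z) * \<bar>1 / gd y - 1 / gd z\<bar>"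
        unfolding norm_mult norm_of_real ..
      also have "\<dots> \<le> 1 / t * (\<beta> * exp 4 * c2 ^ 3 * \<bar>y - z\<bar> / (t * gd x))"
        using dilate_bound(1)[OF \<phi> t(1), of "x - z"] le t by (intro mult_mono) auto
      finally show ?thesis by (simp add: power2_eq_square mult_ac)
    qed
    have "norm (?D y / of_real (gd y) - ?D z / of_real (gd z)) \<le>
       c2 * \<bar>y - z\<bar> / (t\<^sup>2 * gd x) + \<beta> * exp 4 * c2 ^ 3 * \<bar>y - z\<bar> / (t\<^sup>2 * gd x)"
      unfolding eq by (rule norm_triangle_le) (use 1 2 in linarith)
    also have "\<dots> = c3 * \<bar>y - z\<bar> / (t\<^sup>2 * gd x)" by (simp add: c3_def add_divide_distrib distrib_right)
    finally show ?thesis .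
  qed
  consider "\<bar>x - y\<bar> < t" | "\<bar>x - z\<bar> < t" | "t \<le> \<bar>x - y\<bar>" "t \<le> \<bar>x - z\<bar>" by linarith
  then show ?thesis
  proof cases
    case 1 then show ?thesis by (rule main[OF y z])
  next
    case 2 then show ?thesis using main[OF z y] by (simp add: norm_minus_commute abs_minus_commute)
  next
    case 3 then show ?thesis using dilate_bound(2)[OF \<phi> t(1)] c3_pos gx by simp
  qed
qed

end

section \<open>Near and far estimates for the maximal function of an atom\<close>

locale grid_atom = gamma_grid \<alpha> a + atom_setting \<alpha> b x0 r p for \<alpha> a b x0 r p
begin

text \<open>The part of \<open>b\<close> up to height s contributes at most s to any average, so an
  average above 2 s forces the part above s to average more than s. The weak type inequality for
  that part and \<open>truncated_le\<close> give the power of s m.\<close>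

lemma maximal_level_set:
  assumes s: "0 < s"
  shows "ennreal s * emeasure \<gamma> {x \<in> space \<gamma>. ennreal (4 * c2\<^sup>2 * s) < local_maximal a b x} \<le>
    ennreal (5 * c2\<^sup>2 * (s * measure \<gamma> (itv x0 r)) powr (1 - p))"
proof -
  let ?G = "{x \<in> space \<gamma>. ennreal (4 * c2\<^sup>2 * s) < local_maximal a b x}"
  define u where "u y = (if s < norm (b y) then ennreal (norm (b y)) else 0)" for y
  note [measurable] = b_measurable
  have um [measurable]: "u \<in> borel_measurable \<gamma>" unfolding u_def by measurable
  have sub: "?G \<subseteq> weak_set u s"
  proof
    fix x assume "x \<in> ?G"
    then have x: "0 < x" and gt: "ennreal (2 * c2\<^sup>2 * (2 * s)) < local_maximal a b x" by (auto simp: mult_ac)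
    have "x \<in> weak_set (\<lambda>y. ennreal (norm (b y))) (2 * s)"
      using s by (intro maximal_weak_set[OF b_measurable x _ gt]) simp
    then obtain t where t: "0 < t" "t \<le> w_fun x"
      and lt: "ennreal (2 * s) * emeasure \<gamma> (ball x t) < (\<integral>\<^sup>+y. ennreal (norm (b y)) * indicator (ball x t) y \<partial>\<gamma>)"
      by (auto simp: weak_set_def)
    have B [measurable]: "ball x t \<in> sets \<gamma>" using t by (intro ball_measure(1)[OF x t(2)]) auto
    have "ennreal s * emeasure \<gamma> (ball x t) < (\<integral>\<^sup>+y. u y * indicator (ball x t) y \<partial>\<gamma>)"
    proof (rule ccontr)
      assume "\<not> ?thesis"
      then have ule: "(\<integral>\<^sup>+y. u y * indicator (ball x t) y \<partial>\<gamma>) \<le> ennreal s * emeasure \<gamma> (ball x t)" by (simp add: not_less)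
      have "(\<integral>\<^sup>+y. ennreal (norm (b y)) * indicator (ball x t) y \<partial>\<gamma>) \<le>
        (\<integral>\<^sup>+y. ennreal s * indicator (ball x t) y + u y * indicator (ball x t) y \<partial>\<gamma>)"
        by (intro nn_integral_mono) (auto simp: u_def indicator_def intro: ennreal_leI)
      also have "\<dots> = ennreal s * emeasure \<gamma> (ball x t) + (\<integral>\<^sup>+y. u y * indicator (ball x t) y \<partial>\<gamma>)"
        by (subst nn_integral_add) (auto simp: nn_integral_cmult_indicator)
      also have "\<dots> \<le> ennreal s * emeasure \<gamma> (ball x t) + ennreal s * emeasure \<gamma> (ball x t)"
        by (rule add_left_mono[OF ule])
      also have "\<dots> = ennreal (2 * s) * emeasure \<gamma> (ball x t)"
        by (simp only: mult_2 ennreal_plus less_imp_le[OF s] distrib_right)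
      finally show False using lt by simp
    qed
    then show "x \<in> weak_set u s" using x t by (auto simp: weak_set_def)
  qed
  obtain U where U: "U \<in> sets \<gamma>" "weak_set u s \<subseteq> U" "ennreal s * emeasure \<gamma> U \<le> ennreal (5 * c2\<^sup>2) * (\<integral>\<^sup>+y. u y \<partial>\<gamma>)"
    using weak_type[OF um s] by blast
  have "(\<integral>\<^sup>+y. u y \<partial>\<gamma>) \<le> (\<integral>\<^sup>+y. ennreal (s powr (1 - p)) * ennreal (norm (b y) powr p) \<partial>\<gamma>)"
    using truncated_le(2)[OF s] by (intro nn_integral_mono) (auto simp: u_def ennreal_mult[symmetric] intro!: ennreal_leI)
  also have "\<dots> = ennreal (s powr (1 - p)) * (\<integral>\<^sup>+y. ennreal (norm (b y) powr p) \<partial>\<gamma>)"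
    by (rule nn_integral_cmult) measurable
  also have "\<dots> \<le> ennreal (s powr (1 - p)) * ennreal (measure \<gamma> (itv x0 r) powr (1 - p))"
    by (rule mult_left_mono[OF b_Lp]) simp
  also have "\<dots> = ennreal ((s * measure \<gamma> (itv x0 r)) powr (1 - p))"
    using s m_pos by (simp add: powr_mult ennreal_mult)
  finally have ule: "(\<integral>\<^sup>+y. u y \<partial>\<gamma>) \<le> ennreal ((s * measure \<gamma> (itv x0 r)) powr (1 - p))" .
  have "ennreal s * emeasure \<gamma> ?G \<le> ennreal s * emeasure \<gamma> U"
    using sub U by (intro mult_left_mono emeasure_mono) auto
  also have "\<dots> \<le> ennreal (5 * c2\<^sup>2) * (\<integral>\<^sup>+y. u y \<partial>\<gamma>)" by (rule U(3))
  also have "\<dots> \<le> ennreal (5 * c2\<^sup>2) * ennreal ((s * measure \<gamma> (itv x0 r)) powr (1 - p))"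
    by (rule mult_left_mono[OF ule]) simp
  also have "\<dots> = ennreal (5 * c2\<^sup>2 * (s * measure \<gamma> (itv x0 r)) powr (1 - p))"
    by (simp add: ennreal_mult)
  finally show ?thesis .
qed

definition CN :: real where
  "CN = 16 * c2\<^sup>2 * c1 * exp 8 + 20 * c2 ^ 4 / (1 - 2 powr (1 - p))"

text \<open>Layer cake with a base level proportional to 1/m: the base costs a constant on the
  doubled interval, and the levels s = 2^k / m cost a geometric series of ratio 2^(1-p), convergent
  because p > 1.\<close>

lemma maximal_near: "(\<integral>\<^sup>+x. local_maximal a b x * indicator (itv x0 (2 * r)) x \<partial>\<gamma>) \<le> ennreal CN"
proof -
  let ?m = "measure \<gamma> (itv x0 r)"
  define \<sigma> where "\<sigma> = 4 * c2\<^sup>2 / ?m"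
  define \<rho> where "\<rho> = (2::real) powr (1 - p)"
  have c2: "0 < c2" using c2_ge by simp
  have \<sigma>: "0 < \<sigma>" using m_pos c2 by (simp add: \<sigma>_def)
  have \<rho>: "0 < \<rho>" "\<rho> < 1" using p powr_less_one[of 2 "1 - p"] by (auto simp: \<rho>_def)
  have Q: "itv x0 (2 * r) \<in> sets \<gamma>" by (rule itv_sets)
  have [measurable]: "local_maximal a b \<in> borel_measurable \<gamma>" by (rule local_maximal_measurable[OF b_integrable])
  define G where "G k = {x \<in> space \<gamma>. ennreal (\<sigma> * 2 ^ k) < local_maximal a b x}" for k :: nat
  have G [measurable]: "G k \<in> sets \<gamma>" for k unfolding G_def by measurable
  have lev: "ennreal (\<sigma> * 2 ^ k) * emeasure \<gamma> (G k) \<le> ennreal (20 * c2 ^ 4 * \<rho> ^ k)" for k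
  proof -
    define s where "s = 2 ^ k / ?m"
    have s: "0 < s" using m_pos by (simp add: s_def)
    have eq: "\<sigma> * 2 ^ k = 4 * c2\<^sup>2 * s" by (simp add: \<sigma>_def s_def)
    have "ennreal (\<sigma> * 2 ^ k) * emeasure \<gamma> (G k) = ennreal (4 * c2\<^sup>2) * (ennreal s * emeasure \<gamma> (G k))"
      using s unfolding eq by (simp add: ennreal_mult mult.assoc)
    also have "\<dots> \<le> ennreal (4 * c2\<^sup>2) * ennreal (5 * c2\<^sup>2 * (s * ?m) powr (1 - p))"
      unfolding G_def eq by (rule mult_left_mono[OF maximal_level_set[OF s]]) simp
    also have "\<dots> = ennreal (4 * c2\<^sup>2 * (5 * c2\<^sup>2 * (s * ?m) powr (1 - p)))"
      by (subst ennreal_mult[symmetric]) auto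
    also have "4 * c2\<^sup>2 * (5 * c2\<^sup>2 * (s * ?m) powr (1 - p)) = 20 * c2 ^ 4 * \<rho> ^ k"
    proof -
      have "s * ?m = 2 powr real k" using m_pos by (simp add: s_def powr_realpow)
      then have "(s * ?m) powr (1 - p) = \<rho> ^ k"
        by (simp add: powr_powr \<rho>_def powr_realpow[symmetric] mult.commute)
      then show ?thesis by (simp add: power2_eq_square power4_eq_xxxx)
    qed
    finally show ?thesis .
  qed
  have "(\<integral>\<^sup>+x. local_maximal a b x * indicator (itv x0 (2 * r)) x \<partial>\<gamma>) \<le>
    (\<integral>\<^sup>+x. ennreal \<sigma> * indicator (itv x0 (2 * r)) x + (\<Sum>k. ennreal (\<sigma> * 2 ^ k) * indicator (G k) x) \<partial>\<gamma>)"
  proof (rule nn_integral_mono)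
    fix x assume x: "x \<in> space \<gamma>"
    have "local_maximal a b x \<le> ennreal \<sigma> + (\<Sum>k. ennreal (\<sigma> * 2 ^ k) * indicator {t. ennreal (\<sigma> * 2 ^ k) < t} (local_maximal a b x))"
      by (rule dyadic_layer_cake[OF \<sigma>])
    also have "\<dots> = ennreal \<sigma> + (\<Sum>k. ennreal (\<sigma> * 2 ^ k) * indicator (G k) x)"
      using x by (simp add: G_def indicator_def)
    finally show "local_maximal a b x * indicator (itv x0 (2 * r)) x \<le>
      ennreal \<sigma> * indicator (itv x0 (2 * r)) x + (\<Sum>k. ennreal (\<sigma> * 2 ^ k) * indicator (G k) x)"
      by (auto simp: indicator_def)
  qed
  also have "\<dots> = ennreal \<sigma> * emeasure \<gamma> (itv x0 (2 * r)) + (\<Sum>k. ennreal (\<sigma> * 2 ^ k) * emeasure \<gamma> (G k))"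
    using Q by (subst nn_integral_add) (auto simp: nn_integral_cmult_indicator nn_integral_suminf)
  also have "\<dots> \<le> ennreal (16 * c2\<^sup>2 * c1 * exp 8) + (\<Sum>k. ennreal (20 * c2 ^ 4 * \<rho> ^ k))"
  proof (intro add_mono suminf_le lev summableI)
    have "\<sigma> * measure \<gamma> (itv x0 (2 * r)) \<le> \<sigma> * (4 * c1 * exp 8 * ?m)"
      using doubling \<sigma> by (intro mult_left_mono) auto
    also have "\<dots> = 16 * c2\<^sup>2 * c1 * exp 8" using m_pos by (simp add: \<sigma>_def)
    finally show "ennreal \<sigma> * emeasure \<gamma> (itv x0 (2 * r)) \<le> ennreal (16 * c2\<^sup>2 * c1 * exp 8)"
      using \<sigma> by (simp add: emeasure_eq_measure ennreal_mult[symmetric] ennreal_leI)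
  qed
  also have "(\<Sum>k. ennreal (20 * c2 ^ 4 * \<rho> ^ k)) = ennreal (20 * c2 ^ 4 / (1 - \<rho>))"
  proof (rule suminf_ennreal_eq)
    show "(\<lambda>k. 20 * c2 ^ 4 * \<rho> ^ k) sums (20 * c2 ^ 4 / (1 - \<rho>))"
      using sums_mult[OF geometric_sums[of \<rho>], of "20 * c2 ^ 4"] \<rho> by simp
  qed (use \<rho> in simp)
  also have "ennreal (16 * c2\<^sup>2 * c1 * exp 8) + \<dots> = ennreal CN"
    using \<rho> c1_pos by (simp add: CN_def \<rho>_def[symmetric] ennreal_plus[symmetric] del: ennreal_plus)
  finally show ?thesis .
qed

text \<open>A ball too small to reach the supporting interval gives 0. Otherwise t is at least half
  the distance to x0, and the Lipschitz bound applies; 8 is 4 from this half, squared, times 2 from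
  the L1 norm of \<open>b\<close>.\<close>

lemma maximal_far:
  assumes x: "0 < x" and far: "2 * r \<le> \<bar>x - x0\<bar>"
  shows "local_maximal a b x \<le> ennreal (8 * c3 * r / ((x - x0)\<^sup>2 * gd x))"
  unfolding local_maximal_def
proof (rule Sup_least, clarsimp)
  fix \<phi> t assume \<phi>: "\<phi> \<in> test_functions" and t: "0 < t" "t < a * w_fun x"
  let ?k = "\<lambda>y. dilate t \<phi> (x - y) / of_real (gd y)"
  note [measurable] = b_measurable conv_eq_gamma(2)[OF b_measurable x \<phi> t]
  have gx: "0 < gd x" by (rule gd_pos[OF x])
  have conv: "fun_conv (dilate t \<phi>) b x = (\<integral>y. ?k y * b y \<partial>\<gamma>)" by (rule conv_eq_gamma(1)[OF b_measurable x \<phi> t])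
  have nonneg: "0 \<le> 8 * c3 * r / ((x - x0)\<^sup>2 * gd x)" using c3_pos r_pos gx by simp
  show "ennreal (norm (fun_conv (dilate t \<phi>) b x)) \<le> ennreal (8 * c3 * r / ((x - x0)\<^sup>2 * gd x))"
  proof (cases "t \<le> \<bar>x - x0\<bar> - r")
    case True
    have "(\<integral>y. ?k y * b y \<partial>\<gamma>) = (\<integral>y. 0 \<partial>\<gamma>)"
    proof (rule Bochner_Integration.integral_cong[OF refl])
      fix y assume y: "y \<in> space \<gamma>"
      show "?k y * b y = 0"
      proof (cases "y \<in> itv x0 r")
        case True
        then have "\<bar>y - x0\<bar> < r" by (auto simp: J_eq)
        then have "t \<le> \<bar>x - y\<bar>" using \<open>t \<le> \<bar>x - x0\<bar> - r\<close> by linarith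
        then show ?thesis using dilate_bound(2)[OF \<phi> t(1)] by simp
      next
        case False then show ?thesis using b_zero y by simp
      qed
    qed
    then show ?thesis using conv nonneg by simp
  next
    case False
    then have tge: "\<bar>x - x0\<bar> / 2 \<le> t" using far by simp
    define B where "B = c3 * r / (t\<^sup>2 * gd x)"
    have B: "0 \<le> B" using c3_pos r_pos gx by (simp add: B_def)
    have ki: "integrable \<gamma> (\<lambda>y. ?k y * b y)"
    proof (rule Bochner_Integration.integrable_bound)
      show "integrable \<gamma> (\<lambda>y. of_real (c2 / (t * gd x)) * b y)" using b_integrable by simp
      show "AE y in \<gamma>. norm (?k y * b y) \<le> norm (of_real (c2 / (t * gd x)) * b y)"
      proof (rule AE_I2)
        fix y assume "y \<in> space \<gamma>"
        then have "0 < y" by simp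
        then have "norm (?k y) \<le> \<bar>c2 / (t * gd x)\<bar>" by (rule order_trans[OF kernel_bound[OF x \<phi> t] abs_ge_self])
        then show "norm (?k y * b y) \<le> norm (of_real (c2 / (t * gd x)) * b y)"
          unfolding norm_mult norm_of_real by (rule mult_right_mono) simp
      qed
    qed measurable
    \<comment> \<open>Mean zero allows the kernel value at the centre to be subtracted.\<close>
    have "(\<integral>y. ?k y * b y \<partial>\<gamma>) = (\<integral>y. ?k y * b y \<partial>\<gamma>) - (\<integral>y. ?k x0 * b y \<partial>\<gamma>)"
      using b_mean by simp
    also have "\<dots> = (\<integral>y. ?k y * b y - ?k x0 * b y \<partial>\<gamma>)"
      using ki b_integrable by (intro Bochner_Integration.integral_diff[symmetric]) auto
    finally have eq: "(\<integral>y. ?k y * b y \<partial>\<gamma>) = (\<integral>y. ?k y * b y - ?k x0 * b y \<partial>\<gamma>)" .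
    have "ennreal (norm (\<integral>y. ?k y * b y \<partial>\<gamma>)) \<le> (\<integral>\<^sup>+y. ennreal (norm (?k y * b y - ?k x0 * b y)) \<partial>\<gamma>)"
      by (subst eq, rule integral_norm_bound_ennreal, rule Bochner_Integration.integrable_diff[OF ki])
         (use b_integrable in simp)
    also have "\<dots> \<le> (\<integral>\<^sup>+y. ennreal B * ennreal (norm (b y)) \<partial>\<gamma>)"
    proof (rule nn_integral_mono)
      fix y assume y: "y \<in> space \<gamma>"
      have "norm (?k y * b y - ?k x0 * b y) \<le> B * norm (b y)"
      proof (cases "y \<in> itv x0 r")
        case True
        then have yr: "\<bar>y - x0\<bar> \<le> r" by (auto simp: J_eq)
        have "norm (?k y - ?k x0) \<le> c3 * \<bar>y - x0\<bar> / (t\<^sup>2 * gd x)"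
          using y x0_pos by (intro kernel_Lipschitz[OF x \<phi> t]) auto
        also have "\<dots> \<le> B" unfolding B_def using yr c3_pos gx
          by (intro divide_right_mono mult_left_mono) auto
        finally show ?thesis unfolding left_diff_distrib[symmetric] norm_mult by (rule mult_right_mono) simp
      next
        case False then show ?thesis using b_zero y by simp
      qed
      then show "ennreal (norm (?k y * b y - ?k x0 * b y)) \<le> ennreal B * ennreal (norm (b y))"
        using B by (simp add: ennreal_mult[symmetric] ennreal_leI)
    qed
    also have "\<dots> = ennreal B * (\<integral>\<^sup>+y. ennreal (norm (b y)) \<partial>\<gamma>)"
      by (rule nn_integral_cmult) measurable
    also have "\<dots> \<le> ennreal B * 2" by (rule mult_left_mono[OF b_L1]) simp
    also have "\<dots> = ennreal (2 * B)" using B by (simp add: ennreal_mult mult.commute)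
    also have "\<dots> \<le> ennreal (8 * c3 * r / ((x - x0)\<^sup>2 * gd x))"
    proof (rule ennreal_leI)
      have d: "0 < \<bar>x - x0\<bar>" using far r_pos by linarith
      have "(\<bar>x - x0\<bar> / 2)\<^sup>2 \<le> t\<^sup>2" using tge by (rule power_mono) simp
      then have "(x - x0)\<^sup>2 * gd x \<le> 4 * t\<^sup>2 * gd x" using gx by (intro mult_right_mono) (auto simp: power_divide)
      then have "8 * c3 * r / (4 * t\<^sup>2 * gd x) \<le> 8 * c3 * r / ((x - x0)\<^sup>2 * gd x)"
        using c3_pos r_pos gx d t by (intro divide_left_mono mult_pos_pos) auto
      then show "2 * B \<le> 8 * c3 * r / ((x - x0)\<^sup>2 * gd x)" by (simp add: B_def mult_ac)
    qed
    finally show ?thesis by (simp add: conv)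
  qed
qed

text \<open>Explicit antiderivative on the right; the left integral is its reflection in x0.\<close>

lemma nn_integral_far:
  "(\<integral>\<^sup>+x. ennreal (8 * c3 * r / (x - x0)\<^sup>2) * indicator {x0 + 2 * r..} x \<partial>lborel) = ennreal (4 * c3)"
  "(\<integral>\<^sup>+x. ennreal (8 * c3 * r / (x - x0)\<^sup>2) * indicator {..x0 - 2 * r} x \<partial>lborel) = ennreal (4 * c3)"
proof -
  have "(\<integral>\<^sup>+x. ennreal (8 * c3 * r / (x - x0)\<^sup>2) * indicator {x0 + 2 * r..} x \<partial>lborel) =
    ennreal (0 - (- (8 * c3 * r / (x0 + 2 * r - x0))))"
  proof (rule nn_integral_FTC_atLeast)
    show "((\<lambda>x. - (8 * c3 * r / (x - x0))) has_real_derivative 8 * c3 * r / (x - x0)\<^sup>2) (at x)"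
      if "x0 + 2 * r \<le> x" for x
      using that r_pos by (auto intro!: derivative_eq_intros simp: power2_eq_square)
    have "filterlim (\<lambda>x. - x0 + x) at_top at_top"
      by (rule filterlim_tendsto_add_at_top[OF tendsto_const filterlim_ident])
    then have "((\<lambda>x. - (8 * c3 * r / (x - x0))) \<longlongrightarrow> - 0) at_top"
      by (intro tendsto_minus tendsto_divide_0[OF tendsto_const] filterlim_at_top_imp_at_infinity) simp
    then show "((\<lambda>x. - (8 * c3 * r / (x - x0))) \<longlongrightarrow> 0) at_top" by simp
  qed (use c3_pos r_pos in auto)
  then show 1: "(\<integral>\<^sup>+x. ennreal (8 * c3 * r / (x - x0)\<^sup>2) * indicator {x0 + 2 * r..} x \<partial>lborel) = ennreal (4 * c3)"
    using r_pos by simp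
  have "(\<integral>\<^sup>+x. ennreal (8 * c3 * r / (x - x0)\<^sup>2) * indicator {..x0 - 2 * r} x \<partial>lborel) =
    (\<integral>\<^sup>+x. ennreal (8 * c3 * r / (2 * x0 + (- 1) * x - x0)\<^sup>2) * indicator {..x0 - 2 * r} (2 * x0 + (- 1) * x) \<partial>lborel)"
    by (subst nn_integral_real_affine[where c = "- 1" and t = "2 * x0"]) auto
  also have "\<dots> = (\<integral>\<^sup>+x. ennreal (8 * c3 * r / (x - x0)\<^sup>2) * indicator {x0 + 2 * r..} x \<partial>lborel)"
    by (intro nn_integral_cong) (auto simp: indicator_def power2_commute)
  finally show "(\<integral>\<^sup>+x. ennreal (8 * c3 * r / (x - x0)\<^sup>2) * indicator {..x0 - 2 * r} x \<partial>lborel) = ennreal (4 * c3)"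
    unfolding 1 .
qed

text \<open>In the far region the factor 1/gd of the bound cancels the density, which leaves the
  Lebesgue integrals of \<open>nn_integral_far\<close>.\<close>

lemma maximal_atom_le: "(\<integral>\<^sup>+x. local_maximal a b x \<partial>\<gamma>) \<le> ennreal (CN + 8 * c3)"
proof -
  have mm [measurable]: "local_maximal a b \<in> borel_measurable \<gamma>" by (rule local_maximal_measurable[OF b_integrable])
  let ?A = "{x. 0 < x \<and> 2 * r \<le> \<bar>x - x0\<bar>}"
  let ?g = "\<lambda>x. ennreal (8 * c3 * r / (x - x0)\<^sup>2)"
  have A: "?A \<in> sets \<gamma>" by (auto simp: sets_gamma_iff)
  have Q: "itv x0 (2 * r) \<in> sets \<gamma>" by (rule itv_sets)
  have CN: "0 \<le> CN"
  proof -
    have "2 powr (1 - p) < 1" using p powr_less_one[of 2 "1 - p"] by simp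
    then show ?thesis using c1_pos by (simp add: CN_def)
  qed
  have far: "(\<integral>\<^sup>+x. local_maximal a b x * indicator ?A x \<partial>\<gamma>) \<le> ennreal (8 * c3)"
  proof -
    have "(\<integral>\<^sup>+x. local_maximal a b x * indicator ?A x \<partial>\<gamma>) =
      (\<integral>\<^sup>+x. ennreal (gd x) * (local_maximal a b x * indicator ?A x) * indicator {0<..} x \<partial>lborel)"
      using A by (intro nn_integral_gamma) auto
    also have "\<dots> \<le> (\<integral>\<^sup>+x. ?g x * indicator {x0 + 2 * r..} x + ?g x * indicator {..x0 - 2 * r} x \<partial>lborel)"
    proof (rule nn_integral_mono)
      fix x
      show "ennreal (gd x) * (local_maximal a b x * indicator ?A x) * indicator {0<..} x \<le>
         ?g x * indicator {x0 + 2 * r..} x + ?g x * indicator {..x0 - 2 * r} x"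
      proof (cases "x \<in> ?A")
        case True
        then have x: "0 < x" "2 * r \<le> \<bar>x - x0\<bar>" by auto
        have gx: "0 < gd x" by (rule gd_pos[OF x(1)])
        have "ennreal (gd x) * local_maximal a b x \<le> ennreal (gd x) * ennreal (8 * c3 * r / ((x - x0)\<^sup>2 * gd x))"
          by (rule mult_left_mono[OF maximal_far[OF x]]) simp
        also have "\<dots> = ennreal (gd x * (8 * c3 * r / ((x - x0)\<^sup>2 * gd x)))"
          using gx c3_pos r_pos by (subst ennreal_mult) auto
        also have "gd x * (8 * c3 * r / ((x - x0)\<^sup>2 * gd x)) = 8 * c3 * r / (x - x0)\<^sup>2" using gx by simp
        finally have le: "ennreal (gd x) * local_maximal a b x \<le> ?g x" .
        have "x0 + 2 * r \<le> x \<or> x \<le> x0 - 2 * r" using x by linarith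
        then have "?g x \<le> ?g x * indicator {x0 + 2 * r..} x + ?g x * indicator {..x0 - 2 * r} x" by auto
        with le show ?thesis using x by simp
      qed simp
    qed
    also have "\<dots> = ennreal (4 * c3) + ennreal (4 * c3)"
      by (subst nn_integral_add) (simp_all only: nn_integral_far, auto)
    also have "\<dots> = ennreal (8 * c3)" using c3_pos by (simp add: ennreal_plus[symmetric] del: ennreal_plus)
    finally show ?thesis .
  qed
  have "(\<integral>\<^sup>+x. local_maximal a b x \<partial>\<gamma>) =
    (\<integral>\<^sup>+x. local_maximal a b x * indicator (itv x0 (2 * r)) x + local_maximal a b x * indicator ?A x \<partial>\<gamma>)"
    by (intro nn_integral_cong) (auto simp: itv_def indicator_def)
  also have "\<dots> = (\<integral>\<^sup>+x. local_maximal a b x * indicator (itv x0 (2 * r)) x \<partial>\<gamma>) + (\<integral>\<^sup>+x. local_maximal a b x * indicator ?A x \<partial>\<gamma>)"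
    using Q A by (intro nn_integral_add) auto
  also have "\<dots> \<le> ennreal CN + ennreal (8 * c3)" by (rule add_mono[OF maximal_near far])
  also have "\<dots> = ennreal (CN + 8 * c3)" using CN c3_pos by simp
  finally show ?thesis .
qed

end

section \<open>Equivalence of the norms\<close>

context gamma_setting begin

lemma E_fun_cong:
  assumes "\<And>x. 0 < x \<Longrightarrow> f x = g x"
  shows "E_fun \<alpha> f = E_fun \<alpha> g"
proof -
  have "(LINT x:A|\<gamma>. f x) = (LINT x:A|\<gamma>. g x)" for A
    unfolding set_lebesgue_integral_def by (intro Bochner_Integration.integral_cong refl) (simp add: assms)
  then show ?thesis by (simp add: E_fun_def)
qed

text \<open>Almost everywhere \<open>b\<close> is at most 1/m on \<open>J\<close>, so the integral
  is at most m^(-p) m.\<close>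

lemma esssup_powr_integral_le:
  assumes b: "b \<in> borel_measurable \<gamma>" and J: "J \<in> sets \<gamma>" "\<And>x. 0 < x \<Longrightarrow> x \<notin> J \<Longrightarrow> b x = 0"
    and le: "Lq_norm \<infinity> \<gamma> b \<le> ennreal (measure \<gamma> J powr (- 1))" and p: "1 < p"
  shows "(\<integral>\<^sup>+x. ennreal (norm (b x) powr p) \<partial>\<gamma>) \<le> ennreal (measure \<gamma> J powr (1 - p))"
proof -
  let ?m = "measure \<gamma> J"
  have le': "esssup \<gamma> (\<lambda>x. ennreal (norm (b x))) \<le> ennreal (?m powr (- 1))"
    using le by (simp add: Lq_norm_def)
  have "(\<integral>\<^sup>+x. ennreal (norm (b x) powr p) \<partial>\<gamma>) \<le> (\<integral>\<^sup>+x. ennreal (?m powr (- p)) * indicator J x \<partial>\<gamma>)"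
  proof (rule nn_integral_mono_AE)
    show "AE x in \<gamma>. ennreal (norm (b x) powr p) \<le> ennreal (?m powr (- p)) * indicator J x"
      using esssup_AE[where M=\<gamma> and f="\<lambda>x. ennreal (norm (b x))"] AE_space
    proof eventually_elim
      case (elim x)
      show ?case
      proof (cases "x \<in> J")
        case True
        have "ennreal (norm (b x)) \<le> ennreal (?m powr (- 1))"
          by (rule order_trans[OF elim(1) le'])
        then have "norm (b x) \<le> ?m powr (- 1)" by (subst (asm) ennreal_le_iff) auto
        then have "norm (b x) powr p \<le> (?m powr (- 1)) powr p" using p by (intro powr_mono2) auto
        then have "norm (b x) powr p \<le> ?m powr (- p)"
          by (simp only: powr_powr mult_minus_left mult_1_left)
        then show ?thesis using True by (simp add: ennreal_leI)
      next
        case False with elim J(2) p show ?thesis by simp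
      qed
    qed
  qed
  also have "\<dots> = ennreal (?m powr (- p)) * ennreal ?m"
    using J by (simp add: nn_integral_cmult_indicator emeasure_eq_measure)
  also have "\<dots> = ennreal (?m powr (- p) * ?m powr 1)" by (subst ennreal_mult) auto
  also have "?m powr (- p) * ?m powr 1 = ?m powr (1 - p)" by (simp only: powr_add[symmetric]) simp
  finally show ?thesis .
qed

text \<open>Take p-th powers, with (1/q - 1) p = 1 - p. If the integral is infinite, both sides
  fail.\<close>

lemma Lq_norm_le_iff:
  assumes q: "1 < q" "q \<noteq> \<infinity>"
  shows "Lq_norm q \<gamma> b \<le> ennreal (measure \<gamma> J powr (enn2real (inverse q) - 1)) \<longleftrightarrow>
    (\<integral>\<^sup>+x. ennreal (norm (b x) powr enn2real q) \<partial>\<gamma>) \<le> ennreal (measure \<gamma> J powr (1 - enn2real q))"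
proof -
  define p where "p = enn2real q"
  let ?m = "measure \<gamma> J" and ?I = "\<integral>\<^sup>+x. ennreal (norm (b x) powr p) \<partial>\<gamma>"
  have p: "1 < p" using atom_exponent_gt[OF q(1)] q(2) by (simp add: atom_exponent_def p_def)
  have "q = ennreal p" using q(2) by (simp add: p_def less_top)
  then have e: "enn2real (inverse q) - 1 = (1 - p) * (1 / p)" using p by (simp add: inverse_ennreal field_simps)
  have "Lq_norm q \<gamma> b \<le> ennreal (?m powr ((1 - p) * (1 / p))) \<longleftrightarrow> ?I \<le> ennreal (?m powr (1 - p))"
  proof (cases "?I = \<infinity>")
    case True
    then show ?thesis using q(2) by (simp add: Lq_norm_def p_def[symmetric] top_unique)
  next
    case False
    then obtain i where i: "?I = ennreal i" "0 \<le> i" by (cases ?I) auto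
    have "Lq_norm q \<gamma> b = ennreal (i powr (1 / p))"
      using q(2) i by (simp add: Lq_norm_def p_def[symmetric])
    moreover have "i powr (1 / p) \<le> (?m powr (1 - p)) powr (1 / p) \<longleftrightarrow> i \<le> ?m powr (1 - p)"
    proof
      assume "i powr (1 / p) \<le> (?m powr (1 - p)) powr (1 / p)"
      then have "(i powr (1 / p)) powr p \<le> ((?m powr (1 - p)) powr (1 / p)) powr p"
        using p by (intro powr_mono2[of p]) simp_all
      then show "i \<le> ?m powr (1 - p)" using p i(2) by (simp add: powr_powr)
    qed (use p i in \<open>intro powr_mono2, auto\<close>)
    ultimately show ?thesis using i by (simp add: powr_powr ennreal_le_iff)
  qed
  then show ?thesis by (simp only: e p_def[symmetric])
qed

lemma atom_powr_integral_le:
  assumes b: "b \<in> borel_measurable \<gamma>" and J: "J \<in> sets \<gamma>" "support_on {0<..} b \<subseteq> J" and q: "1 < q"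
    and le: "Lq_norm q \<gamma> b \<le> ennreal (measure \<gamma> J powr (enn2real (inverse q) - 1))"
  shows "(\<integral>\<^sup>+x. ennreal (norm (b x) powr atom_exponent q) \<partial>\<gamma>) \<le> ennreal (measure \<gamma> J powr (1 - atom_exponent q))"
proof (cases "q = \<infinity>")
  case True
  have "b x = 0" if "0 < x" "x \<notin> J" for x using that J(2) by (auto simp: support_on_def)
  from esssup_powr_integral_le[OF b J(1) this _ atom_exponent_gt[OF q]] le True show ?thesis by simp
next
  case False
  then show ?thesis using le Lq_norm_le_iff[OF q False] by (simp add: atom_exponent_def)
qed

text \<open>Carries the bounded atoms produced by the decomposition into the class of every exponent
  q.\<close>

lemma is_atom_infinity_imp:
  assumes \<B>: "\<And>J. J \<in> \<B> \<Longrightarrow> J \<in> sets \<gamma>" and q: "1 < q" and b: "is_atom \<B> \<infinity> \<alpha> b"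
  shows "is_atom \<B> q \<alpha> b"
proof (cases "q = \<infinity> \<or> (\<forall>x>0. b x = 1)")
  case False
  with b obtain J where J: "J \<in> \<B>" "support_on {0<..} b \<subseteq> J" "(\<integral>x. b x \<partial>\<gamma>) = 0"
    and le: "Lq_norm \<infinity> \<gamma> b \<le> ennreal (measure \<gamma> J powr (enn2real (inverse \<infinity>) - 1))"
    and bm: "b \<in> borel_measurable \<gamma>"
    unfolding is_atom_def by blast
  have z: "b x = 0" if "0 < x" "x \<notin> J" for x using that J(2) by (auto simp: support_on_def)
  have "1 < enn2real q" using atom_exponent_gt[OF q] False by (simp add: atom_exponent_def)
  from esssup_powr_integral_le[OF bm \<B>[OF J(1)] z _ this] le
  have "Lq_norm q \<gamma> b \<le> ennreal (measure \<gamma> J powr (enn2real (inverse q) - 1))"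
    using False by (subst Lq_norm_le_iff[OF q]) auto
  with J bm show ?thesis unfolding is_atom_def by blast
qed (use b in \<open>auto simp: is_atom_def\<close>)

end

lemma is_atom_mono: "is_atom \<B> q \<alpha> b \<Longrightarrow> \<B> \<subseteq> \<C> \<Longrightarrow> is_atom \<C> q \<alpha> b"
  unfolding is_atom_def by blast

lemma bb_B_mono: "a \<le> a' \<Longrightarrow> bb_B a \<subseteq> bb_B a'"
proof
  fix J assume a: "a \<le> a'" and "J \<in> bb_B a"
  then obtain x r where xr: "J = itv x r" "0 < x" "0 < r" "r \<le> a * w_fun x" by (auto simp: bb_B_def)
  moreover have "a * w_fun x \<le> a' * w_fun x" using a xr by (intro mult_right_mono) (auto simp: w_fun_def)
  ultimately show "J \<in> bb_B a'" by (force simp: bb_B_def)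
qed

text \<open>8 w(x) is the minimum of x and 1/x, which never exceeds 1.\<close>

lemma bb_B_subset_cal_B: "a \<le> 8 \<Longrightarrow> bb_B a \<subseteq> cal_B 1"
proof
  fix J assume a: "a \<le> 8" and "J \<in> bb_B a"
  then obtain x r where xr: "J = itv x r" "0 < x" "0 < r" "r \<le> a * w_fun x" by (auto simp: bb_B_def)
  have "a * w_fun x \<le> 8 * w_fun x" using a xr by (intro mult_right_mono) (auto simp: w_fun_def)
  with xr have r: "r \<le> x" "r \<le> 1 / x" by (auto simp: w_fun_def)
  moreover have "r \<le> 1"
  proof (cases "x \<le> 1")
    case False
    then have "1 / x \<le> 1" by simp
    with r show ?thesis by simp
  qed (use r in simp)
  ultimately show "J \<in> cal_B 1" using xr by (force simp: cal_B_def m_fun_def)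
qed

section \<open>The maximal norm of atoms and of atomic series\<close>

context gamma_grid begin

text \<open>Bumps of scale below w(x) stay inside the half-line; the constant atom is prescribed
  only there.\<close>

lemma local_maximal_cong:
  assumes eq: "\<And>x. 0 < x \<Longrightarrow> f x = g x" and x: "0 < x"
  shows "local_maximal a f x = local_maximal a g x"
proof -
  have "fun_conv (dilate t \<phi>) f x = fun_conv (dilate t \<phi>) g x"
    if \<phi>: "\<phi> \<in> test_functions" and t: "0 < t" "t < a * w_fun x" for \<phi> t
    unfolding fun_conv_def
  proof (rule Bochner_Integration.integral_cong[OF refl])
    fix y
    show "dilate t \<phi> (x - y) * f y = dilate t \<phi> (x - y) * g y"
      using eq[of y] dilate_bound(2)[OF \<phi> t(1), of "x - y"] a_w_less(2)[OF x t(2)] by (cases "0 < y") auto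
  qed
  then show ?thesis unfolding local_maximal_def by (intro arg_cong[where f=Sup] Collect_cong) metis
qed

definition maximal_norm :: "(real \<Rightarrow> complex) \<Rightarrow> ennreal" where
  "maximal_norm f = (\<integral>\<^sup>+x. local_maximal a f x \<partial>\<gamma>) + E_fun \<alpha> f"

text \<open>The constants \<open>CN\<close>, \<open>c3\<close> and \<open>CE\<close> depend only on
  alpha and p, so the bound is uniform over all non-constant atoms; the constant atom is covered by
  \<open>maximal_one_le\<close> and \<open>E_one_finite\<close>.\<close>

lemma atom_bound:
  assumes q: "1 < q"
  shows "\<exists>C>0. \<forall>b. is_atom (cal_B 1) q \<alpha> b \<longrightarrow> integrable \<gamma> b \<and> maximal_norm b \<le> ennreal C"
proof -
  define p where "p = atom_exponent q"
  have p: "1 < p" using atom_exponent_gt[OF q] by (simp add: p_def)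
  define C1 where "C1 = grid_atom.CN \<alpha> p + 8 * c3 + atom_setting.CE \<alpha> p"
  have one: "maximal_norm (\<lambda>_. 1) < \<infinity>"
  proof -
    have "(\<integral>\<^sup>+x. local_maximal a (\<lambda>_. 1) x \<partial>\<gamma>) \<le> (\<integral>\<^sup>+x. ennreal (2 * c2\<^sup>2) \<partial>\<gamma>)"
      by (intro nn_integral_mono maximal_one_le) simp
    also have "\<dots> < \<infinity>" by (simp add: emeasure_eq_measure ennreal_mult_less_top)
    finally show ?thesis using E_one_finite by (simp add: maximal_norm_def)
  qed
  then obtain C0 where C0: "maximal_norm (\<lambda>_. 1) = ennreal C0" "0 \<le> C0"
    by (auto simp: less_top_ennreal)
  define C where "C = max 1 (max C0 C1)"
  have "integrable \<gamma> b \<and> maximal_norm b \<le> ennreal C" if b: "is_atom (cal_B 1) q \<alpha> b" for b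
  proof (cases "\<forall>x>0. b x = 1")
    case True
    have "integrable \<gamma> b \<longleftrightarrow> integrable \<gamma> (\<lambda>_. 1::complex)"
      using True by (intro Bochner_Integration.integrable_cong refl) simp
    moreover have "maximal_norm b = maximal_norm (\<lambda>_. 1)"
      unfolding maximal_norm_def using True
      by (intro arg_cong2[where f="(+)"] nn_integral_cong E_fun_cong local_maximal_cong) auto
    ultimately show ?thesis using C0 by (auto simp: C_def intro!: ennreal_leI)
  next
    case False
    with b obtain x0 r where xr: "0 < r" "r \<le> x0" "r \<le> 1 * m_fun x0"
      and supp: "support_on {0<..} b \<subseteq> itv x0 r"
      and le: "Lq_norm q \<gamma> b \<le> ennreal (measure \<gamma> (itv x0 r) powr (enn2real (inverse q) - 1))"
      and mean: "(\<integral>x. b x \<partial>\<gamma>) = 0" and bm: "b \<in> borel_measurable \<gamma>"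
      unfolding is_atom_def cal_B_def by blast
    have m: "r \<le> m_fun x0" using xr(3) by simp
    have Lp: "(\<integral>\<^sup>+x. ennreal (norm (b x) powr p) \<partial>\<gamma>) \<le> ennreal (measure \<gamma> (itv x0 r) powr (1 - p))"
      unfolding p_def by (rule atom_powr_integral_le[OF bm itv_sets supp q le])
    interpret A: grid_atom \<alpha> a b x0 r p
      by unfold_locales (fact xr m p bm supp Lp mean)+
    have "maximal_norm b \<le> ennreal (A.CN + 8 * c3) + ennreal A.CE"
      unfolding maximal_norm_def by (rule add_mono[OF A.maximal_atom_le A.E_atom_le])
    also have "\<dots> = ennreal C1"
    proof -
      have "0 \<le> A.CE" using p by (simp add: A.CE_def)
      moreover have "2 powr (1 - p) < (1::real)" using p powr_less_one[of 2 "1 - p"] by simp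
      then have "0 \<le> A.CN" using c1_pos by (simp add: A.CN_def)
      ultimately show ?thesis using c3_pos by (simp add: C1_def)
    qed
    also have "\<dots> \<le> ennreal C" by (intro ennreal_leI) (simp add: C_def)
    finally show ?thesis using A.b_integrable by simp
  qed
  then show ?thesis by (intro exI[of _ C]) (auto simp: C_def)
qed

text \<open>Integration against a bounded kernel is continuous in L1, so it passes from partial sums
  to the limit; the remainder is at most B times their L1 distance to \<open>f\<close>.\<close>

lemma rep_functional_le:
  assumes rep: "is_atomic_rep \<B> q \<alpha> f c b" and b: "\<And>j. integrable \<gamma> (b j)" and f: "integrable \<gamma> f"
    and k [measurable]: "k \<in> borel_measurable \<gamma>" and kB: "\<And>x. 0 < x \<Longrightarrow> norm (k x) \<le> B"
  shows "ennreal (norm (\<integral>x. k x * f x \<partial>\<gamma>)) \<le> (\<Sum>j. ennreal (norm (c j)) * ennreal (norm (\<integral>x. k x * b j x \<partial>\<gamma>)))"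
proof -
  let ?S = "\<Sum>j. ennreal (norm (c j)) * ennreal (norm (\<integral>x. k x * b j x \<partial>\<gamma>))"
  let ?d = "\<lambda>n. L1_dist \<gamma> (\<lambda>x. \<Sum>j<n. c j * b j x) f"
  have B: "0 \<le> B" using kB[of 1] norm_ge_zero[of "k 1"] by linarith
  have ki: "integrable \<gamma> (\<lambda>x. k x * g x)" if g: "integrable \<gamma> g" for g :: "real \<Rightarrow> complex"
  proof (rule Bochner_Integration.integrable_bound)
    show "integrable \<gamma> (\<lambda>x. of_real B * g x)" using g by simp
    show "AE x in \<gamma>. norm (k x * g x) \<le> norm (of_real B * g x)"
      using kB B by (intro AE_I2) (auto simp: norm_mult intro!: mult_right_mono)
    show "(\<lambda>x. k x * g x) \<in> borel_measurable \<gamma>" using g by measurable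
  qed
  have step: "ennreal (norm (\<integral>x. k x * f x \<partial>\<gamma>)) \<le> ?S + ennreal B * ?d n" for n
  proof -
    let ?g = "\<lambda>x. \<Sum>j<n. c j * b j x"
    have g: "integrable \<gamma> ?g" using b by simp
    have eq: "(\<integral>x. k x * ?g x \<partial>\<gamma>) = (\<Sum>j<n. c j * (\<integral>x. k x * b j x \<partial>\<gamma>))"
    proof -
      have "(\<integral>x. k x * ?g x \<partial>\<gamma>) = (\<integral>x. (\<Sum>j<n. c j * (k x * b j x)) \<partial>\<gamma>)"
        by (intro Bochner_Integration.integral_cong refl) (simp add: sum_distrib_left mult_ac)
      also have "\<dots> = (\<Sum>j<n. c j * (\<integral>x. k x * b j x \<partial>\<gamma>))"
        using ki[OF b] by simp
      finally show ?thesis .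
    qed
    have diff: "ennreal (norm (\<integral>x. k x * (?g x - f x) \<partial>\<gamma>)) \<le> ennreal B * ?d n"
    proof -
      have gf: "integrable \<gamma> (\<lambda>x. ?g x - f x)" using g f by (rule Bochner_Integration.integrable_diff)
      have "ennreal (norm (\<integral>x. k x * (?g x - f x) \<partial>\<gamma>)) \<le> (\<integral>\<^sup>+x. ennreal (norm (k x * (?g x - f x))) \<partial>\<gamma>)"
        by (rule integral_norm_bound_ennreal[OF ki[OF gf]])
      also have "\<dots> \<le> (\<integral>\<^sup>+x. ennreal B * ennreal (norm (?g x - f x)) \<partial>\<gamma>)"
      proof (rule nn_integral_mono)
        fix x assume "x \<in> space \<gamma>"
        then have "norm (k x * (?g x - f x)) \<le> B * norm (?g x - f x)"
          unfolding norm_mult using kB by (intro mult_right_mono) auto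
        then show "ennreal (norm (k x * (?g x - f x))) \<le> ennreal B * ennreal (norm (?g x - f x))"
          using B by (simp only: ennreal_mult[symmetric] ennreal_leI norm_ge_zero)
      qed
      also have "\<dots> = ennreal B * ?d n"
        unfolding L1_dist_def using gf by (intro nn_integral_cmult) simp
      finally show ?thesis .
    qed
    have "(\<integral>x. k x * f x \<partial>\<gamma>) = (\<integral>x. k x * ?g x \<partial>\<gamma>) - (\<integral>x. k x * (?g x - f x) \<partial>\<gamma>)"
    proof -
      have "(\<integral>x. k x * (?g x - f x) \<partial>\<gamma>) = (\<integral>x. k x * ?g x - k x * f x \<partial>\<gamma>)"
        by (simp only: right_diff_distrib)
      also have "\<dots> = (\<integral>x. k x * ?g x \<partial>\<gamma>) - (\<integral>x. k x * f x \<partial>\<gamma>)"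
        by (rule Bochner_Integration.integral_diff[OF ki[OF g] ki[OF f]])
      finally show ?thesis by simp
    qed
    then have "norm (\<integral>x. k x * f x \<partial>\<gamma>) \<le> norm (\<integral>x. k x * ?g x \<partial>\<gamma>) + norm (\<integral>x. k x * (?g x - f x) \<partial>\<gamma>)"
      by (simp only: norm_triangle_ineq4)
    moreover have "norm (\<integral>x. k x * ?g x \<partial>\<gamma>) \<le> (\<Sum>j<n. norm (c j) * norm (\<integral>x. k x * b j x \<partial>\<gamma>))"
      unfolding eq by (rule order_trans[OF norm_sum]) (simp add: norm_mult)
    ultimately have "ennreal (norm (\<integral>x. k x * f x \<partial>\<gamma>)) \<le>
       ennreal ((\<Sum>j<n. norm (c j) * norm (\<integral>x. k x * b j x \<partial>\<gamma>)) + norm (\<integral>x. k x * (?g x - f x) \<partial>\<gamma>))"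
      by (intro ennreal_leI) linarith
    also have "\<dots> = (\<Sum>j<n. ennreal (norm (c j)) * ennreal (norm (\<integral>x. k x * b j x \<partial>\<gamma>))) + ennreal (norm (\<integral>x. k x * (?g x - f x) \<partial>\<gamma>))"
      by (simp only: ennreal_plus sum_nonneg mult_nonneg_nonneg norm_ge_zero sum_ennreal[symmetric] ennreal_mult)
    also have "\<dots> \<le> ?S + ennreal B * ?d n"
      by (intro add_mono sum_le_suminf summableI diff) auto
    finally show ?thesis .
  qed
  have "(\<lambda>n. ?S + ennreal B * ?d n) \<longlonglongrightarrow> ?S + ennreal B * 0"
    using rep by (intro tendsto_add tendsto_const ennreal_tendsto_cmult) (auto simp: is_atomic_rep_def)
  from LIMSEQ_le_const[OF this] step show ?thesis by simp
qed

text \<open>Convolutions at a point and integrals over (0,y) or beyond y are functionals of the kind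
  in \<open>rep_functional_le\<close>. Supremum and integration preserve the inequality, the latter
  term by term.\<close>

lemma maximal_norm_rep_le:
  assumes rep: "is_atomic_rep \<B> q \<alpha> f c b" and b: "\<And>j. integrable \<gamma> (b j)" and f: "integrable \<gamma> f"
  shows "maximal_norm f \<le> (\<Sum>j. ennreal (norm (c j)) * maximal_norm (b j))"
proof -
  note [measurable] = local_maximal_measurable[OF b] Phi_measurable[OF b]
  have M: "local_maximal a f x \<le> (\<Sum>j. ennreal (norm (c j)) * local_maximal a (b j) x)" if x: "0 < x" for x
    unfolding local_maximal_def[of a f]
  proof (rule Sup_least, clarsimp)
    fix \<phi> t assume \<phi>: "\<phi> \<in> test_functions" and t: "0 < t" "t < a * w_fun x"
    have "ennreal (norm (fun_conv (dilate t \<phi>) f x)) \<le> (\<Sum>j. ennreal (norm (c j)) * ennreal (norm (fun_conv (dilate t \<phi>) (b j) x)))"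
      unfolding conv_eq_gamma(1)[OF borel_measurable_integrable[OF f] x \<phi> t]
        conv_eq_gamma(1)[OF borel_measurable_integrable[OF b] x \<phi> t]
      by (rule rep_functional_le[OF rep b f conv_eq_gamma(2)[OF borel_measurable_integrable[OF f] x \<phi> t]
            kernel_bound[OF x \<phi> t]])
    also have "\<dots> \<le> (\<Sum>j. ennreal (norm (c j)) * local_maximal a (b j) x)"
      unfolding local_maximal_def using \<phi> t by (intro suminf_le summableI mult_left_mono Sup_upper) auto
    finally show "ennreal (norm (fun_conv (dilate t \<phi>) f x)) \<le> (\<Sum>j. ennreal (norm (c j)) * local_maximal a (b j) x)" .
  qed
  have set: "ennreal (norm (LINT x:A|\<gamma>. f x)) \<le> (\<Sum>j. ennreal (norm (c j)) * ennreal (norm (LINT x:A|\<gamma>. b j x)))"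
    if A: "A \<in> sets borel" for A
  proof -
    have "(\<lambda>x. of_real (indicator A x) :: complex) \<in> borel_measurable \<gamma>" using A by (intro measurable_gammaI) simp
    from rep_functional_le[OF rep b f this, of 1] show ?thesis
      by (simp add: set_lebesgue_integral_def scaleR_conv_of_real indicator_def)
  qed
  \<comment> \<open>\<open>e\<close> is the indicator of the range of integration, off which the
    weight \<open>w\<close> may be negative.\<close>
  have wset: "ennreal (w * norm (LINT x:A|\<gamma>. f x)) * e \<le> (\<Sum>j. ennreal (norm (c j)) * (ennreal (w * norm (LINT x:A|\<gamma>. b j x)) * e))"
    if "A \<in> sets borel" and w: "e \<noteq> 0 \<Longrightarrow> 0 \<le> w" for A w and e :: ennreal
  proof (cases "e = 0")
    case False
    then have w: "0 \<le> w" by (rule w)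
    have "ennreal (w * norm (LINT x:A|\<gamma>. f x)) * e = (ennreal w * e) * ennreal (norm (LINT x:A|\<gamma>. f x))"
      using w by (simp add: ennreal_mult mult_ac)
    also have "\<dots> \<le> (ennreal w * e) * (\<Sum>j. ennreal (norm (c j)) * ennreal (norm (LINT x:A|\<gamma>. b j x)))"
      by (rule mult_left_mono[OF set[OF that(1)]]) simp
    also have "\<dots> = (\<Sum>j. (ennreal w * e) * (ennreal (norm (c j)) * ennreal (norm (LINT x:A|\<gamma>. b j x))))"
      by (rule ennreal_suminf_cmult[symmetric])
    also have "\<dots> = (\<Sum>j. ennreal (norm (c j)) * (ennreal (w * norm (LINT x:A|\<gamma>. b j x)) * e))"
      using w by (simp add: ennreal_mult mult_ac)
    finally show ?thesis .
  qed simp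
  have sum: "(\<integral>\<^sup>+x. (\<Sum>j. ennreal (norm (c j)) * u j x) \<partial>M') = (\<Sum>j. ennreal (norm (c j)) * (\<integral>\<^sup>+x. u j x \<partial>M'))"
    if [measurable]: "\<And>j. u j \<in> borel_measurable M'" for M' :: "real measure" and u
    by (subst nn_integral_suminf) (auto simp: nn_integral_cmult)
  have 1: "(\<integral>\<^sup>+x. local_maximal a f x \<partial>\<gamma>) \<le> (\<Sum>j. ennreal (norm (c j)) * (\<integral>\<^sup>+x. local_maximal a (b j) x \<partial>\<gamma>))"
    by (subst sum[symmetric], measurable) (intro nn_integral_mono M, simp)
  have 2: "(\<integral>\<^sup>+ y. ennreal (1 / y * norm (Phi f y)) * indicator {0<..<1} y \<partial>lborel) \<le>
     (\<Sum>j. ennreal (norm (c j)) * (\<integral>\<^sup>+ y. ennreal (1 / y * norm (Phi (b j) y)) * indicator {0<..<1} y \<partial>lborel))"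
    by (subst sum[symmetric], measurable) (intro nn_integral_mono, unfold Phi_def, rule wset, auto simp: indicator_def)
  have 3: "(\<integral>\<^sup>+ y. ennreal (y * norm (Psi f y)) * indicator {1<..} y \<partial>lborel) \<le>
     (\<Sum>j. ennreal (norm (c j)) * (\<integral>\<^sup>+ y. ennreal (y * norm (Psi (b j) y)) * indicator {1<..} y \<partial>lborel))"
    by (subst sum[symmetric], measurable) (intro nn_integral_mono, unfold Psi_def, rule wset, auto simp: indicator_def split: if_splits)
  have "maximal_norm f \<le> (\<Sum>j. ennreal (norm (c j)) * (\<integral>\<^sup>+x. local_maximal a (b j) x \<partial>\<gamma>)) +
    ((\<Sum>j. ennreal (norm (c j)) * (\<integral>\<^sup>+ y. ennreal (1 / y * norm (Phi (b j) y)) * indicator {0<..<1} y \<partial>lborel)) +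
     (\<Sum>j. ennreal (norm (c j)) * (\<integral>\<^sup>+ y. ennreal (y * norm (Psi (b j) y)) * indicator {1<..} y \<partial>lborel)))"
    unfolding maximal_norm_def E_fun_eq by (intro add_mono 1 2 3)
  also have "\<dots> = (\<Sum>j. ennreal (norm (c j)) * maximal_norm (b j))"
    unfolding maximal_norm_def E_fun_eq distrib_left by (simp only: suminf_add[OF summableI summableI])
  finally show ?thesis .
qed

lemma atomic_norm_equivalent:
  assumes q: "1 < q" and \<B>: "bb_B a \<subseteq> \<B>" "\<B> \<subseteq> cal_B 1"
  shows "\<exists>C>0. \<forall>f. integrable \<gamma> f \<longrightarrow> maximal_norm f \<le> ennreal C * atomic_norm \<B> q \<alpha> f \<and>
     atomic_norm \<B> q \<alpha> f \<le> ennreal C * maximal_norm f"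
    and "integrable \<gamma> f \<Longrightarrow> (\<exists>c b. is_atomic_rep \<B> q \<alpha> f c b) \<longleftrightarrow> maximal_norm f < \<infinity>"
proof -
  obtain C1 where C1: "0 < C1" "\<And>b. is_atom (cal_B 1) q \<alpha> b \<Longrightarrow> integrable \<gamma> b \<and> maximal_norm b \<le> ennreal C1"
    using atom_bound[OF q] by blast
  obtain C2 where C2: "0 < C2"
    "\<And>f. integrable \<gamma> f \<Longrightarrow> maximal_norm f < \<infinity> \<Longrightarrow> atomic_le \<gamma> atoms f (C2 * enn2real (maximal_norm f))"
    using atomic_decomposition unfolding maximal_norm_def[symmetric] by blast
  have rep_le: "maximal_norm f \<le> ennreal C1 * (\<Sum>j. ennreal (norm (c j)))"
    if f: "integrable \<gamma> f" and rep: "is_atomic_rep \<B> q \<alpha> f c b" for f c b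
  proof -
    have b: "integrable \<gamma> (b j) \<and> maximal_norm (b j) \<le> ennreal C1" for j
      by (rule C1(2)[OF is_atom_mono[OF _ \<B>(2)]]) (use rep in \<open>simp add: is_atomic_rep_def\<close>)
    have "maximal_norm f \<le> (\<Sum>j. ennreal (norm (c j)) * maximal_norm (b j))"
      using b by (intro maximal_norm_rep_le[OF rep _ f]) auto
    also have "\<dots> \<le> (\<Sum>j. ennreal (norm (c j)) * ennreal C1)"
      by (intro suminf_le summableI mult_left_mono) (use b in auto)
    also have "\<dots> = ennreal C1 * (\<Sum>j. ennreal (norm (c j)))"
      by (simp only: mult.commute[of _ "ennreal C1"] ennreal_suminf_cmult)
    finally show ?thesis .
  qed
  have rep_ex: "\<exists>c b. is_atomic_rep \<B> q \<alpha> f c b \<and> (\<Sum>j. ennreal (norm (c j))) \<le> ennreal C2 * maximal_norm f"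
    if f: "integrable \<gamma> f" and fin: "maximal_norm f < \<infinity>" for f
  proof -
    obtain c b where b: "\<And>j. b j \<in> atoms" and c: "summable (\<lambda>j. norm (c j))"
      and le: "(\<Sum>j. norm (c j)) \<le> C2 * enn2real (maximal_norm f)"
      and F: "AE x in \<gamma>. (\<lambda>j. c j * b j x) sums f x"
      using C2(2)[OF f fin] unfolding atomic_le_def by blast
    have "is_atom (bb_B a) q \<alpha> (b j)" for j
    proof (rule is_atom_infinity_imp[OF _ q])
      show "is_atom (bb_B a) \<infinity> \<alpha> (b j)" using b[of j] by (simp add: atoms_def)
    qed (auto simp: bb_B_def itv_sets)
    then have "is_atomic_rep \<B> q \<alpha> f c b"
      using is_atom_mono[OF _ \<B>(1)] c at.atomic_le_L1_limit[OF b c F] f by (auto simp: is_atomic_rep_def)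
    moreover have "(\<Sum>j. ennreal (norm (c j))) \<le> ennreal C2 * maximal_norm f"
    proof -
      have "(\<Sum>j. ennreal (norm (c j))) = ennreal (\<Sum>j. norm (c j))" using c by (intro suminf_ennreal2) auto
      also have "\<dots> \<le> ennreal (C2 * enn2real (maximal_norm f))" using le by (rule ennreal_leI)
      also have "\<dots> = ennreal C2 * maximal_norm f"
        using C2(1) fin by (simp add: ennreal_mult less_top)
      finally show ?thesis .
    qed
    ultimately show ?thesis by blast
  qed
  define C where "C = max C1 C2"
  have C: "ennreal C1 \<le> ennreal C" "ennreal C2 \<le> ennreal C" by (auto simp: C_def intro: ennreal_leI)
  have "maximal_norm f \<le> ennreal C * atomic_norm \<B> q \<alpha> f \<and> atomic_norm \<B> q \<alpha> f \<le> ennreal C * maximal_norm f"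
    if f: "integrable \<gamma> f" for f
  proof
    have one: "ennreal (1 / C1) * ennreal C1 = 1" using C1(1) by (simp add: ennreal_mult[symmetric])
    \<comment> \<open>Dividing by \<open>C1\<close> first turns the claim into a lower bound for
      every member of the infimum.\<close>
    have "ennreal (1 / C1) * maximal_norm f \<le> atomic_norm \<B> q \<alpha> f"
      unfolding atomic_norm_def
    proof (rule Inf_greatest, clarsimp)
      fix c b assume "is_atomic_rep \<B> q \<alpha> f c b"
      from mult_left_mono[OF rep_le[OF f this], of "ennreal (1 / C1)"]
      show "ennreal (1 / C1) * maximal_norm f \<le> (\<Sum>j. ennreal (norm (c j)))"
        by (simp only: mult.assoc[symmetric] one mult_1_left zero_le)
    qed
    from mult_left_mono[OF this, of "ennreal C1"] one
    have "maximal_norm f \<le> ennreal C1 * atomic_norm \<B> q \<alpha> f"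
      by (simp only: mult.assoc[symmetric] mult.commute[of "ennreal C1" "ennreal (1 / C1)"] mult_1_left zero_le)
    also have "\<dots> \<le> ennreal C * atomic_norm \<B> q \<alpha> f" using C by (intro mult_right_mono) auto
    finally show "maximal_norm f \<le> ennreal C * atomic_norm \<B> q \<alpha> f" .
    show "atomic_norm \<B> q \<alpha> f \<le> ennreal C * maximal_norm f"
    proof (cases "maximal_norm f < \<infinity>")
      case True
      from rep_ex[OF f this] obtain c b where rep: "is_atomic_rep \<B> q \<alpha> f c b"
        and le: "(\<Sum>j. ennreal (norm (c j))) \<le> ennreal C2 * maximal_norm f" by blast
      have "atomic_norm \<B> q \<alpha> f \<le> (\<Sum>j. ennreal (norm (c j)))"
        unfolding atomic_norm_def using rep by (intro Inf_lower) blast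
      also have "\<dots> \<le> ennreal C2 * maximal_norm f" by (rule le)
      also have "\<dots> \<le> ennreal C * maximal_norm f" using C by (intro mult_right_mono) auto
      finally show ?thesis .
    next
      case False
      \<comment> \<open>The right-hand side is then infinite, as \<open>C\<close> is
        positive.\<close>
      then have "maximal_norm f = \<infinity>" by (simp add: less_top[symmetric])
      moreover have "0 < C" using C1(1) by (simp add: C_def)
      ultimately show ?thesis by (simp add: ennreal_mult_top)
    qed
  qed
  moreover have "0 < C" using C1(1) by (simp add: C_def)
  ultimately show "\<exists>C>0. \<forall>f. integrable \<gamma> f \<longrightarrow> maximal_norm f \<le> ennreal C * atomic_norm \<B> q \<alpha> f \<and>
     atomic_norm \<B> q \<alpha> f \<le> ennreal C * maximal_norm f" by blast
  assume f: "integrable \<gamma> f"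
  show "(\<exists>c b. is_atomic_rep \<B> q \<alpha> f c b) \<longleftrightarrow> maximal_norm f < \<infinity>"
  proof
    assume "\<exists>c b. is_atomic_rep \<B> q \<alpha> f c b"
    then obtain c b where rep: "is_atomic_rep \<B> q \<alpha> f c b" by blast
    have "summable (\<lambda>j. norm (c j))" using rep by (simp add: is_atomic_rep_def)
    then have "(\<Sum>j. ennreal (norm (c j))) = ennreal (\<Sum>j. norm (c j))" by (intro suminf_ennreal2) auto
    then have "ennreal C1 * (\<Sum>j. ennreal (norm (c j))) < \<infinity>" by (simp add: ennreal_mult_less_top)
    with rep_le[OF f rep] show "maximal_norm f < \<infinity>" by (rule le_less_trans)
  qed (use rep_ex[OF f] in blast)
qed

end

section \<open>Comparability and the final equivalences\<close>

lemma comparable_onI: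
  assumes C: "0 < C" and le: "\<And>f. f \<in> F \<Longrightarrow> N' f \<le> ennreal C * N f" "\<And>f. f \<in> F \<Longrightarrow> N f \<le> ennreal C * N' f"
  shows "comparable_on F N N'"
  unfolding comparable_on_def
proof (rule exI[of _ "1 / C"], rule exI[of _ C], intro conjI ballI)
  fix f assume f: "f \<in> F"
  have one: "ennreal (1 / C) * ennreal C = 1" using C by (simp add: ennreal_mult[symmetric])
  have "ennreal (1 / C) * N f \<le> ennreal (1 / C) * (ennreal C * N' f)"
    by (rule mult_left_mono[OF le(2)[OF f]]) simp
  also have "\<dots> = N' f" by (simp only: mult.assoc[symmetric] one mult_1_left)
  finally show "ennreal (1 / C) * N f \<le> N' f" .
qed (use C le in auto)

lemma comparable_on_sym:
  assumes "comparable_on F N N'"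
  shows "comparable_on F N' N"
proof -
  obtain c C where c: "0 < c" "0 < C" and le: "\<And>f. f \<in> F \<Longrightarrow> ennreal c * N f \<le> N' f" "\<And>f. f \<in> F \<Longrightarrow> N' f \<le> ennreal C * N f"
    using assms unfolding comparable_on_def by blast
  show ?thesis
  proof (rule comparable_onI)
    show "0 < max C (1 / c)" using c by simp
    fix f assume f: "f \<in> F"
    have one: "ennreal (1 / c) * ennreal c = 1" using c by (simp add: ennreal_mult[symmetric])
    have "N f = ennreal (1 / c) * (ennreal c * N f)" by (simp only: mult.assoc[symmetric] one mult_1_left)
    also have "\<dots> \<le> ennreal (max C (1 / c)) * N' f"
      using le(1)[OF f] by (intro mult_mono ennreal_leI) auto
    finally show "N f \<le> ennreal (max C (1 / c)) * N' f" .
    show "N' f \<le> ennreal (max C (1 / c)) * N f"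
      using le(2)[OF f] by (rule order_trans) (intro mult_right_mono ennreal_leI, auto)
  qed
qed

lemma comparable_on_trans:
  assumes "comparable_on F N N'" "comparable_on F N' N''"
  shows "comparable_on F N N''"
proof -
  obtain c C where c: "0 < c" "0 < C" and le: "\<And>f. f \<in> F \<Longrightarrow> ennreal c * N f \<le> N' f" "\<And>f. f \<in> F \<Longrightarrow> N' f \<le> ennreal C * N f"
    using assms(1) unfolding comparable_on_def by blast
  obtain d D where d: "0 < d" "0 < D" and le': "\<And>f. f \<in> F \<Longrightarrow> ennreal d * N' f \<le> N'' f" "\<And>f. f \<in> F \<Longrightarrow> N'' f \<le> ennreal D * N' f"
    using assms(2) unfolding comparable_on_def by blast
  show ?thesis
    unfolding comparable_on_def
  proof (rule exI[of _ "d * c"], rule exI[of _ "D * C"], intro conjI ballI)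
    fix f assume f: "f \<in> F"
    have "ennreal (d * c) * N f = ennreal d * (ennreal c * N f)" using c d by (simp add: ennreal_mult mult.assoc)
    also have "\<dots> \<le> ennreal d * N' f" using le(1)[OF f] by (rule mult_left_mono) simp
    also have "\<dots> \<le> N'' f" by (rule le'(1)[OF f])
    finally show "ennreal (d * c) * N f \<le> N'' f" .
    have "N'' f \<le> ennreal D * N' f" by (rule le'(2)[OF f])
    also have "\<dots> \<le> ennreal D * (ennreal C * N f)" using le(2)[OF f] by (rule mult_left_mono) simp
    also have "\<dots> = ennreal (D * C) * N f" using c d by (simp add: ennreal_mult mult.assoc)
    finally show "N'' f \<le> ennreal (D * C) * N f" .
  qed (use c d in auto)
qed

theorem theorem1p3:
  fixes \<alpha> a :: real and q :: ennreal
  assumes "\<alpha> > - 1 / 2" and "0 < a" and "a \<le> 1" and "1 < q"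
  shows
    "(\<forall>f \<in> L1_space (gamma_measure \<alpha>).
        (f \<in> H1 \<alpha> \<longleftrightarrow> f \<in> bb_H (2 * a) q \<alpha>) \<and>
        (f \<in> H1 \<alpha> \<longleftrightarrow>
           (local_maximal a f \<in> borel_measurable (gamma_measure \<alpha>) \<and>
            (\<integral>\<^sup>+ x. local_maximal a f x \<partial>gamma_measure \<alpha>) < \<infinity>) \<and>
           E_fun \<alpha> f < \<infinity>)) \<and>
     comparable_on (L1_space (gamma_measure \<alpha>)) (H1_norm \<alpha>) (bb_H_norm a q \<alpha>) \<and>
     comparable_on (L1_space (gamma_measure \<alpha>)) (H1_norm \<alpha>)
       (\<lambda>f. (\<integral>\<^sup>+ x. local_maximal a f x \<partial>gamma_measure \<alpha>) + E_fun \<alpha> f) \<and>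
     comparable_on (L1_space (gamma_measure \<alpha>)) (bb_H_norm a q \<alpha>)
       (\<lambda>f. (\<integral>\<^sup>+ x. local_maximal a f x \<partial>gamma_measure \<alpha>) + E_fun \<alpha> f)"
proof -
  interpret gamma_grid \<alpha> a using assms by unfold_locales
  \<comment> \<open>Radii \<open>a\<close> and \<open>2 * a\<close> both occur; both classes lie
    between \<open>bb_B a\<close> and \<open>cal_B 1\<close>, because 2 a is at most 8.\<close>
  have sub: "bb_B a \<subseteq> cal_B 1" "bb_B a \<subseteq> bb_B (2 * a)" "bb_B (2 * a) \<subseteq> cal_B 1"
    using assms by (auto intro!: bb_B_subset_cal_B bb_B_mono del: subsetI)
  have q: "(1::ennreal) < \<infinity>" by simp
  have eqv: "comparable_on (L1_space \<gamma>) (atomic_norm \<B> q' \<alpha>) maximal_norm"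
    if \<B>: "1 < q'" "bb_B a \<subseteq> \<B>" "\<B> \<subseteq> cal_B 1" for \<B> q'
  proof -
    obtain C where "0 < C" and "\<And>f. integrable \<gamma> f \<Longrightarrow> maximal_norm f \<le> ennreal C * atomic_norm \<B> q' \<alpha> f \<and>
        atomic_norm \<B> q' \<alpha> f \<le> ennreal C * maximal_norm f"
      using atomic_norm_equivalent(1)[OF \<B>] by blast
    then show ?thesis by (intro comparable_onI[of C]) (auto simp: L1_space_def)
  qed
  have H: "comparable_on (L1_space \<gamma>) (H1_norm \<alpha>) maximal_norm"
    unfolding H1_norm_def cal_H_norm_def by (rule eqv[OF q sub(1) order_refl])
  have bb: "comparable_on (L1_space \<gamma>) (bb_H_norm a q \<alpha>) maximal_norm"
    unfolding bb_H_norm_def by (rule eqv[OF assms(4) order_refl sub(1)])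
  have "(f \<in> H1 \<alpha> \<longleftrightarrow> f \<in> bb_H (2 * a) q \<alpha>) \<and>
        (f \<in> H1 \<alpha> \<longleftrightarrow>
           (local_maximal a f \<in> borel_measurable \<gamma> \<and> (\<integral>\<^sup>+ x. local_maximal a f x \<partial>\<gamma>) < \<infinity>) \<and> E_fun \<alpha> f < \<infinity>)"
    if "f \<in> L1_space \<gamma>" for f
  proof -
    have f: "integrable \<gamma> f" using that by (simp add: L1_space_def)
    have "f \<in> H1 \<alpha> \<longleftrightarrow> maximal_norm f < \<infinity>"
      using that atomic_norm_equivalent(2)[OF q sub(1) order_refl f] by (simp add: H1_def cal_H_def)
    moreover have "f \<in> bb_H (2 * a) q \<alpha> \<longleftrightarrow> maximal_norm f < \<infinity>"
      using borel_measurable_integrable[OF f] atomic_norm_equivalent(2)[OF assms(4) sub(2,3) f] by (simp add: bb_H_def)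
    ultimately show ?thesis using local_maximal_measurable[OF f] by (simp add: maximal_norm_def)
  qed
  moreover note comparable_on_trans[OF H comparable_on_sym[OF bb]] H bb
  ultimately show ?thesis unfolding maximal_norm_def[abs_def] by blast
qed

end
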